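(* Let $X^n$ be a closed connected smooth $n$-manifold ($n\geq 1$) and let $f:X\to\mathbb{B}^N$ be an immersion with $\mathfrak{c}(f)<\sqrt{\frac{4}{3}}$. Then $X$ is diffeomorphic to the standard $n$-sphere.
   Context: $\mathbb{B}^N\subset\mathbb{R}^N$ denotes the closed unit ball. For a smooth immersion $f:X\to\mathbb{B}^N$ with (vector-valued) second fundamental form $\mathbf{A}$ in $\mathbb{R}^N$, the maximal normal curvature is $\mathfrak{c}(f):=\sup_{|u|=1}|\mathbf{A}(u,u)|$, the supremum being over all tangent vectors $u$ to $X$ of unit length with respect to the pullback metric $g=f^*g_{\mathbb{R}^N}$. *)

theory Defs
  imports "HOL-Analysis.Analysis"
begin

section \<open>Smooth maps between open subsets of Euclidean spaces\<close>

text \<open>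
  All directional derivatives up to order \<open>k\<close> exist, are differentiable below order \<open>k\<close>,
  and are continuous. The notion is only used for open \<open>S\<close>.
\<close>

primrec Ck_on :: "nat \<Rightarrow> 'a::euclidean_space set \<Rightarrow> ('a \<Rightarrow> 'b::euclidean_space) \<Rightarrow> bool" where
  "Ck_on 0 S f \<longleftrightarrow> continuous_on S f"
| "Ck_on (Suc k) S f \<longleftrightarrow>
     f differentiable_on S \<and> (\<forall>v. Ck_on k S (\<lambda>x. frechet_derivative f (at x) v))"

definition smooth_on :: "'a::euclidean_space set \<Rightarrow> ('a \<Rightarrow> 'b::euclidean_space) \<Rightarrow> bool" where
  "smooth_on S f \<longleftrightarrow> (\<forall>k. Ck_on k S f)"

section \<open>Smooth manifolds\<close>

text \<open>
  A smooth manifold is a topological space \<open>T\<close> with a (not necessarily maximal) smooth atlas;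
  its dimension is that of the model space \<open>'e\<close>. A chart is a pair \<open>(U, \<phi>)\<close>, of which
  only the restriction of \<open>\<phi>\<close> to \<open>U\<close> matters.
\<close>

type_synonym ('a, 'e) atlas = "('a set \<times> ('a \<Rightarrow> 'e)) set"

definition is_chart :: "'a topology \<Rightarrow> 'a set \<Rightarrow> ('a \<Rightarrow> 'e::euclidean_space) \<Rightarrow> bool" where
  "is_chart T U \<phi> \<longleftrightarrow> openin T U \<and> open (\<phi> ` U) \<and>
     homeomorphic_map (subtopology T U) (top_of_set (\<phi> ` U)) \<phi>"

definition smooth_atlas :: "'a topology \<Rightarrow> ('a, 'e::euclidean_space) atlas \<Rightarrow> bool" where
  "smooth_atlas T A \<longleftrightarrow>
     (\<forall>(U, \<phi>)\<in>A. is_chart T U \<phi>) \<and>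
     (\<Union>(U, \<phi>)\<in>A. U) = topspace T \<and>
     (\<forall>(U, \<phi>)\<in>A. \<forall>(V, \<psi>)\<in>A. smooth_on (\<phi> ` (U \<inter> V)) (\<psi> \<circ> inv_into U \<phi>))"

definition smooth_manifold :: "'a topology \<Rightarrow> ('a, 'e::euclidean_space) atlas \<Rightarrow> bool" where
  "smooth_manifold T A \<longleftrightarrow> Hausdorff_space T \<and> second_countable T \<and> smooth_atlas T A"

definition smooth_map ::
  "'a topology \<Rightarrow> ('a, 'e::euclidean_space) atlas \<Rightarrow>
   'b topology \<Rightarrow> ('b, 'd::euclidean_space) atlas \<Rightarrow> ('a \<Rightarrow> 'b) \<Rightarrow> bool" where
  "smooth_map T A T' A' F \<longleftrightarrow> continuous_map T T' F \<and>
     (\<forall>(U, \<phi>)\<in>A. \<forall>(V, \<psi>)\<in>A'. smooth_on (\<phi> ` (U \<inter> F -` V)) (\<psi> \<circ> F \<circ> inv_into U \<phi>))"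

definition diffeomorphic ::
  "'a topology \<Rightarrow> ('a, 'e::euclidean_space) atlas \<Rightarrow>
   'b topology \<Rightarrow> ('b, 'd::euclidean_space) atlas \<Rightarrow> bool" where
  "diffeomorphic T A T' A' \<longleftrightarrow>
     (\<exists>F G. smooth_map T A T' A' F \<and> smooth_map T' A' T A G \<and>
        (\<forall>x\<in>topspace T. G (F x) = x) \<and> (\<forall>y\<in>topspace T'. F (G y) = y))"

text \<open>
  The standard sphere of dimension \<open>DIM('e)\<close> is the unit sphere of \<open>'e \<times> real\<close>; its smooth
  structure is given by the stereographic projections from the poles \<open>(0, 1)\<close> and \<open>(0, -1)\<close>.
\<close>

definition std_sphere :: "('e::euclidean_space \<times> real) topology" where
  "std_sphere = top_of_set (sphere 0 1)"

definition std_sphere_atlas :: "('e::euclidean_space \<times> real, 'e) atlas" where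
  "std_sphere_atlas =
     {(sphere 0 1 - {(0, 1)}, \<lambda>(x, t). x /\<^sub>R (1 - t)),
      (sphere 0 1 - {(0, -1)}, \<lambda>(x, t). x /\<^sub>R (1 + t))}"

section \<open>Immersions and their normal curvature\<close>

definition smooth_immersion ::
  "('a, 'e::euclidean_space) atlas \<Rightarrow> ('a \<Rightarrow> 'b::euclidean_space) \<Rightarrow> bool" where
  "smooth_immersion A f \<longleftrightarrow>
     (\<forall>(U, \<phi>)\<in>A. smooth_on (\<phi> ` U) (f \<circ> inv_into U \<phi>) \<and>
        (\<forall>y\<in>\<phi> ` U. inj (frechet_derivative (f \<circ> inv_into U \<phi>) (at y))))"

text \<open>
  In the following, \<open>F = f \<circ> \<phi>\<^sup>-\<^sup>1\<close> is the expression of an immersion in a chart, \<open>y\<close> a point in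
  the image of the chart, and \<open>v\<close>, \<open>w\<close> are the coordinate vectors of tangent vectors at \<open>y\<close>.
\<close>

definition pullback_metric ::
  "('e::euclidean_space \<Rightarrow> 'b::euclidean_space) \<Rightarrow> 'e \<Rightarrow> 'e \<Rightarrow> 'e \<Rightarrow> real" where
  "pullback_metric F y v w = frechet_derivative F (at y) v \<bullet> frechet_derivative F (at y) w"

definition normal_component :: "'b::euclidean_space set \<Rightarrow> 'b \<Rightarrow> 'b" where
  "normal_component S x = (THE z. z \<in> S\<^sup>\<bottom> \<and> x - z \<in> S)"

text \<open>
  The second fundamental form is the normal component of the ambient derivative in direction
  \<open>v\<close> of a tangent field extending \<open>w\<close>. The extension taken here is the coordinate field with
  constant coefficients \<open>w\<close>, whose image under the immersion is \<open>z \<mapsto> DF(z) w\<close>.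
\<close>

definition second_fundamental_form ::
  "('e::euclidean_space \<Rightarrow> 'b::euclidean_space) \<Rightarrow> 'e \<Rightarrow> 'e \<Rightarrow> 'e \<Rightarrow> 'b" where
  "second_fundamental_form F y v w =
     normal_component (range (frechet_derivative F (at y)))
       (frechet_derivative (\<lambda>z. frechet_derivative F (at z) w) (at y) v)"

text \<open>The supremum is taken in the extended reals, so that it is meaningful without a bound.\<close>

definition max_normal_curvature ::
  "('a, 'e::euclidean_space) atlas \<Rightarrow> ('a \<Rightarrow> 'b::euclidean_space) \<Rightarrow> ereal" where
  "max_normal_curvature A f =
     Sup {ereal (norm (second_fundamental_form (f \<circ> inv_into U \<phi>) y u u)) | U \<phi> y u.
            (U, \<phi>) \<in> A \<and> y \<in> \<phi> ` U \<and> pullback_metric (f \<circ> inv_into U \<phi>) y u u = 1}"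

end

theory Submission
  imports Defs
begin

text \<open>
  Let \<open>\<kappa>\<close> bound the normal curvature and let \<open>\<surd>3/2 < c < 1/\<kappa>\<close>. No geodesics are used; comparison geometry is
  replaced by extremal principles: on the closed manifold, \<open>|f - z|\<^sup>2 - 2c |nor (f - z)|\<close> can attain its maximum
  only where \<open>f - z\<close> is normal, because moving along the tangential part of \<open>f - z\<close> changes \<open>|nor (f - z)|\<close> at
  most at rate \<open>\<kappa> |tan (f - z)|\<^sup>2\<close>. Hence, if a radius vector of a sphere is tangent to the manifold at its end point, then
  the manifold has points far outside this sphere, and also points far inside.

  The same inequality shows that the sheet of \<open>x\<close>, the component of \<open>x\<close> in \<open>{|f - f x| < s}\<close> for \<open>\<surd>3 < s < 2c\<close>,
  satisfies \<open>2c |nor (f y - f x)| < |f y - f x|\<^sup>2\<close> away from \<open>x\<close>. Since three points of the unit ball cannot have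
  pairwise distances greater than \<open>\<surd>3\<close>, two sheets with centres that far apart on one sheet cover the manifold.
  For the point \<open>p\<close> farthest from the origin it follows that every other point either lies on the sheet of \<open>p\<close>, and
  then \<open>2c |nor\<^sub>p (f y - f p)| < |f y - f p|\<^sup>2\<close>, or has distance at least \<open>\<surd>3\<close> from \<open>f p\<close>. In dimension at least
  two these alternatives and the extremal principles imply that the map
  \<open>x \<mapsto> (D f\<^sub>p\<^sup>T (f x - f p), q - |f x - f p|\<^sup>2/2)\<close>, for small \<open>q > 0\<close> and normalized to length one, is an immersion into
  the sphere for which \<open>p\<close> is the only preimage of the pole. The number of preimages is locally constant, so
  this map is a diffeomorphism. A closed curve is instead parametrized by arc length.
\<close>

section \<open>Calculus of smooth maps\<close>

text \<open>The constant is fixed by two lengths: \<open>\<surd>3\<close>, the side of an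
  equilateral triangle inscribed in a great circle, and \<open>2/\<kappa>\<close>, the diameter of a
  circle of curvature \<open>\<kappa>\<close>, up to which sheets can be controlled;
  \<open>2/\<kappa> > \<surd>3\<close> means \<open>\<kappa> < \<surd>(4/3)\<close>. The inequality
  for \<open>nor\<close> says that \<open>f x\<close> is outside every closed ball of radius
  \<open>c\<close> touching the manifold at \<open>f y\<close>. The obstacle is that an immersed
  manifold may return close to \<open>f p\<close> on another sheet, where no such inequality is at
  hand. At the farthest point, \<open>f p\<close> is normal and
  \<open>|f y - f p|^2 \<le> -2 (f y - f p) \<bullet> f p\<close>; this makes up for it. The map to
  the sphere stems from inversion: for \<open>q = 0\<close> the quotient of its components is, up to
  a factor, \<open>D f_p^T\<close> applied to \<open>(f x - f p) / |f x - f p|^2\<close>, an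
  inversion about \<open>f p\<close> seen in the tangent space at \<open>p\<close>. A positive
  \<open>q\<close> removes the singularity at \<open>p\<close>. A kernel vector at \<open>x\<close>
  would for \<open>q = 0\<close> give a sphere or hyperplane through \<open>f p\<close> and
  \<open>f x\<close> that touches the manifold at \<open>p\<close> and whose normal at
  \<open>f x\<close> is tangent to it. The margin between \<open>c\<close> and
  \<open>\<surd>3/2\<close> absorbs a small \<open>q\<close>.\<close>

lemma frechet_derivative_D:
  assumes "f differentiable_on S" "open S" "x \<in> S"
  shows "(f has_derivative frechet_derivative f (at x)) (at x)"
  using assms by (metis differentiable_on_def at_within_open frechet_derivative_works)

lemma Ck_on_imp_continuous_on: "Ck_on k S f \<Longrightarrow> continuous_on S f"
  by (cases k) (auto intro: differentiable_imp_continuous_on)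

lemma Ck_on_cong:
  assumes "open S" "\<And>x. x \<in> S \<Longrightarrow> f x = g x" "Ck_on k S f"
  shows "Ck_on k S g"
  using assms(2,3)
proof (induction k arbitrary: f g)
  case 0
  then show ?case unfolding Ck_on.simps by (metis continuous_on_eq)
next
  case (Suc k)
  have eq: "frechet_derivative f (at x) v = frechet_derivative g (at x) v" if "x \<in> S" for x v
  proof (rule fun_cong[OF frechet_derivative_transform_within_open[OF _ assms(1) that Suc.prems(1)]])
    show "f differentiable at x"
      using Suc.prems(2) assms(1) that unfolding Ck_on.simps by (metis differentiable_on_def at_within_open)
  qed
  have "g differentiable_on S"
    using Suc.prems(2) unfolding Ck_on.simps differentiable_on_def
    by (metis Suc.prems(1) differentiable_transform_within zero_less_one)
  moreover have "Ck_on k S (\<lambda>x. frechet_derivative g (at x) v)" for v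
    by (rule Suc.IH[of "\<lambda>x. frechet_derivative f (at x) v"]) (use eq Suc.prems(2) in \<open>auto simp del: Suc.prems(1)\<close>)
  ultimately show ?case by simp
qed

lemma Ck_on_subset: "Ck_on k S f \<Longrightarrow> T \<subseteq> S \<Longrightarrow> Ck_on k T f"
  by (induction k arbitrary: f) (auto intro: continuous_on_subset differentiable_on_subset)

text \<open>Avoids \<open>frechet_derivative\<close>: it suffices to exhibit a derivative all of whose values are smooth enough.\<close>

lemma Ck_on_SucI:
  assumes "open S" "\<And>x. x \<in> S \<Longrightarrow> (f has_derivative f' x) (at x)"
    and "\<And>v. Ck_on k S (\<lambda>x. f' x v)"
  shows "Ck_on (Suc k) S f"
proof -
  have "f differentiable_on S"
    using assms(2) by (metis differentiable_at_imp_differentiable_on differentiable_def)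
  moreover have "Ck_on k S (\<lambda>x. frechet_derivative f (at x) v)" for v
    by (rule Ck_on_cong[OF assms(1) _ assms(3)[of v]]) (metis assms(2) frechet_derivative_at)
  ultimately show ?thesis by simp
qed

lemma Ck_on_SucD:
  assumes "open S" "Ck_on (Suc k) S f"
  shows "\<And>x. x \<in> S \<Longrightarrow> (f has_derivative frechet_derivative f (at x)) (at x)"
    "\<And>v. Ck_on k S (\<lambda>x. frechet_derivative f (at x) v)"
  using assms(2) frechet_derivative_D[OF _ assms(1)] unfolding Ck_on.simps by blast+

lemma Ck_on_lower: "open S \<Longrightarrow> Ck_on (Suc k) S f \<Longrightarrow> Ck_on k S f"
proof (induction k arbitrary: f)
  case 0
  then show ?case by (simp add: differentiable_imp_continuous_on)
next
  case (Suc k)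
  have "f differentiable_on S" "\<And>v. Ck_on (Suc k) S (\<lambda>x. frechet_derivative f (at x) v)"
    using Suc.prems(2) unfolding Ck_on.simps(2)[of "Suc k"] by blast+
  then have "\<And>v. Ck_on k S (\<lambda>x. frechet_derivative f (at x) v)"
    using Suc.IH[OF Suc.prems(1)] by blast
  with \<open>f differentiable_on S\<close> show ?case unfolding Ck_on.simps by blast
qed

lemma Ck_on_const: "open S \<Longrightarrow> Ck_on k S (\<lambda>x. c)"
proof (induction k arbitrary: c)
  case (Suc k)
  show ?case
    by (rule Ck_on_SucI[OF Suc.prems has_derivative_const Suc.IH[OF Suc.prems]])
qed simp

lemma Ck_on_bounded_linear:
  assumes "bounded_linear f" "open S"
  shows "Ck_on k S f"
proof (cases k)
  case 0
  then show ?thesis using assms(1) by (simp add: linear_continuous_on)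
next
  case (Suc j)
  show ?thesis unfolding Suc
    by (rule Ck_on_SucI[OF assms(2) bounded_linear_imp_has_derivative[OF assms(1)] Ck_on_const[OF assms(2)]])
qed

lemma Ck_on_add:
  assumes "open S" "Ck_on k S f" "Ck_on k S g"
  shows "Ck_on k S (\<lambda>x. f x + g x)"
  using assms(2,3)
proof (induction k arbitrary: f g)
  case 0
  then show ?case by (auto intro: continuous_intros)
next
  case (Suc k)
  note f = Ck_on_SucD[OF assms(1) Suc.prems(1)] and g = Ck_on_SucD[OF assms(1) Suc.prems(2)]
  show ?case
    by (rule Ck_on_SucI[OF assms(1) has_derivative_add[OF f(1) g(1)] Suc.IH[OF f(2) g(2)]])
qed

text \<open>By the product rule a directional derivative is a sum of two products of the same kind,
  so one induction serves scalar multiples, products and inner products.\<close>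

lemma Ck_on_bilinear:
  fixes f :: "'a::euclidean_space \<Rightarrow> 'b::euclidean_space" and g :: "'a \<Rightarrow> 'c::euclidean_space"
    and h :: "'b \<Rightarrow> 'c \<Rightarrow> 'd::euclidean_space"
  assumes h: "bounded_bilinear h" and S: "open S" and "Ck_on k S f" "Ck_on k S g"
  shows "Ck_on k S (\<lambda>x. h (f x) (g x))"
  using assms(3,4)
proof (induction k arbitrary: f g)
  case 0
  then show ?case by (simp add: bounded_bilinear.continuous_on[OF h])
next
  case (Suc k)
  note f = Ck_on_SucD[OF S Suc.prems(1)] and g = Ck_on_SucD[OF S Suc.prems(2)]
  show ?case
    by (rule Ck_on_SucI[OF S bounded_bilinear.FDERIV[OF h f(1) g(1)]
          Ck_on_add[OF S Suc.IH Suc.IH]])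
      (use Suc.prems f g Ck_on_lower[OF S] in blast)+
qed

lemmas Ck_on_scaleR = Ck_on_bilinear[OF bounded_bilinear_scaleR]
lemmas Ck_on_mult = Ck_on_bilinear[OF bounded_bilinear_mult[where 'a=real]]
lemmas Ck_on_inner = Ck_on_bilinear[OF bounded_bilinear_inner]

lemma Ck_on_linear_compose:
  fixes f :: "'a::euclidean_space \<Rightarrow> 'b::euclidean_space" and L :: "'b \<Rightarrow> 'c::euclidean_space"
  assumes L: "bounded_linear L" and S: "open S" and "Ck_on k S f"
  shows "Ck_on k S (\<lambda>x. L (f x))"
  using assms(3)
proof (induction k arbitrary: f)
  case 0
  then show ?case using linear_continuous_on_compose[OF _ bounded_linear.linear[OF L]] by auto
next
  case (Suc k)
  note f = Ck_on_SucD[OF S Suc.prems(1)]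
  show ?case
    by (rule Ck_on_SucI[OF S bounded_linear.has_derivative[OF L f(1)] Suc.IH[OF f(2)]])
qed

lemma Ck_on_sum:
  assumes "open S" "\<And>i. i \<in> I \<Longrightarrow> Ck_on k S (f i)"
  shows "Ck_on k S (\<lambda>x. \<Sum>i\<in>I. f i x)"
  using assms(2)
  by (induction I rule: infinite_finite_induct) (auto intro: Ck_on_const Ck_on_add assms(1))

lemma Ck_on_prod:
  fixes f :: "'i \<Rightarrow> 'a::euclidean_space \<Rightarrow> real"
  assumes "open S" "\<And>i. i \<in> I \<Longrightarrow> Ck_on k S (f i)"
  shows "Ck_on k S (\<lambda>x. \<Prod>i\<in>I. f i x)"
  using assms(2)
  by (induction I rule: infinite_finite_induct) (auto intro: Ck_on_const Ck_on_mult assms(1))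

lemma Ck_on_compose:
  fixes f :: "'a::euclidean_space \<Rightarrow> 'b::euclidean_space" and g :: "'b \<Rightarrow> 'c::euclidean_space"
  assumes S: "open S" and T: "open T" and "Ck_on k S f" "Ck_on k T g" "f ` S \<subseteq> T"
  shows "Ck_on k S (\<lambda>x. g (f x))"
  using assms(3-5)
proof (induction k arbitrary: g)
  case 0
  then show ?case by (auto intro: continuous_on_compose2)
next
  case (Suc k)
  note f = Ck_on_SucD[OF S Suc.prems(1)] and g = Ck_on_SucD[OF T Suc.prems(2)]
  have lin: "linear (frechet_derivative g (at y))" if "y \<in> T" for y
    using g(1)[OF that] has_derivative_linear by blast
  \<comment> \<open>\<open>Ck_on\<close> controls derivatives in a fixed direction only, whereas the
    direction in which \<open>g\<close> is differentiated varies with \<open>x\<close>. Expanding it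
    in the basis leaves products of functions of class \<open>k\<close>.\<close>
  have eq: "frechet_derivative g (at (f x)) (frechet_derivative f (at x) v) =
      (\<Sum>b\<in>Basis. (frechet_derivative f (at x) v \<bullet> b) *\<^sub>R frechet_derivative g (at (f x)) b)"
    if "x \<in> S" for x v
  proof -
    have "f x \<in> T" using that Suc.prems(3) by blast
    then have l: "linear (frechet_derivative g (at (f x)))" by (rule lin)
    show ?thesis
      by (subst (1) euclidean_representation[symmetric, of "frechet_derivative f (at x) v"])
        (simp add: linear_sum[OF l] linear_cmul[OF l])
  qed
  have "Ck_on k S (\<lambda>x. frechet_derivative g (at (f x)) (frechet_derivative f (at x) v))" for v
  proof (rule Ck_on_cong[OF S], rule eq[symmetric], assumption)
    show "Ck_on k S (\<lambda>x. \<Sum>b\<in>Basis. (frechet_derivative f (at x) v \<bullet> b) *\<^sub>R frechet_derivative g (at (f x)) b)"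
      by (intro Ck_on_sum Ck_on_scaleR Ck_on_inner S Ck_on_const f Suc.IH Suc.prems(3) g Ck_on_lower[OF S Suc.prems(1)])
  qed
  then show ?case
    by (intro Ck_on_SucI[OF S has_derivative_compose[OF f(1) g(1)]]) (use Suc.prems(3) in auto)
qed

lemma Ck_on_real_fun:
  fixes h h' :: "real \<Rightarrow> real"
  assumes "open T" "\<And>y. y \<in> T \<Longrightarrow> (h has_field_derivative h' y) (at y)" "Ck_on k T h'"
  shows "Ck_on (Suc k) T h"
  by (rule Ck_on_SucI[OF assms(1) has_field_derivative_imp_has_derivative[OF assms(2)]])
    (auto simp: Ck_on_mult[OF assms(1,3) Ck_on_const[OF assms(1)]])

lemma Ck_on_inverse: "Ck_on k {0<..} (inverse :: real \<Rightarrow> real)"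
proof (induction k)
  case 0
  then show ?case by (auto intro!: continuous_intros)
next
  case (Suc k)
  show ?case
  proof (rule Ck_on_real_fun)
    show "(inverse has_field_derivative - (inverse y * inverse y)) (at y)" if "y \<in> {0<..}" for y :: real
      using DERIV_inverse[of y UNIV] that by (simp add: power2_eq_square)
    have "Ck_on k {0<..} (\<lambda>y::real. (-1) * (inverse y * inverse y))"
      by (intro Ck_on_mult Ck_on_const Suc.IH open_greaterThan)
    then show "Ck_on k {0<..} (\<lambda>y::real. - (inverse y * inverse y))" by simp
  qed simp
qed

lemma Ck_on_sqrt: "Ck_on k {0<..} sqrt"
proof (induction k)
  case 0
  then show ?case by (auto intro!: continuous_intros)
next
  case (Suc k)
  show ?case
  proof (rule Ck_on_real_fun)
    show "(sqrt has_field_derivative inverse (sqrt y) * (1/2)) (at y)" if "y \<in> {0<..}" for y :: real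
      using DERIV_real_sqrt[of y] that by (simp)
    show "Ck_on k {0<..} (\<lambda>y. inverse (sqrt y) * (1/2))"
      by (intro Ck_on_mult Ck_on_const open_greaterThan Ck_on_compose[OF _ _ Suc.IH Ck_on_inverse]) auto
  qed simp
qed

lemma Ck_on_Pair:
  fixes f :: "'a::euclidean_space \<Rightarrow> 'b::euclidean_space" and g :: "'a \<Rightarrow> 'c::euclidean_space"
  assumes "open S" "Ck_on k S f" "Ck_on k S g"
  shows "Ck_on k S (\<lambda>x. (f x, g x))"
proof -
  have "Ck_on k S (\<lambda>x. (f x, 0) + (0, g x))"
    by (intro Ck_on_add assms Ck_on_linear_compose[OF _ _ assms(2)] Ck_on_linear_compose[OF _ _ assms(3)]
        bounded_linear_Pair bounded_linear_ident bounded_linear_zero)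
  then show ?thesis by simp
qed

text \<open>Serves \<open>circle_map\<close>, where the map is known only near each point, in terms
  of an arc length parameter.\<close>

lemma Ck_on_local:
  assumes "open S" "\<And>x. x \<in> S \<Longrightarrow> \<exists>T. open T \<and> x \<in> T \<and> Ck_on k T f"
  shows "Ck_on k S f"
  using assms(2)
proof (induction k arbitrary: f)
  case 0
  have "continuous (at x within S) f" if x: "x \<in> S" for x
  proof -
    obtain T where T: "open T" "x \<in> T" "continuous_on T f" using 0[OF x] by auto
    then have "isCont f x" by (simp add: continuous_on_eq_continuous_at)
    then show ?thesis by (rule continuous_at_imp_continuous_at_within)
  qed
  then show ?case by (simp add: continuous_on_eq_continuous_within)
next
  case (Suc k)
  have D: "(f has_derivative frechet_derivative f (at x)) (at x)" if x: "x \<in> S" for x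
    using Suc.prems[OF x] Ck_on_SucD(1) by blast
  have "Ck_on k S (\<lambda>x. frechet_derivative f (at x) v)" for v
  proof (rule Suc.IH)
    fix x assume "x \<in> S"
    from Suc.prems[OF this] show "\<exists>T. open T \<and> x \<in> T \<and> Ck_on k T (\<lambda>x. frechet_derivative f (at x) v)"
      using Ck_on_SucD(2) by blast
  qed
  from Ck_on_SucI[OF assms(1) D this] show ?case .
qed

lemma Ck_on_sin_cos: "Ck_on k UNIV (sin :: real \<Rightarrow> real)" "Ck_on k UNIV (cos :: real \<Rightarrow> real)"
proof -
  have "Ck_on k UNIV (sin :: real \<Rightarrow> real) \<and> Ck_on k UNIV (cos :: real \<Rightarrow> real)"
  proof (induction k)
    case 0
    show ?case by (simp add: continuous_intros)
  next
    case (Suc k)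
    have "Ck_on k UNIV (\<lambda>x. - sin x :: real)"
      using Ck_on_linear_compose[OF bounded_linear_minus[OF bounded_linear_ident] open_UNIV] Suc.IH by blast
    then have "Ck_on (Suc k) UNIV (cos :: real \<Rightarrow> real)" by (rule Ck_on_real_fun[OF open_UNIV DERIV_cos])
    moreover have "Ck_on (Suc k) UNIV (sin :: real \<Rightarrow> real)"
      by (rule Ck_on_real_fun[OF open_UNIV DERIV_sin]) (use Suc.IH in blast)
    ultimately show ?case by blast
  qed
  then show "Ck_on k UNIV (sin :: real \<Rightarrow> real)" "Ck_on k UNIV (cos :: real \<Rightarrow> real)" by auto
qed

text \<open>Cramer's rule makes the solution rational in the coefficients. The quotient by
  \<open>det (M z)\<close> is written as a product with \<open>det (M z)\<close> and the inverse of
  its square because smoothness of \<open>inverse\<close> is available on positive numbers.\<close>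

lemma Ck_on_matrix_solution:
  fixes M :: "'a::euclidean_space \<Rightarrow> real^'n^'n" and x :: "'a \<Rightarrow> real^'n"
  assumes S: "open S" and M: "\<And>i j. Ck_on k S (\<lambda>z. M z $ i $ j)"
    and det: "\<And>z. z \<in> S \<Longrightarrow> det (M z) \<noteq> 0" and eq: "\<And>z. z \<in> S \<Longrightarrow> M z *v x z = w"
  shows "Ck_on k S x"
proof -
  have D: "Ck_on k S (\<lambda>z. det (B z))" if "\<And>i j. Ck_on k S (\<lambda>z. B z $ i $ j)" for B :: "'a \<Rightarrow> real^'n^'n"
    unfolding det_def by (intro Ck_on_sum Ck_on_mult Ck_on_const Ck_on_prod that S)
  have pos: "0 < det (M z) * det (M z)" if "z \<in> S" for z
    using det[OF that] by (metis not_real_square_gt_zero)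
  have inv: "Ck_on k S (\<lambda>z. inverse (det (M z) * det (M z)))"
    by (rule Ck_on_compose[OF S _ _ Ck_on_inverse])
      (use pos in \<open>auto intro!: Ck_on_mult S D M\<close>)
  have "Ck_on k S (\<lambda>z. \<Sum>b\<in>UNIV. (det (\<chi> i j. if j = b then w $ i else M z $ i $ j) *
      (det (M z) * inverse (det (M z) * det (M z)))) *\<^sub>R axis b 1)"
  proof (intro Ck_on_sum Ck_on_scaleR Ck_on_mult Ck_on_const S inv D M)
    show "Ck_on k S (\<lambda>z. (\<chi> i j. if j = b then w $ i else M z $ i $ j) $ i $ j)" for b i j
      by (cases "j = b") (simp_all add: Ck_on_const[OF S] M)
  qed
  then show ?thesis
  proof (rule Ck_on_cong[OF S, rotated])
    fix z assume z: "z \<in> S"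
    have "x z = (\<chi> k. det (\<chi> i j. if j = k then w $ i else M z $ i $ j) / det (M z))"
      using cramer[OF det[OF z], of "x z" w] eq[OF z] by simp
    then show "(\<Sum>b\<in>UNIV. (det (\<chi> i j. if j = b then w $ i else M z $ i $ j) *
      (det (M z) * inverse (det (M z) * det (M z)))) *\<^sub>R axis b 1) = x z"
      using det[OF z] by (simp add: vec_eq_iff axis_def if_distrib field_simps cong: if_cong)
  qed
qed

text \<open>The derivative of the inverse \<open>h\<close> at \<open>z\<close> solves a linear
  system whose matrix is the derivative of \<open>g\<close> at \<open>h z\<close>. Its entries are
  as smooth as \<open>h\<close>, so solving the system raises the class of \<open>h\<close> by one.
  The coordinate space is \<open>real^'n\<close> for the sake of determinants.\<close>

lemma Ck_on_inv_into:
  fixes g :: "real^'n \<Rightarrow> real^'n"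
  assumes S: "open S" and g: "\<And>k. Ck_on k S g" and inj: "inj_on g S"
    and dinj: "\<And>x. x \<in> S \<Longrightarrow> inj (frechet_derivative g (at x))"
  shows "open (g ` S)" "Ck_on k (g ` S) (inv_into S g)"
proof -
  show O: "open (g ` S)"
    using invariance_of_domain[OF Ck_on_imp_continuous_on[OF g[of 0]] S inj] .
  define D where "D x = frechet_derivative g (at x)" for x
  have Dg: "(g has_derivative D x) (at x)" if "x \<in> S" for x
    unfolding D_def using Ck_on_SucD(1)[OF S g[of "Suc 0"] that] .
  have lin: "linear (D x)" if "x \<in> S" for x
    using Dg[OF that] has_derivative_linear by blast
  have bij: "bij (D x)" if "x \<in> S" for x
    using lin[OF that] dinj[OF that] linear_injective_imp_surjective[of "D x"]
    unfolding D_def bij_def by auto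
  define h where "h = inv_into S g"
  have hS: "h z \<in> S" and gh: "g (h z) = z" if "z \<in> g ` S" for z
    using that by (auto simp: h_def inv_into_into f_inv_into_f)
  have hg: "h (g x) = x" if "x \<in> S" for x using that inj by (simp add: h_def)
  have Dh: "(h has_derivative inv (D (h z))) (at z)" if "z \<in> g ` S" for z
  proof -
    have "(h has_derivative inv (D (h z))) (at (g (h z)))"
    proof (rule has_derivative_inverse_on[OF S, where f = g and f' = D and g = h and g' = "\<lambda>x. inv (D x)"])
      show "(g has_derivative D x) (at x)" if "x \<in> S" for x using Dg that .
      show "D (h z) \<circ> inv (D (h z)) = id"
        using bij[OF hS[OF that]] by (metis bij_is_surj surj_iff)
    qed (use hg hS that in auto)
    then show ?thesis using gh that by simp
  qed
  have "Ck_on k (g ` S) h"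
  proof (induction k)
    case 0
    then show ?case using Dh by (auto intro: continuous_at_imp_continuous_on has_derivative_continuous)
  next
    case (Suc k)
    show ?case
    proof (rule Ck_on_SucI[OF O Dh])
      fix w
      show "Ck_on k (g ` S) (\<lambda>z. inv (D (h z)) w)"
      proof (rule Ck_on_matrix_solution[OF O, of _ "\<lambda>z. matrix (D (h z))" _ w])
        show "Ck_on k (g ` S) (\<lambda>z. matrix (D (h z)) $ i $ j)" for i j
        proof -
          have "Ck_on k (g ` S) (\<lambda>z. D (h z) (axis j 1) \<bullet> axis i 1)"
            by (intro Ck_on_inner[OF O _ Ck_on_const[OF O]] Ck_on_compose[OF O S Suc.IH])
              (use hS Ck_on_SucD(2)[OF S g] in \<open>auto simp: D_def\<close>)
          then show ?thesis by (simp add: matrix_def inner_axis)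
        qed
        show "det (matrix (D (h z))) \<noteq> 0" if "z \<in> g ` S" for z
          using bij[OF hS[OF that]] lin[OF hS[OF that]]
          by (metis bij_def det_nz_iff_inj)
        show "matrix (D (h z)) *v inv (D (h z)) w = w" if "z \<in> g ` S" for z
          using bij[OF hS[OF that]] lin[OF hS[OF that]]
          by (simp add: matrix_works bij_is_surj surj_f_inv_f linear_matrix_vector_mul_eq)
      qed
    qed
  qed
  then show "Ck_on k (g ` S) (inv_into S g)" by (simp add: h_def)
qed

section \<open>Orthogonal projections\<close>

text \<open>Justifies \<open>THE\<close> in the definition: orthogonal decomposition gives
  existence, and two candidates differ by a vector of \<open>T\<close> orthogonal to
  \<open>T\<close>.\<close>

lemma normal_component_props:
  fixes v :: "'b::euclidean_space"
  assumes "subspace T"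
  shows "t \<in> T \<Longrightarrow> normal_component T v \<bullet> t = 0" "v - normal_component T v \<in> T"
proof -
  obtain y z where yz: "y \<in> span T" "\<And>w. w \<in> span T \<Longrightarrow> orthogonal z w" "v = y + z"
    by (rule orthogonal_subspace_decomp_exists[of T v]) blast
  have sp: "span T = T" using assms by (simp add: span_eq_iff)
  have ex: "z \<in> T\<^sup>\<bottom> \<and> v - z \<in> T"
    using yz sp by (auto simp: orthogonal_comp_def orthogonal_commute)
  moreover have "w = z" if "w \<in> T\<^sup>\<bottom> \<and> v - w \<in> T" for w
  proof -
    have "(v - w) - (v - z) \<in> T" using that ex assms subspace_diff by blast
    then have "z - w \<in> T" by simp
    moreover have "z - w \<in> T\<^sup>\<bottom>" using that ex subspace_orthogonal_comp subspace_diff by blast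
    ultimately have "orthogonal (z - w) (z - w)" by (simp add: orthogonal_comp_def)
    then show ?thesis by (simp add: orthogonal_self)
  qed
  ultimately have "normal_component T v \<in> T\<^sup>\<bottom> \<and> v - normal_component T v \<in> T"
    unfolding normal_component_def by (rule theI)
  then show "t \<in> T \<Longrightarrow> normal_component T v \<bullet> t = 0" "v - normal_component T v \<in> T"
    by (auto simp: orthogonal_comp_def orthogonal_def inner_commute)
qed

lemma normal_component_unique:
  fixes v :: "'b::euclidean_space"
  assumes T: "subspace T" and "\<And>t. t \<in> T \<Longrightarrow> z \<bullet> t = 0" "v - z \<in> T"
  shows "normal_component T v = z"
proof -
  let ?n = "normal_component T v"
  have "(v - z) - (v - ?n) \<in> T" using assms normal_component_props(2)[OF T] subspace_diff by blast
  then have d: "?n - z \<in> T" by simp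
  have "(?n - z) \<bullet> (?n - z) = 0"
    using assms(2)[OF d] normal_component_props(1)[OF T d] by (simp add: inner_diff_left)
  then show ?thesis by simp
qed

lemma normal_component_linear:
  fixes T :: "'b::euclidean_space set"
  assumes T: "subspace T"
  shows "linear (normal_component T)"
proof
  note p = normal_component_props[OF T]
  show "normal_component T (a + b) = normal_component T a + normal_component T b" for a b
    by (rule normal_component_unique[OF T])
      (use p subspace_add[OF T p(2)[of a] p(2)[of b]] in \<open>auto simp: inner_add_left algebra_simps\<close>)
  show "normal_component T (r *\<^sub>R a) = r *\<^sub>R normal_component T a" for r a
    by (rule normal_component_unique[OF T])
      (use p subspace_scale[OF T p(2)[of a], of r] in \<open>auto simp: algebra_simps\<close>)
qed

lemma normal_component_eq_0_iff:
  fixes T :: "'b::euclidean_space set"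
  assumes T: "subspace T"
  shows "normal_component T v = 0 \<longleftrightarrow> v \<in> T"
  using normal_component_props(2)[OF T, of v] normal_component_unique[OF T, of 0 v] by auto

lemma normal_component_pythagoras:
  fixes v :: "'b::euclidean_space"
  assumes T: "subspace T" and t: "t \<in> T"
  shows "(norm (v - t))\<^sup>2 = (norm (normal_component T v))\<^sup>2 + (norm (v - normal_component T v - t))\<^sup>2"
proof -
  let ?n = "normal_component T v"
  have "v - ?n - t \<in> T" using normal_component_props(2)[OF T, of v] t T subspace_diff by blast
  then have "orthogonal ?n (v - ?n - t)"
    using normal_component_props(1)[OF T] by (simp add: orthogonal_def)
  then have "(norm (?n + (v - ?n - t)))\<^sup>2 = (norm ?n)\<^sup>2 + (norm (v - ?n - t))\<^sup>2"
    by (rule norm_add_Pythagorean)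
  then show ?thesis by simp
qed

text \<open>Any tangent vector serves as a test vector for an upper bound; good test vectors are all
  that \<open>first_variation\<close> needs.\<close>

lemma norm_normal_component_le:
  fixes v :: "'b::euclidean_space"
  assumes "subspace T" "t \<in> T"
  shows "norm (normal_component T v) \<le> norm (v - t)"
proof -
  have "(norm (normal_component T v))\<^sup>2 \<le> (norm (v - t))\<^sup>2"
    using normal_component_pythagoras[OF assms, of v] by simp
  then show ?thesis by (rule power2_le_imp_le) simp
qed

lemma inner_tangential_self:
  fixes v :: "'b::euclidean_space"
  assumes T: "subspace T"
  shows "v \<bullet> (v - normal_component T v) = (norm (v - normal_component T v))\<^sup>2"
proof -
  let ?n = "normal_component T v"
  have "?n \<bullet> (v - ?n) = 0" using normal_component_props[OF T] by blast
  then show ?thesis by (simp add: power2_norm_eq_inner inner_diff_left)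
qed

section \<open>Immersions in a chart\<close>

lemma isCont_tendsto_nhds: "isCont f x \<Longrightarrow> (f \<longlongrightarrow> f x) (nhds x)"
  using tendsto_at_iff_tendsto_nhds[of f x] by (simp add: isCont_def)

lemma linear_diff_bound:
  fixes L L' :: "'x::euclidean_space \<Rightarrow> 'y::real_normed_vector"
  assumes "linear L" "linear L'" "\<And>i. i \<in> Basis \<Longrightarrow> norm (L i - L' i) \<le> e"
  shows "norm (L b - L' b) \<le> real DIM('x) * e * norm b"
proof -
  have ex: "M b = (\<Sum>i\<in>Basis. (b \<bullet> i) *\<^sub>R M i)" if "linear M" for M :: "'x \<Rightarrow> 'y"
    by (subst (1) euclidean_representation[symmetric, of b])
      (simp add: linear_sum[OF that] linear_cmul[OF that])
  have "norm (L b - L' b) = norm (\<Sum>i\<in>Basis. (b \<bullet> i) *\<^sub>R (L i - L' i))"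
    using assms(1,2) by (simp add: ex[of L] ex[of L'] sum_subtractf scaleR_diff_right)
  also have "\<dots> \<le> (\<Sum>i\<in>(Basis::'x set). norm b * e)"
  proof (rule order_trans[OF norm_sum sum_mono])
    fix i :: 'x assume i: "i \<in> Basis"
    show "norm ((b \<bullet> i) *\<^sub>R (L i - L' i)) \<le> norm b * e"
      using assms(3)[OF i] Basis_le_norm[OF i, of b] by (simp add: mult_mono)
  qed
  finally show ?thesis by (simp add: mult_ac)
qed

lemma line_derivative_at:
  assumes "(g has_derivative g') (at (y0 + s *\<^sub>R a))"
  shows "((\<lambda>s. g (y0 + s *\<^sub>R a)) has_vector_derivative g' a) (at s)"
proof -
  have "((\<lambda>s. y0 + s *\<^sub>R a) has_vector_derivative a) (at s)"
    by (auto intro!: derivative_eq_intros)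
  from vector_derivative_diff_chain_within[OF this has_derivative_at_withinI[OF assms]]
  show ?thesis by (simp add: o_def)
qed

lemma line_derivative:
  assumes "(g has_derivative g') (at y0)"
  shows "((\<lambda>s. g (y0 + s *\<^sub>R a)) has_vector_derivative g' a) (at 0)"
  using line_derivative_at[of g g' y0 0 a] assms by simp

lemma vector_derivative_error:
  fixes g :: "real \<Rightarrow> 'c::real_normed_vector"
  assumes "(g has_vector_derivative g') (at 0)" "e > 0"
  shows "\<forall>\<^sub>F s in nhds 0. norm (g s - g 0 - s *\<^sub>R g') \<le> e * \<bar>s\<bar>"
proof -
  obtain d where d: "d > 0" "\<And>s. norm (s - 0) < d \<Longrightarrow> norm (g s - g 0 - (s - 0) *\<^sub>R g') \<le> e * norm (s - 0)"
    using assms unfolding has_vector_derivative_def has_derivative_at_alt by blast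
  show ?thesis
    unfolding eventually_nhds_metric
    by (rule exI[of _ d]) (use d in \<open>auto simp: dist_norm\<close>)
qed

locale chart_immersion =
  fixes S :: "'e::euclidean_space set" and F :: "'e \<Rightarrow> 'b::euclidean_space"
  assumes S: "open S" and smooth: "\<And>k. Ck_on k S F"
    and inj: "\<And>y. y \<in> S \<Longrightarrow> inj (frechet_derivative F (at y))"
begin

definition D where "D y v = frechet_derivative F (at y) v"
definition D2 where "D2 y v w = frechet_derivative (\<lambda>z. D z w) (at y) v"
definition Nor where "Nor y = normal_component (range (D y))"

lemma D_derivative: "y \<in> S \<Longrightarrow> (F has_derivative D y) (at y)"
  using Ck_on_SucD(1)[OF S smooth[of 1, unfolded One_nat_def]] unfolding D_def by blast

lemma D_Ck: "Ck_on k S (\<lambda>y. D y v)"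
  using Ck_on_SucD(2)[OF S smooth[of "Suc k"]] unfolding D_def by blast

lemma D2_derivative: "y \<in> S \<Longrightarrow> ((\<lambda>z. D z w) has_derivative (\<lambda>v. D2 y v w)) (at y)"
  using Ck_on_SucD(1)[OF S D_Ck[of "Suc 0"]] unfolding D2_def by blast

lemma D2_Ck: "Ck_on k S (\<lambda>y. D2 y v w)"
  using Ck_on_SucD(2)[OF S D_Ck[of "Suc k"]] unfolding D2_def by blast

lemma D_linear: "y \<in> S \<Longrightarrow> linear (D y)"
  using D_derivative has_derivative_linear by blast

lemma D_inj: "y \<in> S \<Longrightarrow> inj (D y)"
  using inj unfolding D_def by simp

lemma range_subspace: "y \<in> S \<Longrightarrow> subspace (range (D y))"
  using D_linear linear_subspace_image subspace_UNIV by blast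

lemma D_diff_bound:
  assumes "y \<in> S" "y' \<in> S" "\<And>i. i \<in> Basis \<Longrightarrow> norm (D y i - D y' i) \<le> e"
  shows "norm (D y b - D y' b) \<le> real DIM('e) * e * norm b"
  by (rule linear_diff_bound[OF D_linear[OF assms(1)] D_linear[OF assms(2)] assms(3)])

lemma D_continuous:
  assumes y0: "y0 \<in> S" and e: "e > 0"
  shows "\<forall>\<^sub>F y in nhds y0. y \<in> S \<and> (\<forall>b. norm (D y b - D y0 b) \<le> e * norm b)"
proof -
  let ?d = "e / real DIM('e)"
  have d: "?d > 0" using e by simp
  have "\<forall>\<^sub>F y in nhds y0. \<forall>i\<in>Basis. norm (D y i - D y0 i) < ?d"
  proof (intro eventually_ball_finite ballI)
    fix i :: 'e
    have "isCont (\<lambda>y. D y i) y0"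
      using Ck_on_imp_continuous_on[OF D_Ck[of 0]] S y0 continuous_on_eq_continuous_at by blast
    then have "((\<lambda>y. D y i) \<longlongrightarrow> D y0 i) (nhds y0)"
      by (rule isCont_tendsto_nhds)
    then show "\<forall>\<^sub>F y in nhds y0. norm (D y i - D y0 i) < ?d"
      unfolding dist_norm[symmetric] by (rule tendstoD[OF _ d])
  qed simp
  moreover have "\<forall>\<^sub>F y in nhds y0. y \<in> S" using S y0 eventually_nhds_in_open by blast
  ultimately show ?thesis
  proof eventually_elim
    case (elim y)
    then have "norm (D y b - D y0 b) \<le> real DIM('e) * ?d * norm b" for b
      using D_diff_bound[of y y0 ?d b] y0 by (simp add: less_imp_le)
    then show ?case using elim by simp
  qed
qed

lemma D_bounded_below:
  assumes y0: "y0 \<in> S"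
  obtains m where "m > 0" "\<forall>\<^sub>F y in nhds y0. y \<in> S \<and> (\<forall>b. m * norm b \<le> norm (D y b))"
proof -
  obtain B where B: "B > 0" "\<And>x. B * norm x \<le> norm (D y0 x)"
    using linear_inj_bounded_below_pos[OF D_linear[OF y0] D_inj[OF y0]] by blast
  have "\<forall>\<^sub>F y in nhds y0. y \<in> S \<and> (\<forall>b. B/2 * norm b \<le> norm (D y b))"
    using D_continuous[OF y0 half_gt_zero[OF B(1)]]
  proof eventually_elim
    case (elim y)
    have "B/2 * norm b \<le> norm (D y b)" for b
    proof -
      have "norm (D y b - D y0 b) \<le> B/2 * norm b" using elim B by auto
      moreover have "norm (D y0 b) - norm (D y b) \<le> norm (D y b - D y0 b)"
        by (metis norm_minus_commute norm_triangle_ineq2)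
      ultimately show ?thesis using B(2)[of b] by simp
    qed
    then show ?case using elim B by auto
  qed
  then show thesis using that[of "B/2"] B by simp
qed

text \<open>Split \<open>v\<close> at \<open>y0\<close> into \<open>D y0 b0\<close> and a normal
  vector. Near \<open>y0\<close> the former is almost the tangent vector \<open>D y b0\<close>, and
  the latter is almost orthogonal to the tangent space at \<open>y\<close>, so its tangential part
  \<open>D y b\<close> is small. The uniform lower bound on \<open>D y\<close> controls
  \<open>b\<close>.\<close>

lemma Nor_tendsto:
  assumes y0: "y0 \<in> S"
  shows "((\<lambda>y. Nor y v) \<longlongrightarrow> Nor y0 v) (nhds y0)"
proof (rule tendstoI)
  fix e :: real assume e: "e > 0"
  obtain b0 where b0: "v - Nor y0 v = D y0 b0"
    using normal_component_props(2)[OF range_subspace[OF y0], of v] unfolding Nor_def by blast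
  let ?n = "Nor y0 v"
  obtain m where m: "m > 0" and ev: "\<forall>\<^sub>F y in nhds y0. y \<in> S \<and> (\<forall>b. m * norm b \<le> norm (D y b))"
    by (rule D_bounded_below[OF y0])
  define d where "d = e / (norm b0 + norm ?n / m + 1)"
  have den: "norm b0 + norm ?n / m + 1 > 0"
    using m by (simp add: add_nonneg_pos)
  have d: "d > 0" using e den by (simp add: d_def)
  show "\<forall>\<^sub>F y in nhds y0. dist (Nor y v) (Nor y0 v) < e"
    using ev D_continuous[OF y0 d]
  proof eventually_elim
    case (elim y)
    then have y: "y \<in> S" and low: "\<And>b. m * norm b \<le> norm (D y b)"
      and dif: "\<And>b. norm (D y b - D y0 b) \<le> d * norm b" by auto
    note T = range_subspace[OF y]
    have lin: "linear (Nor y)" unfolding Nor_def by (rule normal_component_linear[OF T])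
    have 1: "norm (Nor y (D y0 b0)) \<le> d * norm b0"
      using norm_normal_component_le[OF T, of "D y b0" "D y0 b0"] dif[of b0]
      by (simp add: Nor_def norm_minus_commute)
    obtain b where b: "?n - Nor y ?n = D y b"
      using normal_component_props(2)[OF T, of ?n] unfolding Nor_def by blast
    have "?n \<bullet> D y0 b = 0"
      using normal_component_props(1)[OF range_subspace[OF y0], of "D y0 b" v] by (simp add: Nor_def)
    then have "(norm (D y b))\<^sup>2 = ?n \<bullet> (D y b - D y0 b)"
      using inner_tangential_self[OF T, of ?n] unfolding Nor_def[of y, symmetric] b
      by (simp add: inner_diff_right)
    also have "\<dots> \<le> norm ?n * (d * norm b)"
      using norm_cauchy_schwarz[of ?n "D y b - D y0 b"] dif[of b]
      by (meson mult_left_mono norm_ge_zero order_trans)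
    also have "\<dots> \<le> norm ?n * (d * (norm (D y b) / m))"
      using low[of b] m d by (intro mult_left_mono) (auto simp: field_simps)
    finally have "norm (D y b) * norm (D y b) \<le> (norm ?n / m * d) * norm (D y b)"
      by (simp add: power2_eq_square mult_ac)
    then have 2: "norm (D y b) \<le> norm ?n / m * d"
      using m d by (cases "norm (D y b) = 0") (auto intro: mult_right_le_imp_le)
    have "Nor y v = Nor y (D y0 b0) + Nor y ?n"
      using linear_add[OF lin, of "D y0 b0" ?n] b0 by (metis diff_add_cancel)
    then have "Nor y v - ?n = Nor y (D y0 b0) - D y b" using b[symmetric] by simp
    then have "norm (Nor y v - ?n) \<le> norm (Nor y (D y0 b0)) + norm (D y b)"
      by (simp add: norm_triangle_ineq4)
    also have "\<dots> \<le> d * (norm b0 + norm ?n / m)" using 1 2 by (simp add: algebra_simps)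
    also have "\<dots> < e" using e den unfolding d_def by (simp add: field_simps)
    finally show ?case by (simp add: dist_norm)
  qed
qed

lemma Nor_tendsto':
  assumes y0: "y0 \<in> S" and V: "(V \<longlongrightarrow> V y0) (nhds y0)"
  shows "((\<lambda>y. Nor y (V y)) \<longlongrightarrow> Nor y0 (V y0)) (nhds y0)"
proof -
  have "((\<lambda>y. Nor y (V y) - Nor y (V y0)) \<longlongrightarrow> 0) (nhds y0)"
  proof (rule Lim_null_comparison[OF _ tendsto_norm_zero[OF LIM_zero[OF V]]])
    show "\<forall>\<^sub>F y in nhds y0. norm (Nor y (V y) - Nor y (V y0)) \<le> norm (V y - V y0)"
      using eventually_nhds_in_open[OF S y0]
    proof eventually_elim
      case (elim y)
      note T = range_subspace[OF elim]
      have "Nor y (V y) - Nor y (V y0) = Nor y (V y - V y0)"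
        unfolding Nor_def using linear_diff[OF normal_component_linear[OF T]] by metis
      then show ?case
        using norm_normal_component_le[OF T, of 0 "V y - V y0"] subspace_0[OF T] by (simp add: Nor_def)
    qed
  qed
  then have "((\<lambda>y. (Nor y (V y) - Nor y (V y0)) + Nor y (V y0)) \<longlongrightarrow> 0 + Nor y0 (V y0)) (nhds y0)"
    by (intro tendsto_add Nor_tendsto y0)
  then show ?thesis by simp
qed

lemma D_line_Lipschitz:
  assumes y0: "y0 \<in> S"
  obtains C where "C > 0" "\<forall>\<^sub>F s in nhds 0. \<forall>b. norm (D (y0 + s *\<^sub>R a) b - D y0 b) \<le> C * \<bar>s\<bar> * norm b"
proof -
  define M where "M = (\<Sum>i\<in>(Basis::'e set). norm (D2 y0 a i)) + 1"
  have Mi: "norm (D2 y0 a i) + 1 \<le> M" if "i \<in> Basis" for i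
    using member_le_sum[OF that, of "\<lambda>i. norm (D2 y0 a i)"] by (simp add: M_def)
  have M: "M > 0" by (simp add: M_def sum_nonneg add_nonneg_pos)
  have line: "((\<lambda>s. y0 + s *\<^sub>R a) \<longlongrightarrow> y0) (nhds (0::real))"
  proof -
    have "((\<lambda>s. y0 + s *\<^sub>R a) \<longlongrightarrow> y0 + 0 *\<^sub>R a) (nhds (0::real))"
      by (intro tendsto_intros filterlim_ident)
    then show ?thesis by simp
  qed
  have ev: "\<forall>\<^sub>F s in nhds (0::real). \<forall>i\<in>Basis. norm (D (y0 + s *\<^sub>R a) i - D y0 i - s *\<^sub>R D2 y0 a i) \<le> 1 * \<bar>s\<bar>"
  proof (intro eventually_ball_finite ballI)
    fix i :: 'e
    show "\<forall>\<^sub>F s in nhds (0::real). norm (D (y0 + s *\<^sub>R a) i - D y0 i - s *\<^sub>R D2 y0 a i) \<le> 1 * \<bar>s\<bar>"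
      using vector_derivative_error[OF line_derivative[OF D2_derivative[OF y0, of i], of a], of 1] by simp
  qed simp
  have "\<forall>\<^sub>F s in nhds (0::real). y0 + s *\<^sub>R a \<in> S"
    using topological_tendstoD[OF line S y0] .
  with ev have "\<forall>\<^sub>F s in nhds 0. \<forall>b. norm (D (y0 + s *\<^sub>R a) b - D y0 b) \<le> real DIM('e) * M * \<bar>s\<bar> * norm b"
  proof eventually_elim
    case (elim s)
    have "norm (D (y0 + s *\<^sub>R a) i - D y0 i) \<le> M * \<bar>s\<bar>" if i: "i \<in> Basis" for i
    proof -
      have "norm (D (y0 + s *\<^sub>R a) i - D y0 i) \<le> norm (D (y0 + s *\<^sub>R a) i - D y0 i - s *\<^sub>R D2 y0 a i) + norm (s *\<^sub>R D2 y0 a i)"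
        by (metis diff_add_cancel norm_triangle_ineq)
      also have "\<dots> \<le> (norm (D2 y0 a i) + 1) * \<bar>s\<bar>" using elim i by (auto simp: algebra_simps)
      also have "\<dots> \<le> M * \<bar>s\<bar>" using Mi[OF i] by (simp add: mult_right_mono)
      finally show ?thesis .
    qed
    then have "norm (D (y0 + s *\<^sub>R a) b - D y0 b) \<le> real DIM('e) * (M * \<bar>s\<bar>) * norm b" for b
      by (rule D_diff_bound[OF elim(2) y0])
    then show ?case by (simp add: mult_ac)
  qed
  then show thesis using that[of "real DIM('e) * M"] M by simp
qed

text \<open>Along the chart line in direction \<open>a\<close>, the distance from \<open>V\<close> to the tangent space is estimated
  from above by testing with the tangent vector \<open>D(a + s b\<^sub>1)\<close>, and from below by exchanging the
  two points; \<open>b\<^sub>1\<close> is chosen to cancel the tangential part of the error.\<close>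

lemma first_variation:
  fixes l :: real
  assumes y0: "y0 \<in> S" and V: "\<And>y. V y = l *\<^sub>R F y - z"
    and a: "V y0 - Nor y0 (V y0) = D y0 a"
    and K: "norm (Nor y0 (D2 y0 a a)) \<le> K" and e: "e > 0"
  shows "\<forall>\<^sub>F s in nhds 0. \<bar>norm (Nor (y0 + s *\<^sub>R a) (V (y0 + s *\<^sub>R a))) - norm (Nor y0 (V y0))\<bar> \<le> (K + e) * \<bar>s\<bar>"
proof -
  define L where "L s = y0 + s *\<^sub>R a" for s
  define A where "A = Nor y0 (D2 y0 a a)"
  note T0 = range_subspace[OF y0]
  have "D2 y0 a a - A \<in> range (D y0)" unfolding A_def Nor_def by (rule normal_component_props(2)[OF T0])
  then have "l *\<^sub>R D y0 a - (D2 y0 a a - A) \<in> range (D y0)"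
    using subspace_diff[OF T0 subspace_scale[OF T0 rangeI]] by blast
  then obtain b1 where b1: "D y0 b1 = l *\<^sub>R D y0 a - (D2 y0 a a - A)" by force
  have L0: "L 0 = y0" by (simp add: L_def)
  have Llim: "(L \<longlongrightarrow> y0) (nhds 0)"
  proof -
    have "(L \<longlongrightarrow> y0 + 0 *\<^sub>R a) (nhds (0::real))"
      unfolding L_def by (intro tendsto_intros filterlim_ident)
    then show ?thesis by simp
  qed
  have LS: "\<forall>\<^sub>F s in nhds 0. L s \<in> S" using topological_tendstoD[OF Llim S y0] .
  have Vder: "(V has_derivative (\<lambda>v. l *\<^sub>R D y0 v)) (at y0)"
    unfolding V by (auto intro!: derivative_eq_intros D_derivative y0)
  have Vcont: "(V \<longlongrightarrow> V y0) (nhds y0)"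
    using has_derivative_continuous[OF Vder] by (rule isCont_tendsto_nhds)
  obtain C where C: "C > 0" "\<forall>\<^sub>F s in nhds 0. \<forall>b. norm (D (L s) b - D y0 b) \<le> C * \<bar>s\<bar> * norm b"
    using D_line_Lipschitz[OF y0, of a] unfolding L_def by blast
  have e4: "e / 4 > 0" using e by simp
  have o1: "\<forall>\<^sub>F s in nhds 0. norm (V (L s) - V y0 - s *\<^sub>R (l *\<^sub>R D y0 a)) \<le> e/4 * \<bar>s\<bar>"
    using vector_derivative_error[OF line_derivative[OF Vder, of a] e4] by (simp add: L_def)
  have o2: "\<forall>\<^sub>F s in nhds 0. norm (D (L s) a - D y0 a - s *\<^sub>R D2 y0 a a) \<le> e/4 * \<bar>s\<bar>"
    using vector_derivative_error[OF line_derivative[OF D2_derivative[OF y0, of a], of a] e4] by (simp add: L_def)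
  have o3: "\<forall>\<^sub>F s in nhds 0. \<bar>s\<bar> < e / 4 / (C * (norm b1 + 1))"
  proof -
    have "e / 4 / (C * (norm b1 + 1)) > 0" using e C by (simp add: add_nonneg_pos)
    then show ?thesis unfolding eventually_nhds_metric by (auto simp: dist_norm)
  qed
  obtain m where m: "m > 0" and low: "\<forall>\<^sub>F y in nhds y0. y \<in> S \<and> (\<forall>b. m * norm b \<le> norm (D y b))"
    by (rule D_bounded_below[OF y0])
  have low: "\<forall>\<^sub>F s in nhds 0. \<forall>b. m * norm b \<le> norm (D (L s) b)"
    using eventually_compose_filterlim[OF low Llim] by eventually_elim auto
  have o4: "\<forall>\<^sub>F s in nhds 0. norm (V (L s) - Nor (L s) (V (L s)) - D (L s) a) < m * (e / 4 / C)"
  proof -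
    have 1: "((\<lambda>s. Nor (L s) (V (L s))) \<longlongrightarrow> Nor y0 (V y0)) (nhds 0)"
      by (rule filterlim_compose[OF Nor_tendsto'[OF y0 Vcont] Llim])
    have 2: "((\<lambda>s. V (L s)) \<longlongrightarrow> V y0) (nhds 0)"
      by (rule filterlim_compose[OF Vcont Llim])
    have 3: "((\<lambda>s. D (L s) a) \<longlongrightarrow> D y0 a) (nhds 0)"
    proof -
      have "isCont (\<lambda>y. D y a) y0"
        using has_derivative_continuous[OF D2_derivative[OF y0]] .
      then have "((\<lambda>y. D y a) \<longlongrightarrow> D y0 a) (nhds y0)"
        by (rule isCont_tendsto_nhds)
      then show ?thesis by (rule filterlim_compose[OF _ Llim])
    qed
    have "((\<lambda>s. V (L s) - Nor (L s) (V (L s)) - D (L s) a) \<longlongrightarrow> V y0 - Nor y0 (V y0) - D y0 a) (nhds 0)"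
      by (intro tendsto_diff 1 2 3)
    then have "((\<lambda>s. V (L s) - Nor (L s) (V (L s)) - D (L s) a) \<longlongrightarrow> 0) (nhds 0)" using a by simp
    from tendstoD[OF this, of "m * (e / 4 / C)"] show ?thesis using m e C by (simp add: dist_norm)
  qed
  show ?thesis
    unfolding L_def[symmetric]
    using LS C(2) o1 o2 o3 low o4
  proof eventually_elim
    case (elim s)
    note T = range_subspace[OF elim(1)] and lin = D_linear[OF elim(1)] and lin0 = D_linear[OF y0]
    let ?V = "V (L s)"
    have Lb: "norm (D (L s) b - D y0 b) \<le> C * \<bar>s\<bar> * norm b" for b using elim(2) by blast
    have sA: "norm (s *\<^sub>R A) \<le> K * \<bar>s\<bar>" using mult_right_mono[OF K abs_ge_zero, of s] by (simp add: A_def mult.commute)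
    have sb: "norm (s *\<^sub>R (D (L s) b1 - D y0 b1)) \<le> e/4 * \<bar>s\<bar>"
    proof -
      have "C * \<bar>s\<bar> * norm b1 \<le> C * \<bar>s\<bar> * (norm b1 + 1)" using C by (intro mult_left_mono) auto
      also have "\<dots> = \<bar>s\<bar> * (C * (norm b1 + 1))" by (simp add: mult_ac)
      also have "\<dots> \<le> e/4"
        using elim(5) C(1) by (subst (asm) pos_less_divide_eq) (auto intro!: mult_pos_pos add_nonneg_pos)
      finally have "norm (D (L s) b1 - D y0 b1) \<le> e/4" using Lb[of b1] by linarith
      from mult_left_mono[OF this abs_ge_zero[of s]] show ?thesis by (simp add: mult.commute)
    qed
    have up: "norm (Nor (L s) ?V) \<le> norm (Nor y0 (V y0)) + (K + e) * \<bar>s\<bar>"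
    proof -
      have "norm (Nor (L s) ?V) \<le> norm (?V - D (L s) (a + s *\<^sub>R b1))"
        unfolding Nor_def by (rule norm_normal_component_le[OF T]) simp
      also have "?V - D (L s) (a + s *\<^sub>R b1) = Nor y0 (V y0) + (?V - V y0 - s *\<^sub>R (l *\<^sub>R D y0 a))
          - (D (L s) a - D y0 a - s *\<^sub>R D2 y0 a a) - s *\<^sub>R (D (L s) b1 - D y0 b1) - s *\<^sub>R A"
        using a by (simp add: linear_add[OF lin] linear_cmul[OF lin] b1 algebra_simps)
      also have "norm \<dots> \<le> norm (Nor y0 (V y0)) + e/4 * \<bar>s\<bar> + e/4 * \<bar>s\<bar> + e/4 * \<bar>s\<bar> + K * \<bar>s\<bar>"
        using elim(3,4) sb sA by (smt (verit, best) norm_triangle_ineq norm_triangle_ineq4)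
      also have "\<dots> \<le> norm (Nor y0 (V y0)) + (K + e) * \<bar>s\<bar>" using e by (simp add: algebra_simps)
      finally show ?thesis .
    qed
    obtain b where b: "?V - Nor (L s) ?V = D (L s) b"
      using normal_component_props(2)[OF T, of ?V] unfolding Nor_def by blast
    have "m * norm (b - a) \<le> norm (D (L s) (b - a))" using elim(6) by blast
    also have "\<dots> < m * (e / 4 / C)" using elim(7) b by (simp add: linear_diff[OF lin])
    finally have ba: "norm (b - a) < e / 4 / C" using m by (simp only: mult_less_cancel_left_pos)
    have sba: "norm (D (L s) (b - a) - D y0 (b - a)) \<le> e/4 * \<bar>s\<bar>"
    proof -
      have "C * \<bar>s\<bar> * norm (b - a) \<le> C * \<bar>s\<bar> * (e / 4 / C)" using ba C by (intro mult_left_mono) auto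
      then show ?thesis using Lb[of "b - a"] C by (simp add: mult.commute)
    qed
    \<comment> \<open>The same test with the two points exchanged: the coefficients \<open>b\<close>
      belong to the point \<open>L s\<close>. The term with \<open>b - a\<close> is of order
      \<open>o(s)\<close> because \<open>b\<close> tends to \<open>a\<close>.\<close>
    have lo: "norm (Nor y0 (V y0)) \<le> norm (Nor (L s) ?V) + (K + e) * \<bar>s\<bar>"
    proof -
      have "norm (Nor y0 (V y0)) \<le> norm (V y0 - D y0 (b - s *\<^sub>R b1))"
        unfolding Nor_def by (rule norm_normal_component_le[OF T0]) simp
      also have "V y0 - D y0 (b - s *\<^sub>R b1) = Nor (L s) ?V - (?V - V y0 - s *\<^sub>R (l *\<^sub>R D y0 a))
          + (D (L s) a - D y0 a - s *\<^sub>R D2 y0 a a) + (D (L s) (b - a) - D y0 (b - a)) + s *\<^sub>R A"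
        using b by (simp add: linear_diff[OF lin] linear_diff[OF lin0] linear_cmul[OF lin0] b1 algebra_simps)
      also have "norm \<dots> \<le> norm (Nor (L s) ?V) + e/4 * \<bar>s\<bar> + e/4 * \<bar>s\<bar> + e/4 * \<bar>s\<bar> + K * \<bar>s\<bar>"
        using elim(3,4) sba sA by (smt (verit, best) norm_triangle_ineq norm_triangle_ineq4)
      also have "\<dots> \<le> norm (Nor (L s) ?V) + (K + e) * \<bar>s\<bar>" using e by (simp add: algebra_simps)
      finally show ?thesis .
    qed
    show ?case using up lo by linarith
  qed
qed

lemma D2_linear1: "y \<in> S \<Longrightarrow> linear (\<lambda>v. D2 y v w)"
  using D2_derivative has_derivative_linear by blast

lemma D2_linear2:
  assumes "y \<in> S"
  shows "linear (D2 y v)"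
proof
  show "D2 y v (a + b) = D2 y v a + D2 y v b" for a b
  proof -
    have "((\<lambda>z. D z a + D z b) has_derivative (\<lambda>v. D2 y v a + D2 y v b)) (at y)"
      by (intro has_derivative_add D2_derivative assms)
    then have "((\<lambda>z. D z (a + b)) has_derivative (\<lambda>v. D2 y v a + D2 y v b)) (at y)"
      by (rule has_derivative_transform_within_open[OF _ S assms]) (simp add: linear_add[OF D_linear])
    from has_derivative_unique[OF D2_derivative[OF assms] this] show ?thesis by meson
  qed
  show "D2 y v (r *\<^sub>R a) = r *\<^sub>R D2 y v a" for r a
  proof -
    have "((\<lambda>z. r *\<^sub>R D z a) has_derivative (\<lambda>v. r *\<^sub>R D2 y v a)) (at y)"
      by (intro has_derivative_scaleR_right D2_derivative assms)
    then have "((\<lambda>z. D z (r *\<^sub>R a)) has_derivative (\<lambda>v. r *\<^sub>R D2 y v a)) (at y)"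
      by (rule has_derivative_transform_within_open[OF _ S assms]) (simp add: linear_cmul[OF D_linear])
    from has_derivative_unique[OF D2_derivative[OF assms] this] show ?thesis by meson
  qed
qed

lemma D2_continuous:
  assumes y0: "y0 \<in> S" and e: "e > 0"
  shows "\<forall>\<^sub>F y in nhds y0. \<forall>h. norm (D2 y h h - D2 y0 h h) \<le> e * (norm h)\<^sup>2"
proof -
  define d where "d = e / (real DIM('e) * real DIM('e))"
  have d: "d > 0" using e by (simp add: d_def)
  have "\<forall>\<^sub>F y in nhds y0. \<forall>i\<in>Basis. \<forall>j\<in>Basis. norm (D2 y j i - D2 y0 j i) < d"
  proof (intro eventually_ball_finite ballI)
    fix i j :: 'e
    have "isCont (\<lambda>y. D2 y j i) y0"
      using Ck_on_imp_continuous_on[OF D2_Ck[of 0]] S y0 continuous_on_eq_continuous_at by blast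
    then have "((\<lambda>y. D2 y j i) \<longlongrightarrow> D2 y0 j i) (nhds y0)" by (rule isCont_tendsto_nhds)
    then show "\<forall>\<^sub>F y in nhds y0. norm (D2 y j i - D2 y0 j i) < d"
      unfolding dist_norm[symmetric] by (rule tendstoD[OF _ d])
  qed simp_all
  with eventually_nhds_in_open[OF S y0] show ?thesis
  proof eventually_elim
    case (elim y)
    have 1: "norm (D2 y h i - D2 y0 h i) \<le> real DIM('e) * d * norm h" if "i \<in> Basis" for h i
      by (rule linear_diff_bound[OF D2_linear1[OF elim(1)] D2_linear1[OF y0]]) (use elim(2) that in \<open>auto intro: less_imp_le\<close>)
    have "norm (D2 y h h - D2 y0 h h) \<le> real DIM('e) * (real DIM('e) * d * norm h) * norm h" for h
      by (rule linear_diff_bound[OF D2_linear2[OF elim(1)] D2_linear2[OF y0]]) (use 1 in auto)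
    moreover have "real DIM('e) * (real DIM('e) * d * norm h) * norm h = e * (norm h)\<^sup>2" for h :: 'e
      by (simp add: d_def power2_eq_square)
    ultimately show ?case by simp
  qed
qed

lemma Nor_continuous:
  assumes y0: "y0 \<in> S" and e: "e > 0"
  shows "\<forall>\<^sub>F y in nhds y0. \<forall>v. norm (Nor y v - Nor y0 v) \<le> e * norm v"
proof -
  define d where "d = e / real DIM('b)"
  have d: "d > 0" using e by (simp add: d_def)
  have "\<forall>\<^sub>F y in nhds y0. \<forall>i\<in>Basis. norm (Nor y i - Nor y0 i) < d"
    by (intro eventually_ball_finite ballI) (auto simp: dist_norm[symmetric] intro: tendstoD[OF Nor_tendsto[OF y0] d])
  with eventually_nhds_in_open[OF S y0] show ?thesis
  proof eventually_elim
    case (elim y)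
    have "norm (Nor y v - Nor y0 v) \<le> real DIM('b) * d * norm v" for v
      unfolding Nor_def
      by (rule linear_diff_bound[OF normal_component_linear[OF range_subspace[OF elim(1)]]
            normal_component_linear[OF range_subspace[OF y0]]])
        (use elim(2) in \<open>auto simp: Nor_def intro: less_imp_le\<close>)
    then show ?case by (simp add: d_def)
  qed
qed

text \<open>Taylor's formula from \<open>y\<close> towards \<open>y0\<close>, paired with
  \<open>N = Nor y (F y - F y0)\<close>: the linear term vanishes as \<open>N\<close> is normal at
  \<open>y\<close>, so \<open>|N|^2\<close> is half a second derivative and
  \<open>|N| \<le> (k + e)/2 |D y0 h|^2\<close>. Since \<open>c * k < 1\<close>, twice
  \<open>c |N|\<close> stays below the squared distance, which is nearly
  \<open>|D y0 h|^2\<close>.\<close>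

lemma near_estimate:
  assumes y0: "y0 \<in> S" and k: "\<And>a. norm (Nor y0 (D2 y0 a a)) \<le> k * (norm (D y0 a))\<^sup>2"
    and c: "c > 0" and ck: "c * k < 1" and k0: "k \<ge> 0"
  shows "\<forall>\<^sub>F y in nhds y0. y \<noteq> y0 \<longrightarrow> 2 * c * norm (Nor y (F y - F y0)) < (norm (F y - F y0))\<^sup>2"
proof -
  obtain m where m: "m > 0" "\<And>b. m * norm b \<le> norm (D y0 b)"
    using linear_inj_bounded_below_pos[OF D_linear[OF y0] D_inj[OF y0]] by blast
  obtain M where M: "M > 0" "\<And>h. norm (D2 y0 h h) \<le> M * (norm h)\<^sup>2"
  proof -
    have "bounded_bilinear (D2 y0)"
      using bilinear_conv_bounded_bilinear[of "D2 y0"] D2_linear1[OF y0] D2_linear2[OF y0]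
      by (simp add: bilinear_def)
    then obtain K where "K > 0" "\<And>a b. norm (D2 y0 a b) \<le> norm a * norm b * K"
      using bounded_bilinear.pos_bounded by blast
    then show thesis using that[of K] by (simp add: power2_eq_square mult.commute)
  qed
  obtain e where e: "e > 0" "e < 1" "c * (k + e) < (1 - e)\<^sup>2"
  proof -
    have "((\<lambda>e. (1 - e)\<^sup>2 - c * (k + e)) \<longlongrightarrow> (1 - 0)\<^sup>2 - c * (k + 0)) (at_right 0)"
      by (intro tendsto_intros)
    then have "\<forall>\<^sub>F e in at_right 0. 0 < (1 - e)\<^sup>2 - c * (k + e)"
      by (rule order_tendstoD) (use ck in simp)
    then have "\<forall>\<^sub>F e in at_right (0::real). 0 < e \<and> e < 1 \<and> c * (k + e) < (1 - e)\<^sup>2"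
      using eventually_at_right_real[of 0 1, simplified]
      by eventually_elim auto
    then show thesis using that eventually_happens' trivial_limit_at_right_real by (metis (mono_tags, lifting))
  qed
  \<comment> \<open>Replacing \<open>y\<close> by \<open>y0\<close> in \<open>Nor\<close> and
    \<open>w\<close> by \<open>y0\<close> in \<open>D2\<close> costs at most
    \<open>e2 * (M + 1)\<close> times the square of \<open>norm h\<close>. This choice keeps that
    below \<open>e\<close> times the square of \<open>m * norm h\<close>.\<close>
  define e1 where "e1 = e * m\<^sup>2 / (M + 2)"
  have e1: "e1 > 0" using e m M by (simp add: e1_def)
  have em: "e * m > 0" using e m by simp
  define e2 where "e2 = min e1 1"
  have e2: "e2 > 0" "e2 \<le> e1" "e2 \<le> 1" using e1 by (auto simp: e2_def)
  obtain d1 where d1: "d1 > 0" "ball y0 d1 \<subseteq> S"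
    "\<And>y h. y \<in> ball y0 d1 \<Longrightarrow> norm (D2 y h h - D2 y0 h h) \<le> e2 * (norm h)\<^sup>2"
  proof -
    obtain d where "d > 0" "\<And>y h. dist y y0 < d \<Longrightarrow> norm (D2 y h h - D2 y0 h h) \<le> e2 * (norm h)\<^sup>2"
      using D2_continuous[OF y0 e2(1)] unfolding eventually_nhds_metric by blast
    moreover obtain d' where "d' > 0" "ball y0 d' \<subseteq> S" using S y0 openE by blast
    ultimately show thesis by (intro that[of "min d d'"]) (auto simp: dist_commute)
  qed
  have Fder: "\<forall>\<^sub>F y in nhds y0. norm (F y - F y0 - D y0 (y - y0)) \<le> e * m * norm (y - y0)"
    using D_derivative[OF y0] em unfolding has_derivative_at_alt eventually_nhds_metric dist_norm by blast
  have ball: "\<forall>\<^sub>F y in nhds y0. y \<in> ball y0 d1"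
    using d1(1) by (intro eventually_nhds_in_open) auto
  show ?thesis
    using Nor_continuous[OF y0 e2(1)] Fder ball
  proof eventually_elim
    case (elim y)
    show ?case
    proof
      assume ne: "y \<noteq> y0"
      define h where "h = y0 - y"
      have h: "norm h > 0" using ne by (simp add: h_def)
      have yS: "y \<in> S" using elim(3) d1 by blast
      note T = range_subspace[OF yS]
      define N where "N = Nor y (F y - F y0)"
      define A where "A = norm (D y0 h)"
      have A: "m * norm h \<le> A" "A > 0"
        using m(2)[of h] mult_pos_pos[OF m(1) h] unfolding A_def by linarith+
      have nor: "norm (Nor y (D2 w h h)) \<le> (k + e) * A\<^sup>2" if "w \<in> ball y0 d1" for w
      proof -
        have lin: "linear (Nor y)" unfolding Nor_def by (rule normal_component_linear[OF T])
        have 1: "norm (Nor y (D2 w h h - D2 y0 h h)) \<le> e2 * (norm h)\<^sup>2"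
          using norm_normal_component_le[OF T subspace_0[OF T], of "D2 w h h - D2 y0 h h"] d1(3)[OF that, of h]
          by (simp add: Nor_def)
        have 2: "norm (Nor y (D2 y0 h h) - Nor y0 (D2 y0 h h)) \<le> e2 * (M * (norm h)\<^sup>2)"
          using elim(1) M(2)[of h] e2(1) by (meson mult_left_mono order_trans less_imp_le)
        have "Nor y (D2 w h h) = Nor y0 (D2 y0 h h) + Nor y (D2 w h h - D2 y0 h h) + (Nor y (D2 y0 h h) - Nor y0 (D2 y0 h h))"
          by (simp add: linear_diff[OF lin])
        then have "norm (Nor y (D2 w h h)) \<le> norm (Nor y0 (D2 y0 h h)) + norm (Nor y (D2 w h h - D2 y0 h h))
            + norm (Nor y (D2 y0 h h) - Nor y0 (D2 y0 h h))"
          by (metis norm_triangle_mono order_refl)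
        also have "\<dots> \<le> k * A\<^sup>2 + e2 * (norm h)\<^sup>2 + e2 * (M * (norm h)\<^sup>2)"
          using 1 2 k[of h] by (simp add: A_def)
        also have "\<dots> = k * A\<^sup>2 + e2 * (M + 1) * (norm h)\<^sup>2" by (simp add: algebra_simps)
        also have "\<dots> \<le> k * A\<^sup>2 + e * A\<^sup>2"
        proof -
          have "e2 * (M + 1) \<le> e1 * (M + 2)" using e2 M by (intro mult_mono) auto
          also have "\<dots> = e * m\<^sup>2" using M by (simp add: e1_def)
          finally have "e2 * (M + 1) * (norm h)\<^sup>2 \<le> e * m\<^sup>2 * (norm h)\<^sup>2" by (simp add: mult_right_mono)
          also have "\<dots> = e * (m * norm h)\<^sup>2" by (simp add: power_mult_distrib)
          also have "\<dots> \<le> e * A\<^sup>2" using e A m h by (intro mult_left_mono power_mono) auto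
          finally show ?thesis by simp
        qed
        finally show ?thesis by (simp add: algebra_simps)
      qed
      have seg: "y + s *\<^sub>R h \<in> ball y0 d1" if "s \<in> {0..1}" for s
      proof -
        have "y + s *\<^sub>R h = (1 - s) *\<^sub>R y + s *\<^sub>R y0" by (simp add: h_def algebra_simps)
        then show ?thesis using convexD_alt[OF convex_ball elim(3), of y0 s] d1(1) that by simp
      qed
      define \<phi> where "\<phi> s = (F (y + s *\<^sub>R h) - F y) \<bullet> N" for s
      have der1: "(\<phi> has_real_derivative D (y + s *\<^sub>R h) h \<bullet> N) (at s)" if "s \<in> {0..1}" for s
      proof -
        have "y + s *\<^sub>R h \<in> S" using seg[OF that] d1 by blast
        from bounded_linear.has_vector_derivative[OF bounded_linear_inner_left
            has_vector_derivative_diff[OF line_derivative_at[OF D_derivative[OF this]] has_vector_derivative_const]]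
        show ?thesis unfolding \<phi>_def has_real_derivative_iff_has_vector_derivative by simp
      qed
      have der2: "((\<lambda>s. D (y + s *\<^sub>R h) h \<bullet> N) has_real_derivative D2 (y + s *\<^sub>R h) h h \<bullet> N) (at s)"
        if "s \<in> {0..1}" for s
      proof -
        have "y + s *\<^sub>R h \<in> S" using seg[OF that] d1 by blast
        from bounded_linear.has_vector_derivative[OF bounded_linear_inner_left
            line_derivative_at[OF D2_derivative[OF this]]]
        show ?thesis unfolding has_real_derivative_iff_has_vector_derivative .
      qed
      define diff where "diff j = (if j = (0::nat) then \<phi> else if j = 1 then (\<lambda>s. D (y + s *\<^sub>R h) h \<bullet> N)
          else (\<lambda>s. D2 (y + s *\<^sub>R h) h h \<bullet> N))" for j
      have "\<exists>t>0. t < 1 \<and> \<phi> 1 = (\<Sum>j<2. diff j 0 / fact j * 1 ^ j) + diff 2 t / fact 2 * 1 ^ 2"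
      proof (rule Maclaurin)
        show "\<forall>j t. j < 2 \<and> 0 \<le> t \<and> t \<le> 1 \<longrightarrow> DERIV (diff j) t :> diff (Suc j) t"
          using der1 der2 by (auto simp: diff_def less_2_cases_iff)
      qed (auto simp: diff_def)
      then obtain t where t: "0 < t" "t < 1" "\<phi> 1 = \<phi> 0 + D y h \<bullet> N + (D2 (y + t *\<^sub>R h) h h \<bullet> N) / 2"
        by (auto simp: diff_def eval_nat_numeral)
      have "\<phi> 0 = 0" by (simp add: \<phi>_def)
      moreover have "D y h \<bullet> N = 0"
        using normal_component_props(1)[OF T, of "D y h" "F y - F y0"] by (simp add: N_def Nor_def inner_commute)
      moreover have "\<phi> 1 = - (norm N)\<^sup>2"
      proof -
        have "N \<bullet> ((F y - F y0) - N) = 0"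
          using normal_component_props[OF T] unfolding N_def Nor_def by blast
        then show ?thesis by (simp add: \<phi>_def h_def inner_diff_right inner_diff_left power2_norm_eq_inner inner_commute)
      qed
      ultimately have N2: "(norm N)\<^sup>2 = - (D2 (y + t *\<^sub>R h) h h \<bullet> N) / 2" using t by simp
      have "D2 (y + t *\<^sub>R h) h h \<bullet> N = Nor y (D2 (y + t *\<^sub>R h) h h) \<bullet> N"
        using normal_component_props(1)[OF T normal_component_props(2)[OF T, of "D2 (y + t *\<^sub>R h) h h"], of "F y - F y0"]
        by (simp add: N_def Nor_def inner_diff_right inner_commute)
      then have "- (D2 (y + t *\<^sub>R h) h h \<bullet> N) \<le> (k + e) * A\<^sup>2 * norm N"
        using Cauchy_Schwarz_ineq2[of "Nor y (D2 (y + t *\<^sub>R h) h h)" N] nor[OF seg[of t]] t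
        by (smt (verit) atLeastAtMost_iff mult_right_mono norm_ge_zero)
      then have "norm N * norm N \<le> ((k + e) * A\<^sup>2 / 2) * norm N" using N2 by (simp add: power2_eq_square)
      moreover have "0 \<le> (k + e) * A\<^sup>2 / 2" using k0 e by simp
      ultimately have N: "norm N \<le> (k + e) * A\<^sup>2 / 2"
        by (cases "norm N = 0") (auto intro: mult_right_le_imp_le)
      have "norm (F y - F y0) \<ge> A * (1 - e)"
      proof -
        have "D y0 (y - y0) = - D y0 h"
          using linear_neg[OF D_linear[OF y0], of h] by (simp add: h_def)
        then have "norm (F y - F y0 + D y0 h) \<le> e * m * norm h"
          using elim(2) by (simp add: h_def norm_minus_commute)
        also have "\<dots> \<le> e * A" using A(1) e by (simp add: mult.assoc)
        finally have "norm (F y - F y0 + D y0 h) \<le> e * A" .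
        moreover have "A \<le> norm (F y - F y0 + D y0 h) + norm (F y - F y0)"
          unfolding A_def by (metis add_diff_cancel_left' norm_triangle_ineq4)
        ultimately show ?thesis by (simp add: algebra_simps)
      qed
      then have "(A * (1 - e))\<^sup>2 \<le> (norm (F y - F y0))\<^sup>2" using A e by (intro power_mono) auto
      moreover have "2 * c * norm N \<le> c * (k + e) * A\<^sup>2" using N c by (simp add: mult_left_mono)
      moreover have "c * (k + e) * A\<^sup>2 < (1 - e)\<^sup>2 * A\<^sup>2" using e(3) A by (simp add: mult_strict_right_mono)
      ultimately show "2 * c * norm (Nor y (F y - F y0)) < (norm (F y - F y0))\<^sup>2"
        by (simp add: N_def power_mult_distrib mult.commute)
    qed
  qed
qed

text \<open>Where the radius vector is not normal, the squared distance has no critical point. One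
  fixed vector \<open>w\<close> then works for a whole ball: moving along \<open>w\<close> lowers
  \<open>G\<close> all the way, and the full translation carries the ball below the level of
  \<open>y0\<close>. This replaces straightening the level set by the implicit function
  theorem.\<close>

lemma descent_in_chart:
  fixes \<sigma> :: real
  assumes y0: "y0 \<in> S" and e: "e > 0" and \<sigma>: "\<sigma> = 1 \<or> \<sigma> = -1"
    and tan: "(F y0 - z) - Nor y0 (F y0 - z) \<noteq> 0"
  defines "G y \<equiv> \<sigma> * (norm (F y - z))\<^sup>2"
  obtains d w where "0 < d" "ball y0 e \<inter> S \<supseteq> ball y0 d"
    "\<And>y t. y \<in> ball y0 d \<Longrightarrow> 0 < t \<Longrightarrow> t \<le> 1 \<Longrightarrow> y + t *\<^sub>R w \<in> ball y0 e \<inter> S \<and> G (y + t *\<^sub>R w) < G y"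
    "\<And>y. y \<in> ball y0 d \<Longrightarrow> G (y + w) < G y0"
proof -
  note T0 = range_subspace[OF y0]
  let ?\<tau> = "(F y0 - z) - Nor y0 (F y0 - z)"
  obtain a where a: "?\<tau> = D y0 a"
    using normal_component_props(2)[OF T0, of "F y0 - z"] unfolding Nor_def by blast
  define \<mu> where "\<mu> = (norm ?\<tau>)\<^sup>2"
  have \<mu>: "\<mu> > 0" using tan by (simp add: \<mu>_def)
  define G' where "G' y v = \<sigma> * (2 * ((F y - z) \<bullet> D y v))" for y v
  have der: "(G has_derivative G' y) (at y)" if "y \<in> S" for y
    unfolding G_def G'_def power2_norm_eq_inner
    by (rule derivative_eq_intros D_derivative that refl ext | simp add: inner_commute algebra_simps)+
  define u where "u = - \<sigma> *\<^sub>R a"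
  have Gu0: "G' y0 u = - 2 * \<mu>"
    using \<sigma> inner_tangential_self[OF T0, of "F y0 - z"] a
    by (auto simp: G'_def u_def \<mu>_def Nor_def linear_neg[OF D_linear[OF y0]] linear_cmul[OF D_linear[OF y0]])
  have cF: "isCont F y0" using has_derivative_continuous[OF D_derivative[OF y0]] .
  have cD: "isCont (\<lambda>y. D y v) y0" for v using has_derivative_continuous[OF D2_derivative[OF y0]] .
  have cG: "isCont (\<lambda>y. G' y v) y0" for v
    unfolding G'_def by (intro continuous_intros cF cD)
  have ev1: "\<forall>\<^sub>F y in nhds y0. G' y u < - \<mu>"
    by (rule order_tendstoD[OF isCont_tendsto_nhds[OF cG[of u]]]) (use Gu0 \<mu> in simp)
  define M where "M = (\<Sum>i\<in>(Basis::'e set). \<bar>G' y0 i\<bar> + 1)"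
  have M: "M > 0" unfolding M_def by (intro sum_pos) auto
  have ev2: "\<forall>\<^sub>F y in nhds y0. \<forall>i\<in>Basis. \<bar>G' y i\<bar> < \<bar>G' y0 i\<bar> + 1"
  proof (intro eventually_ball_finite ballI)
    fix i :: 'e
    have "isCont (\<lambda>y. \<bar>G' y i\<bar>) y0" by (intro continuous_intros cG)
    from order_tendstoD(2)[OF isCont_tendsto_nhds[OF this], of "\<bar>G' y0 i\<bar> + 1"]
    show "\<forall>\<^sub>F y in nhds y0. \<bar>G' y i\<bar> < \<bar>G' y0 i\<bar> + 1" by simp
  qed simp
  from ev1 ev2 eventually_nhds_in_open[OF S y0]
  have "\<forall>\<^sub>F y in nhds y0. y \<in> S \<and> G' y u < - \<mu> \<and> (\<forall>i\<in>Basis. \<bar>G' y i\<bar> < \<bar>G' y0 i\<bar> + 1)"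
    by eventually_elim blast
  then obtain e0 where e0: "e0 > 0" "\<And>y. dist y y0 < e0 \<Longrightarrow> y \<in> S \<and> G' y u < - \<mu> \<and> (\<forall>i\<in>Basis. \<bar>G' y i\<bar> < \<bar>G' y0 i\<bar> + 1)"
    unfolding eventually_nhds_metric by blast
  define e1 where "e1 = min e0 e"
  have e1: "e1 > 0" "e1 \<le> e" using e0 e by (auto simp: e1_def)
  have B: "y \<in> S" "G' y u < - \<mu>" "\<And>i. i \<in> Basis \<Longrightarrow> \<bar>G' y i\<bar> < \<bar>G' y0 i\<bar> + 1" if "y \<in> ball y0 e1" for y
    using e0(2)[of y] that by (auto simp: e1_def dist_commute)
  have bound: "\<bar>G' y v\<bar> \<le> M * norm v" if "y \<in> ball y0 e1" for y v
  proof -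
    have lin: "linear (G' y)" using der[OF B(1)[OF that]] has_derivative_linear by blast
    have "G' y v = (\<Sum>i\<in>Basis. (v \<bullet> i) * G' y i)"
      by (subst (1) euclidean_representation[symmetric, of v]) (simp add: linear_sum[OF lin] linear_cmul[OF lin])
    then have "\<bar>G' y v\<bar> \<le> (\<Sum>i\<in>Basis. \<bar>(v \<bullet> i) * G' y i\<bar>)" by (simp add: sum_abs)
    also have "\<dots> \<le> (\<Sum>i\<in>(Basis::'e set). norm v * (\<bar>G' y0 i\<bar> + 1))"
      unfolding abs_mult
      by (intro sum_mono mult_mono) (use B(3)[OF that] in \<open>auto simp: Basis_le_norm intro: less_imp_le\<close>)
    also have "\<dots> = M * norm v" by (simp add: M_def sum_distrib_left mult.commute)
    finally show ?thesis .
  qed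
  define r where "r = e1 / 2 / (norm u + 1)"
  have r: "r > 0" "r * norm u \<le> e1 / 2"
  proof -
    have pos: "norm u + 1 > 0" by (simp add: add_nonneg_pos)
    then show "r > 0" using e1 by (simp add: r_def)
    have "r * norm u \<le> r * (norm u + 1)" using \<open>r > 0\<close> by (intro mult_left_mono) auto
    also have "\<dots> = e1 / 2" using pos by (metis less_irrefl nonzero_eq_divide_eq r_def)
    finally show "r * norm u \<le> e1 / 2" .
  qed
  \<comment> \<open>On the ball of radius \<open>d\<close> the value of \<open>G\<close> exceeds
    \<open>G y0\<close> by at most \<open>M * d\<close>, which does not exceed the gain
    \<open>\<mu> * r\<close> of the translation.\<close>
  define d where "d = min (e1/2) (\<mu> * r / M)"
  have d: "d > 0" "d \<le> e1/2" "M * d \<le> \<mu> * r"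
    using e1 \<mu> r M by (auto simp: d_def min_def field_simps)
  define w where "w = r *\<^sub>R u"
  have inball: "y + t *\<^sub>R w \<in> ball y0 e1" if "y \<in> ball y0 d" "0 \<le> t" "t \<le> 1" for y t
  proof -
    have "dist y0 (y + t *\<^sub>R w) \<le> dist y0 y + norm (t *\<^sub>R w)"
      by (metis add_diff_cancel_left' dist_commute dist_norm dist_triangle)
    also have "norm (t *\<^sub>R w) = t * (r * norm u)" using that r by (simp add: w_def)
    also have "\<dots> \<le> 1 * (e1/2)" using r that e1 by (intro mult_mono) auto
    finally show ?thesis using that d by (simp)
  qed
  have dec: "G (y + t *\<^sub>R w) \<le> G y - \<mu> * r * t \<and> (0 < t \<longrightarrow> G (y + t *\<^sub>R w) < G y - \<mu> * r * t)"
    if y: "y \<in> ball y0 d" and t: "0 \<le> t" "t \<le> 1" for y t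
  proof (cases "t = 0")
    case False
    then have t0: "0 < t" using t by simp
    have "\<exists>x\<in>{0<..<t}. G (y + t *\<^sub>R w) - G (y + 0 *\<^sub>R w) = (\<lambda>s. G' (y + x *\<^sub>R w) (s *\<^sub>R w)) (t - 0)"
    proof (rule mvt_simple[OF t0])
      fix x assume "0 \<le> x" "x \<le> t"
      then have x: "y + x *\<^sub>R w \<in> S" using inball[OF y, of x] B t by auto
      have "((\<lambda>s. y + s *\<^sub>R w) has_derivative (\<lambda>s. s *\<^sub>R w)) (at x within {0..t})"
        by (auto intro!: derivative_eq_intros)
      from has_derivative_compose[OF this der[OF x]]
      show "((\<lambda>s. G (y + s *\<^sub>R w)) has_derivative (\<lambda>s. G' (y + x *\<^sub>R w) (s *\<^sub>R w))) (at x within {0..t})" .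
    qed
    then obtain x where x: "0 < x" "x < t" "G (y + t *\<^sub>R w) - G y = G' (y + x *\<^sub>R w) (t *\<^sub>R w)" by auto
    have xb: "y + x *\<^sub>R w \<in> ball y0 e1" using inball[OF y, of x] x t by auto
    have "linear (G' (y + x *\<^sub>R w))" using der[OF B(1)[OF xb]] has_derivative_linear by blast
    then have "G' (y + x *\<^sub>R w) (t *\<^sub>R w) = t * r * G' (y + x *\<^sub>R w) u"
      by (simp add: w_def linear_cmul)
    also have "\<dots> < t * r * (- \<mu>)" using B(2)[OF xb] t0 r by (intro mult_strict_left_mono) auto
    finally show ?thesis using x by (simp add: mult_ac)
  qed simp
  have close: "G y \<le> G y0 + M * dist y y0" if "y \<in> ball y0 d" for y
  proof -
    have y1: "y \<in> ball y0 e1" "y0 \<in> ball y0 e1" using that d e1 by auto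
    have "norm (G y - G y0) \<le> M * norm (y - y0)"
    proof (rule differentiable_bound[OF convex_ball _ _ y1])
      show "(G has_derivative G' x) (at x within ball y0 e1)" if "x \<in> ball y0 e1" for x
        using der[OF B(1)[OF that]] by (rule has_derivative_at_withinI)
      show "onorm (G' x) \<le> M" if "x \<in> ball y0 e1" for x
        by (rule onorm_le) (use bound[OF that] in simp)
    qed
    then show ?thesis by (simp add: dist_norm)
  qed
  show thesis
  proof (rule that[of d w])
    show "0 < d" by (rule d)
    show "ball y0 d \<subseteq> ball y0 e \<inter> S" using d e1 B by (auto intro!: B(1))
    show "y + t *\<^sub>R w \<in> ball y0 e \<inter> S \<and> G (y + t *\<^sub>R w) < G y" if "y \<in> ball y0 d" "0 < t" "t \<le> 1" for y t
    proof -
      have "y + t *\<^sub>R w \<in> ball y0 e1" using inball that by simp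
      moreover have "0 < \<mu> * r * t" using \<mu> r that by simp
      ultimately show ?thesis using dec[of y t] that B(1) e1 by (auto)
    qed
    show "G (y + w) < G y0" if "y \<in> ball y0 d" for y
    proof -
      have "G (y + w) < G y - \<mu> * r" using dec[OF that, of 1] by simp
      also have "\<dots> \<le> G y0 + M * dist y y0 - \<mu> * r" using close[OF that] by simp
      also have "M * dist y y0 \<le> M * d" using that M by (simp add: dist_commute less_imp_le)
      finally show ?thesis using d by simp
    qed
  qed
qed

end

section \<open>Joining points inside a set\<close>

text \<open>Compact connected sets instead of paths: they are as easy to unite and to map, and since
  continuous functions attain their extrema on them, a strict bound on such a set can always be
  improved a little.\<close>

definition joined :: "'a topology \<Rightarrow> 'a set \<Rightarrow> 'a \<Rightarrow> 'a \<Rightarrow> bool" where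
  "joined X S a b \<longleftrightarrow> (\<exists>C. compactin X C \<and> connectedin X C \<and> C \<subseteq> S \<and> a \<in> C \<and> b \<in> C)"

lemma joinedI: "compactin X C \<Longrightarrow> connectedin X C \<Longrightarrow> C \<subseteq> S \<Longrightarrow> a \<in> C \<Longrightarrow> b \<in> C \<Longrightarrow> joined X S a b"
  unfolding joined_def by blast

lemma joinedE:
  assumes "joined X S a b"
  obtains C where "compactin X C" "connectedin X C" "C \<subseteq> S" "a \<in> C" "b \<in> C"
  using assms unfolding joined_def by blast

lemma joined_refl: "a \<in> S \<Longrightarrow> a \<in> topspace X \<Longrightarrow> joined X S a a"
  by (rule joinedI[of X "{a}"]) auto

lemma joined_sym: "joined X S a b \<Longrightarrow> joined X S b a"
  unfolding joined_def by blast

lemma joined_trans: "joined X S a b \<Longrightarrow> joined X S b c \<Longrightarrow> joined X S a c"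
proof -
  assume "joined X S a b" "joined X S b c"
  then obtain C D where CD: "compactin X C" "connectedin X C" "C \<subseteq> S" "a \<in> C" "b \<in> C"
    "compactin X D" "connectedin X D" "D \<subseteq> S" "b \<in> D" "c \<in> D"
    unfolding joined_def by blast
  then show ?thesis
    by (intro joinedI[of X "C \<union> D"] compactin_Un connectedin_Un) auto
qed

lemma joined_mono: "joined X S a b \<Longrightarrow> S \<subseteq> T \<Longrightarrow> joined X T a b"
  unfolding joined_def by blast

lemma joined_in: "joined X S a b \<Longrightarrow> a \<in> S \<and> b \<in> S \<and> a \<in> topspace X \<and> b \<in> topspace X"
  unfolding joined_def using compactin_subset_topspace by blast

lemma connectedin_joined: "a \<in> S \<Longrightarrow> a \<in> topspace X \<Longrightarrow> connectedin X {b. joined X S a b}"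
proof -
  assume a: "a \<in> S" "a \<in> topspace X"
  have eq: "{b. joined X S a b} = \<Union>{C. compactin X C \<and> connectedin X C \<and> C \<subseteq> S \<and> a \<in> C}"
    by (auto simp: joined_def)
  show ?thesis unfolding eq
    by (rule connectedin_Union) auto
qed

lemma connectedin_cover_cases:
  assumes "connectedin X C" "openin X U" "openin X V" "C \<subseteq> U \<union> V" "U \<inter> V \<inter> C = {}" "a \<in> C" "a \<in> U"
  shows "C \<subseteq> U"
proof -
  have "V \<inter> C = {}" using connectedinD[OF assms(1-5)] assms(6,7) by blast
  then show ?thesis using assms(4) by blast
qed

section \<open>Immersed closed manifolds\<close>

locale smooth_immersed =
  fixes X :: "'a topology" and A :: "('a, 'e::euclidean_space) atlas"
    and f :: "'a \<Rightarrow> 'b::euclidean_space"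
  assumes manifold: "smooth_manifold X A" and immersion: "smooth_immersion A f"
begin

lemma atlas: "smooth_atlas X A" and Hausdorff: "Hausdorff_space X"
  using manifold by (auto simp: smooth_manifold_def)

lemma chart_props:
  assumes "(U, \<phi>) \<in> A"
  shows "openin X U" "open (\<phi> ` U)" "homeomorphic_map (subtopology X U) (top_of_set (\<phi> ` U)) \<phi>"
    "U \<subseteq> topspace X" "inj_on \<phi> U"
proof -
  show o: "openin X U" and "open (\<phi> ` U)" and h: "homeomorphic_map (subtopology X U) (top_of_set (\<phi> ` U)) \<phi>"
    using atlas assms by (auto simp: smooth_atlas_def is_chart_def)
  show "U \<subseteq> topspace X" using o openin_subset by blast
  then show "inj_on \<phi> U" using homeomorphic_imp_injective_map[OF h] by (simp add: Int_absorb1)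
qed

lemma chart_inverse:
  assumes "(U, \<phi>) \<in> A"
  shows "x \<in> U \<Longrightarrow> inv_into U \<phi> (\<phi> x) = x" "y \<in> \<phi> ` U \<Longrightarrow> inv_into U \<phi> y \<in> U"
    "y \<in> \<phi> ` U \<Longrightarrow> \<phi> (inv_into U \<phi> y) = y"
    "continuous_map (top_of_set (\<phi> ` U)) X (inv_into U \<phi>)"
proof -
  note c = chart_props[OF assms]
  show 1: "x \<in> U \<Longrightarrow> inv_into U \<phi> (\<phi> x) = x" "y \<in> \<phi> ` U \<Longrightarrow> inv_into U \<phi> y \<in> U"
    "y \<in> \<phi> ` U \<Longrightarrow> \<phi> (inv_into U \<phi> y) = y" for x y
    using c(5) by (auto simp: inv_into_into f_inv_into_f)
  obtain g where g: "homeomorphic_maps (subtopology X U) (top_of_set (\<phi> ` U)) \<phi> g"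
    using c(3) homeomorphic_map_maps by blast
  have "continuous_map (top_of_set (\<phi> ` U)) X g"
    using g by (simp add: homeomorphic_maps_def continuous_map_in_subtopology)
  moreover have "g y = inv_into U \<phi> y" if "y \<in> \<phi> ` U" for y
    using g that 1 c(4) by (auto simp: homeomorphic_maps_def Int_absorb1)
  ultimately show "continuous_map (top_of_set (\<phi> ` U)) X (inv_into U \<phi>)"
    by (rule continuous_map_eq) auto
qed

lemma chart_immersion:
  assumes "(U, \<phi>) \<in> A"
  shows "chart_immersion (\<phi> ` U) (f \<circ> inv_into U \<phi>)"
proof
  show "open (\<phi> ` U)" by (rule chart_props[OF assms])
  show "Ck_on k (\<phi> ` U) (f \<circ> inv_into U \<phi>)" for k
    using immersion assms by (auto simp: smooth_immersion_def smooth_on_def)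
  show "inj (frechet_derivative (f \<circ> inv_into U \<phi>) (at y))" if "y \<in> \<phi> ` U" for y
    using immersion assms that by (fastforce simp: smooth_immersion_def)
qed

lemma chart_exists:
  assumes "x \<in> topspace X"
  obtains U \<phi> where "(U, \<phi>) \<in> A" "x \<in> U"
proof -
  have "x \<in> (\<Union>(U, \<phi>)\<in>A. U)" using atlas assms unfolding smooth_atlas_def by metis
  then show thesis using that by auto
qed

lemma chart_open_image:
  assumes "(U, \<phi>) \<in> A" "openin X W"
  shows "open (\<phi> ` (U \<inter> W))"
proof -
  note c = chart_props[OF assms(1)]
  have "openin (subtopology X U) (U \<inter> W)"
    using assms(2) by (metis Int_commute openin_subtopology_Int)
  then have "openin (top_of_set (\<phi> ` U)) (\<phi> ` (U \<inter> W))"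
    using c(3) homeomorphic_map_openness_eq by blast
  then show ?thesis using c(2) openin_open_eq by blast
qed

lemma chart_open_preimage:
  assumes "(U, \<phi>) \<in> A" "open B" "B \<subseteq> \<phi> ` U"
  shows "openin X (inv_into U \<phi> ` B)"
proof -
  note c = chart_props[OF assms(1)] and i = chart_inverse[OF assms(1)]
  have "continuous_map (subtopology X U) (top_of_set (\<phi> ` U)) \<phi>"
    using c(3) homeomorphic_imp_continuous_map by blast
  moreover have "openin (top_of_set (\<phi> ` U)) B" using assms c(2) by (simp add: openin_open_eq)
  ultimately have "openin (subtopology X U) {x \<in> topspace (subtopology X U). \<phi> x \<in> B}"
    by (rule openin_continuous_map_preimage)
  moreover have "{x \<in> topspace (subtopology X U). \<phi> x \<in> B} = inv_into U \<phi> ` B"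
  proof (intro equalityI subsetI)
    fix x assume "x \<in> {x \<in> topspace (subtopology X U). \<phi> x \<in> B}"
    then have "x \<in> U" "\<phi> x \<in> B" by auto
    then show "x \<in> inv_into U \<phi> ` B" using i(1) by (metis image_eqI)
  next
    fix x assume "x \<in> inv_into U \<phi> ` B"
    then obtain y where "y \<in> B" "x = inv_into U \<phi> y" by blast
    then show "x \<in> {x \<in> topspace (subtopology X U). \<phi> x \<in> B}" using i(2,3)[of y] assms(3) c(4) by auto
  qed
  ultimately show ?thesis using openin_open_subtopology[OF c(1)] by simp
qed

definition tangent :: "'a \<Rightarrow> 'b set" where
  "tangent x = {v. \<exists>U \<phi> a. (U, \<phi>) \<in> A \<and> x \<in> U \<and> v = frechet_derivative (f \<circ> inv_into U \<phi>) (at (\<phi> x)) a}"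

lemma tangent_chart:
  assumes UA: "(U, \<phi>) \<in> A" and xU: "x \<in> U"
  shows "tangent x = range (frechet_derivative (f \<circ> inv_into U \<phi>) (at (\<phi> x)))"
proof -
  have "frechet_derivative (f \<circ> inv_into V \<psi>) (at (\<psi> x)) a
      \<in> range (frechet_derivative (f \<circ> inv_into U \<phi>) (at (\<phi> x)))"
    if VA: "(V, \<psi>) \<in> A" and xV: "x \<in> V" for V \<psi> a
  proof -
    interpret u: chart_immersion "\<phi> ` U" "f \<circ> inv_into U \<phi>" by (rule chart_immersion[OF UA])
    let ?W = "\<psi> ` (V \<inter> U)"
    let ?t = "\<phi> \<circ> inv_into V \<psi>"
    have oW: "open ?W" using chart_open_image[OF VA chart_props(1)[OF UA]] .
    have xW: "\<psi> x \<in> ?W" using xU xV by blast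
    have "smooth_on ?W ?t" using atlas UA VA by (fastforce simp: smooth_atlas_def)
    then have "Ck_on (Suc 0) ?W ?t" unfolding smooth_on_def by blast
    from Ck_on_SucD(1)[OF oW this xW]
    have t: "(?t has_derivative frechet_derivative ?t (at (\<psi> x))) (at (\<psi> x))" .
    have tx: "?t (\<psi> x) = \<phi> x" using chart_inverse(1)[OF VA xV] by simp
    have "((f \<circ> inv_into U \<phi>) has_derivative u.D (\<phi> x)) (at (?t (\<psi> x)))"
      using u.D_derivative[of "\<phi> x"] xU tx by simp
    from has_derivative_compose[OF t this]
    have "((\<lambda>y. (f \<circ> inv_into U \<phi>) (?t y)) has_derivative (\<lambda>v. u.D (\<phi> x) (frechet_derivative ?t (at (\<psi> x)) v))) (at (\<psi> x))" .
    then have "((f \<circ> inv_into V \<psi>) has_derivative (\<lambda>v. u.D (\<phi> x) (frechet_derivative ?t (at (\<psi> x)) v))) (at (\<psi> x))"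
    proof (rule has_derivative_transform_within_open[OF _ oW xW])
      show "(f \<circ> inv_into U \<phi>) (?t y) = (f \<circ> inv_into V \<psi>) y" if "y \<in> ?W" for y
        using that chart_inverse(1)[OF VA] chart_inverse(1)[OF UA] by auto
    qed
    then have "frechet_derivative (f \<circ> inv_into V \<psi>) (at (\<psi> x)) = (\<lambda>v. u.D (\<phi> x) (frechet_derivative ?t (at (\<psi> x)) v))"
      using frechet_derivative_at by metis
    then show ?thesis by (simp add: u.D_def)
  qed
  then show ?thesis using UA xU unfolding tangent_def by blast
qed

definition nor :: "'a \<Rightarrow> 'b \<Rightarrow> 'b" where "nor x = normal_component (tangent x)"

lemma tangent_subspace: "x \<in> topspace X \<Longrightarrow> subspace (tangent x)"
proof -
  assume "x \<in> topspace X"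
  then obtain U \<phi> where c: "(U, \<phi>) \<in> A" "x \<in> U" by (rule chart_exists)
  interpret u: chart_immersion "\<phi> ` U" "f \<circ> inv_into U \<phi>" by (rule chart_immersion[OF c(1)])
  show ?thesis using u.range_subspace[of "\<phi> x"] c tangent_chart[OF c] by (simp add: u.D_def[abs_def])
qed

lemma nor_props:
  assumes "x \<in> topspace X"
  shows "linear (nor x)" "t \<in> tangent x \<Longrightarrow> nor x v \<bullet> t = 0" "v - nor x v \<in> tangent x"
    "nor x v = 0 \<longleftrightarrow> v \<in> tangent x" "t \<in> tangent x \<Longrightarrow> norm (nor x v) \<le> norm (v - t)"
    "(norm v)\<^sup>2 = (norm (nor x v))\<^sup>2 + (norm (v - nor x v))\<^sup>2"
    "v \<bullet> (v - nor x v) = (norm (v - nor x v))\<^sup>2"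
    "norm (nor x v) \<le> norm v"
proof -
  note T = tangent_subspace[OF assms]
  show "linear (nor x)" "t \<in> tangent x \<Longrightarrow> nor x v \<bullet> t = 0" "v - nor x v \<in> tangent x"
    "nor x v = 0 \<longleftrightarrow> v \<in> tangent x" "t \<in> tangent x \<Longrightarrow> norm (nor x v) \<le> norm (v - t)"
    "v \<bullet> (v - nor x v) = (norm (v - nor x v))\<^sup>2" for t v
    unfolding nor_def
    by (auto simp: normal_component_linear[OF T] normal_component_props[OF T] normal_component_eq_0_iff[OF T]
        norm_normal_component_le[OF T] inner_tangential_self[OF T])
  show "(norm v)\<^sup>2 = (norm (nor x v))\<^sup>2 + (norm (v - nor x v))\<^sup>2"
    using normal_component_pythagoras[OF T subspace_0[OF T], of v] by (simp add: nor_def)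
  show "norm (nor x v) \<le> norm v"
    using norm_normal_component_le[OF T subspace_0[OF T], of v] by (simp add: nor_def)
qed

lemma continuous_map_chartwise:
  fixes g :: "'a \<Rightarrow> 'c::topological_space"
  assumes "\<And>U \<phi>. (U, \<phi>) \<in> A \<Longrightarrow> continuous_on (\<phi> ` U) (g \<circ> inv_into U \<phi>)"
  shows "continuous_map X euclidean g"
  unfolding continuous_map_def
proof (intro conjI allI impI)
  fix W :: "'c set" assume "openin euclidean W"
  then have W: "open W" by simp
  show "openin X {x \<in> topspace X. g x \<in> W}"
  proof (subst openin_subopen, intro ballI)
    fix x assume "x \<in> {x \<in> topspace X. g x \<in> W}"
    then have x: "x \<in> topspace X" "g x \<in> W" by auto
    obtain U \<phi> where c: "(U, \<phi>) \<in> A" "x \<in> U" using chart_exists[OF x(1)] .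
    note i = chart_inverse[OF c(1)]
    let ?B = "\<phi> ` U \<inter> (g \<circ> inv_into U \<phi>) -` W"
    have "open ?B"
      using continuous_open_preimage[OF assms[OF c(1)] chart_props(2)[OF c(1)] W] .
    then have "openin X (inv_into U \<phi> ` ?B)" by (rule chart_open_preimage[OF c(1)]) auto
    moreover have "x \<in> inv_into U \<phi> ` ?B" using c i x by (auto intro!: image_eqI[of _ _ "\<phi> x"])
    moreover have "inv_into U \<phi> ` ?B \<subseteq> {x \<in> topspace X. g x \<in> W}"
      using i chart_props(4)[OF c(1)] by auto
    ultimately show "\<exists>T. openin X T \<and> x \<in> T \<and> T \<subseteq> {x \<in> topspace X. g x \<in> W}" by blast
  qed
qed auto

lemma chartwise_continuous:
  assumes "(U, \<phi>) \<in> A" "continuous_map X euclidean g"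
  shows "continuous_on (\<phi> ` U) (g \<circ> inv_into U \<phi>)"
  using continuous_map_compose[OF chart_inverse(4)[OF assms(1)] assms(2)] by simp

lemma f_continuous: "continuous_map X euclidean f"
proof (rule continuous_map_chartwise)
  fix U \<phi> assume "(U, \<phi>) \<in> A"
  then interpret u: chart_immersion "\<phi> ` U" "f \<circ> inv_into U \<phi>" by (rule chart_immersion)
  show "continuous_on (\<phi> ` U) (f \<circ> inv_into U \<phi>)" using Ck_on_imp_continuous_on[OF u.smooth[of 0]] .
qed

lemma nor_chart:
  assumes "(U, \<phi>) \<in> A" "y \<in> \<phi> ` U"
  shows "nor (inv_into U \<phi> y) = chart_immersion.Nor (f \<circ> inv_into U \<phi>) y"
proof -
  interpret u: chart_immersion "\<phi> ` U" "f \<circ> inv_into U \<phi>" by (rule chart_immersion[OF assms(1)])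
  have "tangent (inv_into U \<phi> y) = range (u.D y)"
    using tangent_chart[OF assms(1), of "inv_into U \<phi> y"] chart_inverse[OF assms(1)] assms(2)
    by (simp add: u.D_def[abs_def])
  then show ?thesis by (simp add: nor_def u.Nor_def)
qed

lemma nor_continuous:
  assumes "continuous_map X euclidean V"
  shows "continuous_map X euclidean (\<lambda>x. nor x (V x))"
proof (rule continuous_map_chartwise)
  fix U \<phi> assume c: "(U, \<phi>) \<in> A"
  interpret u: chart_immersion "\<phi> ` U" "f \<circ> inv_into U \<phi>" by (rule chart_immersion[OF c])
  let ?V = "V \<circ> inv_into U \<phi>"
  have V: "continuous_on (\<phi> ` U) ?V" by (rule chartwise_continuous[OF c assms])
  have "isCont (\<lambda>y. u.Nor y (?V y)) y" if y: "y \<in> \<phi> ` U" for y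
  proof -
    have "isCont ?V y" using V y u.S continuous_on_eq_continuous_at by blast
    from u.Nor_tendsto'[OF y isCont_tendsto_nhds[OF this]]
    show ?thesis unfolding isCont_def by (rule tendsto_mono[rotated]) (simp add: at_within_le_nhds)
  qed
  then have "continuous_on (\<phi> ` U) (\<lambda>y. u.Nor y (?V y))" by (simp add: continuous_at_imp_continuous_on)
  then show "continuous_on (\<phi> ` U) ((\<lambda>x. nor x (V x)) \<circ> inv_into U \<phi>)"
    by (rule continuous_on_eq) (simp add: nor_chart[OF c])
qed

end

section \<open>Immersions of bounded normal curvature\<close>

locale immersed = smooth_immersed X A f
  for X :: "'a topology" and A :: "('a, 'e::euclidean_space) atlas" and f :: "'a \<Rightarrow> 'b::euclidean_space" +
  fixes \<kappa> :: real
  assumes \<kappa>0: "\<kappa> \<ge> 0"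
    and curv: "\<And>U \<phi> y a. (U, \<phi>) \<in> A \<Longrightarrow> y \<in> \<phi> ` U \<Longrightarrow>
      norm (second_fundamental_form (f \<circ> inv_into U \<phi>) y a a) \<le>
        \<kappa> * (norm (frechet_derivative (f \<circ> inv_into U \<phi>) (at y) a))\<^sup>2"
begin

text \<open>Move with velocity \<open>v\<close>, the tangential part of \<open>V\<close>. As the
  derivative of \<open>V\<close> is tangential, the normal part of the derivative of
  \<open>nor V\<close> is \<open>- A(v, v)\<close>, for every \<open>l\<close>; hence the rate
  \<open>\<kappa> |v|^2\<close>. The cases used are \<open>l = 1\<close> for radius vectors and
  \<open>l = 0\<close> for constant vectors. Continuity of the curve on an interval is recorded
  because \<open>walk\<close> joins points along it.\<close>

lemma first_variation:
  fixes l :: real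
  assumes x: "x \<in> topspace X" and V: "\<And>y. V y = l *\<^sub>R f y - z"
  obtains c d where "d > 0" "c 0 = x" "continuous_map (top_of_set {-d<..<d}) X c"
    "\<And>e. e > 0 \<Longrightarrow> \<forall>\<^sub>F s in nhds 0. \<bar>s\<bar> < d \<and> norm (f (c s) - f x - s *\<^sub>R (V x - nor x (V x))) \<le> e * \<bar>s\<bar> \<and>
       \<bar>norm (nor (c s) (V (c s))) - norm (nor x (V x))\<bar> \<le> (\<kappa> * (norm (V x - nor x (V x)))\<^sup>2 + e) * \<bar>s\<bar>"
proof -
  obtain U \<phi> where c: "(U, \<phi>) \<in> A" "x \<in> U" using chart_exists[OF x] .
  note i = chart_inverse[OF c(1)]
  interpret u: chart_immersion "\<phi> ` U" "f \<circ> inv_into U \<phi>" by (rule chart_immersion[OF c(1)])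
  let ?F = "f \<circ> inv_into U \<phi>" and ?y = "\<phi> x" and ?V = "V \<circ> inv_into U \<phi>"
  have y: "?y \<in> \<phi> ` U" using c by blast
  have norx: "nor x = u.Nor ?y" using nor_chart[OF c(1) y] i(1)[OF c(2)] by simp
  obtain a where a: "V x - nor x (V x) = u.D ?y a"
    using nor_props(3)[OF x, of "V x"] tangent_chart[OF c] by (auto simp: u.D_def)
  have K: "norm (u.Nor ?y (u.D2 ?y a a)) \<le> \<kappa> * (norm (u.D ?y a))\<^sup>2"
    using curv[OF c(1) y, of a] unfolding second_fundamental_form_def u.Nor_def u.D2_def u.D_def .
  define h where "h s = inv_into U \<phi> (?y + s *\<^sub>R a)" for s
  have lim: "((\<lambda>s. ?y + s *\<^sub>R a) \<longlongrightarrow> ?y) (nhds (0::real))"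
  proof -
    have "((\<lambda>s. ?y + s *\<^sub>R a) \<longlongrightarrow> ?y + 0 *\<^sub>R a) (nhds (0::real))"
      by (intro tendsto_intros filterlim_ident)
    then show ?thesis by simp
  qed
  have "\<forall>\<^sub>F s in nhds 0. ?y + s *\<^sub>R a \<in> \<phi> ` U" using topological_tendstoD[OF lim u.S y] .
  then obtain d where d: "d > 0" "\<And>s. \<bar>s\<bar> < d \<Longrightarrow> ?y + s *\<^sub>R a \<in> \<phi> ` U"
    unfolding eventually_nhds_metric dist_real_def by auto
  show thesis
  proof (rule that[OF d(1)])
    show "h 0 = x" using i(1)[OF c(2)] by (simp add: h_def)
    have "continuous_map (top_of_set {-d<..<d}) (top_of_set (\<phi> ` U)) (\<lambda>s. ?y + s *\<^sub>R a)"
      using d by (auto simp: continuous_map_in_subtopology intro!: continuous_intros)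
    from continuous_map_compose[OF this i(4)]
    show "continuous_map (top_of_set {-d<..<d}) X h" by (simp add: h_def[abs_def] o_def)
    fix e :: real assume e: "e > 0"
    have 1: "\<forall>\<^sub>F s in nhds 0. norm (?F (?y + s *\<^sub>R a) - ?F ?y - s *\<^sub>R u.D ?y a) \<le> e * \<bar>s\<bar>"
      using vector_derivative_error[OF line_derivative[OF u.D_derivative[OF y], of a] e] by simp
    have 2: "\<forall>\<^sub>F s in nhds 0. \<bar>norm (u.Nor (?y + s *\<^sub>R a) (?V (?y + s *\<^sub>R a))) - norm (u.Nor ?y (?V ?y))\<bar>
        \<le> (\<kappa> * (norm (u.D ?y a))\<^sup>2 + e) * \<bar>s\<bar>"
      by (rule u.first_variation[OF y _ _ K e, of _ l z]) (use V a norx i(1)[OF c(2)] in auto)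
    have 3: "\<forall>\<^sub>F s in nhds (0::real). \<bar>s\<bar> < d"
      unfolding eventually_nhds_metric using d by (auto simp: dist_norm)
    show "\<forall>\<^sub>F s in nhds 0. \<bar>s\<bar> < d \<and> norm (f (h s) - f x - s *\<^sub>R (V x - nor x (V x))) \<le> e * \<bar>s\<bar> \<and>
       \<bar>norm (nor (h s) (V (h s))) - norm (nor x (V x))\<bar> \<le> (\<kappa> * (norm (V x - nor x (V x)))\<^sup>2 + e) * \<bar>s\<bar>"
      using 1 2 3
    proof eventually_elim
      case (elim s)
      then show ?case
        using a norx i(1)[OF c(2)] nor_chart[OF c(1) d(2)[OF elim(3)]] by (simp add: h_def)
    qed
  qed
qed

lemma chart_ball:
  assumes "openin X O'" "x \<in> O'"
  obtains U \<phi> e where "(U, \<phi>) \<in> A" "x \<in> U" "e > 0" "ball (\<phi> x) e \<subseteq> \<phi> ` U" "inv_into U \<phi> ` ball (\<phi> x) e \<subseteq> O'"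
proof -
  have "x \<in> topspace X" using assms openin_subset by blast
  then obtain U \<phi> where c: "(U, \<phi>) \<in> A" "x \<in> U" by (rule chart_exists)
  have "\<phi> x \<in> \<phi> ` (U \<inter> O')" using c assms by blast
  then obtain e where e: "e > 0" "ball (\<phi> x) e \<subseteq> \<phi> ` (U \<inter> O')"
    using chart_open_image[OF c(1) assms(1)] openE by metis
  have "inv_into U \<phi> ` ball (\<phi> x) e \<subseteq> inv_into U \<phi> ` \<phi> ` (U \<inter> O')"
    using e by (rule_tac image_mono)
  also have "\<dots> \<subseteq> O'" using chart_inverse(1)[OF c(1)] by auto
  finally show thesis using that[OF c e(1)] e(2) by blast
qed

lemma joined_image:
  assumes "(U, \<phi>) \<in> A" "compact C" "connected C" "C \<subseteq> \<phi> ` U" "inv_into U \<phi> ` C \<subseteq> S" "a \<in> C" "b \<in> C"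
  shows "joined X S (inv_into U \<phi> a) (inv_into U \<phi> b)"
proof (rule joinedI[of X "inv_into U \<phi> ` C"])
  note i = chart_inverse(4)[OF assms(1)]
  show "compactin X (inv_into U \<phi> ` C)"
    by (rule image_compactin[OF _ i]) (use assms in \<open>simp add: compactin_subtopology\<close>)
  show "connectedin X (inv_into U \<phi> ` C)"
    by (rule connectedin_continuous_map_image[OF i]) (use assms in \<open>simp add: connectedin_subtopology\<close>)
qed (use assms in auto)

lemma locally_joined:
  assumes "openin X O'" "x \<in> O'"
  obtains U where "openin X U" "x \<in> U" "U \<subseteq> O'" "\<And>y z. y \<in> U \<Longrightarrow> z \<in> U \<Longrightarrow> joined X O' y z"
proof -
  obtain U \<phi> e where c: "(U, \<phi>) \<in> A" "x \<in> U" and e: "e > 0" "ball (\<phi> x) e \<subseteq> \<phi> ` U"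
    "inv_into U \<phi> ` ball (\<phi> x) e \<subseteq> O'" by (rule chart_ball[OF assms])
  let ?B = "ball (\<phi> x) e"
  show thesis
  proof (rule that[of "inv_into U \<phi> ` ?B"])
    show "openin X (inv_into U \<phi> ` ?B)" by (rule chart_open_preimage[OF c(1) _ e(2)]) simp
    show "x \<in> inv_into U \<phi> ` ?B" using chart_inverse(1)[OF c] e(1) by (auto intro!: image_eqI[of _ _ "\<phi> x"])
    show "inv_into U \<phi> ` ?B \<subseteq> O'" by fact
    fix y z assume "y \<in> inv_into U \<phi> ` ?B" "z \<in> inv_into U \<phi> ` ?B"
    then obtain a b where ab: "a \<in> ?B" "b \<in> ?B" "y = inv_into U \<phi> a" "z = inv_into U \<phi> b" by blast
    have "closed_segment a b \<subseteq> ?B" using ab by (simp add: closed_segment_subset)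
    then show "joined X O' y z"
      unfolding ab by (intro joined_image[OF c(1), of "closed_segment a b"]) (use e in auto)
  qed
qed

text \<open>The topological use of the dimension: a punctured ball is connected from dimension two
  on.\<close>

lemma locally_joined_punctured:
  assumes "openin X O'" "x \<in> O'" and dim: "2 \<le> DIM('e)"
  obtains U where "openin X U" "x \<in> U" "U \<subseteq> O'"
    "\<And>y z. y \<in> U - {x} \<Longrightarrow> z \<in> U - {x} \<Longrightarrow> joined X (O' - {x}) y z"
proof -
  obtain U \<phi> e where c: "(U, \<phi>) \<in> A" "x \<in> U" and e: "e > 0" "ball (\<phi> x) e \<subseteq> \<phi> ` U"
    "inv_into U \<phi> ` ball (\<phi> x) e \<subseteq> O'" by (rule chart_ball[OF assms(1,2)])
  let ?B = "ball (\<phi> x) e"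
  have pc: "path_connected (?B - {\<phi> x})"
    by (rule path_connected_punctured_convex) (use e(1) dim in \<open>auto simp: aff_dim_open\<close>)
  show thesis
  proof (rule that[of "inv_into U \<phi> ` ?B"])
    show "openin X (inv_into U \<phi> ` ?B)" by (rule chart_open_preimage[OF c(1) _ e(2)]) simp
    show "x \<in> inv_into U \<phi> ` ?B" using chart_inverse(1)[OF c] e(1) by (auto intro!: image_eqI[of _ _ "\<phi> x"])
    show "inv_into U \<phi> ` ?B \<subseteq> O'" by fact
    fix y z assume "y \<in> inv_into U \<phi> ` ?B - {x}" "z \<in> inv_into U \<phi> ` ?B - {x}"
    then obtain a b where ab0: "a \<in> ?B" "b \<in> ?B" "y = inv_into U \<phi> a" "z = inv_into U \<phi> b" "y \<noteq> x" "z \<noteq> x"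
      by blast
    then have ab: "a \<in> ?B - {\<phi> x}" "b \<in> ?B - {\<phi> x}" "y = inv_into U \<phi> a" "z = inv_into U \<phi> b"
      using chart_inverse(1)[OF c] by auto
    obtain g where g: "path g" "path_image g \<subseteq> ?B - {\<phi> x}" "pathstart g = a" "pathfinish g = b"
      using pc ab unfolding path_connected_def by blast
    have "inv_into U \<phi> w \<noteq> x" if "w \<in> path_image g" for w
    proof
      assume x: "inv_into U \<phi> w = x"
      have w: "w \<in> ?B - {\<phi> x}" using that g(2) by blast
      then have "w \<in> \<phi> ` U" using e(2) by blast
      then show False using chart_inverse(3)[OF c(1), of w] w x by simp
    qed
    moreover have "path_image g \<subseteq> \<phi> ` U" "inv_into U \<phi> ` path_image g \<subseteq> O'"
      using g(2) e(2,3) by blast+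
    ultimately have "inv_into U \<phi> ` path_image g \<subseteq> O' - {x}" by blast
    then show "joined X (O' - {x}) y z"
      unfolding ab
      by (intro joined_image[OF c(1) compact_path_image[OF g(1)] connected_path_image[OF g(1)] \<open>path_image g \<subseteq> \<phi> ` U\<close>])
        (use g(3,4) pathstart_in_path_image[of g] pathfinish_in_path_image[of g] in auto)
  qed
qed

text \<open>Near a noncritical point, sublevel sets of the distance are locally connected: descend
  from \<open>a\<close> to \<open>a + w\<close>, cross over to \<open>b + w\<close>, climb to
  \<open>b\<close>. The sign \<open>\<sigma>\<close> covers superlevel sets too. By the last clause
  nearby points of the closed sublevel set are limits of points strictly below the level.\<close>

lemma descent:
  fixes \<sigma> :: real
  assumes O': "openin X O'" "x \<in> O'" and \<sigma>: "\<sigma> = 1 \<or> \<sigma> = -1"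
    and tan: "f x - z \<notin> {v. nor x v = v}"
  defines "R y \<equiv> \<sigma> * (norm (f y - z))\<^sup>2"
  obtains U where "openin X U" "x \<in> U" "U \<subseteq> O'"
    "\<And>y y'. y \<in> U \<Longrightarrow> y' \<in> U \<Longrightarrow> R y \<le> R x \<Longrightarrow> R y' \<le> R x \<Longrightarrow> joined X (O' \<inter> {w. R w \<le> R x}) y y'"
    "\<And>y y'. y \<in> U \<Longrightarrow> y' \<in> U \<Longrightarrow> R y < R x \<Longrightarrow> R y' < R x \<Longrightarrow> joined X (O' \<inter> {w. R w < R x}) y y'"
    "\<And>y W. y \<in> U \<Longrightarrow> R y \<le> R x \<Longrightarrow> openin X W \<Longrightarrow> y \<in> W \<Longrightarrow> \<exists>w\<in>W. R w < R x"
proof -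
  obtain U \<phi> e where c: "(U, \<phi>) \<in> A" "x \<in> U" and e: "e > 0" "ball (\<phi> x) e \<subseteq> \<phi> ` U"
    "inv_into U \<phi> ` ball (\<phi> x) e \<subseteq> O'" by (rule chart_ball[OF O'])
  note i = chart_inverse[OF c(1)]
  interpret u: chart_immersion "\<phi> ` U" "f \<circ> inv_into U \<phi>" by (rule chart_immersion[OF c(1)])
  let ?F = "f \<circ> inv_into U \<phi>" and ?p = "\<phi> x" and ?j = "inv_into U \<phi>"
  have p: "?p \<in> \<phi> ` U" using c by blast
  have norx: "nor x = u.Nor ?p" using nor_chart[OF c(1) p] i(1)[OF c(2)] by simp
  define G where "G y = \<sigma> * (norm (?F y - z))\<^sup>2" for y
  have GR: "R (?j y) = G y" for y by (simp add: R_def G_def)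
  have G0: "G ?p = R x" using i(1)[OF c(2)] by (simp add: R_def G_def)
  have "?F ?p - z - u.Nor ?p (?F ?p - z) \<noteq> 0"
    using tan norx i(1)[OF c(2)] by auto
  then obtain d w where dw: "0 < d" "ball ?p d \<subseteq> ball ?p e \<inter> \<phi> ` U"
    "\<And>y t. y \<in> ball ?p d \<Longrightarrow> 0 < t \<Longrightarrow> t \<le> 1 \<Longrightarrow> y + t *\<^sub>R w \<in> ball ?p e \<inter> \<phi> ` U \<and> G (y + t *\<^sub>R w) < G y"
    "\<And>y. y \<in> ball ?p d \<Longrightarrow> G (y + w) < G ?p"
    using u.descent_in_chart[OF p e(1) \<sigma>, of z] unfolding G_def by metis
  let ?U = "?j ` ball ?p d"
  have jO: "?j y \<in> O'" if "y \<in> ball ?p e" for y using e(3) that by blast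
  have path: "joined X (O' \<inter> {w. R w \<le> R x}) (?j a) (?j b) \<and>
      (G a < G ?p \<longrightarrow> G b < G ?p \<longrightarrow> joined X (O' \<inter> {w. R w < R x}) (?j a) (?j b))"
    if ab: "a \<in> ball ?p d" "b \<in> ball ?p d" "G a \<le> G ?p" "G b \<le> G ?p" for a b
  proof -
    let ?C = "closed_segment a (a + w) \<union> closed_segment (a + w) (b + w) \<union> closed_segment (b + w) b"
    have seg1: "v \<in> ball ?p e \<inter> \<phi> ` U \<and> (v = y \<or> G v < G y)" if y: "y \<in> ball ?p d" and v: "v \<in> closed_segment y (y + w)" for y v
    proof -
      obtain t where t: "0 \<le> t" "t \<le> 1" "v = y + t *\<^sub>R w"
        using v by (auto simp: closed_segment_def algebra_simps)
      then show ?thesis using dw(2) dw(3)[OF y, of t] y by (cases "t = 0") auto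
    qed
    have seg2: "v \<in> ball ?p e \<inter> \<phi> ` U \<and> G v < G ?p" if v: "v \<in> closed_segment (a + w) (b + w)" for v
    proof -
      have "v - w \<in> closed_segment a b" using v by (simp add: closed_segment_translation_eq[of w "v - w" a b, symmetric] add.commute)
      then have b: "v - w \<in> ball ?p d" using ab closed_segment_subset[OF _ _ convex_ball] by blast
      show ?thesis using dw(3)[OF b, of 1] dw(4)[OF b] by simp
    qed
    have C: "v \<in> ball ?p e \<inter> \<phi> ` U \<and> (v = a \<or> v = b \<or> G v < G ?p)" if "v \<in> ?C" for v
      using that seg1[OF ab(1), of v] seg2[of v] seg1[OF ab(2), of v] ab(3,4)
      by (auto simp: closed_segment_commute)
    have cc: "compact ?C" "connected ?C"
      by (auto intro!: compact_Un connected_Un)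
    have "joined X S (?j a) (?j b)" if "?j ` ?C \<subseteq> S" for S
      by (rule joined_image[OF c(1) cc _ that]) (use C in auto)
    moreover have "?j ` ?C \<subseteq> O' \<inter> {w. R w \<le> R x}"
      using C ab(3,4) jO unfolding image_subset_iff GR G0[symmetric] Int_iff mem_Collect_eq
      by (metis IntE less_imp_le)
    moreover have "?j ` ?C \<subseteq> O' \<inter> {w. R w < R x}" if "G a < G ?p" "G b < G ?p"
      using C that jO unfolding image_subset_iff GR G0[symmetric] Int_iff mem_Collect_eq
      by (metis IntE)
    ultimately show ?thesis by blast
  qed
  show thesis
  proof (rule that[of ?U])
    show "openin X ?U" by (rule chart_open_preimage[OF c(1)]) (use dw(2) in auto)
    show "x \<in> ?U" using i(1)[OF c(2)] dw(1) by (auto intro!: image_eqI[of _ _ ?p])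
    show "?U \<subseteq> O'" using dw(2) e(3) by blast
    show "joined X (O' \<inter> {w. R w \<le> R x}) y y'" if "y \<in> ?U" "y' \<in> ?U" "R y \<le> R x" "R y' \<le> R x" for y y'
      using that path unfolding image_iff GR G0[symmetric] by (metis GR)
    show "joined X (O' \<inter> {w. R w < R x}) y y'" if "y \<in> ?U" "y' \<in> ?U" "R y < R x" "R y' < R x" for y y'
      using that path unfolding image_iff GR G0[symmetric] by (metis GR less_imp_le)
    fix y W assume y: "y \<in> ?U" "R y \<le> R x" and W: "openin X W" "y \<in> W"
    obtain a where a: "a \<in> ball ?p d" "y = ?j a" using y by blast
    have aU: "a \<in> \<phi> ` U" using a dw(2) by blast
    then have "a \<in> \<phi> ` (U \<inter> W)" using a(2) W(2) i by (metis IntI image_eqI)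
    then have "\<forall>\<^sub>F v in nhds a. v \<in> \<phi> ` (U \<inter> W)"
      using chart_open_image[OF c(1) W(1)] eventually_nhds_in_open by blast
    moreover have "((\<lambda>t. a + t *\<^sub>R w) \<longlongrightarrow> a + 0 *\<^sub>R w) (at_right 0)" by (intro tendsto_intros)
    ultimately have "\<forall>\<^sub>F t in at_right 0. a + t *\<^sub>R w \<in> \<phi> ` (U \<inter> W)"
      using eventually_compose_filterlim[of "\<lambda>v. v \<in> \<phi> ` (U \<inter> W)" "nhds a"] by simp
    moreover have "\<forall>\<^sub>F t in at_right 0. t \<in> {0<..<1::real}" by (rule eventually_at_right_real) simp
    ultimately have "\<forall>\<^sub>F t in at_right 0. a + t *\<^sub>R w \<in> \<phi> ` (U \<inter> W) \<and> t \<in> {0<..<1::real}"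
      by eventually_elim simp
    then obtain t where t: "a + t *\<^sub>R w \<in> \<phi> ` (U \<inter> W)" "t \<in> {0<..<1::real}"
      using eventually_happens' trivial_limit_at_right_real by blast
    have "?j (a + t *\<^sub>R w) \<in> W" using t i by auto
    moreover have "R (?j (a + t *\<^sub>R w)) < R x"
      using dw(3)[OF a(1), of t] t y(2) a(2) GR by auto
    ultimately show "\<exists>w\<in>W. R w < R x" by blast
  qed
qed

text \<open>Makes \<open>good\<close> a neighbourhood of its centre, where both sides of the
  inequality vanish and continuity gives nothing.\<close>

lemma near_diagonal:
  assumes p: "p \<in> topspace X" and c0: "c > 0" and ck: "c * \<kappa> < 1"
  obtains U where "openin X U" "p \<in> U"
    "\<And>y. y \<in> U \<Longrightarrow> y \<noteq> p \<Longrightarrow> 2 * c * norm (nor y (f y - f p)) < (norm (f y - f p))\<^sup>2"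
proof -
  obtain U \<phi> where c: "(U, \<phi>) \<in> A" "p \<in> U" using chart_exists[OF p] .
  note i = chart_inverse[OF c(1)]
  interpret u: chart_immersion "\<phi> ` U" "f \<circ> inv_into U \<phi>" by (rule chart_immersion[OF c(1)])
  let ?F = "f \<circ> inv_into U \<phi>"
  have y: "\<phi> p \<in> \<phi> ` U" using c by blast
  have "norm (u.Nor (\<phi> p) (u.D2 (\<phi> p) a a)) \<le> \<kappa> * (norm (u.D (\<phi> p) a))\<^sup>2" for a
    using curv[OF c(1) y, of a] unfolding second_fundamental_form_def u.Nor_def u.D2_def u.D_def .
  from u.near_estimate[OF y this c0 ck \<kappa>0]
  have "\<forall>\<^sub>F y in nhds (\<phi> p). y \<in> \<phi> ` U \<and> (y \<noteq> \<phi> p \<longrightarrow> 2 * c * norm (u.Nor y (?F y - ?F (\<phi> p))) < (norm (?F y - ?F (\<phi> p)))\<^sup>2)"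
    using eventually_nhds_in_open[OF u.S y] by eventually_elim auto
  then obtain B where B: "open B" "\<phi> p \<in> B"
    "\<And>y. y \<in> B \<Longrightarrow> y \<in> \<phi> ` U \<and> (y \<noteq> \<phi> p \<longrightarrow> 2 * c * norm (u.Nor y (?F y - ?F (\<phi> p))) < (norm (?F y - ?F (\<phi> p)))\<^sup>2)"
    unfolding eventually_nhds by blast
  show thesis
  proof (rule that[of "inv_into U \<phi> ` B"])
    show "openin X (inv_into U \<phi> ` B)" by (rule chart_open_preimage[OF c(1) B(1)]) (use B(3) in blast)
    show "p \<in> inv_into U \<phi> ` B" using i(1)[OF c(2)] B(2) by (auto intro!: image_eqI[of _ _ "\<phi> p"])
    fix y assume "y \<in> inv_into U \<phi> ` B" "y \<noteq> p"
    then obtain a where a: "a \<in> B" "y = inv_into U \<phi> a" "a \<noteq> \<phi> p" using i(1)[OF c(2)] by auto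
    then show "2 * c * norm (nor y (f y - f p)) < (norm (f y - f p))\<^sup>2"
      using B(3)[OF a(1)] nor_chart[OF c(1)] i(1)[OF c(2)] by simp
  qed
qed

lemma tangent_perp:
  assumes x: "x \<in> topspace X" and dim: "2 \<le> DIM('e)"
  obtains u where "u \<in> tangent x" "norm u = 1" "u \<bullet> v = 0"
proof -
  obtain U \<phi> where c: "(U, \<phi>) \<in> A" "x \<in> U" using chart_exists[OF x] .
  interpret w: chart_immersion "\<phi> ` U" "f \<circ> inv_into U \<phi>" by (rule chart_immersion[OF c(1)])
  have y: "\<phi> x \<in> \<phi> ` U" using c by blast
  let ?D = "w.D (\<phi> x)"
  note l = w.D_linear[OF y]
  obtain a where a: "a \<noteq> 0" "orthogonal (adjoint ?D v) a" by (rule orthogonal_to_vector_exists[OF dim])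
  have "?D a \<bullet> v = 0" using a(2) adjoint_works[OF l, of a v] by (simp add: orthogonal_def inner_commute)
  moreover have "?D a \<noteq> 0" using a(1) w.D_inj[OF y] linear_injective_0[OF l] by blast
  moreover have "?D a /\<^sub>R norm (?D a) \<in> tangent x"
    using subspace_scale[OF tangent_subspace[OF x]] tangent_chart[OF c] by (auto simp: w.D_def)
  ultimately show thesis using that[of "?D a /\<^sub>R norm (?D a)"] by simp
qed

end

section \<open>Extremal principles\<close>

lemma continuous_map_norm_diff:
  fixes f :: "'a \<Rightarrow> 'b::real_normed_vector"
  shows "continuous_map X euclidean f \<Longrightarrow> continuous_map X euclideanreal (\<lambda>y. norm (f y - z))"
  by (intro continuous_map_norm continuous_map_diff) auto

locale closed_immersed = immersed X A f \<kappa> for X :: "'a topology" and A :: "('a, 'e::euclidean_space) atlas"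
    and f :: "'a \<Rightarrow> 'b::euclidean_space" and \<kappa> +
  assumes compact: "compact_space X" and connected: "connected_space X"
    and ball: "\<And>x. x \<in> topspace X \<Longrightarrow> norm (f x) \<le> 1"
begin

lemma attains_max:
  assumes "closedin X S" "S \<noteq> {}" "continuous_map X euclideanreal g"
  obtains x where "x \<in> S" "\<And>y. y \<in> S \<Longrightarrow> g y \<le> g x"
proof -
  have "compactin X S" by (rule closedin_compact_space[OF compact assms(1)])
  from image_compactin[OF this assms(3)] have "compact (g ` S)" by simp
  moreover have "g ` S \<noteq> {}" using assms(2) by simp
  ultimately show thesis using compact_attains_sup[of "g ` S"] that by (metis imageE imageI)
qed

lemma distance_continuous: "continuous_map X euclideanreal (\<lambda>y. norm (f y - z))"
  by (rule continuous_map_norm_diff[OF f_continuous])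

lemma open_less:
  assumes "continuous_map X euclideanreal g" "continuous_map X euclideanreal h"
  shows "openin X {y \<in> topspace X. g y < h y}"
proof -
  have "openin X {y \<in> topspace X. h y - g y \<in> {0<..}}"
    by (rule openin_continuous_map_preimage[OF continuous_map_diff[OF assms(2,1)]]) simp
  then show ?thesis by simp
qed

lemma closed_le:
  assumes "continuous_map X euclideanreal g" "continuous_map X euclideanreal h"
  shows "closedin X {y \<in> topspace X. g y \<le> h y}"
proof -
  have "closedin X {y \<in> topspace X. h y - g y \<in> {0..}}"
    by (rule closedin_continuous_map_preimage[OF continuous_map_diff[OF assms(2,1)]]) simp
  then show ?thesis by simp
qed

text \<open>The engine of the extremal principles: for \<open>m * \<kappa> < b\<close>, neither sum
  nor difference of \<open>G (f y)\<close> and \<open>m |nor V|\<close> has a local maximum where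
  \<open>V\<close> is not normal. Along the tangential part \<open>\<tau>\<close> of
  \<open>V\<close>, forwards or backwards, \<open>G\<close> gains at rate
  \<open>b |\<tau>|^2\<close>, and \<open>|nor V|\<close> changes at most at rate
  \<open>\<kappa> |\<tau>|^2\<close>.\<close>

lemma ascent:
  fixes l :: real
  assumes x: "x \<in> topspace X" and V: "\<And>y. V y = l *\<^sub>R f y - z"
    and G: "(G has_derivative G') (at (f x))"
    and b: "\<bar>G' (V x - nor x (V x))\<bar> = b * (norm (V x - nor x (V x)))\<^sup>2" and m: "0 \<le> m" "m * \<kappa> < b"
    and V0: "nor x (V x) \<noteq> V x" and O': "openin X O'" "x \<in> O'"
  obtains y where "y \<in> O'" "m * \<bar>norm (nor y (V y)) - norm (nor x (V x))\<bar> < G (f y) - G (f x)"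
proof -
  obtain c d where c: "d > 0" "c 0 = x" "continuous_map (top_of_set {-d<..<d}) X c"
    and fv: "\<And>e. e > 0 \<Longrightarrow> \<forall>\<^sub>F s in nhds 0. \<bar>s\<bar> < d \<and> norm (f (c s) - f x - s *\<^sub>R (V x - nor x (V x))) \<le> e * \<bar>s\<bar> \<and>
       \<bar>norm (nor (c s) (V (c s))) - norm (nor x (V x))\<bar> \<le> (\<kappa> * (norm (V x - nor x (V x)))\<^sup>2 + e) * \<bar>s\<bar>"
    by (rule first_variation[OF x V]) (rule that)
  define \<tau> where "\<tau> = V x - nor x (V x)"
  have t0: "norm \<tau> > 0" using V0 by (simp add: \<tau>_def)
  define e where "e = (b - m * \<kappa>) * (norm \<tau>)\<^sup>2 / (2 * (m + 1))"
  have e: "e > 0" using m t0 by (simp add: e_def)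
  have me: "m * e < (b - m * \<kappa>) * (norm \<tau>)\<^sup>2"
  proof -
    have "m * e \<le> (m + 1) * e" using e by simp
    also have "\<dots> = (b - m * \<kappa>) * (norm \<tau>)\<^sup>2 / 2" using m by (simp add: e_def field_simps)
    also have "\<dots> < (b - m * \<kappa>) * (norm \<tau>)\<^sup>2" using m t0 by simp
    finally show ?thesis .
  qed
  have fc: "((\<lambda>s. f (c s)) has_derivative (\<lambda>s. s *\<^sub>R \<tau>)) (at 0)"
    unfolding has_derivative_at_alt
  proof (intro conjI allI impI)
    show "bounded_linear (\<lambda>s::real. s *\<^sub>R \<tau>)" by (rule bounded_linear_scaleR_left)
    fix e :: real assume "0 < e"
    from fv[OF this] show "\<exists>d>0. \<forall>y. norm (y - 0) < d \<longrightarrow> norm (f (c y) - f (c 0) - (y - 0) *\<^sub>R \<tau>) \<le> e * norm (y - 0)"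
      unfolding eventually_nhds_metric dist_real_def \<tau>_def c(2) by (auto simp: diff_diff_eq)
  qed
  have Gc: "((\<lambda>s. G (f (c s))) has_real_derivative G' \<tau>) (at 0)"
  proof -
    interpret G': bounded_linear G' by (rule has_derivative_bounded_linear[OF G])
    have "(\<lambda>s. G' (s *\<^sub>R \<tau>)) = (\<lambda>s. G' \<tau> * s)" by (simp add: G'.scaleR mult.commute)
    then show ?thesis
      using has_derivative_compose[OF fc, of G G'] G c(2) by (simp add: has_field_derivative_def)
  qed
  \<comment> \<open>The sign of the derivative decides whether to run forwards or backwards along
    the curve.\<close>
  define \<sigma> where "\<sigma> = sgn (G' \<tau>)"
  have "b > 0" using m \<kappa>0 by (metis mult_nonneg_nonneg order.strict_trans1)
  then have "G' \<tau> \<noteq> 0" using b t0 unfolding \<tau>_def[symmetric] by auto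
  then have \<sigma>: "\<bar>\<sigma>\<bar> = 1" "\<sigma> * G' \<tau> = b * (norm \<tau>)\<^sup>2"
    using b unfolding \<tau>_def[symmetric] \<sigma>_def by (auto simp: abs_sgn_eq mult.commute[of "sgn _"] abs_sgn[symmetric])
  obtain e' where e': "e' > 0" "e' < (b - m * \<kappa>) * (norm \<tau>)\<^sup>2 - m * e"
    using me dense[of 0 "(b - m * \<kappa>) * (norm \<tau>)\<^sup>2 - m * e"] by auto
  have 1: "\<forall>\<^sub>F s in at 0. \<bar>(G (f (c s)) - G (f x)) / s - G' \<tau>\<bar> < e'"
    using Gc e' unfolding has_field_derivative_iff tendsto_iff dist_real_def c(2) by simp
  have "openin (top_of_set {-d<..<d}) {s \<in> {-d<..<d}. c s \<in> O'}"
    using openin_continuous_map_preimage[OF c(3) O'(1)] by simp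
  then have "open {s \<in> {-d<..<d}. c s \<in> O'}" by (simp add: openin_open_eq)
  moreover have "0 \<in> {s \<in> {-d<..<d}. c s \<in> O'}" using c O' by simp
  ultimately have "\<forall>\<^sub>F s in nhds 0. s \<in> {s \<in> {-d<..<d}. c s \<in> O'}" by (rule eventually_nhds_in_open)
  then have 2: "\<forall>\<^sub>F s in at 0. c s \<in> O'" unfolding eventually_at_filter by eventually_elim simp
  have 3: "\<forall>\<^sub>F s in at 0. \<bar>norm (nor (c s) (V (c s))) - norm (nor x (V x))\<bar> \<le> (\<kappa> * (norm \<tau>)\<^sup>2 + e) * \<bar>s\<bar>"
    using fv[OF e] unfolding eventually_at_filter \<tau>_def by eventually_elim simp
  have "\<forall>\<^sub>F s in at 0. s \<noteq> 0 \<and> c s \<in> O' \<and> \<bar>(G (f (c s)) - G (f x)) / s - G' \<tau>\<bar> < e' \<and>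
      \<bar>norm (nor (c s) (V (c s))) - norm (nor x (V x))\<bar> \<le> (\<kappa> * (norm \<tau>)\<^sup>2 + e) * \<bar>s\<bar>"
    using 1 2 3 by (intro eventually_conj) (auto simp: eventually_at_filter)
  then obtain r where r: "r > 0" "\<And>s. s \<noteq> 0 \<Longrightarrow> \<bar>s\<bar> < r \<Longrightarrow> c s \<in> O' \<and> \<bar>(G (f (c s)) - G (f x)) / s - G' \<tau>\<bar> < e' \<and>
      \<bar>norm (nor (c s) (V (c s))) - norm (nor x (V x))\<bar> \<le> (\<kappa> * (norm \<tau>)\<^sup>2 + e) * \<bar>s\<bar>"
    unfolding eventually_at dist_real_def by auto
  define s where "s = \<sigma> * (r / 2)"
  have s: "s \<noteq> 0" "\<bar>s\<bar> = r/2" using \<sigma>(1) r(1) by (auto simp: s_def abs_mult)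
  note rs = r(2)[OF s(1)]
  define q where "q = (G (f (c s)) - G (f x)) / s - G' \<tau>"
  have "G (f (c s)) - G (f x) = s * G' \<tau> + s * q" using s(1) by (simp add: q_def field_simps)
  moreover have "\<bar>s * q\<bar> \<le> r/2 * e'"
    unfolding abs_mult s(2) q_def using rs s(2) r(1) by (intro mult_left_mono) auto
  moreover have "s * G' \<tau> = r/2 * (b * (norm \<tau>)\<^sup>2)" using \<sigma>(2) by (simp add: s_def)
  ultimately have "G (f (c s)) - G (f x) \<ge> r/2 * (b * (norm \<tau>)\<^sup>2) - r/2 * e'"
    using abs_ge_minus_self[of "s * q"] by linarith
  then have up: "G (f (c s)) - G (f x) \<ge> r/2 * (b * (norm \<tau>)\<^sup>2 - e')" by (simp add: right_diff_distrib)
  have "m * \<bar>norm (nor (c s) (V (c s))) - norm (nor x (V x))\<bar> \<le> m * ((\<kappa> * (norm \<tau>)\<^sup>2 + e) * (r/2))"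
    using rs s r(1) m(1) by (intro mult_left_mono) auto
  also have "\<dots> = r/2 * (m * \<kappa> * (norm \<tau>)\<^sup>2 + m * e)" by (simp add: algebra_simps)
  also have "\<dots> < r/2 * (b * (norm \<tau>)\<^sup>2 - e')"
  proof -
    have "m * \<kappa> * (norm \<tau>)\<^sup>2 + m * e < b * (norm \<tau>)\<^sup>2 - e'"
      using e'(2) by (simp add: left_diff_distrib)
    then show ?thesis using r(1) by simp
  qed
  finally show thesis using that[of "c s"] rs s r(1) up by simp
qed

text \<open>The model is a circle of radius \<open>c\<close> whose tangent at \<open>f x\<close>
  passes through \<open>z\<close>: by the power of the point \<open>z\<close>, its far point at
  distance \<open>d\<close> has \<open>d (d - 2c) = |f x - z|^2\<close>. At a maximum of
  \<open>?g\<close> the radius vector is normal, so \<open>?g\<close> is \<open>d^2 - 2cd\<close>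
  there, while at \<open>x\<close> the normal part is zero.\<close>

lemma sphere_outside:
  assumes x: "x \<in> topspace X" and t: "f x - z \<in> tangent x" and c: "0 < c" "c * \<kappa> < 1"
  obtains y where "y \<in> topspace X"
    "(norm (f x - z))\<^sup>2 \<le> (norm (f y - z))\<^sup>2 - 2 * c * norm (f y - z)"
proof -
  let ?g = "\<lambda>y. (norm (f y - z))\<^sup>2 - 2 * c * norm (nor y (f y - z))"
  have "continuous_map X euclideanreal ?g"
    by (intro continuous_map_diff continuous_map_real_mult continuous_map_norm continuous_map_real_pow
        nor_continuous f_continuous) auto
  from attains_max[OF closedin_topspace _ this] obtain y where y: "y \<in> topspace X"
    "\<And>w. w \<in> topspace X \<Longrightarrow> ?g w \<le> ?g y" using x by blast
  note n = nor_props[OF y(1)]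
  have "nor y (f y - z) = f y - z"
  proof (rule ccontr)
    assume c0: "nor y (f y - z) \<noteq> f y - z"
    have G: "((\<lambda>v. (norm (v - z))\<^sup>2) has_derivative (\<lambda>h. 2 * ((f y - z) \<bullet> h))) (at (f y))"
      unfolding power2_norm_eq_inner by (auto intro!: derivative_eq_intros simp: inner_commute)
    have b: "\<bar>2 * ((f y - z) \<bullet> (f y - z - nor y (f y - z)))\<bar> = 2 * (norm (f y - z - nor y (f y - z)))\<^sup>2"
      unfolding n(7) by simp
    obtain w where "w \<in> topspace X" "2 * c * \<bar>norm (nor w (f w - z)) - norm (nor y (f y - z))\<bar>
        < (norm (f w - z))\<^sup>2 - (norm (f y - z))\<^sup>2"
      by (rule ascent[where V = "\<lambda>y. f y - z" and l = 1 and z = z and m = "2 * c", OF y(1) _ G b _ _ c0 openin_topspace y(1)])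
        (use c in \<open>simp_all add: mult.assoc\<close>)
    moreover from this have "2 * c * (norm (nor w (f w - z)) - norm (nor y (f y - z)))
        \<le> 2 * c * \<bar>norm (nor w (f w - z)) - norm (nor y (f y - z))\<bar>" using c by (intro mult_left_mono) auto
    ultimately show False using y(2)[of w] by (simp add: right_diff_distrib)
  qed
  moreover have "nor x (f x - z) = 0" using nor_props(4)[OF x] t by blast
  ultimately show thesis using that[OF y(1)] y(2)[OF x] by simp
qed

text \<open>The near point of the same circle has \<open>d (d + 2c) = |f x - z|^2\<close>. The
  squared distance now enters the maximized function with a minus sign.\<close>

lemma sphere_inside:
  assumes x: "x \<in> topspace X" and t: "f x - z \<in> tangent x" and c: "0 < c" "c * \<kappa> < 1"
  obtains y where "y \<in> topspace X"
    "(norm (f y - z))\<^sup>2 + 2 * c * norm (f y - z) \<le> (norm (f x - z))\<^sup>2"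
proof -
  let ?g = "\<lambda>y. - (norm (f y - z))\<^sup>2 - 2 * c * norm (nor y (f y - z))"
  have "continuous_map X euclideanreal ?g"
    by (intro continuous_map_diff continuous_map_minus continuous_map_real_mult continuous_map_norm
        continuous_map_real_pow nor_continuous f_continuous) auto
  from attains_max[OF closedin_topspace _ this] obtain y where y: "y \<in> topspace X"
    "\<And>w. w \<in> topspace X \<Longrightarrow> ?g w \<le> ?g y" using x by blast
  note n = nor_props[OF y(1)]
  have "nor y (f y - z) = f y - z"
  proof (rule ccontr)
    assume c0: "nor y (f y - z) \<noteq> f y - z"
    have G: "((\<lambda>v. - (norm (v - z))\<^sup>2) has_derivative (\<lambda>h. - 2 * ((f y - z) \<bullet> h))) (at (f y))"
      unfolding power2_norm_eq_inner by (auto intro!: derivative_eq_intros simp: inner_commute)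
    have b: "\<bar>- 2 * ((f y - z) \<bullet> (f y - z - nor y (f y - z)))\<bar> = 2 * (norm (f y - z - nor y (f y - z)))\<^sup>2"
      unfolding n(7) by simp
    obtain w where "w \<in> topspace X" "2 * c * \<bar>norm (nor w (f w - z)) - norm (nor y (f y - z))\<bar>
        < - (norm (f w - z))\<^sup>2 - - (norm (f y - z))\<^sup>2"
      by (rule ascent[where V = "\<lambda>y. f y - z" and l = 1 and z = z and m = "2 * c", OF y(1) _ G b _ _ c0 openin_topspace y(1)])
        (use c in \<open>simp_all add: mult.assoc\<close>)
    moreover from this have "2 * c * (norm (nor w (f w - z)) - norm (nor y (f y - z)))
        \<le> 2 * c * \<bar>norm (nor w (f w - z)) - norm (nor y (f y - z))\<bar>" using c by (intro mult_left_mono) auto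
    ultimately show False using y(2)[of w] by (simp add: right_diff_distrib)
  qed
  moreover have "nor x (f x - z) = 0" using nor_props(4)[OF x] t by blast
  ultimately show thesis using that[OF y(1)] y(2)[OF x] by simp
qed

text \<open>The limit of spheres of infinite radius: a circle of radius \<open>c\<close> with
  tangent \<open>w\<close> at \<open>f x\<close> rises by exactly \<open>c\<close>. The field
  \<open>V\<close> is the constant \<open>w\<close>, hence \<open>l = 0\<close>.\<close>

lemma hyperplane_beyond:
  assumes x: "x \<in> topspace X" and t: "w \<in> tangent x" "norm w = 1" and c: "0 < c" "c * \<kappa> < 1"
  obtains y where "y \<in> topspace X" "c \<le> (f y - f x) \<bullet> w"
proof -
  let ?g = "\<lambda>y. f y \<bullet> w - c * norm (nor y w)"
  have "continuous_map X euclideanreal (\<lambda>y. f y \<bullet> w)"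
    using continuous_map_compose[OF f_continuous, of euclideanreal "\<lambda>v. v \<bullet> w"]
    by (simp add: o_def continuous_on_inner continuous_on_id)
  then have "continuous_map X euclideanreal ?g"
    by (intro continuous_map_diff continuous_map_real_mult continuous_map_norm nor_continuous) auto
  from attains_max[OF closedin_topspace _ this] obtain y where y: "y \<in> topspace X"
    "\<And>v. v \<in> topspace X \<Longrightarrow> ?g v \<le> ?g y" using x by blast
  note n = nor_props[OF y(1)]
  have "nor y w = w"
  proof (rule ccontr)
    assume c0: "nor y w \<noteq> w"
    have G: "((\<lambda>v. v \<bullet> w) has_derivative (\<lambda>h. h \<bullet> w)) (at (f y))"
      by (auto intro!: derivative_eq_intros)
    have b: "\<bar>(w - nor y w) \<bullet> w\<bar> = 1 * (norm (w - nor y w))\<^sup>2"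
      using n(7)[of w] by (simp add: inner_commute)
    obtain v where "v \<in> topspace X" "c * \<bar>norm (nor v w) - norm (nor y w)\<bar> < f v \<bullet> w - f y \<bullet> w"
      by (rule ascent[where V = "\<lambda>_. w" and l = 0 and z = "- w" and m = c, OF y(1) _ G b _ _ c0 openin_topspace y(1)])
        (use c in simp_all)
    moreover from this have "c * (norm (nor v w) - norm (nor y w))
        \<le> c * \<bar>norm (nor v w) - norm (nor y w)\<bar>" using c by (intro mult_left_mono) auto
    ultimately show False using y(2)[of v] by (simp add: right_diff_distrib)
  qed
  moreover have "nor x w = 0" using nor_props(4)[OF x] t by blast
  ultimately show thesis using that[OF y(1)] y(2)[OF x] t(2) by (simp add: inner_diff_left)
qed

text \<open>If \<open>K\<close> is isolated within the sublevel set at \<open>t\<close>, it stays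
  isolated up to a higher level \<open>t'\<close>: normality separates \<open>K\<close> from the
  rest, and \<open>g\<close> attains a minimum above \<open>t\<close> on the closed set left
  uncovered by the two neighbourhoods. All arguments by continuity in a radius use this.\<close>

lemma separate_sublevel:
  assumes B: "closedin X B" and g: "continuous_map X euclideanreal g"
    and K: "closedin X K" "K \<subseteq> B" "\<And>y. y \<in> K \<Longrightarrow> g y \<le> t"
    and O': "openin X O'" "K \<subseteq> O'" "\<And>y. y \<in> O' \<Longrightarrow> y \<in> B \<Longrightarrow> g y \<le> t \<Longrightarrow> y \<in> K"
  obtains W W' t' where "openin X W" "openin X W'" "W \<inter> W' = {}" "K \<subseteq> W" "W \<subseteq> O'" "t < t'"
    "\<And>y. y \<in> B \<Longrightarrow> g y \<le> t \<Longrightarrow> y \<notin> K \<Longrightarrow> y \<in> W'"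
    "\<And>y. y \<in> B \<Longrightarrow> g y < t' \<Longrightarrow> y \<in> W \<union> W'"
proof -
  let ?L = "B \<inter> {y \<in> topspace X. g y \<le> t} - O'"
  have "closedin X {y \<in> topspace X. g y \<le> t}" using closed_le[OF g, of "\<lambda>_. t"] by simp
  then have L: "closedin X ?L" using B O'(1) by (intro closedin_diff closedin_Int)
  have "normal_space X" using compact Hausdorff compact_Hausdorff_or_regular_imp_normal_space by blast
  moreover have "disjnt K ?L" using O'(2) unfolding disjnt_def by blast
  ultimately have "\<exists>U V. openin X U \<and> openin X V \<and> K \<subseteq> U \<and> ?L \<subseteq> V \<and> disjnt U V"
    unfolding normal_space_def using K(1) L by (metis (lifting))
  then obtain W W' where W: "openin X W" "openin X W'" "K \<subseteq> W" "?L \<subseteq> W'" "disjnt W W'"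
    by blast
  let ?W = "W \<inter> O'" and ?R = "B - (W \<inter> O' \<union> W')"
  have R: "closedin X ?R" using W O'(1) B by (intro closedin_diff openin_Un openin_Int)
  have Bt: "B \<subseteq> topspace X" using closedin_subset[OF B] .
  have in_W': "y \<in> W'" if "y \<in> B" "g y \<le> t" "y \<notin> K" for y
    using that W(4) O'(3) Bt by blast
  have Rt: "t < g y" if "y \<in> ?R" for y
  proof (rule ccontr)
    assume "\<not> t < g y"
    then have "y \<in> K" using in_W' that by force
    then show False using that W(3) O'(2) by blast
  qed
  obtain t' where t': "t < t'" "\<And>y. y \<in> ?R \<Longrightarrow> t' \<le> g y"
  proof (cases "?R = {}")
    case True
    then show thesis using that[of "t + 1"] by auto
  next
    case False
    have "continuous_map X euclideanreal (\<lambda>y. - g y)" using g by (intro continuous_map_minus)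
    then obtain y where "y \<in> ?R" "\<And>w. w \<in> ?R \<Longrightarrow> - g w \<le> - g y"
      using attains_max[OF R False] by blast
    then show thesis using that[of "g y"] Rt by simp
  qed
  show thesis
  proof (rule that[of ?W W' t'])
    show "openin X ?W" "openin X W'" using W O'(1) by auto
    show "?W \<inter> W' = {}" using W(5) by (auto simp: disjnt_def)
    show "K \<subseteq> ?W" "?W \<subseteq> O'" using W(3) O'(2) by auto
    show "y \<in> ?W \<union> W'" if "y \<in> B" "g y < t'" for y using t'(2)[of y] that by fastforce
  qed (use t' in_W' in auto)
qed

subsection \<open>Sheets\<close>

definition sheet :: "'a \<Rightarrow> real \<Rightarrow> 'a set" where
  "sheet p t = {y. joined X {w. norm (f w - f p) < t} p y}"

text \<open>The centre is inserted because of radius 0, where the sheet is empty but the continuity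
  argument has to start from \<open>p\<close>.\<close>

definition csheet :: "'a \<Rightarrow> real \<Rightarrow> 'a set" where
  "csheet p t = insert p (X closure_of sheet p t)"

text \<open>The inequality results from expanding \<open>|f p - (f y + c \<nu>)|^2 > c^2\<close> for
  all unit normals \<open>\<nu>\<close> at \<open>y\<close>: no ball of radius \<open>c\<close>
  touching the manifold at \<open>f y\<close> contains \<open>f p\<close>.\<close>

definition good :: "real \<Rightarrow> 'a \<Rightarrow> 'a set" where
  "good c p = {y \<in> topspace X. y = p \<or> 2 * c * norm (nor y (f y - f p)) < (norm (f y - f p))\<^sup>2}"

lemma open_dist_less: "openin X {y \<in> topspace X. norm (f y - z) < t}"
  using open_less[OF distance_continuous, of "\<lambda>_. t"] by simp

lemma sheetD: "y \<in> sheet p t \<Longrightarrow> y \<in> topspace X \<and> norm (f y - f p) < t"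
  unfolding sheet_def using joined_in by fastforce

lemma sheet_mono: "t \<le> t' \<Longrightarrow> sheet p t \<subseteq> sheet p t'"
  unfolding sheet_def using joined_mono[of X "{w. norm (f w - f p) < t}" p _ "{w. norm (f w - f p) < t'}"] by force

lemma mem_sheet_self: "p \<in> topspace X \<Longrightarrow> 0 < t \<Longrightarrow> p \<in> sheet p t"
  unfolding sheet_def using joined_refl[of p _ X] by simp

lemma sheetE:
  assumes "y \<in> sheet p t"
  obtains C where "compactin X C" "connectedin X C" "C \<subseteq> topspace X" "\<And>w. w \<in> C \<Longrightarrow> norm (f w - f p) < t"
    "p \<in> C" "y \<in> C"
proof -
  have "joined X {w. norm (f w - f p) < t} p y" using assms by (simp add: sheet_def)
  then obtain C where "compactin X C" "connectedin X C" "C \<subseteq> {w. norm (f w - f p) < t}" "p \<in> C" "y \<in> C"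
    by (rule joinedE)
  then show thesis using that[of C] connectedin_subset_topspace[of X C] by fast
qed

lemma sheet_extend:
  assumes "y \<in> sheet p t" "joined X S y z" "\<And>w. w \<in> S \<Longrightarrow> w \<in> topspace X \<Longrightarrow> norm (f w - f p) < t"
  shows "z \<in> sheet p t"
proof -
  obtain C where C: "compactin X C" "connectedin X C" "C \<subseteq> S" "y \<in> C" "z \<in> C" using assms(2) by (rule joinedE)
  have "C \<subseteq> {w. norm (f w - f p) < t}" using C(3) assms(3) connectedin_subset_topspace[OF C(2)] by blast
  then have "joined X {w. norm (f w - f p) < t} y z" using C by (blast intro: joinedI)
  then show ?thesis using assms(1) joined_trans unfolding sheet_def by fastforce
qed

lemma near_sheet:
  assumes "y \<in> topspace X" "norm (f y - f p) < t"
  obtains U where "openin X U" "y \<in> U" "\<And>a b. a \<in> U \<Longrightarrow> b \<in> U \<Longrightarrow> a \<in> sheet p t \<Longrightarrow> b \<in> sheet p t"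
proof (rule locally_joined[OF open_dist_less])
  show "y \<in> {y \<in> topspace X. norm (f y - f p) < t}" using assms by simp
  fix U assume U: "openin X U" "y \<in> U"
    "\<And>a b. a \<in> U \<Longrightarrow> b \<in> U \<Longrightarrow> joined X {y \<in> topspace X. norm (f y - f p) < t} a b"
  have "b \<in> sheet p t" if "a \<in> U" "b \<in> U" "a \<in> sheet p t" for a b
    by (rule sheet_extend[OF that(3) U(3)[OF that(1,2)]]) simp
  then show thesis using that U(1,2) by blast
qed

lemma openin_sheet: "openin X (sheet p t)"
proof (subst openin_subopen, intro ballI)
  fix y assume y: "y \<in> sheet p t"
  obtain U where "openin X U" "y \<in> U" "\<And>a b. a \<in> U \<Longrightarrow> b \<in> U \<Longrightarrow> a \<in> sheet p t \<Longrightarrow> b \<in> sheet p t"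
    by (rule near_sheet[OF conjunct1[OF sheetD[OF y]] conjunct2[OF sheetD[OF y]]]) (rule that)
  then show "\<exists>T. openin X T \<and> y \<in> T \<and> T \<subseteq> sheet p t" using y by blast
qed

lemma closure_meets: "y \<in> X closure_of S \<Longrightarrow> openin X U \<Longrightarrow> y \<in> U \<Longrightarrow> \<exists>a. a \<in> U \<and> a \<in> S"
  unfolding in_closure_of by blast

lemma closure_sheet:
  assumes y: "y \<in> X closure_of sheet p t"
  shows "norm (f y - f p) \<le> t" "norm (f y - f p) < t \<Longrightarrow> y \<in> sheet p t"
proof -
  have "closedin X {w \<in> topspace X. norm (f w - f p) \<le> t}"
    using closed_le[OF distance_continuous, of "\<lambda>_. t"] by simp
  moreover have "sheet p t \<subseteq> {w \<in> topspace X. norm (f w - f p) \<le> t}" using sheetD by fastforce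
  ultimately show "norm (f y - f p) \<le> t" using closure_of_minimal y by blast
  assume 1: "norm (f y - f p) < t"
  have 2: "y \<in> topspace X" using y closure_of_subset_topspace by fast
  obtain U where U: "openin X U" "y \<in> U"
    "\<And>a b. a \<in> U \<Longrightarrow> b \<in> U \<Longrightarrow> a \<in> sheet p t \<Longrightarrow> b \<in> sheet p t"
    by (rule near_sheet[OF 2 1]) (rule that)
  then obtain a where "a \<in> U" "a \<in> sheet p t" using closure_meets[OF y U(1,2)] by blast
  then show "y \<in> sheet p t" using U by blast
qed

text \<open>The compact set joining \<open>p\<close> to \<open>y\<close> has a largest distance from
  \<open>f p\<close>, and it is less than \<open>t\<close>.\<close>

lemma sheet_shrink:
  assumes "y \<in> sheet p t"
  obtains t' where "t' < t" "y \<in> sheet p t'"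
proof -
  obtain C where C: "compactin X C" "connectedin X C" "C \<subseteq> topspace X"
    "\<And>w. w \<in> C \<Longrightarrow> norm (f w - f p) < t" "p \<in> C" "y \<in> C"
    by (rule sheetE[OF assms]) (rule that)
  have "closedin X C" using compactin_imp_closedin[OF Hausdorff C(1)] .
  then obtain w where w: "w \<in> C" "\<And>v. v \<in> C \<Longrightarrow> norm (f v - f p) \<le> norm (f w - f p)"
    using attains_max[OF _ _ distance_continuous, of C "f p"] C(5) by blast
  obtain t' where t': "norm (f w - f p) < t'" "t' < t" using dense[OF C(4)[OF w(1)]] by blast
  have "C \<subseteq> {w. norm (f w - f p) < t'}" using w(2) t'(1) by fastforce
  then have "y \<in> sheet p t'" unfolding sheet_def using C by (auto intro: joinedI)
  then show thesis using that t'(2) by blast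
qed

lemma openin_good:
  assumes c: "0 < c" "c * \<kappa> < 1" and p: "p \<in> topspace X"
  shows "openin X (good c p)"
proof -
  obtain U where U: "openin X U" "p \<in> U"
    "\<And>y. y \<in> U \<Longrightarrow> y \<noteq> p \<Longrightarrow> 2 * c * norm (nor y (f y - f p)) < (norm (f y - f p))\<^sup>2"
    by (rule near_diagonal[OF p c]) (rule that)
  have "openin X {y \<in> topspace X. 2 * c * norm (nor y (f y - f p)) < (norm (f y - f p))\<^sup>2}"
    by (intro open_less continuous_map_real_mult continuous_map_norm
        continuous_map_real_pow nor_continuous distance_continuous continuous_map_diff f_continuous) auto
  then have "openin X ({y \<in> topspace X. 2 * c * norm (nor y (f y - f p)) < (norm (f y - f p))\<^sup>2} \<union> U)"
    using U(1) by blast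
  also have "{y \<in> topspace X. 2 * c * norm (nor y (f y - f p)) < (norm (f y - f p))\<^sup>2} \<union> U = good c p"
    using U openin_subset[OF U(1)] unfolding good_def by blast
  finally show ?thesis .
qed

text \<open>A normal radius vector would turn the inequality of \<open>good\<close> into a distance
  above \<open>2 * c\<close>. So the distance from \<open>f p\<close> has no critical point on a
  good set within this radius, except at \<open>p\<close>.\<close>

lemma good_tangential:
  assumes c: "0 < c" and y: "y \<in> good c p" "y \<noteq> p" "norm (f y - f p) \<le> 2 * c"
  shows "f y - f p \<notin> {v. nor y v = v}"
proof
  assume "f y - f p \<in> {v. nor y v = v}"
  then have "2 * c * norm (f y - f p) < (norm (f y - f p))\<^sup>2" using y by (simp add: good_def)
  moreover have "(norm (f y - f p))\<^sup>2 \<le> 2 * c * norm (f y - f p)"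
    unfolding power2_eq_square by (rule mult_right_mono[OF y(3)]) simp
  ultimately show False by simp
qed

lemma sheet_within:
  assumes "openin X W" "openin X W'" "W \<inter> W' = {}" "p \<in> W"
    and cover: "\<And>y. y \<in> topspace X \<Longrightarrow> norm (f y - f p) < t \<Longrightarrow> y \<in> W \<union> W'"
  shows "sheet p t \<subseteq> W"
proof
  fix y assume "y \<in> sheet p t"
  then obtain C where C: "compactin X C" "connectedin X C" "C \<subseteq> topspace X"
    "\<And>w. w \<in> C \<Longrightarrow> norm (f w - f p) < t" "p \<in> C" "y \<in> C"
    by (rule sheetE) (rule that)
  have "C \<subseteq> W \<union> W'" using C(3,4) cover by blast
  moreover have "W \<inter> W' \<inter> C = {}" using assms(3) by simp
  ultimately have "C \<subseteq> W" by (rule connectedin_cover_cases[OF C(2) assms(1,2) _ _ C(5) assms(4)])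
  then show "y \<in> W" using C(6) by blast
qed

text \<open>On the bounding sphere the inequality survives weakly by passage to the closure.
  Together with \<open>t < 2 * c\<close> it prevents the radius vector from being normal, so by
  \<open>descent\<close> the sheet is locally the whole sublevel set. Only then is strictness
  shown.\<close>

lemma csheet_step:
  assumes c: "0 < c" "c * \<kappa> < 1" and p: "p \<in> topspace X" and t: "0 \<le> t" "t < 2 * c"
    and IH: "\<And>t'. t' < t \<Longrightarrow> sheet p t' \<subseteq> good c p" and y: "y \<in> csheet p t"
  shows "y \<in> good c p" "\<exists>U. openin X U \<and> y \<in> U \<and> (\<forall>w\<in>U. norm (f w - f p) \<le> t \<longrightarrow> w \<in> csheet p t)"
proof -
  have "y \<in> good c p \<and> (\<exists>U. openin X U \<and> y \<in> U \<and> (\<forall>w\<in>U. norm (f w - f p) \<le> t \<longrightarrow> w \<in> csheet p t))"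
  proof (cases "y \<in> sheet p t")
    case True
    moreover have "sheet p t \<subseteq> csheet p t" unfolding csheet_def
      using closure_of_subset[of "sheet p t" X] openin_subset[OF openin_sheet] by blast
    moreover have "y \<in> good c p" using True IH sheet_shrink by blast
    ultimately show ?thesis using openin_sheet by blast
  next
    case nsheet: False
    show ?thesis
    proof (cases "y = p")
      case True
      \<comment> \<open>Only for radius 0 does the centre fail to lie on its sheet; near
        \<open>p\<close> no other point is then mapped to \<open>f p\<close>.\<close>
      have t0: "t = 0" using nsheet mem_sheet_self[OF p, of t] t(1) True by (cases "t > 0") auto
      obtain U where U: "openin X U" "p \<in> U"
        "\<And>y. y \<in> U \<Longrightarrow> y \<noteq> p \<Longrightarrow> 2 * c * norm (nor y (f y - f p)) < (norm (f y - f p))\<^sup>2"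
        by (rule near_diagonal[OF p c]) (rule that)
      have "w = p" if "w \<in> U" "norm (f w - f p) \<le> t" for w
      proof (rule ccontr)
        assume "w \<noteq> p"
        then have "2 * c * norm (nor w (f w - f p)) < 0" using U(3)[of w] that t0 by simp
        then show False using c(1) by (simp add: mult_less_0_iff)
      qed
      then have "\<forall>w\<in>U. norm (f w - f p) \<le> t \<longrightarrow> w \<in> csheet p t" by (simp add: csheet_def)
      moreover have "y \<in> good c p" using True p by (simp add: good_def)
      ultimately show ?thesis using U(1,2) True by blast
    next
      case yp: False
      then have ycl: "y \<in> X closure_of sheet p t" using y by (simp add: csheet_def)
      then have yX: "y \<in> topspace X" using closure_of_subset_topspace by fast
      have yt: "norm (f y - f p) = t" using closure_sheet[OF ycl] nsheet by fastforce
      have ty: "2 * c * norm (nor y (f y - f p)) \<le> (norm (f y - f p))\<^sup>2"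
      proof -
        have "closedin X {y \<in> topspace X. 2 * c * norm (nor y (f y - f p)) \<le> (norm (f y - f p))\<^sup>2}"
          by (intro closed_le continuous_map_real_mult continuous_map_norm
              continuous_map_real_pow nor_continuous distance_continuous continuous_map_diff f_continuous) auto
        moreover have "sheet p t \<subseteq> {y \<in> topspace X. 2 * c * norm (nor y (f y - f p)) \<le> (norm (f y - f p))\<^sup>2}"
        proof
          fix w assume w: "w \<in> sheet p t"
          then have "w \<in> good c p" using IH sheet_shrink by blast
          then show "w \<in> {y \<in> topspace X. 2 * c * norm (nor y (f y - f p)) \<le> (norm (f y - f p))\<^sup>2}"
            using linear_0[OF nor_props(1)[OF p]] unfolding good_def by auto
        qed
        ultimately show ?thesis using closure_of_minimal ycl by blast
      qed
      obtain b where "b \<in> sheet p t" using closure_meets[OF ycl openin_topspace yX] by blast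
      then have "norm (f b - f p) < t" using sheetD by blast
      then have "t \<noteq> 0" by (metis norm_ge_zero not_less)
      then have tpos: "t > 0" using t(1) by simp
      have tan: "f y - f p \<notin> {v. nor y v = v}"
      proof
        assume "f y - f p \<in> {v. nor y v = v}"
        then have "2 * c * t \<le> t * t" using ty yt by (simp add: power2_eq_square)
        then show False using tpos t(2) by simp
      qed
      obtain U where U: "openin X U" "y \<in> U" "U \<subseteq> topspace X"
        "\<And>a b. a \<in> U \<Longrightarrow> b \<in> U \<Longrightarrow> 1 * (norm (f a - f p))\<^sup>2 < 1 * (norm (f y - f p))\<^sup>2 \<Longrightarrow>
          1 * (norm (f b - f p))\<^sup>2 < 1 * (norm (f y - f p))\<^sup>2 \<Longrightarrow>
          joined X (topspace X \<inter> {w. 1 * (norm (f w - f p))\<^sup>2 < 1 * (norm (f y - f p))\<^sup>2}) a b"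
        "\<And>a W. a \<in> U \<Longrightarrow> 1 * (norm (f a - f p))\<^sup>2 \<le> 1 * (norm (f y - f p))\<^sup>2 \<Longrightarrow> openin X W \<Longrightarrow> a \<in> W \<Longrightarrow>
          \<exists>w\<in>W. 1 * (norm (f w - f p))\<^sup>2 < 1 * (norm (f y - f p))\<^sup>2"
        by (rule descent[OF openin_topspace yX _ tan, of 1]) (simp, rule that)
      have lt: "1 * (norm (f a - f p))\<^sup>2 < 1 * (norm (f y - f p))\<^sup>2 \<longleftrightarrow> norm (f a - f p) < t"
        and le: "1 * (norm (f a - f p))\<^sup>2 \<le> 1 * (norm (f y - f p))\<^sup>2 \<longleftrightarrow> norm (f a - f p) \<le> t" for a
        unfolding yt mult_1 using t(1) by (simp_all only: not_le[symmetric] power_mono_iff norm_ge_zero zero_less_numeral)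
      obtain a where a: "a \<in> U" "a \<in> sheet p t" using closure_meets[OF ycl U(1,2)] by blast
      have Us: "b \<in> sheet p t" if "b \<in> U" "norm (f b - f p) < t" for b
        by (rule sheet_extend[OF a(2) U(4)[OF a(1) that(1)]]) (use that a(2) sheetD lt in auto)
      have "w \<in> csheet p t" if w: "w \<in> U" "norm (f w - f p) \<le> t" for w
      proof -
        have "\<exists>v. v \<in> sheet p t \<and> v \<in> T" if T: "w \<in> T" "openin X T" for T
        proof -
          have "openin X (T \<inter> U)" "w \<in> T \<inter> U" using T U(1) w by auto
          from U(5)[OF w(1) _ this] w(2) obtain v where "v \<in> T \<inter> U" "norm (f v - f p) < t"
            unfolding lt le by blast
          then show ?thesis using Us by blast
        qed
        then have "w \<in> X closure_of sheet p t" using w(1) U(3) by (auto simp only: in_closure_of)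
        then show ?thesis by (simp add: csheet_def)
      qed
      \<comment> \<open>With equality at \<open>y\<close>, moving towards \<open>f p\<close> lowers
        the squared distance faster than it changes \<open>2c |nor|\<close>. This yields a point of
        the sheet that violates the inequality known for smaller radii.\<close>
      moreover have "y \<in> good c p"
      proof (rule ccontr)
        assume "y \<notin> good c p"
        then have eq: "2 * c * norm (nor y (f y - f p)) = (norm (f y - f p))\<^sup>2"
          using ty yX unfolding good_def by force
        have G: "((\<lambda>v. - (norm (v - f p))\<^sup>2) has_derivative (\<lambda>h. - 2 * ((f y - f p) \<bullet> h))) (at (f y))"
          unfolding power2_norm_eq_inner by (auto intro!: derivative_eq_intros simp: inner_commute)
        have b: "\<bar>- 2 * ((f y - f p) \<bullet> (f y - f p - nor y (f y - f p)))\<bar> = 2 * (norm (f y - f p - nor y (f y - f p)))\<^sup>2"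
          unfolding nor_props(7)[OF yX] by simp
        have c0: "nor y (f y - f p) \<noteq> f y - f p" using tan by blast
        obtain w where w: "w \<in> U" "2 * c * \<bar>norm (nor w (f w - f p)) - norm (nor y (f y - f p))\<bar>
            < - (norm (f w - f p))\<^sup>2 - - (norm (f y - f p))\<^sup>2"
          by (rule ascent[where V = "\<lambda>y. f y - f p" and l = 1 and z = "f p" and m = "2 * c", OF yX _ G b _ _ c0 U(1,2)])
            (use c in \<open>simp_all add: mult.assoc\<close>)
        have "2 * c * (norm (nor y (f y - f p)) - norm (nor w (f w - f p)))
            \<le> 2 * c * \<bar>norm (nor w (f w - f p)) - norm (nor y (f y - f p))\<bar>" using c by (intro mult_left_mono) auto
        then have less: "(norm (f w - f p))\<^sup>2 < 2 * c * norm (nor w (f w - f p))"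
          using w(2) eq by (simp add: right_diff_distrib)
        have "0 \<le> 2 * c * \<bar>norm (nor w (f w - f p)) - norm (nor y (f y - f p))\<bar>" using c by simp
        then have "norm (f w - f p) < t" using w(2) lt[of w] by simp
        then have "w \<in> sheet p t" using Us w(1) by blast
        then have "w \<in> good c p" using IH sheet_shrink by blast
        then show False using less linear_0[OF nor_props(1)[OF p]] unfolding good_def by auto
      qed
      ultimately show ?thesis using U by blast
    qed
  qed
  then show "y \<in> good c p" "\<exists>U. openin X U \<and> y \<in> U \<and> (\<forall>w\<in>U. norm (f w - f p) \<le> t \<longrightarrow> w \<in> csheet p t)" by auto
qed

lemma sheet_subset_csheet: "sheet p t \<subseteq> csheet p t"
  unfolding csheet_def using closure_of_subset[of "sheet p t" X] openin_subset[OF openin_sheet] by blast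

lemma closedin_csheet: "p \<in> topspace X \<Longrightarrow> closedin X (csheet p t)"
  unfolding csheet_def using Hausdorff
  by (metis closedin_Hausdorff_singleton closedin_Un closedin_closure_of insert_is_Un)

lemma csheetD:
  assumes p: "p \<in> topspace X" and t: "0 \<le> t" and y: "y \<in> csheet p t"
  shows "y \<in> topspace X" "norm (f y - f p) \<le> t" "0 < t \<Longrightarrow> norm (f y - f p) < t \<Longrightarrow> y \<in> sheet p t"
proof -
  show "y \<in> topspace X" using closedin_subset[OF closedin_csheet[OF p]] y by blast
  show "norm (f y - f p) \<le> t" using y closure_sheet(1)[of y p t] t unfolding csheet_def by auto
  show "y \<in> sheet p t" if "0 < t" "norm (f y - f p) < t"
    using y closure_sheet(2)[of y p t] mem_sheet_self[OF p] that unfolding csheet_def by auto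
qed

lemma csheet_collar:
  assumes c: "0 < c" "c * \<kappa> < 1" and p: "p \<in> topspace X" and t: "0 \<le> t" "t < 2 * c"
    and IH: "\<And>t'. t' < t \<Longrightarrow> sheet p t' \<subseteq> good c p"
  obtains O' where "openin X O'" "csheet p t \<subseteq> O'" "O' \<subseteq> good c p"
    "\<And>w. w \<in> O' \<Longrightarrow> norm (f w - f p) \<le> t \<Longrightarrow> w \<in> csheet p t"
proof -
  note st = csheet_step[OF c p t IH]
  let ?O = "\<Union>{U. openin X U \<and> (\<forall>w\<in>U. norm (f w - f p) \<le> t \<longrightarrow> w \<in> csheet p t)} \<inter> good c p"
  show thesis
  proof (rule that[of ?O])
    show "openin X ?O" using openin_good[OF c p] by (intro openin_Int openin_Union) auto
    show "csheet p t \<subseteq> ?O"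
    proof
      fix y assume "y \<in> csheet p t"
      from st[OF _ this] show "y \<in> ?O" by blast
    qed
  qed auto
qed

text \<open>Continuity in the radius: the closure of a good sheet stays good, and nothing else can join it at once.\<close>

lemma sheet_good:
  assumes c: "0 < c" "c * \<kappa> < 1" and p: "p \<in> topspace X" and t: "t < 2 * c"
  shows "sheet p t \<subseteq> good c p"
proof (rule ccontr)
  assume bad: "\<not> sheet p t \<subseteq> good c p"
  define N where "N = {t. \<not> sheet p t \<subseteq> good c p}"
  define T where "T = Inf N"
  have N0: "0 \<le> t'" if t': "t' \<in> N" for t'
  proof -
    obtain y where "y \<in> sheet p t'" using t' unfolding N_def by blast
    then have "norm (f y - f p) < t'" using sheetD by blast
    then show ?thesis using norm_ge_zero[of "f y - f p"] by linarith
  qed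
  then have bdd: "bdd_below N" by (rule bdd_belowI[of N 0])
  have tN: "t \<in> N" using bad by (simp add: N_def)
  have "T \<le> t" unfolding T_def by (rule cInf_lower[OF tN bdd])
  then have T: "0 \<le> T" "T < 2 * c" using t tN N0 unfolding T_def by (auto intro: cInf_greatest)
  have IH: "sheet p t' \<subseteq> good c p" if "t' < T" for t'
  proof (rule ccontr)
    assume "\<not> sheet p t' \<subseteq> good c p"
    then have "T \<le> t'" unfolding T_def N_def by (intro cInf_lower) (use bdd N_def in auto)
    then show False using that by simp
  qed
  obtain O' where O': "openin X O'" "csheet p T \<subseteq> O'" "O' \<subseteq> good c p"
    "\<And>w. w \<in> O' \<Longrightarrow> norm (f w - f p) \<le> T \<Longrightarrow> w \<in> csheet p T"
    by (rule csheet_collar[OF c p T IH]) (assumption, rule that)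
  obtain W W' t' where W: "openin X W" "openin X W'" "W \<inter> W' = {}" "csheet p T \<subseteq> W" "W \<subseteq> O'" "T < t'"
    "\<And>y. y \<in> topspace X \<Longrightarrow> norm (f y - f p) \<le> T \<Longrightarrow> y \<notin> csheet p T \<Longrightarrow> y \<in> W'"
    "\<And>y. y \<in> topspace X \<Longrightarrow> norm (f y - f p) < t' \<Longrightarrow> y \<in> W \<union> W'"
    by (rule separate_sublevel[OF closedin_topspace distance_continuous closedin_csheet[OF p]
          closedin_subset[OF closedin_csheet[OF p]] csheetD(2)[OF p T(1)] O'(1,2) O'(4)]) (assumption+, rule that)
  have "p \<in> W" using W(4) by (auto simp: csheet_def)
  then have sub: "sheet p t' \<subseteq> good c p" using sheet_within[OF W(1,2,3) _ W(8)] W(5) O'(3) by blast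
  have "t' \<le> v" if "v \<in> N" for v
  proof (rule ccontr)
    assume "\<not> t' \<le> v"
    then have "sheet p v \<subseteq> sheet p t'" by (intro sheet_mono) simp
    then show False using that sub unfolding N_def by blast
  qed
  then have "t' \<le> T" unfolding T_def using tN by (intro cInf_greatest) auto
  then show False using W(6) by simp
qed

end

section \<open>Sheets with moving centre, rings, coverings by two sheets\<close>

context closed_immersed begin

lemma csheet_open:
  assumes "0 < c" "c * \<kappa> < 1" "p \<in> topspace X" "0 \<le> t" "t < 2 * c"
  obtains O' where "openin X O'" "csheet p t \<subseteq> O'" "O' \<subseteq> good c p"
    "\<And>w. w \<in> O' \<Longrightarrow> norm (f w - f p) \<le> t \<Longrightarrow> w \<in> csheet p t"
proof (rule csheet_collar[OF assms])
  fix t' :: real assume "t' < t"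
  then show "sheet p t' \<subseteq> good c p" using sheet_good[OF assms(1-3), of t'] assms(5) by simp
qed (rule that)

lemma sheet_separate:
  assumes c: "0 < c" "c * \<kappa> < 1" and p: "p \<in> topspace X" and t: "0 < t" "t < 2 * c"
  obtains W W' t' where "openin X W" "openin X W'" "W \<inter> W' = {}" "p \<in> W" "t < t'"
    "\<And>y. y \<in> topspace X \<Longrightarrow> norm (f y - f p) < t \<Longrightarrow> y \<notin> sheet p t \<Longrightarrow> y \<in> W'"
    "\<And>y. y \<in> topspace X \<Longrightarrow> norm (f y - f p) < t' \<Longrightarrow> y \<in> W \<union> W'"
proof -
  have t0: "0 \<le> t" using t by simp
  obtain O' where O': "openin X O'" "csheet p t \<subseteq> O'" "O' \<subseteq> good c p"
    "\<And>w. w \<in> O' \<Longrightarrow> norm (f w - f p) \<le> t \<Longrightarrow> w \<in> csheet p t"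
    by (rule csheet_open[OF c p t0 t(2)]) (rule that)
  obtain W W' t' where W: "openin X W" "openin X W'" "W \<inter> W' = {}" "csheet p t \<subseteq> W" "W \<subseteq> O'" "t < t'"
    "\<And>y. y \<in> topspace X \<Longrightarrow> norm (f y - f p) \<le> t \<Longrightarrow> y \<notin> csheet p t \<Longrightarrow> y \<in> W'"
    "\<And>y. y \<in> topspace X \<Longrightarrow> norm (f y - f p) < t' \<Longrightarrow> y \<in> W \<union> W'"
    by (rule separate_sublevel[OF closedin_topspace distance_continuous closedin_csheet[OF p]
          closedin_subset[OF closedin_csheet[OF p]] csheetD(2)[OF p t0] O'(1,2) O'(4)]) (assumption+, rule that)
  show thesis
  proof (rule that[OF W(1-3) _ W(6) _ W(8)])
    show "p \<in> W" using W(4) by (auto simp: csheet_def)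
    show "y \<in> W'" if "y \<in> topspace X" "norm (f y - f p) < t" "y \<notin> sheet p t" for y
      using W(7)[of y] csheetD(3)[OF p t0, of y] that t(1) by (metis less_imp_le)
  qed
qed

lemma sheet_centre_open:
  assumes y: "y \<in> sheet k s"
  obtains U where "openin X U" "k \<in> U" "\<And>k'. k' \<in> U \<Longrightarrow> y \<in> sheet k' s"
proof -
  obtain C where C: "compactin X C" "connectedin X C" "C \<subseteq> topspace X"
    "\<And>w. w \<in> C \<Longrightarrow> norm (f w - f k) < s" "k \<in> C" "y \<in> C"
    by (rule sheetE[OF y]) (rule that)
  have k: "k \<in> topspace X" using C by blast
  have "closedin X C" using compactin_imp_closedin[OF Hausdorff C(1)] .
  then obtain w where w: "w \<in> C" "\<And>v. v \<in> C \<Longrightarrow> norm (f v - f k) \<le> norm (f w - f k)"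
    using attains_max[OF _ _ distance_continuous, of C "f k"] C(5) by blast
  define d where "d = s - norm (f w - f k)"
  have d: "d > 0" "d \<le> s" using C(4)[OF w(1)] by (auto simp: d_def)
  show thesis
  proof (rule locally_joined[OF open_dist_less])
    show "k \<in> {v \<in> topspace X. norm (f v - f k) < d / 2}" using k d by simp
    fix U assume U: "openin X U" "k \<in> U" "U \<subseteq> {v \<in> topspace X. norm (f v - f k) < d / 2}"
      "\<And>a b. a \<in> U \<Longrightarrow> b \<in> U \<Longrightarrow> joined X {v \<in> topspace X. norm (f v - f k) < d / 2} a b"
    have "y \<in> sheet k' s" if k': "k' \<in> U" for k'
    proof -
      have kk: "norm (f k' - f k) < d / 2" using U(3) k' by blast
      have "{v \<in> topspace X. norm (f v - f k) < d / 2} \<subseteq> {v. norm (f v - f k') < s}"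
      proof
        fix v assume "v \<in> {v \<in> topspace X. norm (f v - f k) < d / 2}"
        then show "v \<in> {v. norm (f v - f k') < s}"
          using kk d norm_triangle_ineq4[of "f v - f k" "f k' - f k"] by simp
      qed
      then have 1: "joined X {v. norm (f v - f k') < s} k' k" using joined_mono[OF U(4)[OF k' U(2)]] by blast
      have "C \<subseteq> {v. norm (f v - f k') < s}"
      proof
        fix v assume "v \<in> C"
        then show "v \<in> {v. norm (f v - f k') < s}"
          using kk w(2)[of v] d norm_triangle_ineq4[of "f v - f k" "f k' - f k"] by (simp add: d_def)
      qed
      then have 2: "joined X {v. norm (f v - f k') < s} k y" using C by (blast intro: joinedI)
      show ?thesis unfolding sheet_def using joined_trans[OF 1 2] by simp
    qed
    then show thesis using that U(1,2) by blast
  qed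
qed

text \<open>The gap between \<open>s\<close> and \<open>t'\<close> in \<open>sheet_separate\<close>
  absorbs the shift of the centre: the ball of radius \<open>s\<close> around \<open>f k'\<close>
  lies in the ball of radius \<open>t'\<close> around \<open>f k\<close>, where the two parts are
  still separated.\<close>

lemma sheet_centre_closed:
  assumes c: "0 < c" "c * \<kappa> < 1" and s: "s < 2 * c"
    and k: "k \<in> topspace X" and y: "y \<in> topspace X" "norm (f k - f y) < s" "y \<notin> sheet k s"
  obtains U where "openin X U" "k \<in> U" "\<And>k'. k' \<in> U \<Longrightarrow> y \<notin> sheet k' s"
proof -
  have s0: "0 < s" using y(2) norm_ge_zero[of "f k - f y"] by linarith
  obtain W W' t' where W: "openin X W" "openin X W'" "W \<inter> W' = {}" "k \<in> W" "s < t'"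
    "\<And>y. y \<in> topspace X \<Longrightarrow> norm (f y - f k) < s \<Longrightarrow> y \<notin> sheet k s \<Longrightarrow> y \<in> W'"
    "\<And>y. y \<in> topspace X \<Longrightarrow> norm (f y - f k) < t' \<Longrightarrow> y \<in> W \<union> W'"
    by (rule sheet_separate[OF c k s0 s]) (rule that)
  let ?U = "W \<inter> {v \<in> topspace X. norm (f v - f k) < t' - s}"
  show thesis
  proof (rule that[of ?U])
    show "openin X ?U" using W(1) open_dist_less by blast
    show "k \<in> ?U" using W(4,5) k by simp
    fix k' assume k': "k' \<in> ?U"
    have "sheet k' s \<subseteq> W"
    proof (rule sheet_within[OF W(1-3)])
      show "k' \<in> W" using k' by blast
      fix v assume "v \<in> topspace X" "norm (f v - f k') < s"
      then show "v \<in> W \<union> W'"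
        using W(7)[of v] k' norm_triangle_ineq[of "f v - f k'" "f k' - f k"] by simp
    qed
    moreover have "y \<in> W'" using W(6)[OF y(1) _ y(3)] y(2) by (simp add: norm_minus_commute)
    ultimately show "y \<notin> sheet k' s" using W(3) by blast
  qed
qed

text \<open>A point can enter or leave a moving sheet only through the bounding sphere: while
  \<open>f k\<close> stays within \<open>s\<close> of \<open>f y\<close>, membership of
  \<open>y\<close> in the sheet of \<open>k\<close> is an open and closed condition on
  \<open>k\<close>.\<close>

lemma sheet_stable:
  assumes c: "0 < c" "c * \<kappa> < 1" and s: "s < 2 * c" and y: "y \<in> topspace X"
    and C: "connectedin X C" "\<And>k. k \<in> C \<Longrightarrow> norm (f k - f y) < s" "a \<in> C" "y \<in> sheet a s" "b \<in> C"
  shows "y \<in> sheet b s"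
proof -
  let ?B = "{k \<in> topspace X. norm (f k - f y) < s}"
  let ?U = "{k \<in> ?B. y \<in> sheet k s}" and ?V = "{k \<in> ?B. y \<notin> sheet k s}"
  have CX: "C \<subseteq> topspace X" by (rule connectedin_subset_topspace[OF C(1)])
  have U: "openin X ?U"
  proof (subst openin_subopen, intro ballI)
    fix k assume k: "k \<in> ?U"
    then obtain N where N: "openin X N" "k \<in> N" "\<And>k'. k' \<in> N \<Longrightarrow> y \<in> sheet k' s"
      using sheet_centre_open[of y k s] by (metis (no_types, lifting) mem_Collect_eq)
    have "openin X (N \<inter> ?B)" using N(1) open_dist_less by blast
    then show "\<exists>T. openin X T \<and> k \<in> T \<and> T \<subseteq> ?U" using N k by blast
  qed
  have V: "openin X ?V"
  proof (subst openin_subopen, intro ballI)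
    fix k assume k: "k \<in> ?V"
    obtain N where N: "openin X N" "k \<in> N" "\<And>k'. k' \<in> N \<Longrightarrow> y \<notin> sheet k' s"
      by (rule sheet_centre_closed[OF c s _ y, of k]) (use k in simp, use k in simp, use k in simp, rule that)
    have "openin X (N \<inter> ?B)" using N(1) open_dist_less by blast
    then show "\<exists>T. openin X T \<and> k \<in> T \<and> T \<subseteq> ?V" using N k by blast
  qed
  have "C \<subseteq> ?U \<union> ?V" using C(2) CX by blast
  moreover have "?U \<inter> ?V \<inter> C = {}" by blast
  moreover have "a \<in> ?U" using C(2-4) CX by blast
  ultimately have "C \<subseteq> ?U" by (intro connectedin_cover_cases[OF C(1) U V _ _ C(3)])
  then show ?thesis using C(5) by blast
qed

text \<open>Move the centre from \<open>k\<close> to \<open>y\<close> along the set that joins them.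
  The point \<open>k\<close> starts on its own sheet and stays within distance \<open>s\<close> of
  the centre, so it is never lost.\<close>

lemma sheet_sym:
  assumes c: "0 < c" "c * \<kappa> < 1" and s: "s < 2 * c" and y: "y \<in> sheet k s"
  shows "k \<in> sheet y s"
proof -
  obtain C where C: "compactin X C" "connectedin X C" "C \<subseteq> topspace X"
    "\<And>w. w \<in> C \<Longrightarrow> norm (f w - f k) < s" "k \<in> C" "y \<in> C"
    by (rule sheetE[OF y]) (rule that)
  have k: "k \<in> topspace X" using C by blast
  have "0 < s" using C(4)[OF C(5)] by simp
  then show ?thesis using sheet_stable[OF c s k C(2) C(4) C(5) mem_sheet_self[OF k] C(6)] by blast
qed

lemma no_isolated_point:
  assumes "openin X W" "x \<in> W"
  obtains w where "w \<in> W" "w \<noteq> x"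
proof -
  have "x \<in> topspace X" using assms openin_subset by blast
  then obtain U \<phi> where c: "(U, \<phi>) \<in> A" "x \<in> U" by (rule chart_exists)
  have "open (\<phi> ` (U \<inter> W))" by (rule chart_open_image[OF c(1) assms(1)])
  moreover have "\<phi> x \<in> \<phi> ` (U \<inter> W)" using c assms by blast
  ultimately have "\<phi> ` (U \<inter> W) \<noteq> {\<phi> x}" using not_open_singleton by metis
  then obtain w where "w \<in> U \<inter> W" "\<phi> w \<noteq> \<phi> x" using \<open>\<phi> x \<in> \<phi> ` (U \<inter> W)\<close> by blast
  then show thesis using that by blast
qed

text \<open>Four kinds of points: the centre, where a punctured neighbourhood is connected thanks to
  the dimension; the interior; the inner sphere, handled by \<open>descent\<close> with sign -1; and
  the outer sphere, which belongs to the closed sheet and needs the closed sublevel set. The last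
  clause says that the ring is dense up to its inner boundary.\<close>

lemma ring_local:
  assumes dim: "2 \<le> DIM('e)" and c: "0 < c" "c * \<kappa> < 1" and p: "p \<in> topspace X" and s: "s < 2 * c"
    and T: "0 \<le> T" "T < s" and y: "y \<in> csheet p s" "T \<le> norm (f y - f p)"
  defines "Rg \<equiv> {w \<in> csheet p s. T < norm (f w - f p)}"
  obtains U where "openin X U" "y \<in> U" "\<And>v w. v \<in> U \<Longrightarrow> w \<in> U \<Longrightarrow> v \<in> Rg \<Longrightarrow> w \<in> Rg \<Longrightarrow> joined X Rg v w"
    "\<And>v W. v \<in> U \<Longrightarrow> v \<in> csheet p s \<Longrightarrow> T \<le> norm (f v - f p) \<Longrightarrow> openin X W \<Longrightarrow> v \<in> W \<Longrightarrow> \<exists>w\<in>W. w \<in> Rg \<and> w \<in> U"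
proof -
  have s0: "0 < s" "0 \<le> s" using T by auto
  obtain O' where O': "openin X O'" "csheet p s \<subseteq> O'" "O' \<subseteq> good c p"
    "\<And>w. w \<in> O' \<Longrightarrow> norm (f w - f p) \<le> s \<Longrightarrow> w \<in> csheet p s"
    by (rule csheet_open[OF c p s0(2) s]) (rule that)
  have yX: "y \<in> topspace X" and ys: "norm (f y - f p) \<le> s" using csheetD[OF p s0(2) y(1)] by auto
  have pos: "0 < norm (f w - f p)" if w: "w \<in> O'" "w \<noteq> p" for w
  proof (rule ccontr)
    assume "\<not> 0 < norm (f w - f p)"
    then have "norm (f w - f p) = 0" using norm_ge_zero[of "f w - f p"] by linarith
    then have "2 * c * norm (nor w (f w - f p)) < 0" using O'(3) w by (auto simp: good_def)
    then show False using c(1) by (simp add: mult_less_0_iff)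
  qed
  let ?L = "{w \<in> topspace X. norm (f w - f p) < s}"
  consider "y = p" | "y \<noteq> p" "T < norm (f y - f p)" "norm (f y - f p) < s" | "y \<noteq> p" "norm (f y - f p) = T"
    | "y \<noteq> p" "norm (f y - f p) = s" using y(2) ys by linarith
  then show thesis
  proof cases
    case 1
    then have T0: "T = 0" using y(2) T(1) by simp
    show thesis
    proof (rule locally_joined_punctured[OF _ _ dim])
      show "openin X (O' \<inter> ?L)" using O'(1) open_dist_less by blast
      show "p \<in> O' \<inter> ?L" using O'(2) p s0 by (auto simp: csheet_def)
      fix U assume U: "openin X U" "p \<in> U" "U \<subseteq> O' \<inter> ?L"
        "\<And>v w. v \<in> U - {p} \<Longrightarrow> w \<in> U - {p} \<Longrightarrow> joined X (O' \<inter> ?L - {p}) v w"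
      have sub: "O' \<inter> ?L - {p} \<subseteq> Rg" unfolding Rg_def T0 using O'(4) pos by fastforce
      have ne: "p \<notin> Rg" unfolding Rg_def T0 by simp
      show thesis
      proof (rule that[of U])
        show "openin X U" "y \<in> U" using U 1 by auto
        show "joined X Rg v w" if "v \<in> U" "w \<in> U" "v \<in> Rg" "w \<in> Rg" for v w
          using joined_mono[OF U(4) sub, of v w] that ne by blast
        fix v W assume v: "v \<in> U" "openin X W" "v \<in> W"
        have "openin X (W \<inter> U)" using v U(1) by blast
        then obtain w where "w \<in> W \<inter> U" "w \<noteq> p"
          using no_isolated_point[of "W \<inter> U" v] v by (metis IntI)
        then show "\<exists>w\<in>W. w \<in> Rg \<and> w \<in> U" using sub U(3) by blast
      qed
    qed
  next
    case 2
    let ?O = "O' \<inter> ?L \<inter> {w \<in> topspace X. T < norm (f w - f p)}"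
    have sub: "?O \<subseteq> Rg" unfolding Rg_def using O'(4) by force
    show thesis
    proof (rule locally_joined)
      show "openin X ?O" using O'(1) open_dist_less open_less[OF _ distance_continuous, of "\<lambda>_. T"]
        by (intro openin_Int) auto
      show "y \<in> ?O" using 2 O'(2) y yX by auto
      fix U assume U: "openin X U" "y \<in> U" "U \<subseteq> ?O" "\<And>v w. v \<in> U \<Longrightarrow> w \<in> U \<Longrightarrow> joined X ?O v w"
      show thesis
        by (rule that[OF U(1,2)]) (use U joined_mono[OF _ sub] sub in blast)+
    qed
  next
    case 3
    have tan: "f y - f p \<notin> {v. nor y v = v}"
      by (rule good_tangential[OF c(1) _ 3(1)]) (use y O' ys s in auto)
    let ?O = "O' \<inter> ?L"
    have op: "openin X ?O" using O'(1) open_dist_less by blast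
    have yO: "y \<in> ?O" using 3 O'(2) y yX T by auto
    have lt: "-1 * (norm (f a - f p))\<^sup>2 < -1 * (norm (f y - f p))\<^sup>2 \<longleftrightarrow> T < norm (f a - f p)"
      and le: "-1 * (norm (f a - f p))\<^sup>2 \<le> -1 * (norm (f y - f p))\<^sup>2 \<longleftrightarrow> T \<le> norm (f a - f p)" for a
    proof -
      show "-1 * (norm (f a - f p))\<^sup>2 \<le> -1 * (norm (f y - f p))\<^sup>2 \<longleftrightarrow> T \<le> norm (f a - f p)"
        using T(1) by (simp add: 3(2))
      have "(norm (f a - f p))\<^sup>2 \<le> T\<^sup>2 \<longleftrightarrow> norm (f a - f p) \<le> T" using T(1) by simp
      then show "-1 * (norm (f a - f p))\<^sup>2 < -1 * (norm (f y - f p))\<^sup>2 \<longleftrightarrow> T < norm (f a - f p)"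
        unfolding 3(2) by linarith
    qed
    obtain U where U: "openin X U" "y \<in> U" "U \<subseteq> ?O"
        "\<And>a b. a \<in> U \<Longrightarrow> b \<in> U \<Longrightarrow> -1 * (norm (f a - f p))\<^sup>2 < -1 * (norm (f y - f p))\<^sup>2 \<Longrightarrow>
          -1 * (norm (f b - f p))\<^sup>2 < -1 * (norm (f y - f p))\<^sup>2 \<Longrightarrow>
          joined X (?O \<inter> {w. -1 * (norm (f w - f p))\<^sup>2 < -1 * (norm (f y - f p))\<^sup>2}) a b"
        "\<And>a W. a \<in> U \<Longrightarrow> -1 * (norm (f a - f p))\<^sup>2 \<le> -1 * (norm (f y - f p))\<^sup>2 \<Longrightarrow> openin X W \<Longrightarrow> a \<in> W \<Longrightarrow>
          \<exists>w\<in>W. -1 * (norm (f w - f p))\<^sup>2 < -1 * (norm (f y - f p))\<^sup>2"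
      by (rule descent[OF op yO _ tan, of "-1"]) (simp, rule that)
    have sub: "?O \<inter> {w. -1 * (norm (f w - f p))\<^sup>2 < -1 * (norm (f y - f p))\<^sup>2} \<subseteq> Rg"
      unfolding Rg_def lt using O'(4) by force
    show thesis
    proof (rule that[OF U(1,2)])
      show "joined X Rg v w" if "v \<in> U" "w \<in> U" "v \<in> Rg" "w \<in> Rg" for v w
        using joined_mono[OF U(4)[OF that(1,2)] sub] that(3,4) unfolding Rg_def lt by simp
      fix v W assume v: "v \<in> U" "T \<le> norm (f v - f p)" "openin X W" "v \<in> W"
      have "openin X (W \<inter> U)" "v \<in> W \<inter> U" using v U(1) by auto
      from U(5)[OF v(1) _ this] v(2) obtain w where "w \<in> W \<inter> U" "T < norm (f w - f p)" unfolding le lt by blast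
      then show "\<exists>w\<in>W. w \<in> Rg \<and> w \<in> U" using sub U(3) unfolding lt by blast
    qed
  next
    case 4
    have tan: "f y - f p \<notin> {v. nor y v = v}"
      by (rule good_tangential[OF c(1) _ 4(1)]) (use y O' ys s in auto)
    let ?O = "O' \<inter> {w \<in> topspace X. T < norm (f w - f p)}"
    have op: "openin X ?O" using O'(1) open_less[OF _ distance_continuous, of "\<lambda>_. T"]
      by (intro openin_Int) auto
    have yO: "y \<in> ?O" using 4 O'(2) y yX T by auto
    have le: "1 * (norm (f a - f p))\<^sup>2 \<le> 1 * (norm (f y - f p))\<^sup>2 \<longleftrightarrow> norm (f a - f p) \<le> s" for a
      using s0 by (simp add: 4(2))
    obtain U where U: "openin X U" "y \<in> U" "U \<subseteq> ?O"
        "\<And>a b. a \<in> U \<Longrightarrow> b \<in> U \<Longrightarrow> 1 * (norm (f a - f p))\<^sup>2 \<le> 1 * (norm (f y - f p))\<^sup>2 \<Longrightarrow>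
          1 * (norm (f b - f p))\<^sup>2 \<le> 1 * (norm (f y - f p))\<^sup>2 \<Longrightarrow>
          joined X (?O \<inter> {w. 1 * (norm (f w - f p))\<^sup>2 \<le> 1 * (norm (f y - f p))\<^sup>2}) a b"
      by (rule descent[OF op yO _ tan, of 1]) (simp, rule that)
    have sub: "?O \<inter> {w. 1 * (norm (f w - f p))\<^sup>2 \<le> 1 * (norm (f y - f p))\<^sup>2} \<subseteq> Rg"
      unfolding Rg_def le using O'(4) by force
    show thesis
    proof (rule that[OF U(1,2)])
      show "joined X Rg v w" if "v \<in> U" "w \<in> U" "v \<in> Rg" "w \<in> Rg" for v w
        using joined_mono[OF U(4)[OF that(1,2)] sub] that(3,4) csheetD(2)[OF p s0(2)] unfolding Rg_def le by simp
      fix v W assume v: "v \<in> U" "v \<in> csheet p s" "v \<in> W"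
      then have "v \<in> Rg" using U(3) unfolding Rg_def by blast
      then show "\<exists>w\<in>W. w \<in> Rg \<and> w \<in> U" using v by blast
    qed
  qed
qed

lemma csheet_connected:
  assumes "p \<in> topspace X" "0 < t"
  shows "connectedin X (csheet p t)"
proof -
  have "connectedin X (sheet p t)" unfolding sheet_def using assms by (intro connectedin_joined) auto
  moreover have "csheet p t = X closure_of sheet p t"
    using mem_sheet_self[OF assms] sheet_subset_csheet[of p t]
      closure_of_subset[of "sheet p t" X] openin_subset[OF openin_sheet] unfolding csheet_def by blast
  ultimately show ?thesis using connectedin_closure_of by metis
qed

text \<open>A Morse-type argument. For a negative inner radius the ring is the closed sheet. When
  the inner radius grows, connectedness could be lost only at a critical point of the distance;
  there is none except \<open>p\<close>, whose removal does no harm in dimension at least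
  two.\<close>

lemma ring_connected:
  assumes dim: "2 \<le> DIM('e)" and c: "0 < c" "c * \<kappa> < 1" and p: "p \<in> topspace X" and s: "0 < s" "s < 2 * c"
    and a: "a \<in> csheet p s" "t < norm (f a - f p)" and b: "b \<in> csheet p s" "t < norm (f b - f p)"
  shows "joined X {w \<in> csheet p s. t < norm (f w - f p)} a b"
proof (rule ccontr)
  assume neg: "\<not> joined X {w \<in> csheet p s. t < norm (f w - f p)} a b"
  let ?R = "\<lambda>t. {w \<in> csheet p s. t < norm (f w - f p)}"
  note K = closedin_csheet[OF p, of s] csheet_connected[OF p s(1)]
  have cK: "compactin X (csheet p s)" by (rule closedin_compact_space[OF compact K(1)])
  define N where "N = {t. \<not> joined X (?R t) a b}"
  define T where "T = Inf N"
  have tN: "t \<in> N" using neg by (simp add: N_def)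
  have N0: "0 \<le> t'" if t': "t' \<in> N" for t'
  proof (rule ccontr)
    assume "\<not> 0 \<le> t'"
    then have "t' < norm (f w - f p)" for w using norm_ge_zero[of "f w - f p"] by linarith
    then have "csheet p s \<subseteq> ?R t'" by blast
    then have "joined X (?R t') a b" by (rule joinedI[OF cK K(2) _ a(1) b(1)])
    then show False using t' by (simp add: N_def)
  qed
  have bdd: "bdd_below N" by (rule bdd_belowI[of N 0]) (rule N0)
  have "T \<le> t" unfolding T_def by (rule cInf_lower[OF tN bdd])
  then have Tab: "T < norm (f a - f p)" "T < norm (f b - f p)" using a b by auto
  have s0: "0 \<le> s" using s by simp
  have T: "0 \<le> T" "T < s" using tN N0 csheetD(2)[OF p s0 a(1)] Tab unfolding T_def by (auto intro: cInf_greatest)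
  have IH: "joined X (?R t') a b" if "t' < T" for t'
  proof (rule ccontr)
    assume "\<not> joined X (?R t') a b"
    then have "T \<le> t'" unfolding T_def N_def by (intro cInf_lower) (use bdd N_def in auto)
    then show False using that by simp
  qed
  \<comment> \<open>The infimum is itself a bad radius, because a compact set in the ring of inner
    radius \<open>T\<close> also lies in a ring of larger inner radius.\<close>
  have TN: "\<not> joined X (?R T) a b"
  proof
    assume "joined X (?R T) a b"
    then obtain C where C: "compactin X C" "connectedin X C" "C \<subseteq> ?R T" "a \<in> C" "b \<in> C" by (rule joinedE)
    have "continuous_map X euclideanreal (\<lambda>y. - norm (f y - f p))"
      using distance_continuous by (intro continuous_map_minus)
    moreover have "closedin X C" using compactin_imp_closedin[OF Hausdorff C(1)] .
    ultimately obtain w where w: "w \<in> C" "\<And>v. v \<in> C \<Longrightarrow> - norm (f v - f p) \<le> - norm (f w - f p)"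
      using attains_max[of C "\<lambda>y. - norm (f y - f p)"] C(4) by blast
    have "norm (f w - f p) \<le> t'" if t': "t' \<in> N" for t'
    proof (rule ccontr)
      assume "\<not> norm (f w - f p) \<le> t'"
      then have "C \<subseteq> ?R t'" using C(3) w(2) by fastforce
      then have "joined X (?R t') a b" using C by (blast intro: joinedI)
      then show False using t' by (simp add: N_def)
    qed
    then have "norm (f w - f p) \<le> T" unfolding T_def using tN by (intro cInf_greatest) auto
    then show False using C(3) w(1) by auto
  qed
  \<comment> \<open>The closure of the component of \<open>a\<close> at radius \<open>T\<close>
    turns out to be isolated in the ring closed at its inner boundary. By
    \<open>separate_sublevel\<close> it would then be separated from \<open>b\<close> at a radius
    below \<open>T\<close> already.\<close>
  define E where "E = {y. joined X (?R T) a y}"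
  have EX: "E \<subseteq> ?R T" unfolding E_def using joined_in[of X "?R T"] by blast
  let ?L = "X closure_of E"
  have ER: "E \<subseteq> csheet p s \<inter> {w \<in> topspace X. T \<le> norm (f w - f p)}"
    using EX csheetD(1)[OF p s0] by fastforce
  have "closedin X (csheet p s \<inter> {w \<in> topspace X. T \<le> norm (f w - f p)})"
    using K(1) closed_le[OF _ distance_continuous, of "\<lambda>_. T"] by (intro closedin_Int) auto
  then have LR: "?L \<subseteq> csheet p s \<inter> {w \<in> topspace X. T \<le> norm (f w - f p)}"
    using closure_of_minimal[OF ER] by blast
  have loc: "\<exists>U. openin X U \<and> y \<in> U \<and> (\<forall>v\<in>U. v \<in> csheet p s \<longrightarrow> T \<le> norm (f v - f p) \<longrightarrow> v \<in> ?L) \<and>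
      (\<forall>v\<in>U. v \<in> ?R T \<longrightarrow> v \<in> E)" if y: "y \<in> ?L" for y
  proof -
    have "y \<in> csheet p s" "T \<le> norm (f y - f p)" using LR y by auto
    then obtain U where U: "openin X U" "y \<in> U"
      "\<And>v w. v \<in> U \<Longrightarrow> w \<in> U \<Longrightarrow> v \<in> ?R T \<Longrightarrow> w \<in> ?R T \<Longrightarrow> joined X (?R T) v w"
      "\<And>v W. v \<in> U \<Longrightarrow> v \<in> csheet p s \<Longrightarrow> T \<le> norm (f v - f p) \<Longrightarrow> openin X W \<Longrightarrow> v \<in> W \<Longrightarrow> \<exists>w\<in>W. w \<in> ?R T \<and> w \<in> U"
      by (rule ring_local[OF dim c p s(2) T]) (rule that)
    obtain e where e: "e \<in> U" "e \<in> E" using closure_meets[OF y U(1,2)] by blast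
    have 1: "v \<in> E" if v: "v \<in> U" "v \<in> ?R T" for v
      using joined_trans[OF _ U(3)[OF e(1) v(1) _ v(2)], of a] e(2) EX unfolding E_def by blast
    have "v \<in> ?L" if v: "v \<in> U" "v \<in> csheet p s" "T \<le> norm (f v - f p)" for v
      unfolding in_closure_of
    proof (intro conjI allI impI)
      show "v \<in> topspace X" using csheetD(1)[OF p s0 v(2)] .
      fix W assume W: "v \<in> W \<and> openin X W"
      obtain w where "w \<in> W" "w \<in> ?R T" "w \<in> U" using U(4)[OF v conjunct2[OF W] conjunct1[OF W]] by blast
      then show "\<exists>w. w \<in> E \<and> w \<in> W" using 1 by blast
    qed
    then show ?thesis using U(1,2) 1 by blast
  qed
  let ?O = "\<Union>{U. openin X U \<and> (\<forall>v\<in>U. v \<in> csheet p s \<longrightarrow> T \<le> norm (f v - f p) \<longrightarrow> v \<in> ?L)}"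
  have LO: "?L \<subseteq> ?O"
  proof
    fix y assume "y \<in> ?L"
    from loc[OF this] show "y \<in> ?O" by blast
  qed
  have aR: "a \<in> ?R T" "b \<in> ?R T" using a b Tab by auto
  have aX: "a \<in> topspace X" using csheetD(1)[OF p s0 a(1)] .
  have "a \<in> E" unfolding E_def using joined_refl[OF aR(1) aX] by simp
  then have aL: "a \<in> ?L" using closure_of_subset[of E X] ER by blast
  have bL: "b \<notin> ?L"
  proof
    assume "b \<in> ?L"
    from loc[OF this] aR(2) have "b \<in> E" by blast
    then show False using TN by (simp add: E_def)
  qed
  have m: "continuous_map X euclideanreal (\<lambda>y. - norm (f y - f p))"
    using distance_continuous by (intro continuous_map_minus)
  have LK: "?L \<subseteq> csheet p s" and LT: "- norm (f y - f p) \<le> - T" if "y \<in> ?L" for y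
    using LR that by auto
  have LO': "y \<in> ?L" if "y \<in> ?O" "y \<in> csheet p s" "- norm (f y - f p) \<le> - T" for y
    using that by auto
  obtain W W' t' where W: "openin X W" "openin X W'" "W \<inter> W' = {}" "?L \<subseteq> W" "W \<subseteq> ?O" "- T < t'"
    "\<And>y. y \<in> csheet p s \<Longrightarrow> - norm (f y - f p) \<le> - T \<Longrightarrow> y \<notin> ?L \<Longrightarrow> y \<in> W'"
    "\<And>y. y \<in> csheet p s \<Longrightarrow> - norm (f y - f p) < t' \<Longrightarrow> y \<in> W \<union> W'"
    by (rule separate_sublevel[OF K(1) m closedin_closure_of _ LT _ LO LO'])
      (use LK aL in blast, assumption, blast, assumption+, rule that)
  have "joined X (?R (- t')) a b" using IH W(6) by simp
  then obtain C where C: "compactin X C" "connectedin X C" "C \<subseteq> ?R (- t')" "a \<in> C" "b \<in> C" by (rule joinedE)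
  have "C \<subseteq> W \<union> W'" using C(3) W(8) by fastforce
  moreover have "W \<inter> W' \<inter> C = {}" using W(3) by simp
  ultimately have "C \<subseteq> W" using connectedin_cover_cases[OF C(2) W(1,2) _ _ C(4)] W(4) aL by blast
  moreover have "b \<in> W'" using W(7)[OF b(1) _ bL] Tab by simp
  ultimately show False using W(3) C(5) by blast
qed

text \<open>The sum is three times the sum of the squared norms minus the squared norm of
  \<open>u + v + w\<close>. Equilateral triangles of side \<open>\<surd>3\<close> on the unit sphere
  show where this constant comes from.\<close>

lemma three_points:
  fixes u v w :: 'b
  assumes "norm u \<le> 1" "norm v \<le> 1" "norm w \<le> 1"
  shows "(norm (u - v))\<^sup>2 + (norm (v - w))\<^sup>2 + (norm (w - u))\<^sup>2 \<le> 9"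
proof -
  have "(norm (u - v))\<^sup>2 + (norm (v - w))\<^sup>2 + (norm (w - u))\<^sup>2
      = 3 * (norm u)\<^sup>2 + 3 * (norm v)\<^sup>2 + 3 * (norm w)\<^sup>2 - (norm (u + v + w))\<^sup>2"
    unfolding power2_norm_eq_inner by (simp add: algebra_simps inner_commute)
  moreover have "(norm u)\<^sup>2 \<le> 1" "(norm v)\<^sup>2 \<le> 1" "(norm w)\<^sup>2 \<le> 1" using assms by (auto simp: power_le_one)
  ultimately show ?thesis using zero_le_power2[of "norm (u + v + w)"] by linarith
qed

text \<open>If \<open>y\<close> is on the bounding sphere, the ring joins it to \<open>q\<close>
  through points farther than \<open>\<surd>3\<close> from \<open>f z\<close>. By
  \<open>three_points\<close> these are closer than \<open>\<surd>3\<close> to \<open>f q\<close>,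
  so the joining set does not leave the ball that defines the sheet of \<open>q\<close>.\<close>

lemma two_sheets_half:
  assumes dim: "2 \<le> DIM('e)" and c: "0 < c" "c * \<kappa> < 1" and z: "z \<in> topspace X" and s: "sqrt 3 < s" "s < 2 * c"
    and q: "q \<in> sheet z s" "sqrt 3 < norm (f q - f z)" and y: "y \<in> X closure_of sheet z s"
  shows "y \<in> sheet z s \<union> sheet q s"
proof (cases "norm (f y - f z) < s")
  case True
  then show ?thesis using closure_sheet(2)[OF y] by blast
next
  case False
  then have ys: "sqrt 3 < norm (f y - f z)" using s(1) by simp
  have s0: "0 < s" "0 \<le> s" using s(1) real_sqrt_ge_zero[of 3] by linarith+
  have yc: "y \<in> csheet z s" using y by (simp add: csheet_def)
  have qc: "q \<in> csheet z s" using q(1) sheet_subset_csheet by blast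
  let ?R = "{w \<in> csheet z s. sqrt 3 < norm (f w - f z)}"
  have j: "joined X ?R q y" by (rule ring_connected[OF dim c z s0(1) s(2) qc q(2) yc ys])
  have qX: "q \<in> topspace X" using sheetD[OF q(1)] by blast
  have "norm (f w - f q) < s" if w: "w \<in> ?R" "w \<in> topspace X" for w
  proof -
    have "(sqrt 3)\<^sup>2 < (norm (f w - f z))\<^sup>2" "(sqrt 3)\<^sup>2 < (norm (f q - f z))\<^sup>2"
      using w(1) q(2) by (intro power_strict_mono; simp)+
    then have "(norm (f w - f q))\<^sup>2 < (sqrt 3)\<^sup>2"
      using three_points[of "f q" "f z" "f w"] ball[OF qX] ball[OF z] ball[OF w(2)]
      by (simp add: norm_minus_commute)
    then have "norm (f w - f q) < sqrt 3" by (rule power2_less_imp_less) simp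
    then show ?thesis using s(1) by simp
  qed
  then have "y \<in> sheet q s" by (rule sheet_extend[OF mem_sheet_self[OF qX s0(1)] j])
  then show ?thesis by blast
qed

text \<open>By symmetry of sheets the previous lemma applies with \<open>z\<close> and
  \<open>q\<close> exchanged. So the open union contains its closure, and \<open>X\<close> is
  connected.\<close>

lemma two_sheets:
  assumes dim: "2 \<le> DIM('e)" and c: "0 < c" "c * \<kappa> < 1" and z: "z \<in> topspace X" and s: "sqrt 3 < s" "s < 2 * c"
    and q: "q \<in> sheet z s" "sqrt 3 < norm (f q - f z)"
  shows "topspace X = sheet z s \<union> sheet q s"
proof -
  have qX: "q \<in> topspace X" using sheetD[OF q(1)] by blast
  have zq: "z \<in> sheet q s" by (rule sheet_sym[OF c s(2) q(1)])
  have op: "openin X (sheet z s \<union> sheet q s)" using openin_sheet by blast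
  have "X closure_of (sheet z s \<union> sheet q s) \<subseteq> sheet z s \<union> sheet q s"
    using two_sheets_half[OF dim c z s q] two_sheets_half[OF dim c qX s zq] q(2)
    unfolding closure_of_Un by (auto simp: norm_minus_commute)
  then have "closedin X (sheet z s \<union> sheet q s)"
    using closure_of_subset[OF openin_subset[OF op]] closedin_closure_of by (metis subset_antisym)
  then have "sheet z s \<union> sheet q s = {} \<or> sheet z s \<union> sheet q s = topspace X"
    using connected op unfolding connected_space_clopen_in by blast
  then show ?thesis using q(1) by blast
qed

end

section \<open>Walks from the farthest point\<close>

context closed_immersed begin

lemma height_continuous: "continuous_map X euclideanreal (\<lambda>z. (f z - v) \<bullet> u)"
proof -
  have "continuous_map euclidean euclideanreal (\<lambda>w. (w - v) \<bullet> u)" by (simp add: continuous_intros)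
  from continuous_map_compose[OF f_continuous this] show ?thesis by (simp add: o_def)
qed

lemma sideways_continuous: "continuous_map X euclideanreal (\<lambda>z. norm (f z - v - ((f z - v) \<bullet> u) *\<^sub>R u))"
proof -
  have "continuous_map euclidean euclideanreal (\<lambda>w. norm (w - v - ((w - v) \<bullet> u) *\<^sub>R u))" by (simp add: continuous_intros)
  from continuous_map_compose[OF f_continuous this] show ?thesis by (simp add: o_def)
qed

text \<open>
  The set \<open>\<Omega>\<close> is modelled on a circular arc of radius \<open>c1\<close> (\<open>c2\<close> leaves some room) tangent to \<open>u\<close> at \<open>p\<close>; a point of
  greatest height \<open>h\<close> that can be reached inside \<open>\<Omega>\<close> lies on the face \<open>h = c3\<close>, since below it one can move on along the
  tangential part of \<open>u\<close>. The slack \<open>\<epsilon>\<close> is needed at \<open>p\<close> itself, where both sides of the constraints vanish.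
\<close>

lemma walk:
  assumes p: "p \<in> topspace X" and u: "u \<in> tangent p" "norm u = 1"
    and c: "0 < c3" "c2 < c1" "c1 * \<kappa> < 1" and \<epsilon>: "0 < \<epsilon>" "(c3 + \<epsilon>)\<^sup>2 + c3\<^sup>2 < 2 * c2 * c3"
  defines "h z \<equiv> (f z - f p) \<bullet> u" and "\<tau> z \<equiv> norm (f z - f p - ((f z - f p) \<bullet> u) *\<^sub>R u)"
  defines "\<Omega> \<equiv> {z \<in> topspace X. c1 * norm (nor z u) \<le> h z + \<epsilon> \<and> 2 * c2 * \<tau> z \<le> (h z + \<epsilon>)\<^sup>2 + (\<tau> z)\<^sup>2 \<and>
    \<tau> z \<le> c3 \<and> h z \<le> c3}"
  obtains q where "joined X \<Omega> p q" "h q = c3"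
proof -
  have hc: "continuous_map X euclideanreal h" unfolding h_def by (rule height_continuous)
  have tc: "continuous_map X euclideanreal \<tau>" unfolding \<tau>_def by (rule sideways_continuous)
  have nc: "continuous_map X euclideanreal (\<lambda>z. norm (nor z u))"
    by (intro continuous_map_norm nor_continuous) auto
  have c2: "c3 < c2"
  proof (rule ccontr)
    assume "\<not> c3 < c2"
    then have "c2 * c3 \<le> c3 * c3" using c(1) by (intro mult_right_mono) auto
    moreover have "c3\<^sup>2 \<le> (c3 + \<epsilon>)\<^sup>2" using c(1) \<epsilon>(1) by (intro power_mono) auto
    ultimately show False using \<epsilon>(2) by (simp add: power2_eq_square)
  qed
  have c3c2: "c3 + \<epsilon> < c2"
  proof (rule power2_less_imp_less)
    have "c2\<^sup>2 - (2 * c2 * c3 - c3\<^sup>2) = (c2 - c3)\<^sup>2" by (simp add: power2_diff)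
    moreover have "0 \<le> (c2 - c3)\<^sup>2" by simp
    ultimately show "(c3 + \<epsilon>)\<^sup>2 < c2\<^sup>2" using \<epsilon>(2) by linarith
  qed (use c2 c in simp)
  \<comment> \<open>In the coordinates \<open>(h, \<tau>)\<close> the second constraint excludes an
    open disc of radius \<open>c2\<close> touching the axis of \<open>u\<close> at height
    \<open>- \<epsilon>\<close>. The first one is, for \<open>\<epsilon> = 0\<close>, an equality
    along a circular arc of radius \<open>c1\<close> starting in direction \<open>u\<close>.\<close>
  have \<Omega>1: "\<Omega> = {z \<in> topspace X. c1 * norm (nor z u) \<le> h z + \<epsilon>} \<inter> {z \<in> topspace X. 2 * c2 * \<tau> z \<le> (h z + \<epsilon>)\<^sup>2 + (\<tau> z)\<^sup>2}
      \<inter> ({z \<in> topspace X. \<tau> z \<le> c3} \<inter> {z \<in> topspace X. h z \<le> c3})" unfolding \<Omega>_def by blast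
  have \<Omega>c: "closedin X \<Omega>" unfolding \<Omega>1
    by (intro closedin_Int closed_le continuous_map_real_mult continuous_map_add continuous_map_real_pow hc tc nc) auto
  have "nor p u = 0" using nor_props(4)[OF p] u(1) by blast
  then have p\<Omega>: "p \<in> \<Omega>" using p c(1) \<epsilon>(1) unfolding \<Omega>_def h_def \<tau>_def by simp
  define E where "E = {z. joined X \<Omega> p z}"
  have E\<Omega>: "E \<subseteq> \<Omega>" "E \<subseteq> topspace X" unfolding E_def using joined_in[of X \<Omega>] by blast+
  have "connectedin X E" unfolding E_def using p p\<Omega> by (intro connectedin_joined)
  then have L: "connectedin X (X closure_of E)" by (rule connectedin_closure_of)
  have Lc: "compactin X (X closure_of E)" by (rule closedin_compact_space[OF compact closedin_closure_of])
  have L\<Omega>: "X closure_of E \<subseteq> \<Omega>" by (rule closure_of_minimal[OF E\<Omega>(1) \<Omega>c])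
  have pL: "p \<in> X closure_of E"
    using closure_of_subset[OF E\<Omega>(2)] joined_refl[OF p\<Omega> p] unfolding E_def by blast
  obtain x where x: "x \<in> X closure_of E" "\<And>z. z \<in> X closure_of E \<Longrightarrow> h z \<le> h x"
    using attains_max[OF closedin_closure_of _ hc, of E] pL by blast
  have jx: "joined X \<Omega> p x" by (rule joinedI[OF Lc L L\<Omega> pL x(1)])
  have x\<Omega>: "x \<in> \<Omega>" using x(1) L\<Omega> by blast
  have xX: "x \<in> topspace X" and x1: "c1 * norm (nor x u) \<le> h x + \<epsilon>" and x2: "2 * c2 * \<tau> x \<le> (h x + \<epsilon>)\<^sup>2 + (\<tau> x)\<^sup>2"
    and x3: "\<tau> x \<le> c3" and x4: "h x \<le> c3" using x\<Omega> by (auto simp: \<Omega>_def)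
  have "h x = c3"
  proof (rule ccontr)
    assume "h x \<noteq> c3"
    then have hx: "h x < c3" using x4 by simp
    define n where "n = norm (nor x u)"
    define w where "w = u - nor x u"
    define W where "W = (norm w)\<^sup>2"
    define H where "H = h x + \<epsilon>"
    have "h p = 0" by (simp add: h_def)
    then have H0: "0 < H" using x(2)[OF pL] \<epsilon>(1) by (simp add: H_def)
    have n0: "0 \<le> n" by (simp add: n_def)
    have t0: "0 \<le> \<tau> x" by (simp add: \<tau>_def)
    have c1n: "c1 * n \<le> H" using x1 by (simp add: n_def H_def)
    have nW: "n\<^sup>2 + W = 1" using nor_props(6)[OF xX, of u] u(2) by (simp add: n_def W_def w_def)
    have wu: "w \<bullet> u = W" using nor_props(7)[OF xX, of u] by (simp add: W_def w_def inner_commute)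
    have c1: "0 < c1" using c2 c by simp
    have n1: "n < 1"
    proof (rule ccontr)
      assume "\<not> n < 1"
      then have "c1 * 1 \<le> c1 * n" using c1 by (intro mult_left_mono) auto
      then show False using c1n hx c3c2 c(2) by (simp add: H_def)
    qed
    then have "n\<^sup>2 < 1" using n0 by (simp add: power_less_one_iff abs_square_less_1)
    then have W0: "0 < W" using nW by simp
    \<comment> \<open>The face \<open>\<tau> = c3\<close> cannot be reached below height
      \<open>c3\<close>, since it then lies inside the excluded disc by the condition on
      \<open>\<epsilon>\<close>.\<close>
    have tx: "\<tau> x < c3"
    proof (rule ccontr)
      assume "\<not> \<tau> x < c3"
      then have t: "\<tau> x = c3" using x3 by simp
      have "H\<^sup>2 \<le> (c3 + \<epsilon>)\<^sup>2" using hx H0 by (intro power_mono) (auto simp: H_def)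
      then show False using x2 t \<epsilon>(2) by (simp add: H_def)
    qed
    obtain cc d where d: "d > 0" and c0: "cc 0 = x" and ccont: "continuous_map (top_of_set {-d<..<d}) X cc"
      and fv: "\<And>e. e > 0 \<Longrightarrow> \<forall>\<^sub>F s in nhds 0. \<bar>s\<bar> < d \<and> norm (f (cc s) - f x - s *\<^sub>R (u - nor x u)) \<le> e * \<bar>s\<bar> \<and>
        \<bar>norm (nor (cc s) u) - norm (nor x u)\<bar> \<le> (\<kappa> * (norm (u - nor x u))\<^sup>2 + e) * \<bar>s\<bar>"
      by (rule first_variation[where V = "\<lambda>_. u" and l = 0 and z = "- u", OF xX]) (simp, rule that)
    have nbhd: "\<forall>\<^sub>F s in nhds 0. cc s \<in> O'" if O': "openin X O'" "x \<in> O'" for O'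
    proof -
      have "openin (top_of_set {-d<..<d}) {s \<in> {-d<..<d}. cc s \<in> O'}"
        using openin_continuous_map_preimage[OF ccont O'(1)] by simp
      then have "open {s \<in> {-d<..<d}. cc s \<in> O'}" by (simp add: openin_open_eq)
      moreover have "0 \<in> {s \<in> {-d<..<d}. cc s \<in> O'}" using c0 d O' by simp
      ultimately have "\<forall>\<^sub>F s in nhds 0. s \<in> {s \<in> {-d<..<d}. cc s \<in> O'}" by (rule eventually_nhds_in_open)
      then show ?thesis by eventually_elim simp
    qed
    have e3: "\<forall>\<^sub>F s in nhds 0. cc s \<in> {z \<in> topspace X. \<tau> z < c3} \<inter> {z \<in> topspace X. h z < c3}"
      by (rule nbhd) (use open_less[OF tc, of "\<lambda>_. c3"] open_less[OF hc, of "\<lambda>_. c3"] xX tx hx in \<open>auto intro: openin_Int\<close>)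
    have wWu: "norm (w - W *\<^sub>R u) = sqrt W * n"
    proof (rule power2_eq_imp_eq)
      have "(norm (w - W *\<^sub>R u))\<^sup>2 = (norm w)\<^sup>2 - 2 * W * (w \<bullet> u) + W\<^sup>2 * (norm u)\<^sup>2"
        unfolding power2_norm_eq_inner by (simp add: algebra_simps inner_commute power2_eq_square)
      also have "\<dots> = W * (1 - W)" unfolding wu u(2) W_def[symmetric] by (simp add: algebra_simps power2_eq_square)
      also have "\<dots> = (sqrt W * n)\<^sup>2" using nW W0 by (simp add: power_mult_distrib)
      finally show "(norm (w - W *\<^sub>R u))\<^sup>2 = (sqrt W * n)\<^sup>2" .
    qed (use n0 W0 in auto)
    have step: "h x + s * (W - e) \<le> h z" "\<tau> z \<le> \<tau> x + s * (sqrt W * n + 2 * e)"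
      if z: "norm (f z - f x - s *\<^sub>R w) \<le> e * s" and s: "0 < s" for z s e
    proof -
      define r where "r = f z - f x - s *\<^sub>R w"
      have fz: "f z = f x + s *\<^sub>R w + r" by (simp add: r_def)
      have hz: "h z = h x + s * W + r \<bullet> u"
        unfolding h_def fz using wu by (simp add: inner_diff_left inner_add_left)
      have ru: "\<bar>r \<bullet> u\<bar> \<le> e * s" using Cauchy_Schwarz_ineq2[of r u] u(2) z by (simp add: r_def)
      show "h x + s * (W - e) \<le> h z" using hz ru by (simp add: right_diff_distrib abs_le_iff mult.commute)
      have tri: "norm (a + b + c) \<le> norm a + norm b + norm c" for a b c :: 'b
        using norm_triangle_ineq[of "a + b" c] norm_triangle_ineq[of a b] by linarith
      have eq: "f z - f p - h z *\<^sub>R u = (f x - f p - h x *\<^sub>R u) + s *\<^sub>R (w - W *\<^sub>R u) + (r - (r \<bullet> u) *\<^sub>R u)"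
        unfolding hz fz by (simp add: algebra_simps)
      have "\<tau> z \<le> \<tau> x + norm (s *\<^sub>R (w - W *\<^sub>R u)) + norm (r - (r \<bullet> u) *\<^sub>R u)"
        unfolding \<tau>_def h_def[symmetric] eq by (rule tri)
      moreover have "norm (r - (r \<bullet> u) *\<^sub>R u) \<le> e * s + e * s"
        using norm_triangle_ineq4[of r "(r \<bullet> u) *\<^sub>R u"] ru z u(2) by (simp add: r_def)
      moreover have "norm (s *\<^sub>R (w - W *\<^sub>R u)) = s * (sqrt W * n)" using s wWu by simp
      ultimately show "\<tau> z \<le> \<tau> x + s * (sqrt W * n + 2 * e)" by (simp add: algebra_simps)
    qed
    \<comment> \<open>In the first constraint the left side grows at most at rate
      \<open>c1 * (\<kappa> * W + e)\<close> and the right side at least at rate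
      \<open>W - e\<close>. Errors up to \<open>e1\<close> leave the right side ahead, because
      \<open>c1 * \<kappa> < 1\<close>.\<close>
    define e1 where "e1 = W * (1 - c1 * \<kappa>) / (2 * (1 + c1))"
    have e1: "0 < e1" "e1 * (1 + c1) \<le> W * (1 - c1 * \<kappa>)" "e1 < W"
    proof -
      show "0 < e1" using W0 c(3) c1 by (simp add: e1_def)
      have "e1 * (1 + c1) = W * (1 - c1 * \<kappa>) / 2" using c1 by (simp add: e1_def field_simps)
      moreover have "0 < W * (1 - c1 * \<kappa>)" using W0 c(3) by simp
      ultimately show le: "e1 * (1 + c1) \<le> W * (1 - c1 * \<kappa>)" by linarith
      have "e1 * 1 < e1 * (1 + c1)" using \<open>0 < e1\<close> c1 by (intro mult_strict_left_mono) auto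
      also have "\<dots> \<le> W * (1 - c1 * \<kappa>)" by (rule le)
      also have "\<dots> \<le> W * 1" using W0 c1 \<kappa>0 by (intro mult_left_mono) auto
      finally show "e1 < W" by simp
    qed
    have "\<exists>e>0. e \<le> e1 \<and> (\<forall>\<^sub>F s in at_right 0. norm (f (cc s) - f x - s *\<^sub>R w) \<le> e * \<bar>s\<bar> \<longrightarrow>
        2 * c2 * \<tau> (cc s) \<le> (h (cc s) + \<epsilon>)\<^sup>2 + (\<tau> (cc s))\<^sup>2)"
    proof (cases "2 * c2 * \<tau> x < (h x + \<epsilon>)\<^sup>2 + (\<tau> x)\<^sup>2")
      case True
      have "openin X {z \<in> topspace X. 2 * c2 * \<tau> z < (h z + \<epsilon>)\<^sup>2 + (\<tau> z)\<^sup>2}"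
        by (intro open_less continuous_map_real_mult continuous_map_add continuous_map_real_pow hc tc) auto
      from nbhd[OF this] True xX
      have "\<forall>\<^sub>F s in nhds 0. cc s \<in> {z \<in> topspace X. 2 * c2 * \<tau> z < (h z + \<epsilon>)\<^sup>2 + (\<tau> z)\<^sup>2}" by simp
      then have "\<forall>\<^sub>F s in at_right 0. norm (f (cc s) - f x - s *\<^sub>R w) \<le> e1 * \<bar>s\<bar> \<longrightarrow>
        2 * c2 * \<tau> (cc s) \<le> (h (cc s) + \<epsilon>)\<^sup>2 + (\<tau> (cc s))\<^sup>2"
        unfolding eventually_at_filter by eventually_elim auto
      then show ?thesis using e1(1) by blast
    next
      case False
      then have eq: "2 * c2 * \<tau> x = H\<^sup>2 + (\<tau> x)\<^sup>2" using x2 by (simp add: H_def)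
      have c2n: "c2\<^sup>2 * n\<^sup>2 < H\<^sup>2"
      proof (cases "n = 0")
        case True then show ?thesis using H0 by simp
      next
        case n: False
        have "(c1 * n)\<^sup>2 \<le> H\<^sup>2" using c1n c1 n0 by (intro power_mono) auto
        moreover have "c2\<^sup>2 * n\<^sup>2 < c1\<^sup>2 * n\<^sup>2" using c(2) c2 c(1) n by (intro mult_strict_right_mono power_strict_mono) auto
        ultimately show ?thesis by (simp add: power_mult_distrib)
      qed
      \<comment> \<open>On the boundary of the excluded disc, \<open>c2 - \<tau> x\<close> has
        square \<open>c2^2 - H^2\<close>. The velocity has height component \<open>W\<close> and
        sideways component \<open>sqrt W * n\<close>, so the inequality says that it points out of
        the disc. For \<open>n > 0\<close> strictness comes from \<open>c2 < c1\<close>.\<close>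
      have key: "(c2 - \<tau> x) * n < H * sqrt W"
      proof (rule power2_less_imp_less)
        have "((c2 - \<tau> x) * n)\<^sup>2 = (c2\<^sup>2 - H\<^sup>2) * n\<^sup>2" using eq by (simp add: power_mult_distrib power2_diff)
        also have "\<dots> < H\<^sup>2 * (1 - n\<^sup>2)" using c2n by (simp add: algebra_simps)
        also have "\<dots> = (H * sqrt W)\<^sup>2" using nW W0 by (simp add: power_mult_distrib)
        finally show "((c2 - \<tau> x) * n)\<^sup>2 < (H * sqrt W)\<^sup>2" .
      qed (use H0 W0 in simp)
      define g where "g e = H * (W - e) - (c2 - \<tau> x) * (sqrt W * n + 2 * e)" for e
      have "g 0 = sqrt W * (H * sqrt W - (c2 - \<tau> x) * n)" using W0 by (simp add: g_def algebra_simps)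
      then have "0 < g 0" using key W0 by simp
      moreover have "(g \<longlongrightarrow> g 0) (at_right 0)" unfolding g_def by (intro tendsto_intros)
      ultimately have "\<forall>\<^sub>F e in at_right 0. 0 < g e" by (rule order_tendstoD(1)[rotated])
      moreover have "\<forall>\<^sub>F e in at_right 0. e \<in> {0<..<e1}" using e1(1) by (rule eventually_at_right_real)
      ultimately have "\<forall>\<^sub>F e in at_right 0. 0 < g e \<and> e \<in> {0<..<e1}" by eventually_elim simp
      then obtain e where e: "0 < g e" "0 < e" "e < e1"
        using eventually_happens' trivial_limit_at_right_real by fastforce
      define \<delta> where "\<delta> s = s * (sqrt W * n + 2 * e)" for s
      have "((\<lambda>s. \<tau> x + \<delta> s) \<longlongrightarrow> \<tau> x + \<delta> 0) (at_right 0)" unfolding \<delta>_def by (intro tendsto_intros)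
      moreover have "\<tau> x + \<delta> 0 < c2" using tx c2 by (simp add: \<delta>_def)
      ultimately have "\<forall>\<^sub>F s in at_right 0. \<tau> x + \<delta> s < c2" by (rule order_tendstoD(2))
      moreover have "\<forall>\<^sub>F s in at_right (0::real). 0 < s" by (rule eventually_at_right_less)
      ultimately have "\<forall>\<^sub>F s in at_right 0. norm (f (cc s) - f x - s *\<^sub>R w) \<le> e * \<bar>s\<bar> \<longrightarrow>
        2 * c2 * \<tau> (cc s) \<le> (h (cc s) + \<epsilon>)\<^sup>2 + (\<tau> (cc s))\<^sup>2"
      proof eventually_elim
        case (elim s)
        show ?case
        proof
          assume "norm (f (cc s) - f x - s *\<^sub>R w) \<le> e * \<bar>s\<bar>"
          then have "norm (f (cc s) - f x - s *\<^sub>R w) \<le> e * s" using elim(2) by simp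
          note st = step[OF this elim(2)]
          have t1: "\<tau> (cc s) \<le> \<tau> x + \<delta> s" using st(2) by (simp add: \<delta>_def)
          have "(c2 - (\<tau> x + \<delta> s))\<^sup>2 \<le> (c2 - \<tau> (cc s))\<^sup>2" using t1 elim(1) by (intro power_mono) auto
          then have "2 * c2 * \<tau> (cc s) - (\<tau> (cc s))\<^sup>2 \<le> 2 * c2 * (\<tau> x + \<delta> s) - (\<tau> x + \<delta> s)\<^sup>2"
            by (simp add: power2_diff)
          also have "\<dots> = H\<^sup>2 + 2 * ((c2 - \<tau> x) * \<delta> s) - (\<delta> s)\<^sup>2" using eq by (simp add: power2_sum algebra_simps)
          also have "\<dots> \<le> H\<^sup>2 + 2 * ((c2 - \<tau> x) * \<delta> s)" by simp
          also have "(c2 - \<tau> x) * \<delta> s = s * (H * (W - e) - g e)" by (simp add: \<delta>_def g_def algebra_simps)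
          also have "H\<^sup>2 + 2 * (s * (H * (W - e) - g e)) \<le> H\<^sup>2 + 2 * (s * (H * (W - e)))"
            using e(1) elim(2) by simp
          also have "\<dots> = H\<^sup>2 + 2 * H * (s * (W - e))" by (simp add: mult_ac)
          also have "\<dots> \<le> (H + s * (W - e))\<^sup>2" unfolding power2_sum by simp
          also have "\<dots> \<le> (h (cc s) + \<epsilon>)\<^sup>2"
          proof (rule power_mono)
            have "0 \<le> s * (W - e)" using elim(2) e(3) e1(3) by simp
            then show "0 \<le> H + s * (W - e)" using H0 by simp
          qed (use st(1) in \<open>simp add: H_def\<close>)
          finally show "2 * c2 * \<tau> (cc s) \<le> (h (cc s) + \<epsilon>)\<^sup>2 + (\<tau> (cc s))\<^sup>2" by simp
        qed
      qed
      then show ?thesis using e(2,3) by (meson less_imp_le)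
    qed
    then obtain e where e: "0 < e" "e \<le> e1" and e2: "\<forall>\<^sub>F s in at_right 0. norm (f (cc s) - f x - s *\<^sub>R w) \<le> e * \<bar>s\<bar> \<longrightarrow>
        2 * c2 * \<tau> (cc s) \<le> (h (cc s) + \<epsilon>)\<^sup>2 + (\<tau> (cc s))\<^sup>2" by blast
    have "\<forall>\<^sub>F s in at_right 0. 0 < s \<and> s < d \<and> cc s \<in> \<Omega> \<and> h x < h (cc s)"
    proof -
      have f1: "\<forall>\<^sub>F s in at_right 0. \<bar>s\<bar> < d \<and> norm (f (cc s) - f x - s *\<^sub>R w) \<le> e * \<bar>s\<bar> \<and>
          \<bar>norm (nor (cc s) u) - n\<bar> \<le> (\<kappa> * W + e) * \<bar>s\<bar>"
        using fv[OF e(1)] unfolding eventually_at_filter w_def[symmetric] W_def n_def by eventually_elim blast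
      have f3: "\<forall>\<^sub>F s in at_right 0. cc s \<in> {z \<in> topspace X. \<tau> z < c3} \<inter> {z \<in> topspace X. h z < c3}"
        using e3 unfolding eventually_at_filter by eventually_elim blast
      have f4: "\<forall>\<^sub>F s in at_right (0::real). 0 < s" by (rule eventually_at_right_less)
      show ?thesis using f1 e2 f3 f4
      proof eventually_elim
        case (elim s)
        have 1: "norm (f (cc s) - f x - s *\<^sub>R w) \<le> e * s" using elim by simp
        note st = step[OF this elim(4)]
        have "e * (1 + c1) \<le> e1 * (1 + c1)" using e(2) c1 by (intro mult_right_mono) auto
        then have "s * (e * (1 + c1)) \<le> s * (W * (1 - c1 * \<kappa>))" using e1(2) elim(4) by (intro mult_left_mono) auto
        then have "c1 * ((\<kappa> * W + e) * s) \<le> s * (W - e)" by (simp add: algebra_simps)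
        moreover have "c1 * norm (nor (cc s) u) \<le> c1 * (n + (\<kappa> * W + e) * s)"
          using elim c1 by (intro mult_left_mono) auto
        moreover have "c1 * (n + (\<kappa> * W + e) * s) = c1 * n + c1 * ((\<kappa> * W + e) * s)" by (simp add: distrib_left)
        ultimately have "c1 * norm (nor (cc s) u) \<le> h (cc s) + \<epsilon>" using st(1) c1n unfolding H_def by linarith
        moreover have "0 < s * (W - e)" using elim(4) e(2) e1(3) by simp
        ultimately show ?case using elim st(1) unfolding \<Omega>_def by auto
      qed
    qed
    then obtain r where r: "0 < r" "\<And>s. 0 < s \<Longrightarrow> s < r \<Longrightarrow> s < d \<and> cc s \<in> \<Omega> \<and> h x < h (cc s)"
      unfolding eventually_at_right_field by auto
    let ?C = "cc ` {0..r/2}"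
    have sub: "{0..r/2} \<subseteq> {-d<..<d}" using r(2)[of "r/2"] r(1) d by auto
    have C: "compactin X ?C" "connectedin X ?C"
      by (rule image_compactin[OF _ ccont], use sub in \<open>simp add: compactin_subtopology\<close>,
          rule connectedin_continuous_map_image[OF ccont], use sub in \<open>simp add: connectedin_subtopology\<close>)
    have "?C \<subseteq> \<Omega>"
    proof
      fix v assume "v \<in> ?C"
      then obtain s where s: "0 \<le> s" "s \<le> r/2" "v = cc s" by auto
      show "v \<in> \<Omega>"
      proof (cases "s = 0")
        case True then show ?thesis using s(3) c0 x\<Omega> by simp
      next
        case False then show ?thesis using r(2)[of s] s r(1) by auto
      qed
    qed
    moreover have "x \<in> ?C" using c0 r(1) by (auto intro!: image_eqI[of _ _ 0])
    moreover have "cc (r/2) \<in> ?C" using r(1) by simp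
    ultimately have "joined X \<Omega> x (cc (r/2))" using C by (blast intro: joinedI)
    then have "cc (r/2) \<in> E" using joined_trans[OF jx] by (simp add: E_def)
    then have "h (cc (r/2)) \<le> h x" using x(2) closure_of_subset[OF E\<Omega>(2)] by blast
    then show False using r(2)[of "r/2"] r(1) by auto
  qed
  then show thesis using that jx by blast
qed

text \<open>The first-order condition at a maximum of \<open>|f|^2\<close>, obtained from
  \<open>ascent\<close> with \<open>m = 0\<close>.\<close>

lemma farthest_normal:
  assumes p: "p \<in> topspace X" "\<And>x. x \<in> topspace X \<Longrightarrow> norm (f x) \<le> norm (f p)"
  shows "nor p (f p) = f p"
proof (rule ccontr)
  assume c0: "nor p (f p) \<noteq> f p"
  have G: "((\<lambda>v. (norm v)\<^sup>2) has_derivative (\<lambda>h. 2 * (f p \<bullet> h))) (at (f p))"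
    unfolding power2_norm_eq_inner by (auto intro!: derivative_eq_intros simp: inner_commute)
  have b: "\<bar>2 * (f p \<bullet> (f p - nor p (f p)))\<bar> = 2 * (norm (f p - nor p (f p)))\<^sup>2"
    unfolding nor_props(7)[OF p(1)] by simp
  obtain y where y: "y \<in> topspace X" "0 * \<bar>norm (nor y (f y)) - norm (nor p (f p))\<bar> < (norm (f y))\<^sup>2 - (norm (f p))\<^sup>2"
    by (rule ascent[where V = f and l = 1 and z = 0 and m = 0, OF p(1) _ G b _ _ c0 openin_topspace p(1)]) auto
  have "(norm (f y))\<^sup>2 \<le> (norm (f p))\<^sup>2" using p(2)[OF y(1)] by (intro power_mono) auto
  moreover have "(norm (f p))\<^sup>2 < (norm (f y))\<^sup>2" using y(2) by simp
  ultimately show False by linarith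
qed

text \<open>From \<open>|v| \<le> |P|\<close> the squared distance is at most
  \<open>m - 2 (Y \<bullet> \<rho>)\<close>. For a fixed direction \<open>k\<close> of
  \<open>\<rho>\<close> this is affine in \<open>\<tau>\<close>, so it is enough that it is below 3
  at both ends. At 0 it is \<open>m\<close>. At \<open>c3\<close> the constraint gives
  \<open>P \<bullet> k \<le> - c3\<close>, hence \<open>|P + c3 k| < 1/2\<close> because
  \<open>c3^2 > 3/4\<close>, and the bound follows from \<open>|P|, |Y| \<le> 1\<close>.\<close>

lemma walk_near:
  fixes P Y u v :: 'b
  assumes r: "norm P \<le> 1" "norm Y \<le> 1" "norm v \<le> norm P"
    and M: "(norm (P - Y))\<^sup>2 < 3" and u: "norm u = 1" "u \<bullet> P = 0" "u \<bullet> Y = 0"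
    and c: "0 < c3" "c3 < c2" "3 / 4 < c3\<^sup>2"
    and \<epsilon>: "2 * c3 * \<epsilon> + \<epsilon>\<^sup>2 \<le> (c2 - c3) * (3 - (norm (P - Y))\<^sup>2) / 2" "0 < \<epsilon>"
  defines "h \<equiv> (v - P) \<bullet> u" and "\<tau> \<equiv> norm (v - P - ((v - P) \<bullet> u) *\<^sub>R u)"
  assumes w: "2 * c2 * \<tau> \<le> (h + \<epsilon>)\<^sup>2 + \<tau>\<^sup>2" "\<tau> \<le> c3" "h \<le> c3"
  shows "(norm (v - Y))\<^sup>2 < 3"
proof -
  define m where "m = (norm (P - Y))\<^sup>2"
  define \<rho> where "\<rho> = v - P - h *\<^sub>R u"
  have uu: "u \<bullet> u = 1" using u(1) by (simp add: power2_norm_eq_inner[symmetric])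
  have t: "\<tau> = norm \<rho>" by (simp add: \<tau>_def \<rho>_def h_def)
  have \<rho>u: "\<rho> \<bullet> u = 0" unfolding \<rho>_def h_def by (simp add: inner_diff_left uu)
  have v: "v = P + h *\<^sub>R u + \<rho>" by (simp add: \<rho>_def)
  have exp: "(norm (Q + h *\<^sub>R u + \<rho>))\<^sup>2 = (norm Q)\<^sup>2 + h\<^sup>2 + \<tau>\<^sup>2 + 2 * (Q \<bullet> \<rho>)" if "u \<bullet> Q = 0" for Q
    unfolding t power2_norm_eq_inner using that \<rho>u uu
    by (simp add: inner_add_left inner_add_right inner_commute power2_eq_square)
  have "(norm v)\<^sup>2 \<le> (norm P)\<^sup>2" using r(3) by (intro power_mono) auto
  then have 1: "h\<^sup>2 + \<tau>\<^sup>2 + 2 * (P \<bullet> \<rho>) \<le> 0" using exp[OF u(2)] unfolding v by simp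
  have vY: "v - Y = (P - Y) + h *\<^sub>R u + \<rho>" by (simp add: v)
  have "(norm (v - Y))\<^sup>2 = m + h\<^sup>2 + \<tau>\<^sup>2 + 2 * ((P - Y) \<bullet> \<rho>)"
    unfolding vY using exp[of "P - Y"] u by (simp add: inner_diff_right m_def)
  then have 2: "(norm (v - Y))\<^sup>2 \<le> m - 2 * (Y \<bullet> \<rho>)" using 1 by (simp add: inner_diff_left)
  show ?thesis
  proof (cases "\<tau> < (3 - m) / 4")
    \<comment> \<open>For small \<open>\<tau>\<close> the slack \<open>\<epsilon>\<close> makes the
      constraint useless, but then the Cauchy-Schwarz inequality suffices.\<close>
    case True
    have "\<bar>Y \<bullet> \<rho>\<bar> \<le> norm Y * norm \<rho>" by (rule Cauchy_Schwarz_ineq2)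
    also have "\<dots> \<le> 1 * \<tau>" unfolding t using r(2) by (intro mult_right_mono) auto
    finally have "- (Y \<bullet> \<rho>) \<le> \<tau>" by simp
    moreover have "4 * \<tau> < 3 - m" using True by simp
    moreover have "m < 3" using M by (simp add: m_def)
    ultimately show ?thesis using 2 by linarith
  next
    case False
    have t0: "0 < \<tau>" using False M by (simp add: m_def)
    have "h * \<epsilon> \<le> c3 * \<epsilon>" using w(3) \<epsilon>(2) by (intro mult_right_mono) auto
    then have "(h + \<epsilon>)\<^sup>2 \<le> h\<^sup>2 + (2 * c3 * \<epsilon> + \<epsilon>\<^sup>2)" by (simp add: power2_sum)
    also have "2 * c3 * \<epsilon> + \<epsilon>\<^sup>2 \<le> (c2 - c3) * ((3 - m) / 2)" using \<epsilon>(1) by (simp add: m_def)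
    also have "(c2 - c3) * ((3 - m) / 2) \<le> (c2 - c3) * (2 * \<tau>)"
      using False c(2) by (intro mult_left_mono) auto
    finally have "(h + \<epsilon>)\<^sup>2 \<le> h\<^sup>2 + 2 * c2 * \<tau> - 2 * c3 * \<tau>" by (simp add: algebra_simps)
    then have P\<rho>: "P \<bullet> \<rho> \<le> - (c3 * \<tau>)" using w(1) 1 by linarith
    define k where "k = \<rho> /\<^sub>R \<tau>"
    have k1: "norm k = 1" using t0 by (simp add: k_def t)
    have kr: "\<rho> = \<tau> *\<^sub>R k" using t0 by (simp add: k_def)
    have "\<tau> * (P \<bullet> k) \<le> \<tau> * (- c3)" using P\<rho> by (simp add: kr mult.commute)
    then have Pk: "P \<bullet> k \<le> - c3" using t0 by (simp only: mult_le_cancel_left_pos)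
    have P1: "(norm P)\<^sup>2 \<le> 1" "(norm Y)\<^sup>2 \<le> 1" using r by (auto simp: power_le_one)
    have "(norm (P + c3 *\<^sub>R k))\<^sup>2 = (norm P)\<^sup>2 + 2 * (c3 * (P \<bullet> k)) + c3\<^sup>2"
      using k1 unfolding power2_norm_eq_inner norm_eq_1 by (simp add: inner_add_left inner_add_right inner_commute power2_eq_square)
    moreover have "c3 * (P \<bullet> k) \<le> c3 * (- c3)" using Pk c(1) by (intro mult_left_mono) auto
    ultimately have "(norm (P + c3 *\<^sub>R k))\<^sup>2 < (1/2)\<^sup>2" using P1 c(3) by (simp add: power2_eq_square)
    then have half: "norm (P + c3 *\<^sub>R k) < 1/2" by (rule power2_less_imp_less) simp
    have "\<bar>Y \<bullet> (P + c3 *\<^sub>R k)\<bar> \<le> norm Y * norm (P + c3 *\<^sub>R k)" by (rule Cauchy_Schwarz_ineq2)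
    also have "\<dots> \<le> 1 * norm (P + c3 *\<^sub>R k)" using r(2) by (intro mult_right_mono) auto
    finally have "- (Y \<bullet> (P + c3 *\<^sub>R k)) < 1/2" using half by simp
    moreover have "m - 2 * c3 * (Y \<bullet> k) = (norm P)\<^sup>2 + (norm Y)\<^sup>2 - 2 * (Y \<bullet> (P + c3 *\<^sub>R k))"
      unfolding m_def power2_norm_eq_inner by (simp add: inner_diff_left inner_diff_right inner_add_right inner_commute)
    ultimately have end1: "m - 2 * c3 * (Y \<bullet> k) < 3" using P1 by linarith
    have "c3 * (m - 2 * (Y \<bullet> \<rho>)) = (c3 - \<tau>) * m + \<tau> * (m - 2 * c3 * (Y \<bullet> k))"
      by (simp add: kr algebra_simps)
    also have "\<dots> < (c3 - \<tau>) * 3 + \<tau> * 3"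
      using M w(2) t0 end1 by (intro add_le_less_mono mult_left_mono mult_strict_left_mono) (auto simp: m_def)
    finally have "c3 * (m - 2 * (Y \<bullet> \<rho>)) < c3 * 3" by (simp add: algebra_simps)
    then have "m - 2 * (Y \<bullet> \<rho>) < 3" using c(1) by (simp only: mult_less_cancel_left_pos)
    then show ?thesis using 2 by simp
  qed
qed

text \<open>
  If \<open>y\<close> were closer to \<open>p\<close>, walks from \<open>p\<close> in the directions \<open>\<plusminus>u\<close> with \<open>u\<close> perpendicular to \<open>f y\<close> would stay within
  distance \<open>\<surd>3\<close> of \<open>f y\<close>, so that \<open>y\<close> is not on the sheet of any point of the walks; but they end more than \<open>\<surd>3\<close> apart,
  and the sheets of two of their points cover the manifold.
\<close>

lemma off_sheet_far:
  assumes dim: "2 \<le> DIM('e)" and c: "3 / 4 < c\<^sup>2" "0 < c" "c * \<kappa> < 1" and s: "sqrt 3 < s" "s < 2 * c"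
    and p: "p \<in> topspace X" "\<And>x. x \<in> topspace X \<Longrightarrow> norm (f x) \<le> norm (f p)"
    and y: "y \<in> topspace X" "y \<notin> sheet p s"
  shows "3 \<le> (norm (f y - f p))\<^sup>2"
proof (rule ccontr)
  assume "\<not> 3 \<le> (norm (f y - f p))\<^sup>2"
  then have M: "(norm (f p - f y))\<^sup>2 < 3" by (simp add: norm_minus_commute)
  have "(sqrt 3 / 2)\<^sup>2 < c\<^sup>2" using c(1) by (simp add: power_divide)
  then have "sqrt 3 / 2 < c" by (rule power2_less_imp_less) (use c in simp)
  then obtain c3 where c3: "sqrt 3 / 2 < c3" "c3 < c" using dense by blast
  then obtain c2 where c2: "c3 < c2" "c2 < c" using dense by blast
  have c30: "0 < c3" using c3(1) by (meson less_trans real_sqrt_gt_zero half_gt_zero zero_less_numeral)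
  have "(sqrt 3 / 2)\<^sup>2 < c3\<^sup>2" using c3(1) by (intro power_strict_mono) auto
  then have c34: "3 / 4 < c3\<^sup>2" by (simp add: power_divide)
  \<comment> \<open>The first entry is the slack that \<open>walk_near\<close> tolerates, the second
    one yields the condition on \<open>\<epsilon>\<close> in \<open>walk\<close>.\<close>
  define b where "b = min ((c2 - c3) * (3 - (norm (f p - f y))\<^sup>2) / 2) (c3 * (c2 - c3))"
  have b: "0 < b" using c2 c30 M by (simp add: b_def)
  have "((\<lambda>\<epsilon>. 2 * c3 * \<epsilon> + \<epsilon>\<^sup>2) \<longlongrightarrow> 2 * c3 * 0 + 0\<^sup>2) (at_right 0)" by (intro tendsto_intros)
  then have "\<forall>\<^sub>F \<epsilon> in at_right 0. 2 * c3 * \<epsilon> + \<epsilon>\<^sup>2 < b" using b by (intro order_tendstoD(2)) auto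
  moreover have "\<forall>\<^sub>F \<epsilon> in at_right (0::real). 0 < \<epsilon>" by (rule eventually_at_right_less)
  ultimately have "\<forall>\<^sub>F \<epsilon> in at_right 0. 2 * c3 * \<epsilon> + \<epsilon>\<^sup>2 < b \<and> 0 < \<epsilon>" by eventually_elim simp
  then obtain \<epsilon> where \<epsilon>: "2 * c3 * \<epsilon> + \<epsilon>\<^sup>2 < b" "0 < \<epsilon>"
    using eventually_happens' trivial_limit_at_right_real by blast
  have \<epsilon>1: "2 * c3 * \<epsilon> + \<epsilon>\<^sup>2 \<le> (c2 - c3) * (3 - (norm (f p - f y))\<^sup>2) / 2" using \<epsilon>(1) by (simp add: b_def)
  have "2 * c3 * \<epsilon> + \<epsilon>\<^sup>2 < c3 * (c2 - c3)" using \<epsilon>(1) by (simp add: b_def)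
  moreover have "0 < c3 * (c2 - c3)" using c2 c30 by simp
  moreover have "(c3 + \<epsilon>)\<^sup>2 + c3\<^sup>2 = 2 * c2 * c3 + (2 * c3 * \<epsilon> + \<epsilon>\<^sup>2) - 2 * (c3 * (c2 - c3))"
    by (simp add: power2_eq_square algebra_simps)
  ultimately have \<epsilon>2: "(c3 + \<epsilon>)\<^sup>2 + c3\<^sup>2 < 2 * c2 * c3" by linarith
  obtain u where u: "u \<in> tangent p" "norm u = 1" "u \<bullet> f y = 0" by (rule tangent_perp[OF p(1) dim]) (rule that)
  have uP: "w \<bullet> f p = 0" if "w \<in> tangent p" for w
    using nor_props(2)[OF p(1) that, of "f p"] farthest_normal[OF p] by (simp add: inner_commute)
  let ?B = "{z. (norm (f z - f y))\<^sup>2 < 3}"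
  have go: "\<exists>q. joined X ?B p q \<and> (f q - f p) \<bullet> w = c3" if w: "w \<in> tangent p" "norm w = 1" "w \<bullet> f y = 0" for w
  proof -
    define \<Omega> where "\<Omega> = {z \<in> topspace X. c * norm (nor z w) \<le> (f z - f p) \<bullet> w + \<epsilon> \<and>
      2 * c2 * norm (f z - f p - ((f z - f p) \<bullet> w) *\<^sub>R w) \<le> ((f z - f p) \<bullet> w + \<epsilon>)\<^sup>2 + (norm (f z - f p - ((f z - f p) \<bullet> w) *\<^sub>R w))\<^sup>2 \<and>
      norm (f z - f p - ((f z - f p) \<bullet> w) *\<^sub>R w) \<le> c3 \<and> (f z - f p) \<bullet> w \<le> c3}"
    obtain q where q: "joined X \<Omega> p q" "(f q - f p) \<bullet> w = c3"
      by (rule walk[OF p(1) w(1,2) c30 c2(2) c(3) \<epsilon>(2) \<epsilon>2, folded \<Omega>_def]) (rule that)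
    have "\<Omega> \<subseteq> ?B"
    proof
      fix z assume z: "z \<in> \<Omega>"
      then have zX: "z \<in> topspace X" by (simp add: \<Omega>_def)
      have "(norm (f z - f y))\<^sup>2 < 3"
        by (rule walk_near[OF ball[OF p(1)] ball[OF y(1)] p(2)[OF zX] M w(2) uP[OF w(1)] w(3) c30 c2(1) c34 \<epsilon>1 \<epsilon>(2)])
          (use z in \<open>simp_all add: \<Omega>_def\<close>)
      then show "z \<in> ?B" by simp
    qed
    then have "joined X ?B p q" by (rule joined_mono[OF q(1)])
    then show ?thesis using q(2) by blast
  qed
  obtain q where q: "joined X ?B p q" "(f q - f p) \<bullet> u = c3" using go[OF u] by blast
  have "- u \<in> tangent p" using subspace_neg[OF tangent_subspace[OF p(1)] u(1)] .
  then obtain q' where q': "joined X ?B p q'" "(f q' - f p) \<bullet> (- u) = c3" using go[of "- u"] u by auto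
  have "joined X ?B q q'" "joined X ?B q p" using joined_trans[OF joined_sym[OF q(1)] q'(1)] joined_sym[OF q(1)] .
  then obtain C C' where C: "connectedin X C" "C \<subseteq> ?B" "q \<in> C" "q' \<in> C"
    and C': "connectedin X C'" "C' \<subseteq> ?B" "q \<in> C'" "p \<in> C'" by (metis joinedE)
  let ?C = "C \<union> C'"
  have CC: "connectedin X ?C" using C C' by (intro connectedin_Un) auto
  have CX: "?C \<subseteq> topspace X" by (rule connectedin_subset_topspace[OF CC])
  have Cs: "norm (f k - f y) < s" if "k \<in> ?C" for k
  proof -
    have "(norm (f k - f y))\<^sup>2 < (sqrt 3)\<^sup>2" using that C(2) C'(2) by auto
    then have "norm (f k - f y) < sqrt 3" by (rule power2_less_imp_less) simp
    then show ?thesis using s(1) by simp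
  qed
  have nk: "y \<notin> sheet k s" if k: "k \<in> ?C" for k
    using sheet_stable[OF c(2,3) s(2) y(1) CC Cs k, of p] y(2) C'(4) by blast
  have qX: "q \<in> topspace X" and q'X: "q' \<in> topspace X" using C CX by auto
  have qq: "sqrt 3 < norm (f q' - f q)"
  proof -
    have "(f q - f q') \<bullet> u = 2 * c3" using q(2) q'(2) by (simp add: inner_diff_left)
    then have "2 * c3 \<le> norm (f q - f q')" using Cauchy_Schwarz_ineq2[of "f q - f q'" u] u(2) by simp
    then show ?thesis using c3(1) by (simp add: norm_minus_commute)
  qed
  have "0 < sqrt (3::real)" by simp
  then have s0: "0 < s" "0 \<le> s" using s(1) by linarith+
  \<comment> \<open>If all points of \<open>?C\<close> on the sheet of \<open>q\<close> were within
    \<open>\<surd>3\<close>, which is less than \<open>s\<close>, the sheet would be open and closed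
    relative to \<open>?C\<close>. It would contain \<open>q'\<close>, which is too far
    away.\<close>
  obtain k where k: "k \<in> ?C" "k \<in> sheet q s" "sqrt 3 < norm (f k - f q)"
  proof (rule ccontr)
    assume no: "\<not> thesis"
    then have le: "norm (f k - f q) \<le> sqrt 3" if "k \<in> ?C" "k \<in> sheet q s" for k
      using that \<open>\<And>k. k \<in> ?C \<Longrightarrow> k \<in> sheet q s \<Longrightarrow> sqrt 3 < norm (f k - f q) \<Longrightarrow> thesis\<close> by (meson not_le)
    let ?V = "{w \<in> topspace X. sqrt 3 < norm (f w - f q)} \<union> (topspace X - csheet q s)"
    have V: "openin X ?V" using open_less[OF _ distance_continuous, of "\<lambda>_. sqrt 3"] closedin_csheet[OF qX]
      by (intro openin_Un) (auto intro: openin_diff)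
    have "?C \<subseteq> sheet q s \<union> ?V"
    proof
      fix w assume w: "w \<in> ?C"
      show "w \<in> sheet q s \<union> ?V"
        using csheetD(3)[OF qX s0(2), of w] s0 s(1) w CX by (cases "w \<in> csheet q s"; cases "norm (f w - f q) < s") auto
    qed
    moreover have "sheet q s \<inter> ?V \<inter> ?C = {}" using le sheet_subset_csheet by fastforce
    moreover have "q \<in> sheet q s" by (rule mem_sheet_self[OF qX s0(1)])
    ultimately have "?C \<subseteq> sheet q s" using connectedin_cover_cases[OF CC openin_sheet V, of q] C(3) by blast
    then show False using le[of q'] C(4) qq by auto
  qed
  have "topspace X = sheet q s \<union> sheet k s" by (rule two_sheets[OF dim c(2,3) qX s k(2,3)])
  then show False using nk[OF k(1)] nk[of q] C(3) y(1) by blast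
qed

end

section \<open>The farthest point from the origin\<close>

text \<open>Subtracting \<open>(n \<bullet> P) P\<close> from \<open>n\<close> does not change the
  product with \<open>w\<close> and, as \<open>|P| \<le> 1\<close>, leaves a vector of squared norm
  at most \<open>|n|^2 - (n \<bullet> P)^2\<close>.\<close>

lemma perp_bound:
  fixes n P w :: "'b::real_inner"
  assumes "w \<bullet> P = 0" "norm P \<le> 1"
  shows "\<bar>n \<bullet> w\<bar> \<le> norm w * sqrt ((norm n)\<^sup>2 - (n \<bullet> P)\<^sup>2)" "(n \<bullet> P)\<^sup>2 \<le> (norm n)\<^sup>2"
proof -
  let ?n = "n - (n \<bullet> P) *\<^sub>R P"
  have "(norm ?n)\<^sup>2 = (norm n)\<^sup>2 - 2 * (n \<bullet> P)\<^sup>2 + (n \<bullet> P)\<^sup>2 * (norm P)\<^sup>2"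
    unfolding power2_norm_eq_inner by (simp add: inner_diff_left inner_diff_right inner_commute power2_eq_square)
  moreover have "(n \<bullet> P)\<^sup>2 * (norm P)\<^sup>2 \<le> (n \<bullet> P)\<^sup>2 * 1"
    using assms(2) by (intro mult_left_mono) (auto simp: power_le_one)
  ultimately have le: "(norm ?n)\<^sup>2 \<le> (norm n)\<^sup>2 - (n \<bullet> P)\<^sup>2" by linarith
  have "0 \<le> (norm ?n)\<^sup>2" by simp
  then show "(n \<bullet> P)\<^sup>2 \<le> (norm n)\<^sup>2" using le by linarith
  have "n \<bullet> w = ?n \<bullet> w" using assms(1) by (simp add: inner_diff_left inner_diff_right inner_commute)
  then have "\<bar>n \<bullet> w\<bar> \<le> norm ?n * norm w" using Cauchy_Schwarz_ineq2[of ?n w] by simp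
  also have "\<dots> \<le> sqrt ((norm n)\<^sup>2 - (n \<bullet> P)\<^sup>2) * norm w"
    using real_le_rsqrt[OF le] by (intro mult_right_mono) auto
  finally show "\<bar>n \<bullet> w\<bar> \<le> norm w * sqrt ((norm n)\<^sup>2 - (n \<bullet> P)\<^sup>2)" by (simp add: mult.commute)
qed

text \<open>Serves \<open>shell\<close> for points closer than \<open>\<surd>3\<close> to
  \<open>f p\<close>: \<open>M\<close> is the squared distance, \<open>G\<close> the product of the
  normal part of \<open>f y - f p\<close> with \<open>- f p\<close>, \<open>x\<close> bounds what is
  perpendicular to \<open>f p\<close>, and \<open>R\<close> is the norm of \<open>k\<close>. After
  \<open>x\<close> is replaced by a linear bound, the estimates are linear in \<open>G\<close>, so
  the ends \<open>M/2\<close> and \<open>2 M/3\<close> of its range decide.\<close>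

lemma near_scalar:
  fixes M G x b R \<mu> :: real
  assumes M: "0 \<le> M" "M \<le> 3" and G: "M / 2 \<le> G" and x: "0 \<le> x" "x\<^sup>2 \<le> M\<^sup>2 / 3 - G\<^sup>2"
    and b: "\<bar>b\<bar> \<le> 2 * R * x" and R: "0 \<le> R"
  shows "\<mu> \<le> 1 \<Longrightarrow> \<mu> * G + b - M \<le> max 0 (sqrt 3 * R - 3 / 2)"
    "1 \<le> \<mu> \<Longrightarrow> M - \<mu> * G - b \<le> 3 / 2 + sqrt 3 * R"
proof -
  have G2: "G \<le> 2 * M / 3"
  proof (rule power2_le_imp_le)
    have "G\<^sup>2 \<le> M\<^sup>2 / 3" using x(2) zero_le_power2[of x] by linarith
    also have "\<dots> \<le> (2 * M / 3)\<^sup>2" by (simp add: power_divide power_mult_distrib)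
    finally show "G\<^sup>2 \<le> (2 * M / 3)\<^sup>2" .
  qed (use M in simp)
  have G0: "0 \<le> G" using M G by linarith
  \<comment> \<open>The tangent to the circle \<open>x^2 + G^2 = M^2/3\<close> at its point with
    \<open>G = M/2\<close>, the end of the admissible arc.\<close>
  have xle: "x \<le> sqrt 3 * (2 * M / 3 - G)"
  proof (rule power2_le_imp_le)
    have "(sqrt 3 * (2 * M / 3 - G))\<^sup>2 - (M\<^sup>2 / 3 - G\<^sup>2) = (M - 2 * G)\<^sup>2"
      unfolding power_mult_distrib by (simp add: power2_eq_square field_simps)
    then show "x\<^sup>2 \<le> (sqrt 3 * (2 * M / 3 - G))\<^sup>2" using x(2) zero_le_power2[of "M - 2 * G"] by linarith
  qed (use G2 in simp)
  define K where "K = sqrt 3 * R"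
  have K: "0 \<le> K" using R by (simp add: K_def)
  have "2 * R * x \<le> 2 * R * (sqrt 3 * (2 * M / 3 - G))" using R xle by (intro mult_left_mono) auto
  also have "\<dots> = 2 * K * (2 * M / 3 - G)" by (simp add: K_def)
  finally have bK: "\<bar>b\<bar> \<le> 2 * K * (2 * M / 3 - G)" using b by linarith
  show "\<mu> * G + b - M \<le> max 0 (sqrt 3 * R - 3 / 2)" if \<mu>: "\<mu> \<le> 1"
  proof -
    have "\<mu> * G \<le> 1 * G" using \<mu> G0 by (rule mult_right_mono)
    then have 1: "\<mu> * G + b - M \<le> G * (1 - 2 * K) - M + 4 * (K * M) / 3" using bK by (simp add: algebra_simps)
    show ?thesis
    proof (cases "1 - 2 * K \<le> 0")
      case True
      then have "G * (1 - 2 * K) \<le> M / 2 * (1 - 2 * K)" using G by (rule mult_right_mono_neg[rotated])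
      then have "\<mu> * G + b - M \<le> M * (K / 3 - 1 / 2)" using 1 by (simp add: algebra_simps)
      also have "\<dots> \<le> max 0 (K - 3 / 2)"
      proof (cases "K / 3 - 1 / 2 \<le> 0")
        case True then show ?thesis using M(1) mult_nonneg_nonpos[of M "K / 3 - 1 / 2"] by simp
      next
        case False
        then have "M * (K / 3 - 1 / 2) \<le> 3 * (K / 3 - 1 / 2)" using M(2) by (intro mult_right_mono) auto
        then show ?thesis by simp
      qed
      finally show ?thesis by (simp add: K_def)
    next
      case False
      then have "G * (1 - 2 * K) \<le> 2 * M / 3 * (1 - 2 * K)" using G2 by (intro mult_right_mono) auto
      then have "\<mu> * G + b - M \<le> - (M / 3)" using 1 by (simp add: algebra_simps)
      then show ?thesis using M(1) by simp
    qed
  qed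
  show "M - \<mu> * G - b \<le> 3 / 2 + sqrt 3 * R" if \<mu>: "1 \<le> \<mu>"
  proof -
    have "1 * G \<le> \<mu> * G" using \<mu> G0 by (rule mult_right_mono)
    then have "M - \<mu> * G - b \<le> M - G + 2 * K * (2 * M / 3 - G)" using bK by linarith
    also have "2 * K * (2 * M / 3 - G) \<le> 2 * K * (2 * M / 3 - M / 2)" using K G by (intro mult_left_mono) auto
    also have "M - G + 2 * K * (2 * M / 3 - M / 2) \<le> M / 2 + K * M / 3" using G by (simp add: algebra_simps)
    also have "\<dots> \<le> 3 / 2 + K * 3 / 3" using M(2) K by (intro add_mono divide_right_mono mult_left_mono) auto
    finally show ?thesis by (simp add: K_def)
  qed
qed

text \<open>Serves \<open>shell\<close> for the other points: \<open>N\<close> is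
  \<open>|f y|^2\<close>, \<open>v\<close> is \<open>f y \<bullet> f p\<close> and \<open>r\<close>
  is \<open>|f p|^2\<close>. The assumption on \<open>N - 2 * v\<close> is what
  \<open>M \<ge> 3\<close> and \<open>r \<le> 1\<close> leave.\<close>

lemma far_scalar:
  fixes N v x b R \<mu> r M :: real
  assumes N: "N \<le> 1" and v: "2 \<le> N - 2 * v" and x: "0 \<le> x" "x\<^sup>2 \<le> N - v\<^sup>2"
    and b: "\<bar>b\<bar> \<le> 2 * R * x" and R: "0 \<le> R" and r: "0 \<le> r - v" and M: "M = N - 2 * v + r"
  shows "\<mu> \<le> 1 \<Longrightarrow> \<mu> * (r - v) + b - M \<le> max 0 (sqrt 3 * R - 3 / 2)"
    "1 \<le> \<mu> \<Longrightarrow> M - \<mu> * (r - v) - b \<le> 3 / 2 + sqrt 3 * sqrt (R\<^sup>2 + 3 / 4)"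
proof -
  have N0: "0 \<le> N" using x(2) zero_le_power2[of x] zero_le_power2[of v] by linarith
  show "\<mu> * (r - v) + b - M \<le> max 0 (sqrt 3 * R - 3 / 2)" if \<mu>: "\<mu> \<le> 1"
  proof -
    \<comment> \<open>Eliminating \<open>v\<close> by \<open>2 \<le> N - 2 * v\<close> leaves a
      difference of squares equal to \<open>(1 - N)^2\<close>, so nothing is lost for points on the
      unit sphere.\<close>
    have xle: "x \<le> sqrt 3 / 2 * N"
    proof (rule power2_le_imp_le)
      have "((2 - N) / 2)\<^sup>2 \<le> (- v)\<^sup>2" using v N by (intro power_mono) auto
      then have "N - v\<^sup>2 \<le> N - ((2 - N) / 2)\<^sup>2" by simp
      moreover have "(sqrt 3 / 2 * N)\<^sup>2 - (N - ((2 - N) / 2)\<^sup>2) = (1 - N)\<^sup>2"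
        unfolding power_mult_distrib power_divide by (simp add: power2_eq_square field_simps)
      ultimately show "x\<^sup>2 \<le> (sqrt 3 / 2 * N)\<^sup>2" using x(2) zero_le_power2[of "1 - N"] by linarith
    qed (use N0 in simp)
    define K where "K = sqrt 3 * R"
    have "2 * R * x \<le> 2 * R * (sqrt 3 / 2 * N)" using R xle by (intro mult_left_mono) auto
    also have "\<dots> = K * N" by (simp add: K_def)
    finally have bK: "b \<le> K * N" using b by linarith
    have "\<mu> * (r - v) \<le> r - v" using mult_right_mono[OF \<mu> r] by simp
    then have "\<mu> * (r - v) + b - M \<le> v - N + K * N" using bK M by linarith
    also have "\<dots> \<le> - 1 + N * (K - 1 / 2)" using v by (simp add: algebra_simps)
    also have "\<dots> \<le> max 0 (K - 3 / 2)"
    proof (cases "K - 1 / 2 \<le> 0")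
      case True then show ?thesis using N0 mult_nonneg_nonpos[of N "K - 1 / 2"] by simp
    next
      case False
      then have "N * (K - 1 / 2) \<le> 1 * (K - 1 / 2)" using N by (intro mult_right_mono) auto
      then show ?thesis by simp
    qed
    finally show ?thesis by (simp add: K_def)
  qed
  show "M - \<mu> * (r - v) - b \<le> 3 / 2 + sqrt 3 * sqrt (R\<^sup>2 + 3 / 4)" if \<mu>: "1 \<le> \<mu>"
  proof -
    \<comment> \<open>The admissible pairs \<open>(x, a)\<close> lie in the ellipse
      \<open>4 x^2 + 4/3 a^2 \<le> 3\<close>, and on it the Cauchy-Schwarz inequality bounds the
      linear form \<open>2 R x + a\<close>. This is the origin of the square root of
      \<open>R^2 + 3/4\<close>.\<close>
    define a where "a = N - v - 3 / 2"
    have "x\<^sup>2 + a\<^sup>2 / 3 \<le> 3 / 4"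
    proof -
      have "9 / 4 - 3 * N + 3 * v\<^sup>2 - a\<^sup>2 = (1 - N) * (3 + (N - 2 * v - 2)) + (- v - 1 / 2) * (3 * (1 / 2 - v) - (- v - 1 / 2))"
        unfolding a_def by (simp add: power2_eq_square field_simps)
      moreover have "0 \<le> (1 - N) * (3 + (N - 2 * v - 2))" using N v by simp
      moreover have "0 \<le> (- v - 1 / 2) * (3 * (1 / 2 - v) - (- v - 1 / 2))" using N v by (intro mult_nonneg_nonneg) auto
      ultimately show ?thesis using x(2) by linarith
    qed
    then have q: "4 * x\<^sup>2 + 4 / 3 * a\<^sup>2 \<le> 3" by linarith
    have "2 * R * x + a \<le> sqrt 3 * sqrt (R\<^sup>2 + 3 / 4)"
    proof (rule power2_le_imp_le)
      have "(R\<^sup>2 + 3 / 4) * (4 * x\<^sup>2 + 4 / 3 * a\<^sup>2) - (2 * R * x + a)\<^sup>2 = (2 / sqrt 3 * R * a - sqrt 3 * x)\<^sup>2"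
        by (simp add: power2_diff power2_sum power_mult_distrib power_divide field_simps)
      then have "(2 * R * x + a)\<^sup>2 \<le> (R\<^sup>2 + 3 / 4) * (4 * x\<^sup>2 + 4 / 3 * a\<^sup>2)"
        using zero_le_power2[of "2 / sqrt 3 * R * a - sqrt 3 * x"] by linarith
      also have "\<dots> \<le> (R\<^sup>2 + 3 / 4) * 3" using q by (intro mult_left_mono) auto
      also have "\<dots> = (sqrt 3 * sqrt (R\<^sup>2 + 3 / 4))\<^sup>2" by (simp add: power_mult_distrib)
      finally show "(2 * R * x + a)\<^sup>2 \<le> (sqrt 3 * sqrt (R\<^sup>2 + 3 / 4))\<^sup>2" .
    qed simp
    moreover have "r - v \<le> \<mu> * (r - v)" using mult_right_mono[OF \<mu> r] by simp
    ultimately show ?thesis using b M unfolding a_def by linarith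
  qed
qed

locale farthest = closed_immersed X A f \<kappa> for X :: "'a topology" and A :: "('a, 'e::euclidean_space) atlas"
    and f :: "'a \<Rightarrow> 'b::euclidean_space" and \<kappa> +
  fixes c :: real and p :: 'a
  assumes dim: "2 \<le> DIM('e)" and c: "3 / 4 < c\<^sup>2" "0 < c" "c * \<kappa> < 1"
    and p: "p \<in> topspace X" "\<And>x. x \<in> topspace X \<Longrightarrow> norm (f x) \<le> norm (f p)"
begin

lemma c_gt: "sqrt 3 / 2 < c"
proof (rule power2_less_imp_less)
  show "(sqrt 3 / 2)\<^sup>2 < c\<^sup>2" using c(1) by (simp add: power_divide)
qed (use c in simp)

text \<open>A good sheet around \<open>p\<close> would bound the normal part at \<open>y\<close>,
  but the one at \<open>p\<close> is wanted; symmetry of sheets puts \<open>p\<close> on the good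
  sheet of \<open>y\<close>. Points off the sheet are far away by
  \<open>off_sheet_far\<close>.\<close>

lemma dichotomy:
  assumes y: "y \<in> topspace X"
  shows "y = p \<or> 2 * c * norm (nor p (f y - f p)) < (norm (f y - f p))\<^sup>2 \<or> 3 \<le> (norm (f y - f p))\<^sup>2"
proof -
  have "sqrt 3 < 2 * c" using c_gt by simp
  then obtain s where s: "sqrt 3 < s" "s < 2 * c" using dense by blast
  show ?thesis
  proof (cases "y \<in> sheet p s")
    case True
    have "p \<in> sheet y s" by (rule sheet_sym[OF c(2,3) s(2) True])
    then have "p \<in> good c y" using sheet_good[OF c(2,3) y s(2)] by blast
    moreover have "nor p (f p - f y) = - nor p (f y - f p)"
      using linear_neg[OF nor_props(1)[OF p(1)], of "f y - f p"] by simp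
    ultimately show ?thesis unfolding good_def by (auto simp: norm_minus_commute)
  next
    case False
    then show ?thesis using off_sheet_far[OF dim c s p y] by blast
  qed
qed

lemma below:
  assumes "y \<in> topspace X"
  shows "(norm (f y - f p))\<^sup>2 \<le> - 2 * ((f y - f p) \<bullet> f p)"
proof -
  have "(norm (f y))\<^sup>2 \<le> (norm (f p))\<^sup>2" using p(2)[OF assms] by (intro power_mono) auto
  then show ?thesis unfolding power2_norm_eq_inner by (simp add: inner_diff_left inner_diff_right inner_commute)
qed

text \<open>Estimates how far \<open>f y\<close> can lie inside or outside the sphere around
  \<open>f p + k\<close> through \<open>f p\<close>, which touches the manifold at \<open>p\<close>.
  For \<open>f p \<noteq> 0\<close>, the condition \<open>\<mu> \<le> 1\<close> means that the
  centre is at least as close to \<open>f p\<close> as to the origin. The vector \<open>2 k\<close>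
  splits into \<open>w\<close> perpendicular to \<open>f p\<close> and a multiple of
  \<open>f p\<close>; the former is bounded by Cauchy-Schwarz, the latter by \<open>p\<close> being
  farthest.\<close>

lemma shell:
  assumes y: "y \<in> topspace X" and k: "nor p k = k" and \<mu>: "(2 *\<^sub>R k + \<mu> *\<^sub>R f p) \<bullet> f p = 0"
  shows "\<mu> \<le> 1 \<Longrightarrow> 2 * ((f y - f p) \<bullet> k) - (norm (f y - f p))\<^sup>2 \<le> max 0 (sqrt 3 * norm k - 3 / 2)"
    "1 \<le> \<mu> \<Longrightarrow> (norm (f y - f p))\<^sup>2 - 2 * ((f y - f p) \<bullet> k) \<le> 3 / 2 + sqrt 3 * sqrt ((norm k)\<^sup>2 + 3 / 4)"
proof -
  define D where "D = f y - f p"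
  define M where "M = (norm D)\<^sup>2"
  define w where "w = 2 *\<^sub>R k + \<mu> *\<^sub>R f p"
  have wP: "w \<bullet> f p = 0" using \<mu> by (simp add: w_def)
  have P1: "norm (f p) \<le> 1" by (rule ball[OF p(1)])
  have k2: "2 *\<^sub>R k = w - \<mu> *\<^sub>R f p" by (simp add: w_def)
  have w2: "norm w \<le> 2 * norm k"
  proof (rule power2_le_imp_le)
    have "(norm (2 *\<^sub>R k))\<^sup>2 = (norm w)\<^sup>2 + \<mu>\<^sup>2 * (norm (f p))\<^sup>2"
      unfolding k2 power2_norm_eq_inner using wP
      by (simp add: inner_diff_left inner_diff_right inner_commute power2_eq_square)
    moreover have "0 \<le> \<mu>\<^sup>2 * (norm (f p))\<^sup>2" by simp
    ultimately show "(norm w)\<^sup>2 \<le> (2 * norm k)\<^sup>2" by simp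
  qed simp
  have Dk: "2 * (D \<bullet> k) = n \<bullet> w - \<mu> * (n \<bullet> f p)" if "n \<bullet> k = D \<bullet> k" for n
  proof -
    have "2 * (n \<bullet> k) = n \<bullet> (2 *\<^sub>R k)" by simp
    then show ?thesis using that unfolding k2 by (simp add: inner_diff_right)
  qed
  have M0: "0 \<le> M" by (simp add: M_def)
  have "(\<mu> \<le> 1 \<longrightarrow> 2 * (D \<bullet> k) - M \<le> max 0 (sqrt 3 * norm k - 3 / 2)) \<and>
    (1 \<le> \<mu> \<longrightarrow> M - 2 * (D \<bullet> k) \<le> 3 / 2 + sqrt 3 * sqrt ((norm k)\<^sup>2 + 3 / 4))"
  proof (cases "3 \<le> M")
    case False
    \<comment> \<open>Both \<open>k\<close> and \<open>f p\<close> are normal at \<open>p\<close>,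
      so \<open>D\<close> may be replaced by its normal part, for which the dichotomy gives
      \<open>2 * c * norm n \<le> M\<close>.\<close>
    define n where "n = nor p D"
    have self: "D \<bullet> v = n \<bullet> v" if "nor p v = v" for v
    proof -
      have "nor p v \<bullet> (D - nor p D) = 0" using nor_props(2,3)[OF p(1)] by blast
      then show ?thesis using that by (simp add: n_def inner_diff_right inner_commute)
    qed
    have nM: "(norm n)\<^sup>2 \<le> M\<^sup>2 / 3"
    proof -
      have "2 * c * norm n \<le> M"
        using dichotomy[OF y] False linear_0[OF nor_props(1)[OF p(1)]] unfolding n_def D_def M_def by auto
      then have "(2 * c * norm n)\<^sup>2 \<le> M\<^sup>2" using c by (intro power_mono) auto
      moreover have "3 * (norm n)\<^sup>2 \<le> (4 * c\<^sup>2) * (norm n)\<^sup>2" using c(1) by (intro mult_right_mono) auto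
      ultimately show ?thesis by (simp add: power_mult_distrib)
    qed
    let ?x = "sqrt ((norm n)\<^sup>2 - (n \<bullet> f p)\<^sup>2)"
    have G: "M / 2 \<le> - (n \<bullet> f p)" using below[OF y] self[OF farthest_normal[OF p]] by (simp add: D_def M_def)
    have x: "0 \<le> ?x" "?x\<^sup>2 \<le> M\<^sup>2 / 3 - (- (n \<bullet> f p))\<^sup>2" using perp_bound(2)[OF wP P1, of n] nM by auto
    have "\<bar>n \<bullet> w\<bar> \<le> norm w * ?x" by (rule perp_bound(1)[OF wP P1])
    also have "\<dots> \<le> 2 * norm k * ?x" using w2 x(1) by (intro mult_right_mono) auto
    finally have b: "\<bar>n \<bullet> w\<bar> \<le> 2 * norm k * ?x" .
    have M3: "M \<le> 3" using False by simp
    have "sqrt 3 * norm k \<le> sqrt 3 * sqrt ((norm k)\<^sup>2 + 3 / 4)" by (intro mult_left_mono real_le_rsqrt) auto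
    moreover have "2 * (D \<bullet> k) = \<mu> * - (n \<bullet> f p) + n \<bullet> w" using Dk[OF self[OF k, symmetric]] by simp
    ultimately show ?thesis
      using near_scalar[OF M0 M3 G x b norm_ge_zero, of \<mu>] by (intro conjI impI) (simp, linarith)
  next
    case True
    define v where "v = f y \<bullet> f p"
    let ?x = "sqrt ((norm (f y))\<^sup>2 - (f y \<bullet> f p)\<^sup>2)"
    have N1: "(norm (f y))\<^sup>2 \<le> 1" "(norm (f p))\<^sup>2 \<le> 1" using ball y p by (auto simp: power_le_one)
    have Mv: "M = (norm (f y))\<^sup>2 - 2 * v + (norm (f p))\<^sup>2"
      unfolding M_def D_def v_def power2_norm_eq_inner by (simp add: inner_diff_left inner_diff_right inner_commute)
    have 2: "2 \<le> (norm (f y))\<^sup>2 - 2 * v" using True Mv N1 by linarith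
    have r: "0 \<le> (norm (f p))\<^sup>2 - v"
      using N1 2 zero_le_power2[of "norm (f p)"] by linarith
    have x: "0 \<le> ?x" "?x\<^sup>2 \<le> (norm (f y))\<^sup>2 - v\<^sup>2" using perp_bound(2)[OF wP P1, of "f y"] by (auto simp: v_def)
    have "\<bar>f y \<bullet> w\<bar> \<le> norm w * ?x" by (rule perp_bound(1)[OF wP P1])
    also have "\<dots> \<le> 2 * norm k * ?x" using w2 x(1) by (intro mult_right_mono) auto
    finally have b: "\<bar>f y \<bullet> w\<bar> \<le> 2 * norm k * ?x" .
    have a: "D \<bullet> w = f y \<bullet> w" using wP by (simp add: D_def inner_diff_left inner_diff_right inner_commute)
    have b': "D \<bullet> f p = v - (norm (f p))\<^sup>2"
      by (simp add: D_def v_def power2_norm_eq_inner inner_diff_left)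
    have "2 * (D \<bullet> k) = f y \<bullet> w + \<mu> * ((norm (f p))\<^sup>2 - v)"
      unfolding Dk[OF refl] a b' by (simp add: algebra_simps)
    then show ?thesis using far_scalar[OF N1(1) 2 x b norm_ge_zero r Mv, of \<mu>] by force
  qed
  then show "\<mu> \<le> 1 \<Longrightarrow> 2 * ((f y - f p) \<bullet> k) - (norm (f y - f p))\<^sup>2 \<le> max 0 (sqrt 3 * norm k - 3 / 2)"
    "1 \<le> \<mu> \<Longrightarrow> (norm (f y - f p))\<^sup>2 - 2 * ((f y - f p) \<bullet> k) \<le> 3 / 2 + sqrt 3 * sqrt ((norm k)\<^sup>2 + 3 / 4)"
    by (simp_all add: D_def M_def)
qed

text \<open>The hyperplane version of \<open>shell\<close>: apply its first bound to a large
  multiple of \<open>k\<close>, so that the quadratic term no longer matters. The sign of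
  \<open>k \<bullet> f p\<close> ensures \<open>\<mu> \<le> 1\<close>.\<close>

lemma sideways_bound:
  assumes y: "y \<in> topspace X" and k: "nor p k = k" "norm k = 1" "0 \<le> k \<bullet> f p"
  shows "(f y - f p) \<bullet> k \<le> sqrt 3 / 2"
proof (rule ccontr)
  define a where "a = (f y - f p) \<bullet> k"
  define M where "M = (norm (f y - f p))\<^sup>2"
  assume "\<not> (f y - f p) \<bullet> k \<le> sqrt 3 / 2"
  then have a: "sqrt 3 / 2 < a" by (simp add: a_def)
  have M4: "M \<le> 4"
  proof -
    have "norm (f y - f p) \<le> 2" using norm_triangle_ineq4[of "f y" "f p"] ball[OF y] ball[OF p(1)] by linarith
    then have "M \<le> 2\<^sup>2" unfolding M_def by (intro power_mono) auto
    then show ?thesis by simp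
  qed
  have P0: "f p \<noteq> 0"
  proof
    assume "f p = 0"
    then have "f y - f p = 0" using below[OF y] by simp
    then show False using a unfolding a_def by (simp add: not_less)
  qed
  \<comment> \<open>Large enough to turn the excess of \<open>2 * a\<close> over
    \<open>\<surd>3\<close> into 4, the largest squared distance between points of the ball.\<close>
  define R where "R = 4 / (2 * a - sqrt 3)"
  have "2 * a - sqrt 3 > 0" using a by simp
  then have R: "0 < R" "R * (2 * a - sqrt 3) = 4"
    unfolding R_def by (simp, metis less_irrefl nonzero_eq_divide_eq)
  define \<mu> where "\<mu> = - (2 * R * (k \<bullet> f p)) / (f p \<bullet> f p)"
  have "(2 *\<^sub>R (R *\<^sub>R k) + \<mu> *\<^sub>R f p) \<bullet> f p = 0" using P0 by (simp add: \<mu>_def inner_add_left inner_diff_left)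
  moreover have "\<mu> \<le> 1"
  proof -
    have "\<mu> \<le> 0" unfolding \<mu>_def using k(3) R(1) by (intro divide_nonpos_nonneg) auto
    then show ?thesis by simp
  qed
  moreover have "nor p (R *\<^sub>R k) = R *\<^sub>R k" using linear_scale[OF nor_props(1)[OF p(1)], of R k] k(1) by simp
  ultimately have "2 * ((f y - f p) \<bullet> (R *\<^sub>R k)) - M \<le> max 0 (sqrt 3 * norm (R *\<^sub>R k) - 3 / 2)"
    using shell(1)[OF y, of "R *\<^sub>R k" \<mu>] by (simp add: M_def)
  then have "2 * (R * a) - M \<le> max 0 (sqrt 3 * R - 3 / 2)" using k(2) R(1) by (simp add: a_def)
  then have "2 * (R * a) - M \<le> 0 \<or> 2 * (R * a) - M \<le> sqrt 3 * R - 3 / 2" by (simp add: max_def split: if_splits)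
  moreover have "2 * (R * a) - sqrt 3 * R = 4" using R(2) by (simp add: algebra_simps)
  moreover have "0 < sqrt 3 * R" using R(1) by simp
  ultimately show False using M4 by linarith
qed

text \<open>
  The vector \<open>t - \<xi> (f x - f p)\<close> is normal at \<open>p\<close> exactly when \<open>t\<close> is in the kernel of the differential
  of the map to the sphere. For \<open>\<xi> \<noteq> 0\<close> the sphere around \<open>f p - (t - \<xi> (f x - f p)) / \<xi>\<close> through \<open>f x\<close> has
  a radius vector tangent to the immersed manifold there, which contradicts one of the two extremal principles.
\<close>

lemma no_kernel:
  assumes x: "x \<in> topspace X" and t: "t \<in> tangent x" and q: "0 < q" "2 * q \<le> c\<^sup>2 - 3 / 4"
    and k: "nor p (t - \<xi> *\<^sub>R (f x - f p)) = t - \<xi> *\<^sub>R (f x - f p)"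
    and \<xi>: "- ((f x - f p) \<bullet> t) = \<xi> * (q - (norm (f x - f p))\<^sup>2 / 2)"
  shows "t = 0"
proof (rule ccontr)
  assume t0: "t \<noteq> 0"
  define D where "D = f x - f p"
  define m where "m = (norm D)\<^sup>2"
  note T = tangent_subspace[OF x]
  show False
  proof (cases "\<xi> = 0")
    case True
    \<comment> \<open>The sign of \<open>t\<close> is at disposal, and \<open>sideways_bound\<close>
      asks for a nonnegative product with \<open>f p\<close>.\<close>
    define \<sigma> :: real where "\<sigma> = (if 0 \<le> t \<bullet> f p then 1 else - 1)"
    define u where "u = (\<sigma> / norm t) *\<^sub>R t"
    have u: "u \<in> tangent x" "norm u = 1" "0 \<le> u \<bullet> f p"
      using t0 subspace_scale[OF T t] by (auto simp: u_def \<sigma>_def divide_nonpos_pos)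
    have nt: "nor p t = t" using k True by simp
    have nu: "nor p u = u" unfolding u_def using linear_scale[OF nor_props(1)[OF p(1)], of _ t] nt by simp
    \<comment> \<open>The hyperplane through \<open>f x\<close> orthogonal to \<open>u\<close>
      contains \<open>f p\<close> too, so rising by \<open>c\<close> above it contradicts
      \<open>sideways_bound\<close> at \<open>p\<close>.\<close>
    obtain y where y: "y \<in> topspace X" "c \<le> (f y - f x) \<bullet> u" by (rule hyperplane_beyond[OF x u(1,2) c(2,3)])
    have "D \<bullet> u = 0" using \<xi> True by (simp add: D_def u_def)
    then have "(f y - f x) \<bullet> u = (f y - f p) \<bullet> u" by (simp add: D_def inner_diff_left)
    then show False using sideways_bound[OF y(1) nu u(2,3)] y(2) c_gt by simp
  next
    case False
    \<comment> \<open>The centre of the sphere is \<open>f p + K\<close>. The first component of the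
      kernel equation makes \<open>K\<close> normal at \<open>p\<close>; the second one puts
      \<open>f x\<close> at squared distance \<open>R^2 - 2 q\<close> from the centre, slightly
      inside the sphere through \<open>f p\<close>.\<close>
    define K where "K = D - (1 / \<xi>) *\<^sub>R t"
    define R where "R = norm K"
    have R0: "0 \<le> R" by (simp add: R_def)
    have "K = - (1 / \<xi>) *\<^sub>R (t - \<xi> *\<^sub>R D)" using False by (simp add: K_def scaleR_diff_right)
    then have nK: "nor p K = K" using linear_scale[OF nor_props(1)[OF p(1)]] k by (metis D_def)
    have Dt: "D \<bullet> t = - \<xi> * (q - m / 2)" using \<xi> by (simp add: D_def m_def)
    have DK: "2 * (D \<bullet> K) = m + 2 * q"
      using False by (simp add: K_def inner_diff_right Dt power2_norm_eq_inner m_def field_simps)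
    let ?z = "f p + K"
    have xz: "f x - ?z = (1 / \<xi>) *\<^sub>R t" by (simp add: K_def D_def)
    have tan: "f x - ?z \<in> tangent x" unfolding xz by (rule subspace_scale[OF T t])
    have exp: "(norm (f y - ?z))\<^sup>2 = R\<^sup>2 - (2 * ((f y - f p) \<bullet> K) - (norm (f y - f p))\<^sup>2)" for y
      unfolding R_def power2_norm_eq_inner by (simp add: inner_diff_left inner_diff_right inner_add_left inner_add_right inner_commute)
    have rx: "(norm (f x - ?z))\<^sup>2 = R\<^sup>2 - 2 * q" using exp[of x] DK by (simp add: D_def m_def)
    have "f x - ?z \<noteq> 0" using t0 False unfolding xz by simp
    then have rx0: "0 < R\<^sup>2 - 2 * q" unfolding rx[symmetric] by simp
    have P0: "f p \<noteq> 0"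
    proof
      assume "f p = 0"
      then have "D = 0" using below[OF x] by (simp add: D_def)
      then show False using DK q(1) by (simp add: m_def)
    qed
    define \<mu> where "\<mu> = - (2 * (K \<bullet> f p)) / (f p \<bullet> f p)"
    have \<mu>: "(2 *\<^sub>R K + \<mu> *\<^sub>R f p) \<bullet> f p = 0" using P0 by (simp add: \<mu>_def inner_add_left inner_diff_left)
    show False
    \<comment> \<open>If the centre is on the side of \<open>f p\<close>, no point of the manifold
      is deep inside the sphere, against \<open>sphere_inside\<close>. Otherwise no point is far
      outside, against \<open>sphere_outside\<close>.\<close>
    proof (cases "\<mu> \<le> 1")
      case True
      obtain y where y: "y \<in> topspace X" "(norm (f y - ?z))\<^sup>2 + 2 * c * norm (f y - ?z) \<le> (norm (f x - ?z))\<^sup>2"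
        by (rule sphere_inside[OF x tan c(2,3)])
      define r where "r = norm (f y - ?z)"
      have r0: "0 \<le> r" by (simp add: r_def)
      have r2: "r\<^sup>2 \<ge> R\<^sup>2 - max 0 (sqrt 3 * R - 3 / 2)"
        using shell(1)[OF y(1) nK \<mu> True] exp[of y] by (simp add: r_def R_def)
      have y2: "r\<^sup>2 + 2 * c * r \<le> R\<^sup>2 - 2 * q" using y(2) unfolding rx r_def .
      have cr: "sqrt 3 * r \<le> 2 * c * r" using c_gt r0 by (intro mult_right_mono) auto
      show False
      proof (cases "sqrt 3 * R - 3 / 2 \<le> 0")
        case True
        then have "R\<^sup>2 \<le> r\<^sup>2" using r2 by simp
        moreover have "0 \<le> 2 * c * r" using c(2) r0 by simp
        ultimately show False using y2 q(1) by linarith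
      next
        case False
        then have r2': "R\<^sup>2 - sqrt 3 * R + 3 / 2 \<le> r\<^sup>2" using r2 by simp
        have "R - sqrt 3 / 2 \<le> r"
        proof (rule power2_le_imp_le)
          have "(R - sqrt 3 / 2)\<^sup>2 = R\<^sup>2 - sqrt 3 * R + 3 / 4" by (simp add: power2_diff power_divide)
          then show "(R - sqrt 3 / 2)\<^sup>2 \<le> r\<^sup>2" using r2' by linarith
        qed (rule r0)
        then have "sqrt 3 * (R - sqrt 3 / 2) \<le> sqrt 3 * r" by (intro mult_left_mono) auto
        then have "sqrt 3 * R - 3 / 2 \<le> sqrt 3 * r" by (simp add: right_diff_distrib)
        then show False using r2' cr y2 q(1) by linarith
      qed
    next
      case False
      obtain y where y: "y \<in> topspace X" "(norm (f x - ?z))\<^sup>2 \<le> (norm (f y - ?z))\<^sup>2 - 2 * c * norm (f y - ?z)"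
        by (rule sphere_outside[OF x tan c(2,3)])
      define r where "r = norm (f y - ?z)"
      \<comment> \<open>Completing the square in the extremal inequality gives
        \<open>(r - c)^2 \<ge> R^2 - 2 q + c^2\<close>, and the bound on \<open>q\<close> is what
        makes the right side at least \<open>R^2 + 3/4\<close>.\<close>
      define S where "S = sqrt (R\<^sup>2 + 3 / 4)"
      have S2: "S\<^sup>2 = R\<^sup>2 + 3 / 4" by (simp add: S_def)
      have y2: "R\<^sup>2 - 2 * q \<le> r\<^sup>2 - 2 * c * r" using y(2) unfolding rx r_def .
      have "0 \<le> r" by (simp add: r_def)
      moreover have "r \<noteq> 0" using y2 rx0 by auto
      ultimately have r0: "0 < r" by simp
      have "0 < r * (r - 2 * c)" using y2 rx0 by (simp add: power2_eq_square algebra_simps)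
      then have rc: "2 * c < r" using r0 by (simp add: zero_less_mult_iff)
      have "S\<^sup>2 \<le> (r - c)\<^sup>2" using y2 q(2) unfolding S2 by (simp add: power2_diff algebra_simps)
      then have "S \<le> r - c" by (rule power2_le_imp_le) (use rc c(2) in simp)
      then have "S + sqrt 3 / 2 < r" using c_gt by linarith
      then have "(S + sqrt 3 / 2)\<^sup>2 < r\<^sup>2" by (intro power_strict_mono) (auto simp: S_def)
      then have "R\<^sup>2 + 3 / 2 + sqrt 3 * S < r\<^sup>2" using S2 by (simp add: power2_sum power_divide mult.commute)
      moreover have "r\<^sup>2 \<le> R\<^sup>2 + (3 / 2 + sqrt 3 * S)"
        using shell(2)[OF y(1) nK \<mu>] False exp[of y] by (simp add: r_def R_def S_def)
      ultimately show False by linarith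
    qed
  qed
qed

end

section \<open>Local diffeomorphisms to the sphere\<close>

text \<open>The projection from the pole \<open>(0, \<epsilon>)\<close> with
  \<open>\<epsilon>\<close> equal to 1 or -1, so that both charts of the standard atlas are treated
  at once. \<open>unstereo\<close> is its inverse, smooth on the whole space.\<close>

definition stereo :: "real \<Rightarrow> 'e::euclidean_space \<times> real \<Rightarrow> 'e" where
  "stereo \<epsilon> z = fst z /\<^sub>R (1 - \<epsilon> * snd z)"

definition unstereo :: "real \<Rightarrow> 'e::euclidean_space \<Rightarrow> 'e \<times> real" where
  "unstereo \<epsilon> u = ((2 * inverse (1 + u \<bullet> u)) *\<^sub>R u, \<epsilon> * ((u \<bullet> u - 1) * inverse (1 + u \<bullet> u)))"

lemma stereo_Ck: "Ck_on k {z. \<epsilon> * snd z < 1} (stereo \<epsilon>)"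
proof -
  have S: "open {z :: 'a \<times> real. \<epsilon> * snd z < 1}" by (intro open_Collect_less continuous_intros)
  have "bounded_linear (\<lambda>z :: 'a \<times> real. (- \<epsilon>) * snd z)" by (intro bounded_linear_intros)
  then have "Ck_on k {z :: 'a \<times> real. \<epsilon> * snd z < 1} (\<lambda>z. 1 + (- \<epsilon>) * snd z)"
    by (intro Ck_on_add[OF S Ck_on_const[OF S]] Ck_on_bounded_linear[OF _ S])
  then have "Ck_on k {z :: 'a \<times> real. \<epsilon> * snd z < 1} (\<lambda>z. inverse (1 + (- \<epsilon>) * snd z))"
    by (rule Ck_on_compose[OF S open_greaterThan _ Ck_on_inverse]) auto
  from Ck_on_scaleR[OF S this Ck_on_bounded_linear[OF bounded_linear_fst S]]
  show ?thesis unfolding stereo_def[abs_def] by simp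
qed

lemma unstereo_Ck: "Ck_on k UNIV (unstereo \<epsilon>)"
proof -
  have S: "open (UNIV :: 'a set)" by simp
  have id: "Ck_on k UNIV (\<lambda>u :: 'a. u)" by (rule Ck_on_bounded_linear[OF bounded_linear_ident S])
  have uu: "Ck_on k UNIV (\<lambda>u :: 'a. u \<bullet> u)" by (rule Ck_on_inner[OF S id id])
  have "Ck_on k UNIV (\<lambda>u :: 'a. 1 + u \<bullet> u)" by (rule Ck_on_add[OF S Ck_on_const[OF S] uu])
  then have inv: "Ck_on k UNIV (\<lambda>u :: 'a. inverse (1 + u \<bullet> u))"
    by (rule Ck_on_compose[OF S open_greaterThan _ Ck_on_inverse]) (auto intro: add_pos_nonneg)
  have "Ck_on k UNIV (\<lambda>u :: 'a. u \<bullet> u + - 1)" by (rule Ck_on_add[OF S uu Ck_on_const[OF S]])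
  then have "Ck_on k UNIV (\<lambda>u :: 'a. ((2 * inverse (1 + u \<bullet> u)) *\<^sub>R u, \<epsilon> * ((u \<bullet> u + - 1) * inverse (1 + u \<bullet> u))))"
    by (intro Ck_on_Pair Ck_on_scaleR Ck_on_mult Ck_on_const S id inv)
  then show ?thesis unfolding unstereo_def[abs_def] by simp
qed

lemma norm_prod_1: "norm z = 1 \<longleftrightarrow> fst z \<bullet> fst z + (snd z)\<^sup>2 = 1" for z :: "'e::euclidean_space \<times> real"
  unfolding norm_eq_1 by (simp add: inner_prod_def power2_eq_square)

lemma unstereo_stereo:
  assumes "norm z = 1" "\<epsilon> * \<epsilon> = 1" "\<epsilon> * snd z < 1"
  shows "unstereo \<epsilon> (stereo \<epsilon> z) = z"
proof -
  define t where "t = \<epsilon> * snd z"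
  have tt: "t * t = snd z * snd z" using assms(2) by (simp add: t_def algebra_simps)
  have t1: "1 - t > 0" using assms(3) by (simp add: t_def)
  have st: "stereo \<epsilon> z = (inverse (1 - t)) *\<^sub>R fst z" by (simp add: stereo_def t_def)
  have gen: "inverse d * (inverse d * (d * e)) = e / d" if "d \<noteq> 0" for d e :: real
    using that by (simp add: field_simps)
  have "fst z \<bullet> fst z = (1 - t) * (1 + t)"
    using assms(1) tt unfolding norm_prod_1 by (simp add: power2_eq_square algebra_simps)
  then have uu: "stereo \<epsilon> z \<bullet> stereo \<epsilon> z = (1 + t) / (1 - t)"
    unfolding st using t1 gen[of "1 - t" "1 + t"] by simp
  have 1: "inverse (1 + stereo \<epsilon> z \<bullet> stereo \<epsilon> z) = (1 - t) / 2" unfolding uu using t1 by (simp add: field_simps)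
  have 2: "stereo \<epsilon> z \<bullet> stereo \<epsilon> z - 1 = 2 * t / (1 - t)" unfolding uu using t1 by (simp add: field_simps)
  have "\<epsilon> * t = snd z" using assms(2) by (simp add: t_def flip: mult.assoc)
  moreover have "2 * ((1 - t) / 2) * inverse (1 - t) = 1" "2 * t / (1 - t) * ((1 - t) / 2) = t"
    using t1 by (simp_all add: field_simps)
  ultimately show ?thesis unfolding unstereo_def 1 2 unfolding st scaleR_scaleR
    by (simp only: prod_eq_iff fst_conv snd_conv scaleR_one simp_thms)
qed

lemma not_pole:
  fixes z :: "'e::euclidean_space \<times> real"
  assumes "norm z = 1" "\<epsilon> * \<epsilon> = 1"
  shows "\<epsilon> * snd z < 1 \<longleftrightarrow> z \<noteq> (0, \<epsilon>)"
proof
  assume "z \<noteq> (0, \<epsilon>)"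
  show "\<epsilon> * snd z < 1"
  proof (rule ccontr)
    assume "\<not> \<epsilon> * snd z < 1"
    then have 1: "1 \<le> \<epsilon> * snd z" by simp
    then have "1 * 1 \<le> (\<epsilon> * snd z) * (\<epsilon> * snd z)" by (intro mult_mono) auto
    also have "\<dots> = (snd z)\<^sup>2" using assms(2) by (metis mult.assoc mult.left_commute mult_1 power2_eq_square)
    finally have "fst z \<bullet> fst z \<le> 0" and s: "(snd z)\<^sup>2 = 1"
      using assms(1) inner_ge_zero[of "fst z"] unfolding norm_prod_1 by linarith+
    then have "fst z = 0" using inner_ge_zero[of "fst z"] inner_eq_zero_iff[of "fst z"] by force
    moreover have "snd z = \<epsilon>"
    proof -
      have "(\<epsilon> * snd z)\<^sup>2 = 1" unfolding power_mult_distrib s using assms(2) by (simp add: power2_eq_square)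
      then have "\<epsilon> * snd z = 1" using 1 unfolding power2_eq_1_iff by linarith
      then have "\<epsilon> * (\<epsilon> * snd z) = \<epsilon>" by simp
      then show ?thesis using assms(2) by (simp flip: mult.assoc)
    qed
    ultimately show False using \<open>z \<noteq> (0, \<epsilon>)\<close> by (simp add: prod_eq_iff)
  qed
qed (use assms in auto)

lemma std_sphere_atlas_eq:
  "(V, \<psi>) \<in> std_sphere_atlas \<longleftrightarrow> (\<exists>\<epsilon>. (\<epsilon> = 1 \<or> \<epsilon> = - 1) \<and> V = sphere 0 1 - {(0, \<epsilon>)} \<and> \<psi> = stereo \<epsilon>)"
proof -
  have "(\<lambda>(x, t). x /\<^sub>R (1 - t)) = stereo 1" "(\<lambda>(x, t). x /\<^sub>R (1 + t)) = stereo (- 1)"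
    by (auto simp: stereo_def fun_eq_iff)
  then show ?thesis unfolding std_sphere_atlas_def by auto
qed

context chart_immersion begin

lemma locally_injective:
  assumes y0: "y0 \<in> S"
  obtains r where "0 < r" "ball y0 r \<subseteq> S" "inj_on F (ball y0 r)"
proof -
  obtain g' where g': "linear g'" "g' \<circ> D y0 = id"
    using linear_injective_left_inverse[OF D_linear[OF y0] D_inj[OF y0]] by blast
  show thesis
  proof (rule has_derivative_locally_injective[OF y0 S _ g'(2) D_derivative])
    show "bounded_linear g'" using g'(1) by (simp add: linear_conv_bounded_linear)
    fix e :: real assume e: "0 < e"
    then have "\<forall>\<^sub>F y in nhds y0. y \<in> S \<and> (\<forall>b. norm (D y b - D y0 b) \<le> e / 2 * norm b)"
      by (intro D_continuous[OF y0]) simp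
    then obtain d where d: "d > 0" "\<And>y. dist y y0 < d \<Longrightarrow> \<forall>b. norm (D y b - D y0 b) \<le> e / 2 * norm b"
      unfolding eventually_nhds_metric by blast
    have "onorm (\<lambda>v. D y v - D y0 v) < e" if "dist y0 y < d" for y
    proof -
      have "onorm (\<lambda>v. D y v - D y0 v) \<le> e / 2" using d(2)[of y] that e by (intro onorm_bound) (auto simp: dist_commute)
      then show ?thesis using e by simp
    qed
    then show "\<exists>d>0. \<forall>x. dist y0 x < d \<longrightarrow> onorm (\<lambda>v. D x v - D y0 v) < e" using d(1) by blast
  qed (assumption, rule that)
qed

end

section \<open>Immersions of a closed manifold into the sphere of the same dimension\<close>

locale sphere_immersed = smooth_immersed X A \<Psi>
  for X :: "'a topology" and A :: "('a, real^'n) atlas" and \<Psi> :: "'a \<Rightarrow> (real^'n) \<times> real" +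
  assumes compact: "compact_space X" and unit: "\<And>x. x \<in> topspace X \<Longrightarrow> norm (\<Psi> x) = 1"
begin

text \<open>On the sphere \<open>unstereo\<close> undoes \<open>stereo\<close>, so the immersion
  \<open>\<Psi>\<close> factors through the projected map; by the chain rule the derivative of the
  latter is injective.\<close>

lemma stereo_chart:
  assumes c: "(U, \<phi>) \<in> A" and \<epsilon>: "\<epsilon> = 1 \<or> \<epsilon> = - 1"
  shows "chart_immersion {y \<in> \<phi> ` U. \<epsilon> * snd (\<Psi> (inv_into U \<phi> y)) < 1} (stereo \<epsilon> \<circ> \<Psi> \<circ> inv_into U \<phi>)"
proof -
  interpret u: chart_immersion "\<phi> ` U" "\<Psi> \<circ> inv_into U \<phi>" by (rule chart_immersion[OF c])
  let ?F = "\<Psi> \<circ> inv_into U \<phi>" and ?B = "{y \<in> \<phi> ` U. \<epsilon> * snd (\<Psi> (inv_into U \<phi> y)) < 1}"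
  let ?T = "{z :: (real^'n) \<times> real. \<epsilon> * snd z < 1}"
  have T: "open ?T" by (intro open_Collect_less continuous_intros)
  have "?B = \<phi> ` U \<inter> ?F -` ?T" by auto
  then have B: "open ?B"
    using continuous_open_preimage[OF Ck_on_imp_continuous_on[OF u.smooth[of 0]] u.S T] by simp
  have Ck: "Ck_on k ?B (stereo \<epsilon> \<circ> ?F)" for k
  proof -
    have "Ck_on k ?B ?F" by (rule Ck_on_subset[OF u.smooth]) auto
    from Ck_on_compose[OF B T this stereo_Ck] show ?thesis unfolding o_def by auto
  qed
  show ?thesis
  proof
    show "open ?B" by (rule B)
    show "Ck_on k ?B (stereo \<epsilon> \<circ> \<Psi> \<circ> inv_into U \<phi>)" for k using Ck[of k] by (simp add: o_assoc)
    fix y assume y: "y \<in> ?B"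
    let ?g = "stereo \<epsilon> \<circ> \<Psi> \<circ> inv_into U \<phi>"
    have "(?g has_derivative frechet_derivative ?g (at y)) (at y)"
      using Ck_on_SucD(1)[OF B Ck[of "Suc 0"] y] by (simp add: o_assoc)
    moreover have "(unstereo \<epsilon> has_derivative frechet_derivative (unstereo \<epsilon>) (at (?g y))) (at (?g y))"
      using Ck_on_SucD(1)[OF open_UNIV unstereo_Ck[of "Suc 0"]] by simp
    ultimately have hd: "(unstereo \<epsilon> \<circ> ?g has_derivative frechet_derivative (unstereo \<epsilon>) (at (?g y)) \<circ> frechet_derivative ?g (at y)) (at y)"
      by (rule diff_chain_at)
    have "(unstereo \<epsilon> \<circ> ?g) z = ?F z" if z: "z \<in> ?B" for z
    proof -
      have "inv_into U \<phi> z \<in> U" using z by (intro chart_inverse(2)[OF c]) blast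
      then have "norm (\<Psi> (inv_into U \<phi> z)) = 1" using unit chart_props(4)[OF c] by blast
      moreover have "\<epsilon> * \<epsilon> = 1" using \<epsilon> by auto
      ultimately show ?thesis using z unstereo_stereo[of "\<Psi> (inv_into U \<phi> z)" \<epsilon>] by simp
    qed
    then have "(?F has_derivative frechet_derivative (unstereo \<epsilon>) (at (?g y)) \<circ> frechet_derivative ?g (at y)) (at y)"
      by (rule has_derivative_transform_within_open[OF hd B y])
    then have "u.D y = frechet_derivative (unstereo \<epsilon>) (at (?g y)) \<circ> frechet_derivative ?g (at y)"
      by (rule has_derivative_unique[OF u.D_derivative, rotated]) (use y in blast)
    moreover have "inj (u.D y)" by (rule u.D_inj) (use y in blast)
    ultimately have "inj (frechet_derivative (unstereo \<epsilon>) (at (?g y)) \<circ> frechet_derivative ?g (at y))" by (simp only:)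
    then show "inj (frechet_derivative ?g (at y))" by (rule inj_on_imageI2)
  qed
qed

text \<open>After projection from a pole other than \<open>\<Psi> x\<close>, the map goes between
  spaces of equal dimension; invariance of domain makes it open where it is injective.\<close>

lemma locally_open_injective:
  assumes x: "x \<in> topspace X"
  obtains W where "openin X W" "x \<in> W" "inj_on \<Psi> W"
    "\<And>V. openin X V \<Longrightarrow> V \<subseteq> W \<Longrightarrow> openin (top_of_set (sphere 0 1)) (\<Psi> ` V)"
proof -
  obtain U \<phi> where c: "(U, \<phi>) \<in> A" "x \<in> U" using chart_exists[OF x] .
  note i = chart_inverse[OF c(1)]
  obtain \<epsilon> :: real where \<epsilon>: "\<epsilon> = 1 \<or> \<epsilon> = - 1" "\<Psi> x \<noteq> (0, \<epsilon>)"
    by (metis one_neq_neg_one prod.inject)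
  have e1: "\<epsilon> * \<epsilon> = 1" using \<epsilon>(1) by auto
  let ?B = "{y \<in> \<phi> ` U. \<epsilon> * snd (\<Psi> (inv_into U \<phi> y)) < 1}" and ?g = "stereo \<epsilon> \<circ> \<Psi> \<circ> inv_into U \<phi>"
  interpret g: chart_immersion ?B ?g by (rule stereo_chart[OF c(1) \<epsilon>(1)])
  have "\<phi> x \<in> ?B" using c i(1)[OF c(2)] not_pole[OF unit[OF x] e1] \<epsilon>(2) by simp
  then obtain r where r: "0 < r" "ball (\<phi> x) r \<subseteq> ?B" "inj_on ?g (ball (\<phi> x) r)" by (rule g.locally_injective)
  let ?W = "inv_into U \<phi> ` ball (\<phi> x) r"
  have rU: "ball (\<phi> x) r \<subseteq> \<phi> ` U" using r(2) by blast
  have WU: "?W \<subseteq> U" using rU i(2) by blast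
  have wB: "\<phi> w \<in> ball (\<phi> x) r" if "w \<in> ?W" for w using that rU i(3) by auto
  show thesis
  proof (rule that[of ?W])
    show "openin X ?W" by (rule chart_open_preimage[OF c(1) open_ball rU])
    show "x \<in> ?W" using i(1)[OF c(2)] r(1) by (auto intro!: image_eqI[of _ _ "\<phi> x"])
    show "inj_on \<Psi> ?W"
    proof (rule inj_onI)
      fix a b assume ab: "a \<in> ?W" "b \<in> ?W" "\<Psi> a = \<Psi> b"
      have U: "a \<in> U" "b \<in> U" using ab(1,2) WU by blast+
      have "?g (\<phi> a) = ?g (\<phi> b)" using ab(3) i(1)[OF U(1)] i(1)[OF U(2)] by simp
      then have "\<phi> a = \<phi> b" by (rule inj_onD[OF r(3) _ wB[OF ab(1)] wB[OF ab(2)]])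
      then show "a = b" using i(1)[OF U(1)] i(1)[OF U(2)] by metis
    qed
    fix V assume V: "openin X V" "V \<subseteq> ?W"
    have V': "open (\<phi> ` (U \<inter> V))" by (rule chart_open_image[OF c(1) V(1)])
    have UV: "U \<inter> V = V" using V WU by blast
    have sub: "\<phi> ` V \<subseteq> ball (\<phi> x) r" using wB V(2) by blast
    then have subB: "\<phi> ` V \<subseteq> ?B" using r(2) by blast
    have op: "open (?g ` \<phi> ` V)"
    proof (rule invariance_of_domain)
      show "continuous_on (\<phi> ` V) ?g"
        using continuous_on_subset[OF Ck_on_imp_continuous_on[OF g.smooth[of 0]] subB] .
      show "open (\<phi> ` V)" using V' UV by simp
      show "inj_on ?g (\<phi> ` V)" using inj_on_subset[OF r(3) sub] .
    qed
    let ?S = "sphere 0 1 \<inter> {z :: (real^'n) \<times> real. \<epsilon> * snd z < 1}"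
    have "\<Psi> ` V = ?S \<inter> stereo \<epsilon> -` (?g ` \<phi> ` V)"
    proof (intro equalityI subsetI)
      fix z assume "z \<in> \<Psi> ` V"
      then obtain v where v: "v \<in> V" "z = \<Psi> v" by blast
      have vU: "v \<in> U" using v V WU by blast
      have "\<phi> v \<in> ?B" using v subB by blast
      then have "\<epsilon> * snd (\<Psi> v) < 1" using i(1)[OF vU] by simp
      moreover have "norm (\<Psi> v) = 1" using unit vU chart_props(4)[OF c(1)] by blast
      moreover have "stereo \<epsilon> (\<Psi> v) = ?g (\<phi> v)" using i(1)[OF vU] by simp
      ultimately show "z \<in> ?S \<inter> stereo \<epsilon> -` (?g ` \<phi> ` V)" using v by auto
    next
      fix z assume z: "z \<in> ?S \<inter> stereo \<epsilon> -` (?g ` \<phi> ` V)"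
      then obtain v where v: "v \<in> V" "stereo \<epsilon> z = ?g (\<phi> v)" by blast
      have vU: "v \<in> U" using v V WU by blast
      have "\<phi> v \<in> ?B" using v subB by blast
      then have 1: "\<epsilon> * snd (\<Psi> v) < 1" using i(1)[OF vU] by simp
      have 2: "norm (\<Psi> v) = 1" using unit vU chart_props(4)[OF c(1)] by blast
      have "stereo \<epsilon> z = stereo \<epsilon> (\<Psi> v)" using v(2) i(1)[OF vU] by simp
      then have "z = \<Psi> v" using unstereo_stereo[OF 2 e1 1] unstereo_stereo[of z \<epsilon>] z e1 by simp
      then show "z \<in> \<Psi> ` V" using v by blast
    qed
    moreover have "openin (top_of_set ?S) (?S \<inter> stereo \<epsilon> -` (?g ` \<phi> ` V))"
    proof (rule continuous_openin_preimage_gen[OF _ op])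
      show "continuous_on ?S (stereo \<epsilon>)"
        by (rule continuous_on_subset[OF Ck_on_imp_continuous_on[OF stereo_Ck[of 0]]]) auto
    qed
    moreover have "openin (top_of_set (sphere 0 1)) ?S"
      by (intro openin_open_Int open_Collect_less continuous_intros)
    ultimately show "openin (top_of_set (sphere 0 1)) (\<Psi> ` V)" using openin_trans by metis
  qed
qed

lemma \<Psi>_continuous: "continuous_map X (top_of_set (sphere 0 1)) \<Psi>"
  using f_continuous unit by (auto simp: continuous_map_in_subtopology)

lemma open_image: "openin X V \<Longrightarrow> openin (top_of_set (sphere 0 1)) (\<Psi> ` V)"
proof (subst openin_subopen, intro ballI)
  fix z assume V: "openin X V" and "z \<in> \<Psi> ` V"
  then obtain x where x: "x \<in> V" "z = \<Psi> x" by blast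
  then have "x \<in> topspace X" using openin_subset[OF V] by blast
  then obtain W where W: "openin X W" "x \<in> W" "inj_on \<Psi> W"
    "\<And>V. openin X V \<Longrightarrow> V \<subseteq> W \<Longrightarrow> openin (top_of_set (sphere 0 1)) (\<Psi> ` V)"
    by (rule locally_open_injective) (rule that)
  have "openin (top_of_set (sphere 0 1)) (\<Psi> ` (V \<inter> W))" using W(4)[of "V \<inter> W"] V W(1) by blast
  then show "\<exists>T. openin (top_of_set (sphere 0 1)) T \<and> z \<in> T \<and> T \<subseteq> \<Psi> ` V" using x W(2) by blast
qed

text \<open>In place of covering theory: the points with exactly one preimage form an open set, by
  compactness. So do the others: the image is closed, and two preimages have disjoint neighbourhoods
  with open images. The sphere is connected and \<open>N\<close> belongs to the first set.\<close>

lemma bijective: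
  assumes N: "N \<in> sphere 0 1" "\<exists>!x. x \<in> topspace X \<and> \<Psi> x = N"
  shows "bij_betw \<Psi> (topspace X) (sphere 0 1)"
proof -
  let ?T = "top_of_set (sphere 0 1 :: ((real^'n) \<times> real) set)"
  define S1 where "S1 = {z \<in> sphere 0 1. \<exists>!x. x \<in> topspace X \<and> \<Psi> x = z}"
  have comp_closed: "closedin ?T (\<Psi> ` K)" if "closedin X K" for K
  proof -
    have "compactin ?T (\<Psi> ` K)" by (rule image_compactin[OF closedin_compact_space[OF compact that] \<Psi>_continuous])
    then show ?thesis by (rule compactin_imp_closedin[OF Hausdorff_space_subtopology[OF Hausdorff_space_euclidean]])
  qed
  have o1: "openin ?T S1"
  proof (subst openin_subopen, intro ballI)
    fix z assume z: "z \<in> S1"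
    then obtain x where x: "x \<in> topspace X" "\<Psi> x = z" "\<And>y. y \<in> topspace X \<Longrightarrow> \<Psi> y = z \<Longrightarrow> y = x"
      unfolding S1_def by blast
    obtain W where W: "openin X W" "x \<in> W" "inj_on \<Psi> W"
      "\<And>V. openin X V \<Longrightarrow> V \<subseteq> W \<Longrightarrow> openin ?T (\<Psi> ` V)"
      by (rule locally_open_injective[OF x(1)]) (rule that)
    \<comment> \<open>Away from the closed image of the complement of \<open>W\<close> all preimages
      lie in \<open>W\<close>, where \<open>\<Psi>\<close> is injective.\<close>
    have "openin ?T (\<Psi> ` W - \<Psi> ` (topspace X - W))"
      using W(1) by (intro openin_diff open_image comp_closed) auto
    moreover have "z \<in> \<Psi> ` W - \<Psi> ` (topspace X - W)" using x W(2) by blast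
    moreover have "\<Psi> ` W - \<Psi> ` (topspace X - W) \<subseteq> S1"
    proof
      fix v assume v: "v \<in> \<Psi> ` W - \<Psi> ` (topspace X - W)"
      then obtain w where w: "w \<in> W" "v = \<Psi> w" by blast
      have wX: "w \<in> topspace X" using w(1) openin_subset[OF W(1)] by blast
      have "y = w" if y: "y \<in> topspace X" "\<Psi> y = v" for y
      proof -
        have "y \<in> W" using y v by blast
        then show ?thesis using inj_onD[OF W(3)] w y(2) by blast
      qed
      then show "v \<in> S1" unfolding S1_def using w(2) wX unit[OF wX] by auto
    qed
    ultimately show "\<exists>T. openin ?T T \<and> z \<in> T \<and> T \<subseteq> S1" by blast
  qed
  have o2: "openin ?T (sphere 0 1 - S1)"
  proof (subst openin_subopen, intro ballI)
    fix z assume z: "z \<in> sphere 0 1 - S1"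
    show "\<exists>T. openin ?T T \<and> z \<in> T \<and> T \<subseteq> sphere 0 1 - S1"
    proof (cases "z \<in> \<Psi> ` topspace X")
      case False
      have "openin ?T (topspace ?T - \<Psi> ` topspace X)" by (intro openin_diff comp_closed) auto
      then have "openin ?T (sphere 0 1 - \<Psi> ` topspace X)" by simp
      moreover have "sphere 0 1 - \<Psi> ` topspace X \<subseteq> sphere 0 1 - S1" unfolding S1_def by blast
      ultimately show ?thesis using False z by blast
    next
      case True
      then obtain x where x: "x \<in> topspace X" "\<Psi> x = z" by blast
      then obtain y where y: "y \<in> topspace X" "\<Psi> y = z" "y \<noteq> x" using z unfolding S1_def by blast
      obtain U V where UV: "openin X U" "openin X V" "x \<in> U" "y \<in> V" "disjnt U V"
        using Hausdorff x(1) y(1,3) unfolding Hausdorff_space_def by metis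
      have "openin ?T (\<Psi> ` U \<inter> \<Psi> ` V)" using UV by (intro openin_Int open_image)
      moreover have "z \<in> \<Psi> ` U \<inter> \<Psi> ` V" using UV(3,4) x(2) y(2) by (simp add: image_iff) metis
      moreover have "\<Psi> ` U \<inter> \<Psi> ` V \<subseteq> sphere 0 1 - S1"
      proof
        fix v assume "v \<in> \<Psi> ` U \<inter> \<Psi> ` V"
        then have "\<exists>a\<in>U. \<Psi> a = v" "\<exists>b\<in>V. \<Psi> b = v" by auto
        then obtain a b where ab: "a \<in> U" "b \<in> V" "\<Psi> a = v" "\<Psi> b = v" by metis
        have X: "a \<in> topspace X" "b \<in> topspace X"
          using ab(1,2) openin_subset[OF UV(1)] openin_subset[OF UV(2)] by blast+
        have "a \<noteq> b" using ab UV(5) by (auto simp: disjnt_def)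
        then show "v \<in> sphere 0 1 - S1" unfolding S1_def using ab X unit[OF X(1)] by auto
      qed
      ultimately show ?thesis by blast
    qed
  qed
  have "connected (sphere 0 1 :: ((real^'n) \<times> real) set)" by (rule connected_sphere) simp
  moreover have "closedin ?T S1" using o2 unfolding closedin_def by (auto simp: S1_def)
  ultimately have "S1 = {} \<or> S1 = sphere 0 1" using o1 unfolding connected_clopen by blast
  moreover have "N \<in> S1" using N by (simp add: S1_def)
  ultimately have "S1 = sphere 0 1" by blast
  then have ex1: "\<exists>!x. x \<in> topspace X \<and> \<Psi> x = z" if "z \<in> sphere 0 1" for z using that unfolding S1_def by blast
  show ?thesis unfolding bij_betw_def
  proof
    show "inj_on \<Psi> (topspace X)" using ex1 unit by (intro inj_onI) (metis mem_sphere_0)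
    show "\<Psi> ` topspace X = sphere 0 1"
    proof
      show "\<Psi> ` topspace X \<subseteq> sphere 0 1" using unit by auto
      show "sphere 0 1 \<subseteq> \<Psi> ` topspace X" using ex1 by blast
    qed
  qed
qed

theorem diffeomorphic_sphere:
  assumes N: "N \<in> sphere 0 1" "\<exists>!x. x \<in> topspace X \<and> \<Psi> x = N"
  shows "diffeomorphic X A (std_sphere :: ((real^'n) \<times> real) topology) std_sphere_atlas"
proof -
  have bij: "bij_betw \<Psi> (topspace X) (sphere 0 1)" by (rule bijective[OF N])
  let ?G = "inv_into (topspace X) \<Psi>"
  have G1: "?G (\<Psi> x) = x" if "x \<in> topspace X" for x using bij that by (simp add: bij_betw_def)
  have G2: "?G z \<in> topspace X" "\<Psi> (?G z) = z" if "z \<in> sphere 0 1" for z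
    using bij that unfolding bij_betw_def by (metis inv_into_into, metis f_inv_into_f)
  have cont: "continuous_map (top_of_set (sphere 0 1)) X ?G"
    unfolding continuous_map_def
  proof (intro conjI allI impI)
    show "?G \<in> topspace (top_of_set (sphere 0 1)) \<rightarrow> topspace X" using G2(1) by simp
    fix V assume V: "openin X V"
    have "{z \<in> topspace (top_of_set (sphere 0 1)). ?G z \<in> V} = \<Psi> ` V"
      using G1 G2 openin_subset[OF V] unit by (auto simp: image_iff subset_iff) metis
    then show "openin (top_of_set (sphere 0 1)) {z \<in> topspace (top_of_set (sphere 0 1)). ?G z \<in> V}"
      using open_image[OF V] by simp
  qed
  have dom: "\<phi> ` (U \<inter> \<Psi> -` (sphere 0 1 - {(0, \<epsilon>)})) = {y \<in> \<phi> ` U. \<epsilon> * snd (\<Psi> (inv_into U \<phi> y)) < 1}"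
    if c: "(U, \<phi>) \<in> A" and \<epsilon>: "\<epsilon> = 1 \<or> \<epsilon> = - 1" for U \<phi> \<epsilon>
  proof -
    note i = chart_inverse[OF c]
    have e: "\<epsilon> * \<epsilon> = 1" using \<epsilon> by auto
    have "\<Psi> x \<in> sphere 0 1 - {(0, \<epsilon>)} \<longleftrightarrow> \<epsilon> * snd (\<Psi> x) < 1" if "x \<in> U" for x
      using not_pole[OF _ e, of "\<Psi> x"] unit[of x] that chart_props(4)[OF c] by auto
    then show ?thesis using i(1) by force
  qed
  show ?thesis unfolding diffeomorphic_def
  proof (intro exI conjI ballI)
    show "?G (\<Psi> x) = x" if "x \<in> topspace X" for x using G1 that .
    show "\<Psi> (?G y) = y" if "y \<in> topspace (std_sphere :: ((real^'n) \<times> real) topology)" for y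
      using G2(2) that by (simp add: std_sphere_def)
    show "smooth_map X A (std_sphere :: ((real^'n) \<times> real) topology) std_sphere_atlas \<Psi>"
      unfolding smooth_map_def std_sphere_def
    proof (intro conjI ballI, rule \<Psi>_continuous, clarify)
      fix U \<phi> V and \<psi> :: "(real^'n) \<times> real \<Rightarrow> real^'n" assume c: "(U, \<phi>) \<in> A" and "(V, \<psi>) \<in> std_sphere_atlas"
      then obtain \<epsilon> :: real where \<epsilon>: "\<epsilon> = 1 \<or> \<epsilon> = - 1" "V = sphere 0 1 - {(0, \<epsilon>)}" "\<psi> = stereo \<epsilon>"
        unfolding std_sphere_atlas_eq by blast
      show "smooth_on (\<phi> ` (U \<inter> \<Psi> -` V)) (\<psi> \<circ> \<Psi> \<circ> inv_into U \<phi>)"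
        unfolding \<epsilon>(2,3) dom[OF c \<epsilon>(1)] smooth_on_def
        using chart_immersion.smooth[OF stereo_chart[OF c \<epsilon>(1)]] by blast
    qed
    show "smooth_map (std_sphere :: ((real^'n) \<times> real) topology) std_sphere_atlas X A ?G"
      unfolding smooth_map_def std_sphere_def
    proof (intro conjI ballI, rule cont, clarify)
      fix U \<phi> V and \<psi> :: "(real^'n) \<times> real \<Rightarrow> real^'n" assume c: "(U, \<phi>) \<in> A" and "(V, \<psi>) \<in> std_sphere_atlas"
      then obtain \<epsilon> :: real where \<epsilon>: "\<epsilon> = 1 \<or> \<epsilon> = - 1" "V = sphere 0 1 - {(0, \<epsilon>)}" "\<psi> = stereo \<epsilon>"
        unfolding std_sphere_atlas_eq by blast
      note i = chart_inverse[OF c]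
      have e: "\<epsilon> * \<epsilon> = 1" using \<epsilon>(1) by auto
      let ?B = "{y \<in> \<phi> ` U. \<epsilon> * snd (\<Psi> (inv_into U \<phi> y)) < 1}" and ?g = "stereo \<epsilon> \<circ> \<Psi> \<circ> inv_into U \<phi>"
      interpret g: chart_immersion ?B ?g by (rule stereo_chart[OF c \<epsilon>(1)])
      have inj\<psi>: "inj_on \<psi> V"
      proof (rule inj_on_inverseI[of _ "unstereo \<epsilon>"])
        fix z assume "z \<in> V"
        then have z: "norm z = 1" "z \<noteq> (0, \<epsilon>)" using \<epsilon>(2) by auto
        then show "unstereo \<epsilon> (\<psi> z) = z" using unstereo_stereo[OF z(1) e] not_pole[OF z(1) e] \<epsilon>(3) by simp
      qed
      have BV: "\<Psi> (inv_into U \<phi> y) \<in> V" "inv_into U \<phi> y \<in> topspace X" "inv_into U \<phi> y \<in> U" if "y \<in> ?B" for y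
      proof -
        show 1: "inv_into U \<phi> y \<in> U" using i(2) that by blast
        then show 2: "inv_into U \<phi> y \<in> topspace X" using chart_props(4)[OF c] by blast
        show "\<Psi> (inv_into U \<phi> y) \<in> V" using not_pole[OF unit[OF 2] e] that unit[OF 2] \<epsilon>(2) by simp
      qed
      have injg: "inj_on ?g ?B"
      proof (rule inj_onI)
        fix y y' assume y: "y \<in> ?B" "y' \<in> ?B" "?g y = ?g y'"
        then have "\<Psi> (inv_into U \<phi> y) = \<Psi> (inv_into U \<phi> y')"
          using inj\<psi> BV(1) \<epsilon>(3) unfolding inj_on_def by simp
        then have "?G (\<Psi> (inv_into U \<phi> y)) = ?G (\<Psi> (inv_into U \<phi> y'))" by (rule arg_cong)
        then have "inv_into U \<phi> y = inv_into U \<phi> y'" unfolding G1[OF BV(2)[OF y(1)]] G1[OF BV(2)[OF y(2)]] .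
        moreover have "y \<in> \<phi> ` U" "y' \<in> \<phi> ` U" using y(1,2) by blast+
        ultimately show "y = y'" using i(3)[of y] i(3)[of y'] by metis
      qed
      have img: "\<psi> ` (V \<inter> ?G -` U) = ?g ` ?B"
      proof (intro equalityI subsetI)
        fix w assume "w \<in> \<psi> ` (V \<inter> ?G -` U)"
        then obtain z where z: "z \<in> V" "?G z \<in> U" "w = \<psi> z" by blast
        have zs: "z \<in> sphere 0 1" using z(1) \<epsilon>(2) by blast
        have "\<phi> (?G z) \<in> ?B"
          using z i(1)[OF z(2)] G2(2)[OF zs] not_pole[of z \<epsilon>] zs e \<epsilon>(2) by auto
        moreover have "?g (\<phi> (?G z)) = w" using i(1)[OF z(2)] G2(2)[OF zs] z(3) \<epsilon>(3) by simp
        ultimately show "w \<in> ?g ` ?B" by blast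
      next
        fix w assume "w \<in> ?g ` ?B"
        then obtain y where y: "y \<in> ?B" "w = ?g y" by blast
        then show "w \<in> \<psi> ` (V \<inter> ?G -` U)"
          using BV[OF y(1)] G1[OF BV(2)[OF y(1)]] \<epsilon>(3) by (auto intro!: image_eqI[of _ _ "\<Psi> (inv_into U \<phi> y)"])
      qed
      \<comment> \<open>In coordinates the inverse of \<open>\<Psi>\<close> is the inverse of
        \<open>?g\<close>, whose smoothness is \<open>Ck_on_inv_into\<close>.\<close>
      have eq: "inv_into ?B ?g w = (\<phi> \<circ> ?G \<circ> inv_into V \<psi>) w" if w: "w \<in> ?g ` ?B" for w
      proof -
        obtain y where y: "y \<in> ?B" "w = ?g y" using w by blast
        have "w = \<psi> (\<Psi> (inv_into U \<phi> y))" unfolding y(2) \<epsilon>(3) by (simp only: o_apply)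
        then have "inv_into V \<psi> w = \<Psi> (inv_into U \<phi> y)"
          using inv_into_f_f[OF inj\<psi> BV(1)[OF y(1)]] by (simp only:)
        then have "(\<phi> \<circ> ?G \<circ> inv_into V \<psi>) w = \<phi> (?G (\<Psi> (inv_into U \<phi> y)))" by (simp only: o_apply)
        also have "\<dots> = \<phi> (inv_into U \<phi> y)" by (simp only: G1[OF BV(2)[OF y(1)]])
        also have "\<dots> = y" by (rule i(3)) (use y(1) in blast)
        finally show ?thesis unfolding y(2) using inv_into_f_f[OF injg y(1)] by (simp only:)
      qed
      note ck = Ck_on_inv_into[OF g.S g.smooth injg g.inj]
      show "smooth_on (\<psi> ` (V \<inter> ?G -` U)) (\<phi> \<circ> ?G \<circ> inv_into V \<psi>)"
        unfolding smooth_on_def img by (intro allI Ck_on_cong[OF ck(1) eq ck(2)])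
    qed
  qed
qed

end

section \<open>The map to the sphere in dimension at least two\<close>

lemma normalize_Ck:
  "Ck_on k (- {0}) (\<lambda>z :: 'e::euclidean_space. inverse (norm z) *\<^sub>R z)"
proof -
  have S: "open (- {0 :: 'e})" by (intro open_Compl closed_singleton)
  have id: "Ck_on k (- {0}) (\<lambda>z :: 'e. z)" by (rule Ck_on_bounded_linear[OF bounded_linear_ident S])
  have "Ck_on k (- {0}) (\<lambda>z :: 'e. sqrt (z \<bullet> z))"
    by (rule Ck_on_compose[OF S open_greaterThan Ck_on_inner[OF S id id] Ck_on_sqrt]) auto
  then have "Ck_on k (- {0}) (\<lambda>z :: 'e. inverse (sqrt (z \<bullet> z)))"
    by (rule Ck_on_compose[OF S open_greaterThan _ Ck_on_inverse]) auto
  from Ck_on_scaleR[OF S this id] show ?thesis by (simp add: norm_eq_sqrt_inner)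
qed

text \<open>Write \<open>e\<close> as its norm times its direction. Where the derivative of the
  direction vanishes, the product rule leaves only the radial term.\<close>

lemma has_derivative_of_normalized:
  fixes e :: "'a::euclidean_space \<Rightarrow> 'b::euclidean_space"
  assumes e: "(e has_derivative e') (at y)" "e y \<noteq> 0"
    and F: "((\<lambda>z. inverse (norm (e z)) *\<^sub>R e z) has_derivative F') (at y)" and a: "F' a = 0"
  obtains \<xi> where "e' a = \<xi> *\<^sub>R e y"
proof -
  let ?F = "\<lambda>z. inverse (norm (e z)) *\<^sub>R e z"
  have n: "((\<lambda>z. norm (e z)) has_derivative (\<lambda>h. sgn (e y) \<bullet> e' h)) (at y)"
    using has_derivative_compose[OF e(1) has_derivative_norm[OF e(2)]] by (simp add: inner_commute)
  have "((\<lambda>z. norm (e z) *\<^sub>R ?F z) has_derivative (\<lambda>h. norm (e y) *\<^sub>R F' h + (sgn (e y) \<bullet> e' h) *\<^sub>R ?F y)) (at y)"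
    by (rule has_derivative_scaleR[OF n F])
  moreover have "(\<lambda>z. norm (e z) *\<^sub>R ?F z) = e"
  proof
    show "norm (e z) *\<^sub>R ?F z = e z" for z by (cases "e z = 0") auto
  qed
  ultimately have "(e has_derivative (\<lambda>h. norm (e y) *\<^sub>R F' h + (sgn (e y) \<bullet> e' h) *\<^sub>R ?F y)) (at y)" by simp
  then have "e' = (\<lambda>h. norm (e y) *\<^sub>R F' h + (sgn (e y) \<bullet> e' h) *\<^sub>R ?F y)"
    by (rule has_derivative_unique[OF e(1)])
  then have "e' a = norm (e y) *\<^sub>R F' a + (sgn (e y) \<bullet> e' a) *\<^sub>R ?F y" by meson
  then have "e' a = ((sgn (e y) \<bullet> e' a) * inverse (norm (e y))) *\<^sub>R e y" using a by simp
  then show thesis using that by blast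
qed

text \<open>The strict inequality leaves room for a real bound below \<open>r\<close>, and
  homogeneity of degree two carries the bound from unit vectors to all vectors.\<close>

lemma smooth_immersed_curvature:
  assumes "smooth_immersed X A f" and less: "max_normal_curvature A f < ereal r" and r: "0 < r"
  obtains \<kappa> where "\<kappa> < r" "immersed X A f \<kappa>"
proof -
  interpret smooth_immersed X A f by fact
  obtain k where k: "max_normal_curvature A f < ereal k" "k < r"
    using ereal_dense2[OF less] by auto
  define \<kappa> where "\<kappa> = max 0 k"
  have \<kappa>: "0 \<le> \<kappa>" "\<kappa> < r" using k(2) r by (auto simp: \<kappa>_def)
  have "immersed X A f \<kappa>"
  proof
    fix U \<phi> y a assume c: "(U, \<phi>) \<in> A" and y: "y \<in> \<phi> ` U"
    interpret u: chart_immersion "\<phi> ` U" "f \<circ> inv_into U \<phi>" by (rule chart_immersion[OF c])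
    let ?F = "f \<circ> inv_into U \<phi>"
    have II: "second_fundamental_form ?F y v v = u.Nor y (u.D2 y v v)" for v
      unfolding second_fundamental_form_def u.Nor_def u.D2_def u.D_def ..
    have Nl: "linear (u.Nor y)" unfolding u.Nor_def by (rule normal_component_linear[OF u.range_subspace[OF y]])
    have D: "frechet_derivative ?F (at y) = u.D y" by (simp add: u.D_def[abs_def])
    show "norm (second_fundamental_form ?F y a a) \<le> \<kappa> * (norm (frechet_derivative ?F (at y) a))\<^sup>2"
    proof (cases "a = 0")
      case True
      then show ?thesis unfolding II using linear_0[OF u.D2_linear1[OF y]] linear_0[OF Nl] \<kappa>(1) by simp
    next
      case False
      define l where "l = norm (u.D y a)"
      have "u.D y a \<noteq> 0" using False u.D_inj[OF y] linear_injective_0[OF u.D_linear[OF y]] by blast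
      then have l: "l > 0" by (simp add: l_def)
      define w where "w = a /\<^sub>R l"
      have aw: "a = l *\<^sub>R w" using l by (simp add: w_def)
      have "norm (u.D y w) = 1"
        unfolding w_def using linear_scale[OF u.D_linear[OF y]] l by (simp add: l_def[symmetric])
      then have "pullback_metric ?F y w w = 1" unfolding pullback_metric_def D by (simp add: norm_eq_1)
      then have "ereal (norm (second_fundamental_form ?F y w w)) \<le> max_normal_curvature A f"
        unfolding max_normal_curvature_def using c y by (intro Sup_upper) blast
      then have "ereal (norm (second_fundamental_form ?F y w w)) < ereal k" using k(1) by (rule order.strict_trans1)
      then have w: "norm (second_fundamental_form ?F y w w) \<le> \<kappa>" by (simp add: \<kappa>_def)
      have "second_fundamental_form ?F y a a = (l * l) *\<^sub>R second_fundamental_form ?F y w w"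
        unfolding II aw using linear_scale[OF u.D2_linear1[OF y]] linear_scale[OF u.D2_linear2[OF y]] linear_scale[OF Nl]
        by simp
      then have "norm (second_fundamental_form ?F y a a) = l\<^sup>2 * norm (second_fundamental_form ?F y w w)"
        by (simp add: power2_eq_square)
      also have "\<dots> \<le> l\<^sup>2 * \<kappa>" using w by (intro mult_left_mono) auto
      finally show ?thesis unfolding D l_def by (simp add: mult.commute)
    qed
  qed (rule \<kappa>(1))
  then show thesis using that \<kappa>(2) by blast
qed

context farthest begin

lemma sphere_map:
  obtains F :: "'a \<Rightarrow> 'e \<times> real" where "smooth_immersion A F" "\<And>x. x \<in> topspace X \<Longrightarrow> norm (F x) = 1"
    "\<exists>!x. x \<in> topspace X \<and> F x = (0, 1)"
proof -
  obtain U0 \<phi>0 where c0: "(U0, \<phi>0) \<in> A" "p \<in> U0" using chart_exists[OF p(1)] .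
  interpret u0: chart_immersion "\<phi>0 ` U0" "f \<circ> inv_into U0 \<phi>0" by (rule chart_immersion[OF c0(1)])
  have y0: "\<phi>0 p \<in> \<phi>0 ` U0" using c0(2) by blast
  define D0 where "D0 = u0.D (\<phi>0 p)"
  \<comment> \<open>The kernel of \<open>L\<close> is the normal space at \<open>p\<close>, so
    \<open>L\<close> reads off tangential parts at \<open>p\<close> in chart coordinates, that is,
    with values in the model space.\<close>
  define L where "L = adjoint D0"
  have D0: "linear D0" unfolding D0_def by (rule u0.D_linear[OF y0])
  have L: "linear L" unfolding L_def by (rule adjoint_linear[OF D0])
  have Lb: "bounded_linear L" using L by (simp add: linear_conv_bounded_linear)
  have tp: "tangent p = range D0" using tangent_chart[OF c0] by (simp add: D0_def u0.D_def[abs_def])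
  have Lnor: "nor p v = v" if v: "L v = 0" for v
  proof -
    have "v \<bullet> t = 0" if t: "t \<in> tangent p" for t
    proof -
      obtain a where "t = D0 a" using t unfolding tp by blast
      then show ?thesis using adjoint_works[OF D0, of a v] v by (simp add: L_def inner_commute)
    qed
    then have "v \<bullet> (v - nor p v) = 0" using nor_props(3)[OF p(1)] by blast
    then show ?thesis using nor_props(7)[OF p(1), of v] by simp
  qed
  \<comment> \<open>Half of \<open>c^2 - 3/4\<close> is the margin in \<open>no_kernel\<close>. The
    bound by 1 keeps \<open>2 * q\<close> below 3, which rules out the third alternative of
    \<open>dichotomy\<close>.\<close>
  define q where "q = min ((c\<^sup>2 - 3 / 4) / 2) 1"
  have q: "0 < q" "2 * q \<le> c\<^sup>2 - 3 / 4" "q \<le> 1" using c(1) by (auto simp: q_def min_def)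
  define G where "G v = (L (v - f p), q - ((v - f p) \<bullet> (v - f p)) / 2)" for v
  define G' where "G' v h = (L h, - ((v - f p) \<bullet> h))" for v h
  have G': "(G has_derivative G' v) (at v)" for v
  proof -
    have "((\<lambda>v. L (v - f p)) has_derivative (\<lambda>h. L (h - 0))) (at v)"
      by (rule bounded_linear.has_derivative[OF Lb]) (intro has_derivative_diff has_derivative_ident has_derivative_const)
    then show ?thesis unfolding G_def[abs_def] G'_def[abs_def]
      by (auto intro!: derivative_eq_intros simp: inner_commute)
  qed
  have GCk: "Ck_on k UNIV G" for k
  proof -
    have id: "Ck_on k UNIV (\<lambda>v. v + - f p)"
      by (intro Ck_on_add Ck_on_bounded_linear bounded_linear_ident Ck_on_const open_UNIV)
    have "Ck_on k UNIV (\<lambda>v. (L (v + - f p), q + (- (1/2)) * ((v + - f p) \<bullet> (v + - f p))))"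
      by (intro Ck_on_Pair Ck_on_linear_compose[OF Lb] Ck_on_add Ck_on_mult Ck_on_inner Ck_on_const id open_UNIV)
    then show ?thesis by (simp add: G_def[abs_def])
  qed
  \<comment> \<open>Over the closed upper half-axis \<open>f x - f p\<close> is normal at
    \<open>p\<close>; unless \<open>x = p\<close>, the dichotomy then pushes its length beyond
    \<open>2 * c\<close>.\<close>
  have horn: "x = p" if x: "x \<in> topspace X" "L (f x - f p) = 0" "(norm (f x - f p))\<^sup>2 \<le> 2 * q" for x
  proof (rule ccontr)
    assume "x \<noteq> p"
    then have "2 * c * norm (f x - f p) < (norm (f x - f p))\<^sup>2"
      using dichotomy[OF x(1)] Lnor[OF x(2)] x(3) q(3) by auto
    then have "2 * c * norm (f x - f p) < norm (f x - f p) * norm (f x - f p)" by (simp add: power2_eq_square)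
    then have "2 * c < norm (f x - f p)"
      by (metis mult_right_mono norm_ge_zero not_le)
    then have "(2 * c)\<^sup>2 < (norm (f x - f p))\<^sup>2" using c(2) by (intro power_strict_mono) auto
    then show False using x(3) q(3) c(1) by (simp add: power_mult_distrib)
  qed
  have G0: "G (f x) \<noteq> 0" if x: "x \<in> topspace X" for x
  proof
    assume "G (f x) = 0"
    then have g: "L (f x - f p) = 0" "(norm (f x - f p))\<^sup>2 = 2 * q"
      by (auto simp: G_def prod_eq_iff power2_norm_eq_inner)
    then have "x = p" using horn[OF x] by simp
    then show False using g(2) q(1) by simp
  qed
  define F where "F x = inverse (norm (G (f x))) *\<^sub>R G (f x)" for x
  have "smooth_immersion A F"
    unfolding smooth_immersion_def
  proof (intro ballI, clarify, intro conjI ballI)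
    fix U \<phi> assume c': "(U, \<phi>) \<in> A"
    interpret u: chart_immersion "\<phi> ` U" "f \<circ> inv_into U \<phi>" by (rule chart_immersion[OF c'])
    let ?f = "f \<circ> inv_into U \<phi>"
    have X: "inv_into U \<phi> y \<in> topspace X" if "y \<in> \<phi> ` U" for y
      using chart_inverse(2)[OF c' that] chart_props(4)[OF c'] by blast
    have e: "Ck_on k (\<phi> ` U) (\<lambda>y. G (?f y))" for k
      by (rule Ck_on_compose[OF u.S open_UNIV u.smooth GCk]) simp
    have FE: "F \<circ> inv_into U \<phi> = (\<lambda>y. inverse (norm (G (?f y))) *\<^sub>R G (?f y))" by (simp add: F_def fun_eq_iff)
    have FCk: "Ck_on k (\<phi> ` U) (F \<circ> inv_into U \<phi>)" for k
      unfolding FE by (rule Ck_on_compose[OF u.S _ e normalize_Ck]) (use G0[OF X] in auto)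
    then show "smooth_on (\<phi> ` U) (F \<circ> inv_into U \<phi>)" by (simp add: smooth_on_def)
    fix y assume y: "y \<in> \<phi> ` U"
    let ?F' = "frechet_derivative (F \<circ> inv_into U \<phi>) (at y)" and ?x = "inv_into U \<phi> y"
    have F': "(F \<circ> inv_into U \<phi> has_derivative ?F') (at y)" by (rule Ck_on_SucD(1)[OF u.S FCk y])
    have e': "((\<lambda>y. G (?f y)) has_derivative (\<lambda>h. G' (?f y) (u.D y h))) (at y)"
      by (rule has_derivative_compose[OF u.D_derivative[OF y] G'])
    have "a = 0" if a: "?F' a = 0" for a
    proof -
      have "G (?f y) \<noteq> 0" using G0[OF X[OF y]] by simp
      then obtain \<xi> where \<xi>: "G' (?f y) (u.D y a) = \<xi> *\<^sub>R G (?f y)"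
        by (rule has_derivative_of_normalized[OF e' _ F'[unfolded FE] a[unfolded FE]])
      let ?t = "u.D y a"
      have t: "?t \<in> tangent ?x"
        using tangent_chart[OF c' chart_inverse(2)[OF c' y]] chart_inverse(3)[OF c' y] by (simp add: u.D_def)
      have "L ?t = \<xi> *\<^sub>R L (f ?x - f p)" using \<xi> by (simp add: G_def G'_def)
      then have "L (?t - \<xi> *\<^sub>R (f ?x - f p)) = 0" by (simp add: linear_diff[OF L] linear_scale[OF L])
      from Lnor[OF this] have k: "nor p (?t - \<xi> *\<^sub>R (f ?x - f p)) = ?t - \<xi> *\<^sub>R (f ?x - f p)" .
      have "- ((f ?x - f p) \<bullet> ?t) = \<xi> * (q - (norm (f ?x - f p))\<^sup>2 / 2)"
        using \<xi> by (simp add: G_def G'_def power2_norm_eq_inner)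
      from no_kernel[OF X[OF y] t q(1,2) k this] have "u.D y a = 0" .
      then show "a = 0" using u.D_inj[OF y] linear_injective_0[OF u.D_linear[OF y]] by blast
    qed
    then show "inj ?F'" using linear_injective_0[OF has_derivative_linear[OF F']] by blast
  qed
  moreover have "norm (F x) = 1" if "x \<in> topspace X" for x using G0[OF that] by (simp add: F_def)
  moreover have "\<exists>!x. x \<in> topspace X \<and> F x = (0, 1)"
  proof (rule ex1I[of _ p])
    have "G (f p) = (0, q)" by (simp add: G_def linear_0[OF L])
    moreover have "norm (0 :: 'e, q) = q" using q(1) by (simp add: norm_Pair)
    ultimately show "p \<in> topspace X \<and> F p = (0, 1)" using p(1) q(1) by (simp add: F_def)
    fix x assume x: "x \<in> topspace X \<and> F x = (0, 1)"
    have "G (f x) = norm (G (f x)) *\<^sub>R F x" unfolding F_def using G0[OF conjunct1[OF x]] by simp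
    then have g: "G (f x) = (0, norm (G (f x)))" using x by simp
    then have "L (f x - f p) = 0" by (simp add: G_def prod_eq_iff)
    moreover have "q - ((f x - f p) \<bullet> (f x - f p)) / 2 \<ge> 0"
      using g norm_ge_zero[of "G (f x)"] by (metis G_def snd_conv)
    ultimately show "x = p" using horn x by (simp add: power2_norm_eq_inner)
  qed
  ultimately show thesis by (rule that)
qed

end

section \<open>Closed curves\<close>

text \<open>Injectivity and continuity make \<open>\<theta>\<close> monotone, which fixes the sign
  of the difference quotients. So \<open>\<sigma> * \<theta> t - t\<close> has derivative
  zero.\<close>

lemma unit_slope_affine:
  fixes \<theta> :: "real \<Rightarrow> real"
  assumes J: "open J" "is_interval J" and c: "continuous_on J \<theta>" "inj_on \<theta> J"
    and s: "\<And>t. t \<in> J \<Longrightarrow> ((\<lambda>s. \<bar>(\<theta> s - \<theta> t) / (s - t)\<bar>) \<longlongrightarrow> 1) (at t)"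
  obtains \<sigma> :: real where "\<sigma> = 1 \<or> \<sigma> = - 1" "\<And>s t. s \<in> J \<Longrightarrow> t \<in> J \<Longrightarrow> \<theta> s - \<theta> t = \<sigma> * (s - t)"
proof -
  have "strict_mono_on J \<theta> \<or> strict_antimono_on J \<theta>"
    using injective_eq_monotone_map[OF J(2) c(1)] c(2) by blast
  then obtain \<sigma> :: real where \<sigma>: "\<sigma> = 1 \<or> \<sigma> = - 1"
    and m: "\<And>s t. s \<in> J \<Longrightarrow> t \<in> J \<Longrightarrow> s < t \<Longrightarrow> 0 < \<sigma> * (\<theta> t - \<theta> s)"
  proof
    assume a: "strict_mono_on J \<theta>"
    show thesis by (rule that[of 1]) (use a in \<open>auto simp: monotone_on_def\<close>)
  next
    assume a: "strict_antimono_on J \<theta>"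
    show thesis by (rule that[of "- 1"]) (use a in \<open>auto simp: monotone_on_def\<close>)
  qed
  have abs: "\<bar>(\<theta> s - \<theta> t) / (s - t)\<bar> = \<sigma> * ((\<theta> s - \<theta> t) / (s - t))" if "s \<in> J" "t \<in> J" "s \<noteq> t" for s t
  proof -
    have "0 \<le> \<sigma> * ((\<theta> s - \<theta> t) / (s - t))"
    proof (cases "s < t")
      case True
      have "\<sigma> * ((\<theta> s - \<theta> t) / (s - t)) = (\<sigma> * (\<theta> t - \<theta> s)) / (t - s)"
        by (metis minus_diff_eq minus_divide_divide times_divide_eq_right)
      then show ?thesis using m[OF that(1,2) True] True by simp
    next
      case False
      then show ?thesis using m[OF that(2,1)] that(3) by simp
    qed
    then have "\<bar>\<sigma> * ((\<theta> s - \<theta> t) / (s - t))\<bar> = \<sigma> * ((\<theta> s - \<theta> t) / (s - t))" by (rule abs_of_nonneg)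
    moreover have "\<bar>\<sigma> * a\<bar> = \<bar>a\<bar>" for a using \<sigma> by auto
    ultimately show ?thesis by (simp only:)
  qed
  have d: "((\<lambda>t. \<sigma> * \<theta> t - t) has_real_derivative 0) (at t)" if t: "t \<in> J" for t
  proof -
    have "\<forall>\<^sub>F s in at t. s \<in> J" using J(1) t by (metis eventually_at_topological)
    moreover have "\<forall>\<^sub>F s in at t. s \<noteq> t" by (simp add: eventually_at_filter)
    ultimately have "\<forall>\<^sub>F s in at t. \<bar>(\<theta> s - \<theta> t) / (s - t)\<bar> = \<sigma> * ((\<theta> s - \<theta> t) / (s - t))"
      by eventually_elim (rule abs[OF _ t])
    from Lim_transform_eventually[OF s[OF t] this]
    have "((\<lambda>s. \<sigma> * ((\<theta> s - \<theta> t) / (s - t)) - 1) \<longlongrightarrow> 1 - 1) (at t)" by (intro tendsto_diff tendsto_const)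
    moreover have "\<forall>\<^sub>F s in at t. \<sigma> * ((\<theta> s - \<theta> t) / (s - t)) - 1 = ((\<sigma> * \<theta> s - s) - (\<sigma> * \<theta> t - t)) / (s - t)"
      unfolding eventually_at_filter by (rule always_eventually) (simp add: field_simps)
    ultimately have "((\<lambda>s. ((\<sigma> * \<theta> s - s) - (\<sigma> * \<theta> t - t)) / (s - t)) \<longlongrightarrow> 1 - 1) (at t)"
      by (rule Lim_transform_eventually)
    then show ?thesis by (simp add: has_field_derivative_iff)
  qed
  have "convex J" using J(2) by (simp add: is_interval_convex)
  then have eq: "\<sigma> * \<theta> s - s = \<sigma> * \<theta> t - t" if "s \<in> J" "t \<in> J" for s t
    using has_field_derivative_zero_constant[of J "\<lambda>t. \<sigma> * \<theta> t - t"] d that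
    by (metis has_field_derivative_at_within)
  show thesis
  proof (rule that[OF \<sigma>])
    fix s t assume "s \<in> J" "t \<in> J"
    from eq[OF this] show "\<theta> s - \<theta> t = \<sigma> * (s - t)" using \<sigma> by auto
  qed
qed

lemma unit_Basis_1:
  fixes b :: "'e::euclidean_space"
  assumes "DIM('e) = 1" "b \<in> Basis"
  shows "v = (v \<bullet> b) *\<^sub>R b" "norm v = \<bar>v \<bullet> b\<bar>"
proof -
  have B: "(Basis :: 'e set) = {b}" using assms by (metis card_1_singletonE singletonD)
  have "(\<Sum>i\<in>{b}. (v \<bullet> i) *\<^sub>R i) = v" unfolding B[symmetric] by (rule euclidean_representation)
  then show v: "v = (v \<bullet> b) *\<^sub>R b" by simp
  have "norm v = norm ((v \<bullet> b) *\<^sub>R b)" using v by simp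
  then show "norm v = \<bar>v \<bullet> b\<bar>" using assms(2) by simp
qed

context smooth_immersed begin

text \<open>The last clause says that \<open>k\<close> is an arc length parameter on \<open>W\<close>.\<close>

definition isochart :: "'a set \<Rightarrow> ('a \<Rightarrow> real) \<Rightarrow> bool" where
  "isochart W k \<longleftrightarrow> openin X W \<and> inj_on k W \<and> continuous_map (subtopology X W) euclideanreal k \<and>
    (\<forall>V. openin X V \<longrightarrow> V \<subseteq> W \<longrightarrow> open (k ` V)) \<and>
    (\<forall>x\<in>W. \<forall>e>0. \<exists>N. openin X N \<and> x \<in> N \<and> (\<forall>y\<in>N \<inter> W. (1 - e) * \<bar>k y - k x\<bar> \<le> norm (f y - f x) \<and>
      norm (f y - f x) \<le> (1 + e) * \<bar>k y - k x\<bar>))"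

lemma isochart_open_less:
  assumes "isochart W k" "open T"
  shows "openin X {x \<in> W. k x \<in> T}"
proof -
  have W: "openin X W" and c: "continuous_map (subtopology X W) euclideanreal k" using assms(1) by (auto simp: isochart_def)
  have "openin (subtopology X W) {x \<in> topspace (subtopology X W). k x \<in> T}"
    using openin_continuous_map_preimage[OF c] assms(2) by simp
  moreover have "{x \<in> topspace (subtopology X W). k x \<in> T} = {x \<in> W. k x \<in> T}" using openin_subset[OF W] by auto
  ultimately show ?thesis using W by (simp add: openin_open_subtopology)
qed

text \<open>The parameter is signed arc length from \<open>x\<close>, the integral of the speed
  \<open>v\<close> along the chart line. Its smoothness in the chart is kept for
  \<open>circle_map\<close>.\<close>

lemma chart_isochart:
  assumes dim: "DIM('e) = 1" and c: "(U, \<phi>) \<in> A" "x \<in> U"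
  obtains W k r where "isochart W k" "x \<in> W" "W \<subseteq> U" "k x = 0" "0 < r" "k ` W = {-r<..<r}"
    "open (\<phi> ` W)" "\<And>n. Ck_on n (\<phi> ` W) (k \<circ> inv_into U \<phi>)"
    "\<And>y. y \<in> \<phi> ` W \<Longrightarrow> inj (frechet_derivative (k \<circ> inv_into U \<phi>) (at y))"
proof -
  note i = chart_inverse[OF c(1)]
  interpret u: chart_immersion "\<phi> ` U" "f \<circ> inv_into U \<phi>" by (rule chart_immersion[OF c(1)])
  let ?F = "f \<circ> inv_into U \<phi>" and ?y0 = "\<phi> x"
  obtain b :: 'e where b: "b \<in> Basis" using nonempty_Basis by blast
  note B1 = unit_Basis_1[OF dim b]
  have bb: "b \<bullet> b = 1" using b by simp
  obtain e where e: "e > 0" "ball ?y0 e \<subseteq> \<phi> ` U"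
    using u.S c(2) open_contains_ball by blast
  define d where "d = e / 2"
  have d: "0 < d" "d < e" using e(1) by (auto simp: d_def)
  define j where "j s = ?y0 + s *\<^sub>R b" for s :: real
  have jS: "j s \<in> \<phi> ` U" if "\<bar>s\<bar> < e" for s
    using e(2) that b by (intro subsetD[OF e(2)]) (simp add: j_def dist_norm)
  define v where "v s = sqrt (u.D (j s) b \<bullet> u.D (j s) b)" for s
  have vn: "v s = norm (u.D (j s) b)" for s by (simp add: v_def norm_eq_sqrt_inner)
  have v0: "0 < v s" if "\<bar>s\<bar> < e" for s
  proof -
    have "u.D (j s) b \<noteq> 0" using u.D_inj[OF jS[OF that]] linear_injective_0[OF u.D_linear[OF jS[OF that]]] b
      by (metis nonzero_Basis)
    then show ?thesis by (simp add: vn)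
  qed
  have I: "open {-e<..<e}" by simp
  have jCk: "Ck_on n {-e<..<e} j" for n
    unfolding j_def[abs_def] by (intro Ck_on_add Ck_on_const Ck_on_bounded_linear bounded_linear_scaleR_left I)
  have DCk: "Ck_on n {-e<..<e} (\<lambda>s. u.D (j s) b)" for n
    by (rule Ck_on_compose[OF I u.S jCk u.D_Ck]) (use jS in force)
  have vCk: "Ck_on n {-e<..<e} v" for n
    unfolding v_def[abs_def]
    by (rule Ck_on_compose[OF I open_greaterThan Ck_on_inner[OF I DCk DCk] Ck_on_sqrt])
      (use v0 in \<open>force simp: v_def\<close>)
  have "continuous_on {-d..d} v" by (rule continuous_on_subset[OF Ck_on_imp_continuous_on[OF vCk[of 0]]]) (use d in auto)
  then have int: "((\<lambda>t. integral {-d..t} v) has_real_derivative v t) (at t within {-d..d})" if "t \<in> {-d..d}" for t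
    using integral_has_real_derivative that by blast
  define l where "l t = integral {-d..t} v - integral {-d..0} v" for t
  have l: "(l has_real_derivative v t) (at t)" if t: "t \<in> {-d<..<d}" for t
  proof -
    have "((\<lambda>t. integral {-d..t} v) has_real_derivative v t) (at t within {-d<..<d})"
      using int[of t] t by (intro DERIV_subset[of _ _ _ "{-d..d}" "{-d<..<d}"]) auto
    then have "((\<lambda>t. integral {-d..t} v) has_real_derivative v t) (at t)"
      using at_within_open[of t "{-d<..<d}"] t by simp
    then show ?thesis unfolding l_def[abs_def] by (auto intro!: derivative_eq_intros)
  qed
  have l0: "l 0 = 0" by (simp add: l_def)
  have I': "open {-d<..<d}" by simp
  have lmono: "l s < l t" if st: "s \<in> {-d<..<d}" "t \<in> {-d<..<d}" "s < t" for s t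
  proof (rule DERIV_pos_imp_increasing[OF st(3)])
    fix a assume "s \<le> a" "a \<le> t"
    then have a: "a \<in> {-d<..<d}" using st by auto
    have "0 < v a" by (rule v0) (use a d in auto)
    then show "\<exists>y. (l has_real_derivative y) (at a) \<and> 0 < y" using l[OF a] by blast
  qed
  have linj: "inj_on l {-d<..<d}"
    by (intro inj_onI) (metis lmono less_irrefl linorder_less_linear)
  have lCk: "Ck_on n {-d<..<d} l" for n
  proof -
    have "Ck_on (Suc n) {-d<..<d} l"
      by (rule Ck_on_real_fun[OF I' l Ck_on_subset[OF vCk]]) (use d in auto)
    then show ?thesis by (rule Ck_on_lower[OF I'])
  qed
  have lopen: "open (l ` {-d<..<d})"
    by (rule invariance_of_domain_gen[OF I' Ck_on_imp_continuous_on[OF lCk[of 0]] linj]) simp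
  then obtain r where r: "r > 0" "ball 0 r \<subseteq> l ` {-d<..<d}"
    using l0 d(1) open_contains_ball by (metis (no_types, lifting) greaterThanLessThan_iff imageI neg_less_0_iff_less)
  define h where "h y = (y - ?y0) \<bullet> b" for y
  have hy: "y = j (h y)" for y using B1(1)[of "y - ?y0"] by (simp add: j_def h_def)
  have hd: "\<bar>h y\<bar> = dist ?y0 y" for y using B1(2)[of "y - ?y0"] by (simp add: h_def dist_norm norm_minus_commute)
  define \<kappa> where "\<kappa> y = l (h y)" for y
  let ?B = "ball ?y0 d"
  have hB: "h y \<in> {-d<..<d}" if "y \<in> ?B" for y using that hd[of y] by auto
  have hlin: "Ck_on n S h" if "open S" for n S
  proof -
    have "Ck_on n S (\<lambda>y. (y + - ?y0) \<bullet> b)"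
      by (intro Ck_on_inner Ck_on_add Ck_on_const Ck_on_bounded_linear[OF bounded_linear_ident] that)
    then show ?thesis by (simp add: h_def[abs_def])
  qed
  have \<kappa>Ck: "Ck_on n ?B \<kappa>" for n
    unfolding \<kappa>_def[abs_def] by (rule Ck_on_compose[OF open_ball I' hlin[OF open_ball] lCk]) (use hB in blast)
  have hder: "(h has_derivative (\<lambda>a. a \<bullet> b)) (at y)" for y
    unfolding h_def[abs_def] by (auto intro!: derivative_eq_intros)
  have \<kappa>der: "(\<kappa> has_derivative (\<lambda>a. v (h y) * (a \<bullet> b))) (at y)" if y: "y \<in> ?B" for y
    using has_derivative_compose[OF hder has_field_derivative_imp_has_derivative[OF l[OF hB[OF y]]]]
    by (simp add: \<kappa>_def[abs_def])
  have \<kappa>inj: "inj_on \<kappa> ?B"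
  proof (rule inj_onI)
    fix a b' assume ab: "a \<in> ?B" "b' \<in> ?B" "\<kappa> a = \<kappa> b'"
    then have "h a = h b'" using inj_onD[OF linj _ hB hB] unfolding \<kappa>_def by blast
    then show "a = b'" using hy by metis
  qed
  \<comment> \<open>Cut down so that the values of the parameter fill a symmetric interval, as
    \<open>uniform_isochart\<close> requires.\<close>
  define T where "T = {y \<in> ?B. \<kappa> y \<in> {-r<..<r}}"
  have Teq: "T = ?B \<inter> \<kappa> -` {-r<..<r}" by (auto simp: T_def)
  have T: "open T" unfolding Teq
    by (rule continuous_open_preimage[OF Ck_on_imp_continuous_on[OF \<kappa>Ck[of 0]]]) auto
  have TB: "T \<subseteq> ?B" by (auto simp: T_def)
  have TU: "T \<subseteq> \<phi> ` U" using TB d(2) e(2) by (meson ball_subset_ball_iff less_imp_le order_trans subset_ball)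
  let ?W = "inv_into U \<phi> ` T"
  define k where "k z = \<kappa> (\<phi> z)" for z
  have WU: "?W \<subseteq> U" using TU i(2) by blast
  have \<phi>W: "\<phi> ` ?W = T" using TU i(3) by (force simp: image_image)
  have kT: "k (inv_into U \<phi> y) = \<kappa> y" if "y \<in> T" for y using that TU i(3) by (auto simp: k_def)
  have kiT: "(k \<circ> inv_into U \<phi>) y = \<kappa> y" if "y \<in> T" for y using kT[OF that] by simp
  have W: "openin X ?W" by (rule chart_open_preimage[OF c(1) T TU])
  have y0T: "?y0 \<in> T" using r(1) d(1) l0 by (simp add: T_def \<kappa>_def h_def)
  have xW: "x \<in> ?W" using y0T i(1)[OF c(2)] by (metis image_eqI)
  have wT: "\<phi> w \<in> T" if "w \<in> ?W" for w using \<phi>W that by blast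
  have kimg: "k ` ?W = {-r<..<r}"
  proof (intro equalityI subsetI)
    fix t assume "t \<in> k ` ?W"
    then show "t \<in> {-r<..<r}" using kT by (auto simp: T_def)
  next
    fix t assume t: "t \<in> {-r<..<r}"
    then have "t \<in> l ` {-d<..<d}" using r(2) by (auto simp: subset_iff dist_norm)
    then obtain s where s: "s \<in> {-d<..<d}" "t = l s" by blast
    have hs: "h (j s) = s" by (simp add: h_def j_def bb)
    have "j s \<in> T" using s t b by (auto simp: T_def \<kappa>_def hs) (simp add: j_def dist_norm)
    moreover have "\<kappa> (j s) = t" using s by (simp add: \<kappa>_def hs)
    ultimately show "t \<in> k ` ?W" using kT by (metis image_eqI)
  qed
  have kinj: "inj_on k ?W"
  proof (rule inj_onI)
    fix a b' assume ab: "a \<in> ?W" "b' \<in> ?W" "k a = k b'"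
    then have "\<phi> a = \<phi> b'" using inj_onD[OF \<kappa>inj] wT TB unfolding k_def by blast
    then show "a = b'" using ab WU i(1) by (metis subsetD)
  qed
  have kopen: "open (k ` V)" if V: "openin X V" "V \<subseteq> ?W" for V
  proof -
    have "open (\<phi> ` (U \<inter> V))" by (rule chart_open_image[OF c(1) V(1)])
    moreover have "U \<inter> V = V" using V(2) WU by blast
    ultimately have o: "open (\<phi> ` V)" by simp
    have sub: "\<phi> ` V \<subseteq> ?B" using wT TB V(2) by blast
    have "open (\<kappa> ` \<phi> ` V)"
      by (rule invariance_of_domain_gen[OF o continuous_on_subset[OF Ck_on_imp_continuous_on[OF \<kappa>Ck[of 0]] sub] inj_on_subset[OF \<kappa>inj sub]])
        (simp add: dim)
    then show ?thesis by (simp add: k_def[abs_def] image_image)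
  qed
  have kcont: "continuous_map (subtopology X ?W) euclideanreal k"
  proof -
    have "continuous_map (subtopology X U) (top_of_set (\<phi> ` U)) \<phi>"
      using chart_props(3)[OF c(1)] homeomorphic_imp_continuous_map by blast
    then have "continuous_map (subtopology X U) euclidean \<phi>" by (simp add: continuous_map_in_subtopology)
    then have "continuous_map (subtopology X ?W) euclidean \<phi>"
      using WU by (metis continuous_map_from_subtopology_mono)
    then have "continuous_map (subtopology X ?W) (top_of_set ?B) \<phi>"
      using wT TB by (auto simp: continuous_map_in_subtopology)
    moreover have "continuous_map (top_of_set ?B) euclideanreal \<kappa>"
      using Ck_on_imp_continuous_on[OF \<kappa>Ck[of 0]] by simp
    ultimately have "continuous_map (subtopology X ?W) euclideanreal (\<kappa> \<circ> \<phi>)" by (rule continuous_map_compose)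
    then show ?thesis by (simp add: k_def[abs_def] o_def)
  qed
  have metric: "\<exists>N. openin X N \<and> z \<in> N \<and> (\<forall>y\<in>N \<inter> ?W. (1 - \<epsilon>) * \<bar>k y - k z\<bar> \<le> norm (f y - f z) \<and>
      norm (f y - f z) \<le> (1 + \<epsilon>) * \<bar>k y - k z\<bar>)" if z: "z \<in> ?W" and \<epsilon>: "\<epsilon> > 0" for z \<epsilon>
  proof -
    let ?y = "\<phi> z"
    have zT: "?y \<in> T" by (rule wT[OF z])
    have zU: "z \<in> U" using z WU by blast
    have yB: "?y \<in> ?B" using zT TB by blast
    define V where "V = v (h ?y)"
    have V0: "0 < V" using v0[of "h ?y"] hB[OF yB] d by (auto simp: V_def abs_less_iff)
    \<comment> \<open>Solves \<open>(1 + \<epsilon>) (V - \<eta>) = V + \<eta>\<close>: an error of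
      \<open>\<eta> * t\<close> in both lengths is just covered by the factor
      \<open>1 + \<epsilon>\<close>.\<close>
    define \<eta> where "\<eta> = V * \<epsilon> / (2 + \<epsilon>)"
    have \<eta>: "0 < \<eta>" using V0 \<epsilon> by (simp add: \<eta>_def)
    have \<eta>1: "\<eta> * (2 + \<epsilon>) = V * \<epsilon>" using \<epsilon> by (simp add: \<eta>_def)
    have "\<exists>\<delta>>0. \<forall>y'. norm (y' - ?y) < \<delta> \<longrightarrow> norm (?F y' - ?F ?y - u.D ?y (y' - ?y)) \<le> \<eta> * norm (y' - ?y)"
      using u.D_derivative[of ?y] zU \<eta> unfolding has_derivative_at_alt by blast
    then obtain \<delta>1 where \<delta>1: "\<delta>1 > 0" "\<And>y'. norm (y' - ?y) < \<delta>1 \<Longrightarrow> norm (?F y' - ?F ?y - u.D ?y (y' - ?y)) \<le> \<eta> * norm (y' - ?y)" by blast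
    have "\<exists>\<delta>>0. \<forall>y'. norm (y' - ?y) < \<delta> \<longrightarrow> norm (\<kappa> y' - \<kappa> ?y - V * ((y' - ?y) \<bullet> b)) \<le> \<eta> * norm (y' - ?y)"
      using \<kappa>der[OF yB] \<eta> unfolding has_derivative_at_alt V_def by blast
    then obtain \<delta>2 where \<delta>2: "\<delta>2 > 0" "\<And>y'. norm (y' - ?y) < \<delta>2 \<Longrightarrow> norm (\<kappa> y' - \<kappa> ?y - V * ((y' - ?y) \<bullet> b)) \<le> \<eta> * norm (y' - ?y)" by blast
    let ?N = "inv_into U \<phi> ` (T \<inter> ball ?y (min \<delta>1 \<delta>2))"
    show ?thesis
    proof (intro exI conjI ballI)
      show "openin X ?N" by (rule chart_open_preimage[OF c(1)]) (use T TU in auto)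
      show "z \<in> ?N" using zT i(1)[OF zU] \<delta>1(1) \<delta>2(1) by (auto intro!: image_eqI[of _ _ ?y])
      fix y assume "y \<in> ?N \<inter> ?W"
      then obtain y' where y': "y' \<in> T" "dist ?y y' < \<delta>1" "dist ?y y' < \<delta>2" "y = inv_into U \<phi> y'" by auto
      define t where "t = norm (y' - ?y)"
      have t0: "0 \<le> t" by (simp add: t_def)
      have lt: "norm (y' - ?y) < \<delta>1" "norm (y' - ?y) < \<delta>2" using y'(2,3) by (simp_all add: dist_norm norm_minus_commute)
      have "?F ?y = f z" using i(1)[OF zU] by simp
      then have f1: "norm (f y - f z - u.D ?y (y' - ?y)) \<le> \<eta> * t" using \<delta>1(2)[OF lt(1)] y'(4) by (simp add: t_def)
      have k1: "\<bar>k y - k z - V * ((y' - ?y) \<bullet> b)\<bar> \<le> \<eta> * t"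
        using \<delta>2(2)[OF lt(2)] kT[OF y'(1)] y'(4) by (simp add: t_def k_def[of z])
      have "u.D ?y (y' - ?y) = ((y' - ?y) \<bullet> b) *\<^sub>R u.D ?y b"
        using linear_scale[OF u.D_linear[of ?y]] zU B1(1)[of "y' - ?y"] by (metis imageI)
      then have n1: "norm (u.D ?y (y' - ?y)) = V * t"
        using hy[of ?y] B1(2)[of "y' - ?y"] by (simp add: V_def vn t_def)
      have n2: "\<bar>V * ((y' - ?y) \<bullet> b)\<bar> = V * t"
        using V0 B1(2)[of "y' - ?y"] by (simp add: abs_mult t_def)
      have a1: "norm (f y - f z) \<le> V * t + \<eta> * t" "V * t - \<eta> * t \<le> norm (f y - f z)"
        using f1 n1 norm_triangle_ineq2[of "f y - f z" "u.D ?y (y' - ?y)"]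
          norm_triangle_ineq3[of "f y - f z" "u.D ?y (y' - ?y)"] by linarith+
      have a2: "\<bar>k y - k z\<bar> \<le> V * t + \<eta> * t" "V * t - \<eta> * t \<le> \<bar>k y - k z\<bar>" using k1 n2 by linarith+
      have "(1 + \<epsilon>) * (V * t - \<eta> * t) = V * t + \<eta> * t + (V * \<epsilon> - \<eta> * (2 + \<epsilon>)) * t" by (simp add: algebra_simps)
      then have e1: "(1 + \<epsilon>) * (V * t - \<eta> * t) = V * t + \<eta> * t" using \<eta>1 by simp
      have "(1 + \<epsilon>) * (V * t - \<eta> * t) \<le> (1 + \<epsilon>) * \<bar>k y - k z\<bar>" using a2(2) \<epsilon> by (intro mult_left_mono) auto
      then show "norm (f y - f z) \<le> (1 + \<epsilon>) * \<bar>k y - k z\<bar>" using a1(1) e1 by linarith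
      show "(1 - \<epsilon>) * \<bar>k y - k z\<bar> \<le> norm (f y - f z)"
      proof (cases "\<epsilon> \<le> 1")
        case True
        have "(1 - \<epsilon>) * \<bar>k y - k z\<bar> \<le> (1 - \<epsilon>) * (V * t + \<eta> * t)" using a2(1) True by (intro mult_left_mono) auto
        also have "\<dots> = V * t - \<eta> * t - (V * \<epsilon> - \<eta> * (2 + \<epsilon>)) * t - 2 * (\<eta> * (\<epsilon> * t))" by (simp add: algebra_simps)
        also have "\<dots> \<le> V * t - \<eta> * t" using \<eta>1 \<eta> \<epsilon> t0 by simp
        finally show ?thesis using a1(2) by linarith
      next
        case False
        then have "(1 - \<epsilon>) * \<bar>k y - k z\<bar> \<le> 0" by (simp add: mult_nonpos_nonneg)
        then show ?thesis using norm_ge_zero[of "f y - f z"] by linarith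
      qed
    qed
  qed
  show thesis
  proof (rule that[of ?W k r])
    show "isochart ?W k" unfolding isochart_def using W kinj kcont kopen metric by blast
    show "x \<in> ?W" "?W \<subseteq> U" "0 < r" "k ` ?W = {-r<..<r}" using xW WU r(1) kimg by auto
    show "k x = 0" by (simp add: k_def \<kappa>_def h_def l0)
    show "open (\<phi> ` ?W)" unfolding \<phi>W by (rule T)
    show "Ck_on n (\<phi> ` ?W) (k \<circ> inv_into U \<phi>)" for n
      unfolding \<phi>W by (rule Ck_on_cong[OF T kiT[symmetric] Ck_on_subset[OF \<kappa>Ck TB]])
    fix y assume "y \<in> \<phi> ` ?W"
    then have y: "y \<in> T" unfolding \<phi>W .
    have "(k \<circ> inv_into U \<phi> has_derivative (\<lambda>a. v (h y) * (a \<bullet> b))) (at y)"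
      by (rule has_derivative_transform_within_open[OF \<kappa>der T y kiT[symmetric]]) (use y TB in auto)
    then have D: "frechet_derivative (k \<circ> inv_into U \<phi>) (at y) = (\<lambda>a. v (h y) * (a \<bullet> b))"
      by (rule frechet_derivative_at[symmetric])
    have "v (h y) \<noteq> 0" using v0[of "h y"] hB[of y] y TB d by (auto simp: abs_less_iff)
    then show "inj (frechet_derivative (k \<circ> inv_into U \<phi>) (at y))"
      unfolding D using B1(1) by (intro injI) (metis mult_left_cancel)
  qed
qed

end

section \<open>Arc length parametrization of a closed curve\<close>

locale curve = smooth_immersed X A f
  for X :: "'a topology" and A :: "('a, 'e::euclidean_space) atlas" and f :: "'a \<Rightarrow> 'b::euclidean_space" +
  assumes dim: "DIM('e) = 1" and compact: "compact_space X" and connected: "connected_space X"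
    and nonempty: "topspace X \<noteq> {}"
begin

lemma isochartD:
  assumes "isochart W k"
  shows "openin X W" "inj_on k W" "\<And>V. openin X V \<Longrightarrow> V \<subseteq> W \<Longrightarrow> open (k ` V)" "W \<subseteq> topspace X" "open (k ` W)"
  using assms openin_subset unfolding isochart_def by auto

lemma isochart_inv:
  assumes "isochart W k"
  shows "y \<in> W \<Longrightarrow> inv_into W k (k y) = y" "t \<in> k ` W \<Longrightarrow> inv_into W k t \<in> W" "t \<in> k ` W \<Longrightarrow> k (inv_into W k t) = t"
  using isochartD(2)[OF assms] by (auto simp: inv_into_into f_inv_into_f)

lemma isochart_exists:
  assumes "x \<in> topspace X"
  obtains W k where "isochart W k" "x \<in> W"
proof -
  obtain U \<phi> where c: "(U, \<phi>) \<in> A" "x \<in> U" using chart_exists[OF assms] .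
  show thesis by (rule chart_isochart[OF dim c]) (rule that)
qed

text \<open>Both parameters measure the ambient distance up to factors tending to 1, so the
  difference quotients of their transition \<open>\<theta>\<close> tend to 1 in absolute value, and
  \<open>unit_slope_affine\<close> applies.\<close>

lemma isochart_compatible:
  assumes 1: "isochart W1 k1" and 2: "isochart W2 k2" and x: "x \<in> W1" "x \<in> W2"
  obtains \<sigma> :: real and N where "\<sigma> = 1 \<or> \<sigma> = - 1" "openin X N" "x \<in> N" "N \<subseteq> W1" "N \<subseteq> W2"
    "\<And>y. y \<in> N \<Longrightarrow> k2 y - k2 x = \<sigma> * (k1 y - k1 x)"
proof -
  let ?O = "W1 \<inter> W2"
  have O: "openin X ?O" using isochartD(1)[OF 1] isochartD(1)[OF 2] by blast
  have o1: "open (k1 ` V)" if "openin X V" "V \<subseteq> ?O" for V using isochartD(3)[OF 1 that(1)] that(2) by blast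
  have inj1: "inj_on k1 ?O" using isochartD(2)[OF 1] by (rule inj_on_subset) blast
  have inj2: "inj_on k2 ?O" using isochartD(2)[OF 2] by (rule inj_on_subset) blast
  obtain d where d: "d > 0" "ball (k1 x) d \<subseteq> k1 ` ?O"
    using o1[OF O] x open_contains_ball by (metis IntI imageI order_refl)
  let ?J = "ball (k1 x) d"
  define g where "g = inv_into ?O k1"
  have g: "g t \<in> ?O" "k1 (g t) = t" if "t \<in> ?J" for t
  proof -
    have "t \<in> k1 ` ?O" using d(2) that by blast
    then show "g t \<in> ?O" "k1 (g t) = t" unfolding g_def by (rule inv_into_into, rule f_inv_into_f)
  qed
  have gk: "g (k1 y) = y" if "y \<in> ?O" for y unfolding g_def by (rule inv_into_f_f[OF inj1 that])
  define \<theta> where "\<theta> t = k2 (g t)" for t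
  have c1: "continuous_on ?J \<theta>"
    unfolding continuous_on_open_vimage[OF open_ball]
  proof (intro allI impI)
    fix T :: "real set" assume T: "open T"
    let ?V = "{y \<in> W2. k2 y \<in> T} \<inter> ?O"
    have "openin X ?V" using isochart_open_less[OF 2 T] O by blast
    then have "open (k1 ` ?V \<inter> ?J)" by (intro open_Int o1) auto
    moreover have "k1 ` ?V \<inter> ?J = \<theta> -` T \<inter> ?J"
    proof (intro equalityI subsetI)
      fix t assume "t \<in> k1 ` ?V \<inter> ?J"
      then obtain y where y: "y \<in> ?V" "t = k1 y" "t \<in> ?J" by blast
      then show "t \<in> \<theta> -` T \<inter> ?J" using gk[of y] by (simp add: \<theta>_def)
    next
      fix t assume t: "t \<in> \<theta> -` T \<inter> ?J"
      then have tJ: "t \<in> ?J" by blast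
      then have "g t \<in> ?V" using g[OF tJ] t by (auto simp: \<theta>_def)
      then have "k1 (g t) \<in> k1 ` ?V" by (rule imageI)
      then show "t \<in> k1 ` ?V \<inter> ?J" unfolding g(2)[OF tJ] using tJ by (rule IntI)
    qed
    ultimately show "open (\<theta> -` T \<inter> ?J)" by simp
  qed
  have c2: "inj_on \<theta> ?J"
  proof (rule inj_onI)
    fix s t assume st: "s \<in> ?J" "t \<in> ?J" "\<theta> s = \<theta> t"
    then have "g s = g t" using inj_onD[OF inj2 _ g(1) g(1)] unfolding \<theta>_def by blast
    then show "s = t" using g(2)[OF st(1)] g(2)[OF st(2)] by metis
  qed
  have c3: "((\<lambda>s. \<bar>(\<theta> s - \<theta> t) / (s - t)\<bar>) \<longlongrightarrow> 1) (at t)" if t: "t \<in> ?J" for t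
  proof (rule tendstoI)
    fix \<epsilon> :: real assume \<epsilon>: "0 < \<epsilon>"
    \<comment> \<open>With \<open>e \<le> 1/2\<close> the two-sided comparison gives
      \<open>c \<le> 3 * a\<close> and then a relative error of at most
      \<open>4 * e\<close>.\<close>
    define e where "e = min (1/2) (\<epsilon> / 8)"
    have e: "0 < e" "e \<le> 1/2" "8 * e \<le> \<epsilon>" using \<epsilon> by (auto simp: e_def)
    have gt: "g t \<in> W1" "g t \<in> W2" using g(1)[OF t] by auto
    obtain N1 where N1: "openin X N1" "g t \<in> N1" "\<forall>y\<in>N1 \<inter> W1. (1 - e) * \<bar>k1 y - k1 (g t)\<bar> \<le> norm (f y - f (g t)) \<and>
        norm (f y - f (g t)) \<le> (1 + e) * \<bar>k1 y - k1 (g t)\<bar>" using 1 e(1) gt(1) unfolding isochart_def by meson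
    obtain N2 where N2: "openin X N2" "g t \<in> N2" "\<forall>y\<in>N2 \<inter> W2. (1 - e) * \<bar>k2 y - k2 (g t)\<bar> \<le> norm (f y - f (g t)) \<and>
        norm (f y - f (g t)) \<le> (1 + e) * \<bar>k2 y - k2 (g t)\<bar>" using 2 e(1) gt(2) unfolding isochart_def by meson
    let ?N = "N1 \<inter> N2 \<inter> ?O"
    have "openin X ?N" using N1(1) N2(1) O by blast
    then have "open (k1 ` ?N)" by (rule o1) blast
    moreover have "k1 (g t) \<in> k1 ` ?N" using N1(2) N2(2) g(1)[OF t] by (intro imageI) blast
    ultimately have "\<forall>\<^sub>F s in at t. s \<in> k1 ` ?N"
      unfolding g(2)[OF t] eventually_at_topological by blast
    moreover have "\<forall>\<^sub>F s in at t. s \<noteq> t" by (simp add: eventually_at_filter)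
    ultimately show "\<forall>\<^sub>F s in at t. dist \<bar>(\<theta> s - \<theta> t) / (s - t)\<bar> 1 < \<epsilon>"
    proof eventually_elim
      case (elim s)
      then obtain y where y: "y \<in> ?N" "s = k1 y" by blast
      have gs: "g s = y" using gk y by simp
      define a where "a = \<bar>s - t\<bar>"
      define c where "c = \<bar>\<theta> s - \<theta> t\<bar>"
      have a0: "0 < a" using elim by (simp add: a_def)
      have yN: "y \<in> N1 \<inter> W1" "y \<in> N2 \<inter> W2" using y(1) by blast+
      have c_eq: "c = \<bar>k2 y - k2 (g t)\<bar>" unfolding c_def \<theta>_def gs ..
      have a_eq: "a = \<bar>k1 y - k1 (g t)\<bar>" unfolding a_def y(2) g(2)[OF t] ..
      note b1 = bspec[OF N1(3) yN(1), folded a_eq] and b2 = bspec[OF N2(3) yN(2), folded c_eq]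
      have "1/2 * c \<le> (1 - e) * c" "(1 + e) * a \<le> 3/2 * a" using e(2) a0 by (intro mult_right_mono; simp add: c_def)+
      then have c3: "c \<le> 3 * a" using b1 b2 by linarith
      have "c - a \<le> e * c + e * a" "a - c \<le> e * c + e * a" using b1 b2 by (simp_all add: algebra_simps)
      moreover have "e * c \<le> e * (3 * a)" using c3 e(1) by (intro mult_left_mono) auto
      ultimately have "\<bar>c - a\<bar> \<le> 4 * (e * a)" by (simp add: abs_le_iff)
      then have "\<bar>c - a\<bar> / a \<le> 4 * e" using a0 by (simp add: field_simps)
      moreover have "c / a - 1 = (c - a) / a" using a0 by (simp add: diff_divide_distrib)
      then have "\<bar>c / a - 1\<bar> = \<bar>c - a\<bar> / a" using a0 by (simp only: abs_divide abs_of_pos)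
      ultimately have "\<bar>c / a - 1\<bar> < \<epsilon>" using e \<epsilon> by linarith
      then show ?case by (simp add: dist_real_def a_def c_def abs_divide)
    qed
  qed
  have c0: "is_interval ?J" by (simp add: is_interval_ball_real)
  obtain \<sigma> :: real where \<sigma>: "\<sigma> = 1 \<or> \<sigma> = - 1" "\<And>s t. s \<in> ?J \<Longrightarrow> t \<in> ?J \<Longrightarrow> \<theta> s - \<theta> t = \<sigma> * (s - t)"
    by (rule unit_slope_affine[OF open_ball c0 c1 c2 c3]) (assumption, rule that)
  let ?N = "{y \<in> W1. k1 y \<in> ?J} \<inter> ?O"
  show thesis
  proof (rule that[OF \<sigma>(1), of ?N])
    show "openin X ?N" using isochart_open_less[OF 1 open_ball] O by blast
    show "x \<in> ?N" using x d(1) by simp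
    fix y assume y: "y \<in> ?N"
    then show "k2 y - k2 x = \<sigma> * (k1 y - k1 x)"
      using \<sigma>(2)[of "k1 y" "k1 x"] gk[of y] gk[of x] x d(1) by (simp add: \<theta>_def)
  qed auto
qed

definition unit_speed :: "(real \<Rightarrow> 'a) \<Rightarrow> real \<Rightarrow> bool" where
  "unit_speed \<gamma> t \<longleftrightarrow> \<gamma> t \<in> topspace X \<and> (\<forall>W k. isochart W k \<longrightarrow> \<gamma> t \<in> W \<longrightarrow>
    (\<exists>\<sigma> d. (\<sigma> = 1 \<or> \<sigma> = - 1) \<and> 0 < d \<and> (\<forall>s. \<bar>s\<bar> < d \<longrightarrow> \<gamma> (t + s) \<in> W \<and> k (\<gamma> (t + s)) = k (\<gamma> t) + \<sigma> * s)))"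

lemma unit_speedE:
  assumes "unit_speed \<gamma> t" "isochart W k" "\<gamma> t \<in> W"
  obtains \<sigma> d :: real where "\<sigma> = 1 \<or> \<sigma> = - 1" "0 < d"
    "\<And>s. \<bar>s\<bar> < d \<Longrightarrow> \<gamma> (t + s) \<in> W" "\<And>s. \<bar>s\<bar> < d \<Longrightarrow> k (\<gamma> (t + s)) = k (\<gamma> t) + \<sigma> * s"
  using assms unfolding unit_speed_def by metis

lemma unit_speedI:
  assumes W: "isochart W k" "\<gamma> t \<in> W" and \<sigma>: "\<sigma> = 1 \<or> \<sigma> = - 1" and d: "0 < d"
    and \<gamma>: "\<And>s. \<bar>s\<bar> < d \<Longrightarrow> \<gamma> (t + s) \<in> W \<and> k (\<gamma> (t + s)) = k (\<gamma> t) + \<sigma> * s"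
  shows "unit_speed \<gamma> t"
  unfolding unit_speed_def
proof (intro conjI allI impI)
  show "\<gamma> t \<in> topspace X" using isochartD(4)[OF W(1)] W(2) by blast
  fix W' k' assume W': "isochart W' k'" "\<gamma> t \<in> W'"
  obtain \<sigma>' :: real and N where N: "\<sigma>' = 1 \<or> \<sigma>' = - 1" "openin X N" "\<gamma> t \<in> N" "N \<subseteq> W" "N \<subseteq> W'"
    "\<And>y. y \<in> N \<Longrightarrow> k' y - k' (\<gamma> t) = \<sigma>' * (k y - k (\<gamma> t))"
    by (rule isochart_compatible[OF W(1) W'(1) W(2) W'(2)]) (rule that)
  have "open (k ` N)" by (rule isochartD(3)[OF W(1) N(2,4)])
  then obtain r where r: "r > 0" "ball (k (\<gamma> t)) r \<subseteq> k ` N"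
    using N(3) open_contains_ball by (metis imageI)
  have "\<gamma> (t + s) \<in> W' \<and> k' (\<gamma> (t + s)) = k' (\<gamma> t) + \<sigma>' * \<sigma> * s" if s: "\<bar>s\<bar> < min d r" for s
  proof -
    have g: "\<gamma> (t + s) \<in> W" "k (\<gamma> (t + s)) = k (\<gamma> t) + \<sigma> * s" using \<gamma>[of s] s by auto
    have "\<bar>\<sigma> * s\<bar> < r" using \<sigma> s by (auto simp: abs_mult)
    then have "k (\<gamma> (t + s)) \<in> ball (k (\<gamma> t)) r" unfolding g(2) by (simp add: dist_norm)
    then obtain y where y: "y \<in> N" "k (\<gamma> (t + s)) = k y" using r(2) by blast
    have "\<gamma> (t + s) = y" by (rule inj_onD[OF isochartD(2)[OF W(1)] y(2) g(1)]) (use y(1) N(4) in blast)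
    then show ?thesis using N(5) N(6)[OF y(1)] y g(2) by (auto simp: algebra_simps)
  qed
  moreover have "\<sigma>' * \<sigma> = 1 \<or> \<sigma>' * \<sigma> = - 1" using \<sigma> N(1) by auto
  moreover have "0 < min d r" using d r(1) by simp
  ultimately show "\<exists>\<sigma> d. (\<sigma> = 1 \<or> \<sigma> = - 1) \<and> 0 < d \<and> (\<forall>s. \<bar>s\<bar> < d \<longrightarrow> \<gamma> (t + s) \<in> W' \<and> k' (\<gamma> (t + s)) = k' (\<gamma> t) + \<sigma> * s)"
    by blast
qed

lemma unit_speed_cong:
  assumes "unit_speed \<gamma> t" "0 < r" "\<And>s. \<bar>s\<bar> < r \<Longrightarrow> \<gamma>' (t + s) = \<gamma> (t + s)"
  shows "unit_speed \<gamma>' t"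
proof -
  have eq: "\<gamma>' t = \<gamma> t" using assms(3)[of 0] assms(2) by simp
  have "\<gamma> t \<in> topspace X" using assms(1) by (simp add: unit_speed_def)
  then obtain W k where W: "isochart W k" "\<gamma> t \<in> W" by (rule isochart_exists)
  obtain \<sigma> d :: real where "\<sigma> = 1 \<or> \<sigma> = - 1" "0 < d"
    "\<And>s. \<bar>s\<bar> < d \<Longrightarrow> \<gamma> (t + s) \<in> W" "\<And>s. \<bar>s\<bar> < d \<Longrightarrow> k (\<gamma> (t + s)) = k (\<gamma> t) + \<sigma> * s"
    by (rule unit_speedE[OF assms(1) W]) (rule that)
  then show ?thesis using assms(2,3) W eq by (intro unit_speedI[of W k \<gamma>' t \<sigma> "min d r"]) auto
qed

lemma unit_speed_affine:
  assumes \<rho>: "\<rho> = 1 \<or> \<rho> = - 1" and u: "unit_speed \<gamma> (a + \<rho> * t)"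
  shows "unit_speed (\<lambda>s. \<gamma> (a + \<rho> * s)) t"
proof -
  have "\<gamma> (a + \<rho> * t) \<in> topspace X" using u by (simp add: unit_speed_def)
  then obtain W k where W: "isochart W k" "\<gamma> (a + \<rho> * t) \<in> W" by (rule isochart_exists)
  obtain \<sigma> d :: real where \<sigma>: "\<sigma> = 1 \<or> \<sigma> = - 1" "0 < d"
    "\<And>s. \<bar>s\<bar> < d \<Longrightarrow> \<gamma> (a + \<rho> * t + s) \<in> W"
    "\<And>s. \<bar>s\<bar> < d \<Longrightarrow> k (\<gamma> (a + \<rho> * t + s)) = k (\<gamma> (a + \<rho> * t)) + \<sigma> * s"
    by (rule unit_speedE[OF u W]) (rule that)
  show ?thesis
  proof (rule unit_speedI[OF W(1), of _ t "\<sigma> * \<rho>" d])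
    show "\<sigma> * \<rho> = 1 \<or> \<sigma> * \<rho> = - 1" using \<rho> \<sigma>(1) by auto
    fix s :: real assume "\<bar>s\<bar> < d"
    then have s: "\<bar>\<rho> * s\<bar> < d" using \<rho> by auto
    have eq: "a + \<rho> * (t + s) = a + \<rho> * t + \<rho> * s" by (simp add: algebra_simps)
    show "\<gamma> (a + \<rho> * (t + s)) \<in> W \<and> k (\<gamma> (a + \<rho> * (t + s))) = k (\<gamma> (a + \<rho> * t)) + \<sigma> * \<rho> * s"
      unfolding eq mult.assoc[of \<sigma>] using \<sigma>(3)[OF s] \<sigma>(4)[OF s] by blast
  qed (use W \<sigma> in auto)
qed

lemma unit_speed_isochart:
  assumes W: "isochart W k" and t: "t \<in> k ` W"
  shows "unit_speed (inv_into W k) t"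
proof -
  note i = isochart_inv[OF W]
  obtain r where r: "r > 0" "ball t r \<subseteq> k ` W" using isochartD(5)[OF W] t open_contains_ball by blast
  show ?thesis
  proof (rule unit_speedI[OF W, of _ t 1 r])
    fix s :: real assume "\<bar>s\<bar> < r"
    then have "t + s \<in> k ` W" using r(2) by (auto simp: subset_iff dist_norm)
    then show "inv_into W k (t + s) \<in> W \<and> k (inv_into W k (t + s)) = k (inv_into W k t) + 1 * s"
      using i(2,3) t by simp
  qed (use r i t in auto)
qed

lemma unit_speed_continuous:
  assumes u: "unit_speed \<gamma> t" and O': "openin X O'" "\<gamma> t \<in> O'"
  obtains d where "0 < d" "\<And>s. \<bar>s\<bar> < d \<Longrightarrow> \<gamma> (t + s) \<in> O'"
proof -
  have "\<gamma> t \<in> topspace X" using u by (simp add: unit_speed_def)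
  then obtain W k where W: "isochart W k" "\<gamma> t \<in> W" by (rule isochart_exists)
  obtain \<sigma> d :: real where \<sigma>: "\<sigma> = 1 \<or> \<sigma> = - 1" "0 < d"
    "\<And>s. \<bar>s\<bar> < d \<Longrightarrow> \<gamma> (t + s) \<in> W" "\<And>s. \<bar>s\<bar> < d \<Longrightarrow> k (\<gamma> (t + s)) = k (\<gamma> t) + \<sigma> * s"
    by (rule unit_speedE[OF u W]) (rule that)
  have "openin X (O' \<inter> W)" using O'(1) isochartD(1)[OF W(1)] by blast
  then have "open (k ` (O' \<inter> W))" by (rule isochartD(3)[OF W(1)]) blast
  then obtain r where r: "r > 0" "ball (k (\<gamma> t)) r \<subseteq> k ` (O' \<inter> W)"
    using O'(2) W(2) open_contains_ball by (metis IntI imageI)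
  show thesis
  proof (rule that[of "min d r"])
    show "0 < min d r" using \<sigma>(2) r(1) by simp
    fix s assume s: "\<bar>s\<bar> < min d r"
    have "\<bar>\<sigma> * s\<bar> < r" using \<sigma>(1) s by auto
    then have "k (\<gamma> (t + s)) \<in> ball (k (\<gamma> t)) r" using \<sigma>(4)[of s] s by (simp add: dist_norm)
    then obtain y where y: "y \<in> O' \<inter> W" "k (\<gamma> (t + s)) = k y" using r(2) by blast
    have "\<gamma> (t + s) = y" by (rule inj_onD[OF isochartD(2)[OF W(1)] y(2)]) (use y(1) \<sigma>(3)[of s] s in auto)
    then show "\<gamma> (t + s) \<in> O'" using y(1) by blast
  qed
qed

text \<open>Agreement near \<open>t\<close> is an open condition, and so is its negation: if only
  the values at \<open>t\<close> agree, the curves run in opposite directions and differ at all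
  other times close to \<open>t\<close>.\<close>

lemma unit_speed_unique:
  assumes I: "open I" "connected I" and u: "\<And>t. t \<in> I \<Longrightarrow> unit_speed \<gamma> t" "\<And>t. t \<in> I \<Longrightarrow> unit_speed \<beta> t"
    and t0: "t0 \<in> I" "0 < r" "\<And>s. \<bar>s\<bar> < r \<Longrightarrow> \<gamma> (t0 + s) = \<beta> (t0 + s)" and t: "t \<in> I"
  shows "\<gamma> t = \<beta> t"
proof -
  define S where "S = {t \<in> I. \<exists>d>0. \<forall>s. \<bar>s\<bar> < d \<longrightarrow> \<gamma> (t + s) = \<beta> (t + s)}"
  have oI: "\<exists>e>0. \<forall>s. \<bar>s\<bar> < e \<longrightarrow> t + s \<in> I" if "t \<in> I" for t
  proof -
    obtain e where "e > 0" "ball t e \<subseteq> I" using I(1) \<open>t \<in> I\<close> open_contains_ball by blast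
    then show ?thesis by (intro exI[of _ e]) (auto simp: subset_iff dist_norm)
  qed
  have opI: "open T" if T: "\<And>t. t \<in> T \<Longrightarrow> \<exists>e>0. \<forall>s. \<bar>s\<bar> < e \<longrightarrow> t + s \<in> T" for T :: "real set"
    unfolding open_dist
  proof
    fix t assume t: "t \<in> T"
    obtain e where e: "e > 0" "\<forall>s. \<bar>s\<bar> < e \<longrightarrow> t + s \<in> T" using T[OF t] by blast
    have "y \<in> T" if y: "dist y t < e" for y using e(2)[rule_format, of "y - t"] y by (simp add: dist_real_def)
    then show "\<exists>e>0. \<forall>y. dist y t < e \<longrightarrow> y \<in> T" using e(1) by blast
  qed
  have o1: "open S"
  proof (rule opI)
    fix t assume "t \<in> S"
    then obtain d where d: "t \<in> I" "d > 0" "\<forall>s. \<bar>s\<bar> < d \<longrightarrow> \<gamma> (t + s) = \<beta> (t + s)" unfolding S_def by blast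
    obtain e where e: "e > 0" "\<forall>s. \<bar>s\<bar> < e \<longrightarrow> t + s \<in> I" using oI[OF d(1)] by blast
    have "t + s \<in> S" if s: "\<bar>s\<bar> < min e (d / 2)" for s
    proof -
      have "\<gamma> (t + s + s') = \<beta> (t + s + s')" if s': "\<bar>s'\<bar> < d / 2" for s'
      proof -
        have "\<bar>s + s'\<bar> < d" using s s' by linarith
        then show ?thesis using d(3) by (simp add: add.assoc)
      qed
      then show ?thesis unfolding S_def using e(2) s d(2) by (auto intro!: exI[of _ "d / 2"])
    qed
    then show "\<exists>e>0. \<forall>s. \<bar>s\<bar> < e \<longrightarrow> t + s \<in> S" using e(1) d(2) by (intro exI[of _ "min e (d / 2)"]) auto
  qed
  have o2: "open (I - S)"
  proof (rule opI)
    fix t assume t: "t \<in> I - S"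
    then obtain e where e: "e > 0" "\<forall>s. \<bar>s\<bar> < e \<longrightarrow> t + s \<in> I" using oI by blast
    have "\<exists>d>0. \<forall>s. \<bar>s\<bar> < d \<longrightarrow> s \<noteq> 0 \<longrightarrow> \<gamma> (t + s) \<noteq> \<beta> (t + s)"
    proof (cases "\<gamma> t = \<beta> t")
      case False
      have X: "\<gamma> t \<in> topspace X" "\<beta> t \<in> topspace X" using u t by (auto simp: unit_speed_def)
      obtain U V where UV: "openin X U" "openin X V" "\<gamma> t \<in> U" "\<beta> t \<in> V" "disjnt U V"
        using Hausdorff X False unfolding Hausdorff_space_def by metis
      obtain d1 where d1: "0 < d1" "\<And>s. \<bar>s\<bar> < d1 \<Longrightarrow> \<gamma> (t + s) \<in> U"
        using unit_speed_continuous[OF u(1) UV(1,3)] t by blast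
      obtain d2 where d2: "0 < d2" "\<And>s. \<bar>s\<bar> < d2 \<Longrightarrow> \<beta> (t + s) \<in> V"
        using unit_speed_continuous[OF u(2) UV(2,4)] t by blast
      have "\<gamma> (t + s) \<noteq> \<beta> (t + s)" if "\<bar>s\<bar> < min d1 d2" for s
        using d1(2)[of s] d2(2)[of s] that UV(5) unfolding disjnt_iff by auto
      then show ?thesis using d1(1) d2(1) by (intro exI[of _ "min d1 d2"]) auto
    next
      case True
      have "\<gamma> t \<in> topspace X" using u t by (auto simp: unit_speed_def)
      then obtain W k where W: "isochart W k" "\<gamma> t \<in> W" by (rule isochart_exists)
      have W2: "\<beta> t \<in> W" using W(2) True by simp
      have tI: "t \<in> I" using t by blast
      obtain \<sigma>1 d1 :: real where 1: "\<sigma>1 = 1 \<or> \<sigma>1 = - 1" "0 < d1"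
        "\<And>s. \<bar>s\<bar> < d1 \<Longrightarrow> \<gamma> (t + s) \<in> W" "\<And>s. \<bar>s\<bar> < d1 \<Longrightarrow> k (\<gamma> (t + s)) = k (\<gamma> t) + \<sigma>1 * s"
        by (rule unit_speedE[OF u(1)[OF tI] W]) (rule that)
      obtain \<sigma>2 d2 :: real where 2: "\<sigma>2 = 1 \<or> \<sigma>2 = - 1" "0 < d2"
        "\<And>s. \<bar>s\<bar> < d2 \<Longrightarrow> \<beta> (t + s) \<in> W" "\<And>s. \<bar>s\<bar> < d2 \<Longrightarrow> k (\<beta> (t + s)) = k (\<beta> t) + \<sigma>2 * s"
        by (rule unit_speedE[OF u(2)[OF tI] W(1) W2]) (rule that)
      have "\<sigma>1 \<noteq> \<sigma>2"
      proof
        assume eq: "\<sigma>1 = \<sigma>2"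
        have "\<gamma> (t + s) = \<beta> (t + s)" if s: "\<bar>s\<bar> < min d1 d2" for s
          by (rule inj_onD[OF isochartD(2)[OF W(1)]]) (use 1(3,4)[of s] 2(3,4)[of s] s eq True in auto)
        then have "t \<in> S" unfolding S_def using tI 1(2) 2(2) by (auto intro!: exI[of _ "min d1 d2"])
        then show False using t by blast
      qed
      then have "\<gamma> (t + s) \<noteq> \<beta> (t + s)" if "\<bar>s\<bar> < min d1 d2" "s \<noteq> 0" for s
        using 1(4)[of s] 2(4)[of s] that True by auto
      then show ?thesis using 1(2) 2(2) by (intro exI[of _ "min d1 d2"]) auto
    qed
    then obtain d where d: "d > 0" "\<forall>s. \<bar>s\<bar> < d \<longrightarrow> s \<noteq> 0 \<longrightarrow> \<gamma> (t + s) \<noteq> \<beta> (t + s)" by blast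
    have "t + s \<in> I - S" if s: "\<bar>s\<bar> < min d e" for s
    proof (cases "s = 0")
      case True then show ?thesis using t by simp
    next
      case False
      then have ne: "\<gamma> (t + s) \<noteq> \<beta> (t + s)" using d(2) s by simp
      have "t + s \<notin> S"
      proof
        assume "t + s \<in> S"
        then obtain d' where d': "d' > 0" "\<forall>s'. \<bar>s'\<bar> < d' \<longrightarrow> \<gamma> (t + s + s') = \<beta> (t + s + s')"
          unfolding S_def by blast
        from d'(2)[rule_format, of 0] d'(1) ne show False by simp
      qed
      then show ?thesis using e(2) s by simp
    qed
    then show "\<exists>e>0. \<forall>s. \<bar>s\<bar> < e \<longrightarrow> t + s \<in> I - S" using e(1) d(1) by (intro exI[of _ "min d e"]) auto
  qed
  have "t0 \<in> S" unfolding S_def using t0 by blast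
  moreover have "S \<subseteq> I" by (auto simp: S_def)
  ultimately have "I \<subseteq> S" using connectedD[OF I(2) o1 o2] t0(1) by blast
  then obtain d where "d > 0" "\<forall>s. \<bar>s\<bar> < d \<longrightarrow> \<gamma> (t + s) = \<beta> (t + s)" using t unfolding S_def by blast
  from this(2)[rule_format, of 0] this(1) show ?thesis by simp
qed

text \<open>Inside an isochart, motion at constant rate in the parameter is a unit speed curve;
  uniqueness extends the agreement from a short interval to the whole range of the isochart.\<close>

lemma unit_speed_flow:
  assumes u: "\<And>s. \<bar>s\<bar> < r \<Longrightarrow> unit_speed \<gamma> (t + s)" and r: "0 < r" and W: "isochart W k" "\<gamma> t \<in> W"
    and img: "{k (\<gamma> t) - r<..<k (\<gamma> t) + r} \<subseteq> k ` W"
  obtains \<sigma> :: real where "\<sigma> = 1 \<or> \<sigma> = - 1"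
    "\<And>s. \<bar>s\<bar> < r \<Longrightarrow> \<gamma> (t + s) = inv_into W k (k (\<gamma> t) + \<sigma> * s)"
proof -
  have ut: "unit_speed \<gamma> t" using u[of 0] r by simp
  obtain \<sigma> d :: real where \<sigma>: "\<sigma> = 1 \<or> \<sigma> = - 1" "0 < d"
    "\<And>s. \<bar>s\<bar> < d \<Longrightarrow> \<gamma> (t + s) \<in> W" "\<And>s. \<bar>s\<bar> < d \<Longrightarrow> k (\<gamma> (t + s)) = k (\<gamma> t) + \<sigma> * s"
    by (rule unit_speedE[OF ut W]) (rule that)
  define \<beta> where "\<beta> s = inv_into W k ((k (\<gamma> t) - \<sigma> * t) + \<sigma> * s)" for s
  have ub: "unit_speed \<beta> s" if s: "s \<in> {t - r<..<t + r}" for s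
    unfolding \<beta>_def[abs_def]
  proof (rule unit_speed_affine[OF \<sigma>(1) unit_speed_isochart[OF W(1)]])
    show "k (\<gamma> t) - \<sigma> * t + \<sigma> * s \<in> k ` W" using img s \<sigma>(1) by (auto simp: subset_iff)
  qed
  have eq: "\<gamma> (t + s) = \<beta> (t + s)" if s: "\<bar>s\<bar> < d" for s
    unfolding \<beta>_def using isochart_inv(1)[OF W(1) \<sigma>(3)[OF s]] \<sigma>(4)[OF s] by (simp add: algebra_simps)
  show thesis
  proof (rule that[OF \<sigma>(1)])
    fix s assume s: "\<bar>s\<bar> < r"
    have "\<gamma> (t + s) = \<beta> (t + s)"
    proof (rule unit_speed_unique[where I = "{t - r<..<t + r}" and ?t0.0 = t and r = d])
      show "unit_speed \<gamma> v" if "v \<in> {t - r<..<t + r}" for v using u[of "v - t"] that by (simp add: abs_less_iff)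
      show "t + s \<in> {t - r<..<t + r}" using s by auto
    qed (use ub eq r \<sigma>(2) in auto)
    then show "\<gamma> (t + s) = inv_into W k (k (\<gamma> t) + \<sigma> * s)" by (simp add: \<beta>_def algebra_simps)
  qed
qed

lemma isochart_shift:
  assumes "isochart W k"
  shows "isochart W (\<lambda>y. k y - a)"
  unfolding isochart_def
proof (intro conjI allI impI)
  show "openin X W" by (rule isochartD(1)[OF assms])
  show "inj_on (\<lambda>y. k y - a) W" using isochartD(2)[OF assms] by (simp add: inj_on_def)
  show "continuous_map (subtopology X W) euclideanreal (\<lambda>y. k y - a)"
    using assms unfolding isochart_def by (intro continuous_map_diff) auto
  show "open ((\<lambda>y. k y - a) ` V)" if V: "openin X V" "V \<subseteq> W" for V
  proof -
    have "(\<lambda>y. k y - a) ` V = (\<lambda>t. t - a) ` k ` V" by (simp add: image_image)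
    then show ?thesis using open_translation_subtract[OF isochartD(3)[OF assms V], of a] by simp
  qed
  show "\<forall>x\<in>W. \<forall>e>0. \<exists>N. openin X N \<and> x \<in> N \<and> (\<forall>y\<in>N \<inter> W. (1 - e) * \<bar>k y - a - (k x - a)\<bar> \<le> norm (f y - f x) \<and>
      norm (f y - f x) \<le> (1 + e) * \<bar>k y - a - (k x - a)\<bar>)"
    using assms unfolding isochart_def by simp
qed

text \<open>A Lebesgue number: in an isochart with values in \<open>(-r, r)\<close>, every point of
  the middle half has room \<open>r/2\<close> on both sides after a shift of the parameter.\<close>

lemma uniform_isochart:
  obtains \<epsilon> where "0 < \<epsilon>" "\<epsilon> \<le> 1"
    "\<And>x. x \<in> topspace X \<Longrightarrow> \<exists>W k. isochart W k \<and> x \<in> W \<and> k x = 0 \<and> {-\<epsilon><..<\<epsilon>} \<subseteq> k ` W"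
proof -
  define P where "P \<epsilon> x \<longleftrightarrow> (\<exists>W k. isochart W k \<and> x \<in> W \<and> k x = 0 \<and> {-\<epsilon><..<\<epsilon>} \<subseteq> k ` W)" for \<epsilon> :: real and x
  have mono: "P \<epsilon> x" if "P \<epsilon>' x" "\<epsilon> \<le> \<epsilon>'" for \<epsilon> \<epsilon>' x
  proof -
    have "{-\<epsilon><..<\<epsilon>} \<subseteq> {-\<epsilon>'<..<\<epsilon>'}" using that(2) by auto
    then show ?thesis using that(1) unfolding P_def by (meson order_trans)
  qed
  let ?\<U> = "{V. openin X V \<and> (\<exists>\<epsilon>>0. \<forall>y\<in>V. P \<epsilon> y)}"
  have "topspace X \<subseteq> \<Union>?\<U>"
  proof
    fix x assume "x \<in> topspace X"
    then obtain U \<phi> where c: "(U, \<phi>) \<in> A" "x \<in> U" by (rule chart_exists)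
    obtain W k r where W: "isochart W k" "x \<in> W" "k x = 0" "0 < r" "k ` W = {-r<..<r}"
      by (rule chart_isochart[OF dim c]) (rule that)
    let ?V = "{y \<in> W. k y \<in> {-(r/2)<..<r/2}}"
    have "openin X ?V" by (rule isochart_open_less[OF W(1)]) simp
    moreover have "P (r/2) y" if y: "y \<in> ?V" for y
      unfolding P_def
    proof (intro exI conjI)
      show "isochart W (\<lambda>z. k z - k y)" by (rule isochart_shift[OF W(1)])
      show "{-(r/2)<..<r/2} \<subseteq> (\<lambda>z. k z - k y) ` W"
      proof
        fix t assume "t \<in> {-(r/2)<..<r/2}"
        then have "t + k y \<in> k ` W" unfolding W(5) using y by auto
        then obtain z where "z \<in> W" "t + k y = k z" by blast
        then show "t \<in> (\<lambda>z. k z - k y) ` W" by (intro image_eqI[of _ _ z]) auto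
      qed
    qed (use y in auto)
    moreover have "0 < r/2" using W(4) by simp
    ultimately have "?V \<in> ?\<U>" by blast
    moreover have "x \<in> ?V" using W by simp
    ultimately show "x \<in> \<Union>?\<U>" by (rule UnionI)
  qed
  moreover have "\<forall>V\<in>?\<U>. openin X V" by blast
  ultimately obtain \<F> where F: "finite \<F>" "\<F> \<subseteq> ?\<U>" "topspace X \<subseteq> \<Union>\<F>"
    using compact unfolding compact_space_def compactin_def by meson
  have "\<exists>\<epsilon>>0. \<forall>y\<in>\<Union>\<G>. P \<epsilon> y" if "finite \<G>" "\<G> \<subseteq> ?\<U>" for \<G>
    using that
  proof (induction \<G> rule: finite_induct)
    case empty
    show ?case by (intro exI[of _ 1]) simp
  next
    case (insert V \<G>)
    obtain e1 where e1: "e1 > 0" "\<forall>y\<in>\<Union>\<G>. P e1 y" using insert by auto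
    obtain e2 where e2: "e2 > 0" "\<forall>y\<in>V. P e2 y" using insert.prems by blast
    have "\<forall>y\<in>\<Union>(insert V \<G>). P (min e1 e2) y"
      using e1(2) e2(2) mono[of e1 _ "min e1 e2"] mono[of e2 _ "min e1 e2"] by auto
    then show ?case using e1(1) e2(1) by (intro exI[of _ "min e1 e2"]) auto
  qed
  from this[OF F(1,2)] obtain \<epsilon> where e: "\<epsilon> > 0" "\<forall>y\<in>\<Union>\<F>. P \<epsilon> y" by blast
  show thesis
  proof (rule that[of "min \<epsilon> 1"])
    fix x assume "x \<in> topspace X"
    then have "P \<epsilon> x" using F(3) e(2) by blast
    then have "P (min \<epsilon> 1) x" by (rule mono) simp
    then show "\<exists>W k. isochart W k \<and> x \<in> W \<and> k x = 0 \<and> {-min \<epsilon> 1<..<min \<epsilon> 1} \<subseteq> k ` W" unfolding P_def .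
  qed (use e(1) in auto)
qed

lemma unit_speed_extend:
  assumes \<epsilon>: "0 < \<epsilon>" "\<And>x. x \<in> topspace X \<Longrightarrow> \<exists>W k. isochart W k \<and> x \<in> W \<and> k x = 0 \<and> {-\<epsilon><..<\<epsilon>} \<subseteq> k ` W"
    and \<gamma>: "\<And>t. t \<in> {0<..<b} \<Longrightarrow> unit_speed \<gamma> t" and b: "\<epsilon> \<le> b"
  obtains \<gamma>' where "\<And>t. t \<in> {0<..<b + \<epsilon> / 2} \<Longrightarrow> unit_speed \<gamma>' t" "\<And>t. t \<in> {0<..<b} \<Longrightarrow> \<gamma>' t = \<gamma> t"
proof -
  \<comment> \<open>Starting half the guaranteed length before the end, the comparison curve agrees
    with \<open>\<gamma>\<close> on \<open>(b - \<epsilon>, b)\<close> and continues to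
    \<open>b + \<epsilon> / 2\<close>.\<close>
  define a where "a = b - \<epsilon> / 2"
  have a: "0 < a" "a < b" using \<epsilon>(1) b by (auto simp: a_def)
  have "\<gamma> a \<in> topspace X" using \<gamma>[of a] a by (simp add: unit_speed_def)
  then obtain W k where W: "isochart W k" "\<gamma> a \<in> W" "k (\<gamma> a) = 0" "{-\<epsilon><..<\<epsilon>} \<subseteq> k ` W" using \<epsilon>(2) by meson
  have e2: "0 < \<epsilon> / 2" using \<epsilon>(1) by simp
  have us: "unit_speed \<gamma> (a + s)" if "\<bar>s\<bar> < \<epsilon> / 2" for s
  proof (rule \<gamma>)
    have "- (\<epsilon> / 2) < s" "s < \<epsilon> / 2" using that by linarith+
    then show "a + s \<in> {0<..<b}" using b by (simp add: a_def)
  qed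
  have img: "{k (\<gamma> a) - \<epsilon> / 2<..<k (\<gamma> a) + \<epsilon> / 2} \<subseteq> k ` W" using W(3,4) \<epsilon>(1) by (auto simp: subset_iff)
  obtain \<sigma> :: real where \<sigma>: "\<sigma> = 1 \<or> \<sigma> = - 1" "\<And>s. \<bar>s\<bar> < \<epsilon> / 2 \<Longrightarrow> \<gamma> (a + s) = inv_into W k (k (\<gamma> a) + \<sigma> * s)"
    by (rule unit_speed_flow[OF us e2 W(1,2) img]) (assumption, rule that)
  define h where "h t = inv_into W k (- \<sigma> * a + \<sigma> * t)" for t
  have hu: "unit_speed h t" if "t \<in> {a - \<epsilon><..<a + \<epsilon>}" for t
    unfolding h_def[abs_def]
  proof (rule unit_speed_affine[OF \<sigma>(1) unit_speed_isochart[OF W(1)]])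
    show "- \<sigma> * a + \<sigma> * t \<in> k ` W" using W(4) that \<sigma>(1) by (auto simp: subset_iff)
  qed
  have h\<gamma>: "h t = \<gamma> t" if t: "b - \<epsilon> < t" "t < b" for t
  proof -
    have "\<bar>t - a\<bar> < \<epsilon> / 2" using t unfolding a_def abs_less_iff by (simp add: field_simps)
    from \<sigma>(2)[OF this] show ?thesis using W(3) by (simp add: h_def right_diff_distrib)
  qed
  define \<gamma>' where "\<gamma>' t = (if t < a then \<gamma> t else h t)" for t
  have eq: "\<gamma>' t = \<gamma> t" if "t < b" for t using h\<gamma>[of t] that \<epsilon>(1) by (auto simp: \<gamma>'_def a_def)
  show thesis
  proof (rule that[of \<gamma>'])
    show "\<gamma>' t = \<gamma> t" if "t \<in> {0<..<b}" for t using eq[of t] that by simp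
    fix t assume t: "t \<in> {0<..<b + \<epsilon> / 2}"
    show "unit_speed \<gamma>' t"
    proof (cases "t < b")
      case True
      then show ?thesis using t eq by (intro unit_speed_cong[OF \<gamma>[of t], of "b - t"]) auto
    next
      case False
      then show ?thesis using t a
        by (intro unit_speed_cong[OF hu[of t], of "t - a"]) (auto simp: \<gamma>'_def a_def)
    qed
  qed
qed

lemma unit_speed_exists:
  obtains \<gamma> where "\<And>t. 0 < t \<Longrightarrow> unit_speed \<gamma> t"
proof -
  obtain \<epsilon> where \<epsilon>: "0 < \<epsilon>" "\<epsilon> \<le> 1"
    "\<And>x. x \<in> topspace X \<Longrightarrow> \<exists>W k. isochart W k \<and> x \<in> W \<and> k x = 0 \<and> {-\<epsilon><..<\<epsilon>} \<subseteq> k ` W"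
    by (rule uniform_isochart) (rule that)
  obtain x where "x \<in> topspace X" using nonempty by blast
  then obtain W k where W: "isochart W k" "x \<in> W" "k x = 0" "{-\<epsilon><..<\<epsilon>} \<subseteq> k ` W" using \<epsilon>(3) by meson
  define \<gamma>0 where "\<gamma>0 t = inv_into W k (- (\<epsilon> / 2) + 1 * t)" for t
  have \<gamma>0: "unit_speed \<gamma>0 t" if "t \<in> {0<..<\<epsilon>}" for t
    unfolding \<gamma>0_def[abs_def]
    by (rule unit_speed_affine[OF _ unit_speed_isochart[OF W(1)]]) (use that W(4) \<epsilon>(1) in \<open>auto simp: subset_iff\<close>)
  define I where "I n = {0<..<\<epsilon> + real n * (\<epsilon> / 2)}" for n
  have "\<exists>\<gamma>. (\<forall>t\<in>I n. unit_speed \<gamma> t) \<and> (\<forall>t\<in>{0<..<\<epsilon>}. \<gamma> t = \<gamma>0 t)" for n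
  proof (induction n)
    case 0
    show ?case using \<gamma>0 by (intro exI[of _ \<gamma>0]) (simp add: I_def)
  next
    case (Suc n)
    then obtain \<gamma> where \<gamma>: "\<And>t. t \<in> I n \<Longrightarrow> unit_speed \<gamma> t" "\<And>t. t \<in> {0<..<\<epsilon>} \<Longrightarrow> \<gamma> t = \<gamma>0 t" by blast
    have b: "\<epsilon> \<le> \<epsilon> + real n * (\<epsilon> / 2)" using \<epsilon>(1) by simp
    obtain \<gamma>' where \<gamma>': "\<And>t. t \<in> {0<..<\<epsilon> + real n * (\<epsilon> / 2) + \<epsilon> / 2} \<Longrightarrow> unit_speed \<gamma>' t"
      "\<And>t. t \<in> {0<..<\<epsilon> + real n * (\<epsilon> / 2)} \<Longrightarrow> \<gamma>' t = \<gamma> t"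
      by (rule unit_speed_extend[OF \<epsilon>(1,3) \<gamma>(1)[unfolded I_def] b]) (assumption+, rule that)
    have "I (Suc n) = {0<..<\<epsilon> + real n * (\<epsilon> / 2) + \<epsilon> / 2}" by (simp add: I_def algebra_simps add_divide_distrib)
    moreover have "\<gamma>' t = \<gamma>0 t" if t: "t \<in> {0<..<\<epsilon>}" for t
    proof -
      have "0 < t \<and> t < \<epsilon> + real n * (\<epsilon> / 2)" using t b by (meson greaterThanLessThan_iff less_le_trans)
      then show ?thesis using \<gamma>'(2)[of t] \<gamma>(2)[OF t] by simp
    qed
    ultimately show ?case using \<gamma>'(1) by blast
  qed
  then obtain G where G: "\<And>n t. t \<in> I n \<Longrightarrow> unit_speed (G n) t" "\<And>n t. t \<in> {0<..<\<epsilon>} \<Longrightarrow> G n t = \<gamma>0 t" by metis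
  have agree: "G m t = G n t" if mn: "m \<le> n" "t \<in> I m" for m n t
  proof (rule unit_speed_unique[where I = "I m" and ?t0.0 = "\<epsilon> / 2" and r = "\<epsilon> / 2"])
    show "open (I m)" "connected (I m)" by (auto simp: I_def)
    have "real m * (\<epsilon> / 2) \<le> real n * (\<epsilon> / 2)" using mn(1) \<epsilon>(1) by (intro mult_right_mono) auto
    then have "I m \<subseteq> I n" unfolding I_def by (intro greaterThanLessThan_subseteq_greaterThanLessThan[THEN iffD2]) simp
    then show "unit_speed (G n) t" if "t \<in> I m" for t using G(1) that by blast
    show "\<epsilon> / 2 \<in> I m" using \<epsilon>(1) by (simp add: I_def add_pos_nonneg)
    show "G m (\<epsilon> / 2 + s) = G n (\<epsilon> / 2 + s)" if s: "\<bar>s\<bar> < \<epsilon> / 2" for s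
    proof -
      have "- (\<epsilon> / 2) < s" "s < \<epsilon> / 2" using s by linarith+
      then have "\<epsilon> / 2 + s \<in> {0<..<\<epsilon>}" by simp
      then show ?thesis using G(2) by metis
    qed
  qed (use G(1) mn \<epsilon>(1) in auto)
  have inI: "\<exists>n. t \<in> I n" if t: "0 < t" for t
  proof -
    obtain n :: nat where "t / (\<epsilon> / 2) < real n" using reals_Archimedean2 by blast
    then have "t < real n * (\<epsilon> / 2)" using \<epsilon>(1) by (simp add: field_simps)
    then show ?thesis using t \<epsilon>(1) by (intro exI[of _ n]) (simp add: I_def)
  qed
  \<comment> \<open>Any stage that has reached time \<open>t\<close> may be chosen, since all stages
    agree where they are defined.\<close>
  define \<gamma> where "\<gamma> t = G (SOME n. t \<in> I n) t" for t
  have \<gamma>: "\<gamma> t = G n t" if t: "t \<in> I n" for n t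
  proof -
    have "t \<in> I (SOME n. t \<in> I n)" using t by (rule someI)
    then show ?thesis unfolding \<gamma>_def using agree t by (metis nle_le)
  qed
  show thesis
  proof (rule that)
    fix t :: real assume "0 < t"
    then obtain n where n: "t \<in> I n" using inI by blast
    then obtain r where r: "r > 0" "ball t r \<subseteq> I n" unfolding I_def using open_contains_ball open_greaterThanLessThan by metis
    show "unit_speed \<gamma> t"
    proof (rule unit_speed_cong[OF G(1)[OF n] r(1)])
      fix s assume "\<bar>s\<bar> < r"
      then have "t + s \<in> I n" using r(2) by (auto simp: subset_iff dist_norm)
      then show "\<gamma> (t + s) = G n (t + s)" by (rule \<gamma>)
    qed
  qed
qed

text \<open>Near \<open>x\<close> the curve moves at unit rate in the parameter of the isochart, so
  it passes through \<open>x\<close> itself shortly before or after \<open>t\<close>.\<close>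

lemma unit_speed_reach:
  assumes u: "\<And>t. 0 < t \<Longrightarrow> unit_speed \<gamma> t" and \<epsilon>: "0 < \<epsilon>" "\<epsilon> \<le> 1"
    and W: "isochart W k" "x \<in> W" "k x = 0" "{-\<epsilon><..<\<epsilon>} \<subseteq> k ` W"
    and t: "1 \<le> t" "\<gamma> t \<in> W" "\<bar>k (\<gamma> t)\<bar> < \<epsilon> / 4"
  obtains s where "\<bar>s\<bar> < 1 / 4" "\<gamma> (t + s) = x"
proof -
  have e2: "0 < \<epsilon> / 2" using \<epsilon>(1) by simp
  have us: "unit_speed \<gamma> (t + s)" if "\<bar>s\<bar> < \<epsilon> / 2" for s
    by (rule u) (use that \<epsilon> t(1) in linarith)
  have img: "{k (\<gamma> t) - \<epsilon> / 2<..<k (\<gamma> t) + \<epsilon> / 2} \<subseteq> k ` W"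
  proof
    fix v assume "v \<in> {k (\<gamma> t) - \<epsilon> / 2<..<k (\<gamma> t) + \<epsilon> / 2}"
    then have "v \<in> {-\<epsilon><..<\<epsilon>}" using t(3) unfolding greaterThanLessThan_iff by linarith
    then show "v \<in> k ` W" using W(4) by blast
  qed
  obtain \<sigma> :: real where \<sigma>: "\<sigma> = 1 \<or> \<sigma> = - 1" "\<And>s. \<bar>s\<bar> < \<epsilon> / 2 \<Longrightarrow> \<gamma> (t + s) = inv_into W k (k (\<gamma> t) + \<sigma> * s)"
    by (rule unit_speed_flow[OF us e2 W(1) t(2) img]) (assumption, rule that)
  define s where "s = - \<sigma> * k (\<gamma> t)"
  have s: "\<bar>s\<bar> < \<epsilon> / 4" using t(3) \<sigma>(1) by (auto simp: s_def)
  then have "\<bar>s\<bar> < \<epsilon> / 2" using \<epsilon>(1) by linarith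
  from \<sigma>(2)[OF this] have "\<gamma> (t + s) = inv_into W k (k (\<gamma> t) + \<sigma> * s)" .
  also have "k (\<gamma> t) + \<sigma> * s = k x" using \<sigma>(1) W(3) by (auto simp: s_def)
  also have "inv_into W k (k x) = x" by (rule isochart_inv(1)[OF W(1,2)])
  finally show thesis using that s \<epsilon>(2) by force
qed

text \<open>Pigeonhole on integer times and a finite cover. Two times in the same set bring the
  curve through the same point \<open>x\<close>, each within less than 1/4, so at distinct
  times.\<close>

lemma unit_speed_recurrent:
  assumes u: "\<And>t. 0 < t \<Longrightarrow> unit_speed \<gamma> t"
  obtains t1 t2 where "0 < t1" "t1 < t2" "\<gamma> t1 = \<gamma> t2"
proof -
  obtain \<epsilon> where \<epsilon>: "0 < \<epsilon>" "\<epsilon> \<le> 1"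
    "\<And>x. x \<in> topspace X \<Longrightarrow> \<exists>W k. isochart W k \<and> x \<in> W \<and> k x = 0 \<and> {-\<epsilon><..<\<epsilon>} \<subseteq> k ` W"
    by (rule uniform_isochart) (rule that)
  let ?\<U> = "{V. openin X V \<and> (\<exists>x. \<forall>t\<ge>1. \<gamma> t \<in> V \<longrightarrow> (\<exists>s. \<bar>s\<bar> < 1 / 4 \<and> \<gamma> (t + s) = x))}"
  have "topspace X \<subseteq> \<Union>?\<U>"
  proof
    fix x assume "x \<in> topspace X"
    then obtain W k where W: "isochart W k" "x \<in> W" "k x = 0" "{-\<epsilon><..<\<epsilon>} \<subseteq> k ` W" using \<epsilon>(3) by meson
    let ?V = "{y \<in> W. k y \<in> {-(\<epsilon>/4)<..<\<epsilon>/4}}"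
    have "openin X ?V" by (rule isochart_open_less[OF W(1)]) simp
    moreover have "\<exists>s. \<bar>s\<bar> < 1 / 4 \<and> \<gamma> (t + s) = x" if t: "1 \<le> t" "\<gamma> t \<in> ?V" for t
    proof -
      have "\<gamma> t \<in> W" "\<bar>k (\<gamma> t)\<bar> < \<epsilon> / 4" using t(2) by auto
      from unit_speed_reach[OF u \<epsilon>(1,2) W t(1) this] show ?thesis by blast
    qed
    ultimately have "?V \<in> ?\<U>" by blast
    moreover have "x \<in> ?V" using W \<epsilon>(1) by simp
    ultimately show "x \<in> \<Union>?\<U>" by (rule UnionI)
  qed
  moreover have "\<forall>V\<in>?\<U>. openin X V" by blast
  ultimately obtain \<F> where F: "finite \<F>" "\<F> \<subseteq> ?\<U>" "topspace X \<subseteq> \<Union>\<F>"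
    using compact unfolding compact_space_def compactin_def by meson
  have "\<exists>V\<in>\<F>. \<gamma> (real (Suc n)) \<in> V" for n
  proof -
    have "\<gamma> (real (Suc n)) \<in> topspace X" using u[of "real (Suc n)"] by (simp add: unit_speed_def)
    then show ?thesis using F(3) by blast
  qed
  then obtain v where v: "\<And>n. v n \<in> \<F>" "\<And>n. \<gamma> (real (Suc n)) \<in> v n" by metis
  have "\<not> inj v"
  proof
    assume i: "inj v"
    have "finite (range v)" using v(1) F(1) by (meson finite_subset image_subsetI)
    then show False using finite_imageD[OF _ i] by simp
  qed
  then obtain m n where mn: "m < n" "v m = v n" by (metis injI linorder_neqE_nat)
  obtain x where x: "\<forall>t\<ge>1. \<gamma> t \<in> v m \<longrightarrow> (\<exists>s. \<bar>s\<bar> < 1 / 4 \<and> \<gamma> (t + s) = x)"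
    using v(1)[of m] F(2) by blast
  obtain s where s: "\<bar>s\<bar> < 1/4" "\<gamma> (real (Suc m) + s) = x" using x[rule_format, of "real (Suc m)"] v(2)[of m] by auto
  obtain s' where s': "\<bar>s'\<bar> < 1/4" "\<gamma> (real (Suc n) + s') = x"
    using x[rule_format, of "real (Suc n)"] v(2)[of n] mn(2) by auto
  have "real (Suc m) + 1 \<le> real (Suc n)" using mn(1) by simp
  moreover have "1 \<le> real (Suc m)" by simp
  ultimately have "0 < real (Suc m) + s" "real (Suc m) + s < real (Suc n) + s'" using s(1) s'(1) by linarith+
  then show thesis by (rule that) (simp only: s(2) s'(2))
qed

text \<open>Otherwise the curve would be symmetric about the midpoint of \<open>t1\<close> and \<open>t2\<close>, where it is injective.\<close>

lemma unit_speed_periodic: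
  assumes u: "\<And>t. 0 < t \<Longrightarrow> unit_speed \<gamma> t" and t12: "0 < t1" "t1 < t2" "\<gamma> t1 = \<gamma> t2" and t: "0 < t"
  shows "\<gamma> (t + (t2 - t1)) = \<gamma> t"
proof -
  have u1: "unit_speed \<gamma> t1" and u2: "unit_speed \<gamma> t2" using u t12 by auto
  have "\<gamma> t1 \<in> topspace X" using u1 by (simp add: unit_speed_def)
  then obtain W k where W: "isochart W k" "\<gamma> t1 \<in> W" by (rule isochart_exists)
  have W2: "\<gamma> t2 \<in> W" using W(2) t12(3) by simp
  obtain \<sigma>1 d1 :: real where 1: "\<sigma>1 = 1 \<or> \<sigma>1 = - 1" "0 < d1"
    "\<And>s. \<bar>s\<bar> < d1 \<Longrightarrow> \<gamma> (t1 + s) \<in> W" "\<And>s. \<bar>s\<bar> < d1 \<Longrightarrow> k (\<gamma> (t1 + s)) = k (\<gamma> t1) + \<sigma>1 * s"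
    by (rule unit_speedE[OF u1 W]) (rule that)
  obtain \<sigma>2 d2 :: real where 2: "\<sigma>2 = 1 \<or> \<sigma>2 = - 1" "0 < d2"
    "\<And>s. \<bar>s\<bar> < d2 \<Longrightarrow> \<gamma> (t2 + s) \<in> W" "\<And>s. \<bar>s\<bar> < d2 \<Longrightarrow> k (\<gamma> (t2 + s)) = k (\<gamma> t2) + \<sigma>2 * s"
    by (rule unit_speedE[OF u2 W(1) W2]) (rule that)
  \<comment> \<open>Compares the directions of travel at the two times. The curve
    \<open>\<beta>\<close> starts at \<open>t1\<close> the way \<open>\<gamma>\<close> runs at
    \<open>t2\<close>, reversed if \<open>\<rho> = - 1\<close>, so that the germs agree.\<close>
  define \<rho> where "\<rho> = \<sigma>2 * \<sigma>1"
  have \<rho>: "\<rho> = 1 \<or> \<rho> = - 1" using 1(1) 2(1) by (auto simp: \<rho>_def)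
  define \<beta> where "\<beta> s = \<gamma> ((t2 - \<rho> * t1) + \<rho> * s)" for s
  have germ: "\<gamma> (t1 + s) = \<beta> (t1 + s)" if s: "\<bar>s\<bar> < min d1 d2" for s
  proof -
    have s2: "\<bar>\<rho> * s\<bar> < d2" using s \<rho> by auto
    have b: "\<beta> (t1 + s) = \<gamma> (t2 + \<rho> * s)" by (simp add: \<beta>_def algebra_simps)
    have "k (\<gamma> (t2 + \<rho> * s)) = k (\<gamma> t1) + \<sigma>1 * s" using 2(4)[OF s2] 2(1) t12(3) by (auto simp: \<rho>_def)
    then have "k (\<gamma> (t1 + s)) = k (\<beta> (t1 + s))" using 1(4)[of s] s b by simp
    then show ?thesis by (rule inj_onD[OF isochartD(2)[OF W(1)]]) (use 1(3)[of s] 2(3)[OF s2] s b in auto)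
  qed
  have ub: "unit_speed \<beta> s" if "0 < (t2 - \<rho> * t1) + \<rho> * s" for s
    unfolding \<beta>_def[abs_def] using that by (intro unit_speed_affine[OF \<rho>] u)
  have d: "0 < min d1 d2" using 1(2) 2(2) by simp
  show ?thesis
  proof (cases "\<rho> = 1")
    case True
    have "\<gamma> t = \<beta> t"
      by (rule unit_speed_unique[where I = "{0<..}" and ?t0.0 = t1 and r = "min d1 d2"])
        (use germ d t t12 u ub True in auto)
    then show ?thesis using True by (simp add: \<beta>_def add.commute)
  next
    case False
    then have \<rho>1: "\<rho> = - 1" using \<rho> by simp
    define m where "m = (t1 + t2) / 2"
    have eq: "\<gamma> s = \<beta> s" if "s \<in> {0<..<t1 + t2}" for s
      by (rule unit_speed_unique[where I = "{0<..<t1 + t2}" and ?t0.0 = t1 and r = "min d1 d2"])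
        (use germ d that t12 u ub \<rho>1 in auto)
    have m: "0 < m" using t12 by (simp add: m_def)
    have um: "unit_speed \<gamma> m" by (rule u[OF m])
    then have "\<gamma> m \<in> topspace X" by (simp add: unit_speed_def)
    then obtain W' k' where W': "isochart W' k'" "\<gamma> m \<in> W'" by (rule isochart_exists)
    obtain \<sigma> d :: real where \<sigma>: "\<sigma> = 1 \<or> \<sigma> = - 1" "0 < d"
      "\<And>s. \<bar>s\<bar> < d \<Longrightarrow> \<gamma> (m + s) \<in> W'" "\<And>s. \<bar>s\<bar> < d \<Longrightarrow> k' (\<gamma> (m + s)) = k' (\<gamma> m) + \<sigma> * s"
      by (rule unit_speedE[OF um W']) (rule that)
    define s where "s = min (d / 2) (m / 2)"
    have s: "0 < s" "s < d" "s < m" using \<sigma>(2) m by (auto simp: s_def)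
    have m2: "t1 + t2 = m + m" by (simp add: m_def)
    have "m + s \<in> {0<..<t1 + t2}" using s(1,3) m unfolding m2 by simp
    from eq[OF this] have "\<gamma> (m + s) = \<gamma> (t2 - \<rho> * t1 + \<rho> * (m + s))" unfolding \<beta>_def .
    also have "t2 - \<rho> * t1 + \<rho> * (m + s) = m + - s" using m2 by (simp add: \<rho>1)
    finally have "\<gamma> (m + s) = \<gamma> (m + - s)" .
    then have "\<sigma> * s = \<sigma> * (- s)" using \<sigma>(4)[of s] \<sigma>(4)[of "- s"] s by simp
    then show ?thesis using \<sigma>(1) s(1) by auto
  qed
qed

text \<open>The length \<open>L\<close> is the least period. Periods are at least \<open>d\<close>,
  as \<open>\<gamma>\<close> is injective near time 1, and positive differences of periods are
  periods; hence the infimum is attained and every period is a multiple of it.\<close>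

lemma unit_speed_closed:
  obtains \<gamma> and L :: real where "0 < L" "\<And>t. 0 < t \<Longrightarrow> unit_speed \<gamma> t"
    "\<And>s t. 0 < s \<Longrightarrow> 0 < t \<Longrightarrow> \<gamma> s = \<gamma> t \<longleftrightarrow> (\<exists>n::int. t = s + L * n)"
    "\<And>x. x \<in> topspace X \<Longrightarrow> \<exists>t>0. \<gamma> t = x"
proof -
  obtain \<gamma> where u: "\<And>t. 0 < t \<Longrightarrow> unit_speed \<gamma> t" by (rule unit_speed_exists) (rule that)
  define Per where "Per = {T. 0 < T \<and> (\<forall>t>0. \<gamma> (t + T) = \<gamma> t)}"
  have PerI: "t - s \<in> Per" if "0 < s" "s < t" "\<gamma> s = \<gamma> t" for s t
    using unit_speed_periodic[OF u that] that(2) by (simp add: Per_def)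
  have PerD: "0 < T" "\<And>t. 0 < t \<Longrightarrow> \<gamma> (t + T) = \<gamma> t" if "T \<in> Per" for T using that by (auto simp: Per_def)
  have diff: "T - S \<in> Per" if "S \<in> Per" "T \<in> Per" "S < T" for S T
    using PerI[of "1 + S" "1 + T"] PerD[OF that(1)] PerD[OF that(2)] that(3) by simp
  have "unit_speed \<gamma> 1" by (rule u) simp
  then have "\<gamma> 1 \<in> topspace X" by (simp add: unit_speed_def)
  then obtain W k where W: "isochart W k" "\<gamma> 1 \<in> W" by (rule isochart_exists)
  obtain \<sigma> d :: real where \<sigma>: "\<sigma> = 1 \<or> \<sigma> = - 1" "0 < d"
    "\<And>s. \<bar>s\<bar> < d \<Longrightarrow> \<gamma> (1 + s) \<in> W" "\<And>s. \<bar>s\<bar> < d \<Longrightarrow> k (\<gamma> (1 + s)) = k (\<gamma> 1) + \<sigma> * s"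
    by (rule unit_speedE[OF \<open>unit_speed \<gamma> 1\<close> W]) (rule that)
  have dle: "d \<le> T" if T: "T \<in> Per" for T
  proof (rule ccontr)
    assume "\<not> d \<le> T"
    then have "\<sigma> * T = 0" using \<sigma>(4)[of T] PerD[OF T] by simp
    then show False using \<sigma>(1) PerD(1)[OF T] by auto
  qed
  have "Per \<noteq> {}" by (rule unit_speed_recurrent[OF u]) (assumption, use PerI in blast)
  have bdd: "bdd_below Per" by (rule bdd_belowI[of Per d]) (rule dle)
  define L where "L = Inf Per"
  have Lle: "L \<le> T" if "T \<in> Per" for T unfolding L_def by (rule cInf_lower[OF that bdd])
  have L: "L \<in> Per"
  proof -
    obtain T where T: "T \<in> Per" "T < L + d"
      using cInf_lessD[OF \<open>Per \<noteq> {}\<close>, of "L + d"] \<sigma>(2) unfolding L_def by auto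
    have "T = L"
    proof (rule ccontr)
      assume "T \<noteq> L"
      then have "L < T" using Lle[OF T(1)] by simp
      then obtain S where S: "S \<in> Per" "S < T" using cInf_lessD[OF \<open>Per \<noteq> {}\<close>] unfolding L_def by blast
      have "d \<le> T - S" by (rule dle[OF diff[OF S(1) T(1) S(2)]])
      then show False using Lle[OF S(1)] T(2) by simp
    qed
    then show ?thesis using T(1) by simp
  qed
  note L0 = PerD(1)[OF L]
  have mult: "\<gamma> (t + L * real n) = \<gamma> t" if "0 < t" for t n
  proof (induction n)
    case (Suc n)
    have "0 < t + L * real n" using that L0 by (simp add: add_pos_nonneg)
    then have "\<gamma> ((t + L * real n) + L) = \<gamma> (t + L * real n)" by (rule PerD(2)[OF L])
    then show ?case using Suc by (simp add: algebra_simps)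
  qed simp
  have Pmult: "\<exists>n::nat. T = L * n" if T: "T \<in> Per" for T
  proof -
    define n where "n = nat \<lfloor>T / L\<rfloor>"
    have T0: "0 \<le> T / L" using PerD(1)[OF T] L0 by simp
    have n: "real n \<le> T / L" "T / L < real n + 1" using T0 by (auto simp: n_def)
    then have n': "L * real n \<le> T" "T < L * real n + L" using L0 by (simp_all add: field_simps)
    have "T = L * real n"
    proof (rule ccontr)
      assume "T \<noteq> L * real n"
      then have lt: "L * real n < T" using n'(1) by simp
      have "(1 + T) - (1 + L * real n) \<in> Per"
        by (rule PerI) (use lt L0 mult[of 1 n] PerD(2)[OF T, of 1] in \<open>auto intro: add_pos_nonneg\<close>)
      then show False using Lle[of "T - L * real n"] n'(2) by simp
    qed
    then show ?thesis by blast
  qed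
  have iff: "\<gamma> s = \<gamma> t \<longleftrightarrow> (\<exists>n::int. t = s + L * n)" if st: "0 < s" "0 < t" for s t
  proof
    assume eq: "\<gamma> s = \<gamma> t"
    consider "s < t" | "s = t" | "t < s" by linarith
    then show "\<exists>n::int. t = s + L * n"
    proof cases
      case 1
      obtain n :: nat where "t - s = L * n" using Pmult[OF PerI[OF st(1) 1 eq]] by blast
      then show ?thesis by (intro exI[of _ "int n"]) simp
    next
      case 2
      then show ?thesis by (intro exI[of _ 0]) simp
    next
      case 3
      obtain n :: nat where "s - t = L * n" using Pmult[OF PerI[OF st(2) 3 eq[symmetric]]] by blast
      then show ?thesis by (intro exI[of _ "- int n"]) simp
    qed
  next
    assume "\<exists>n::int. t = s + L * n"
    then obtain n :: int where n: "t = s + L * n" by blast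
    show "\<gamma> s = \<gamma> t"
    proof (cases "0 \<le> n")
      case True
      then show ?thesis using mult[OF st(1), of "nat n"] n by simp
    next
      case False
      then show ?thesis using mult[OF st(2), of "nat (- n)"] n by simp
    qed
  qed
  \<comment> \<open>The range is open since isocharts are traversed on both sides, and closed by
    \<open>unit_speed_reach\<close>, which applies after adding periods until the time is at least
    1.\<close>
  let ?I = "\<gamma> ` {0<..}"
  have IX: "?I \<subseteq> topspace X" using u by (auto simp: unit_speed_def)
  have o1: "openin X ?I"
  proof (subst openin_subopen, intro ballI)
    fix x assume "x \<in> ?I"
    then obtain t where t: "0 < t" "x = \<gamma> t" by auto
    have "\<gamma> t \<in> topspace X" using u[OF t(1)] by (simp add: unit_speed_def)
    then obtain W k where W: "isochart W k" "\<gamma> t \<in> W" by (rule isochart_exists)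
    obtain \<sigma> d :: real where \<sigma>: "\<sigma> = 1 \<or> \<sigma> = - 1" "0 < d"
      "\<And>s. \<bar>s\<bar> < d \<Longrightarrow> \<gamma> (t + s) \<in> W" "\<And>s. \<bar>s\<bar> < d \<Longrightarrow> k (\<gamma> (t + s)) = k (\<gamma> t) + \<sigma> * s"
      by (rule unit_speedE[OF u[OF t(1)] W]) (rule that)
    let ?V = "{y \<in> W. k y \<in> ball (k (\<gamma> t)) (min d t)}"
    have "openin X ?V" by (rule isochart_open_less[OF W(1) open_ball])
    moreover have "x \<in> ?V" using W(2) t \<sigma>(2) by simp
    moreover have "?V \<subseteq> ?I"
    proof
      fix y assume y: "y \<in> ?V"
      define s where "s = \<sigma> * (k y - k (\<gamma> t))"
      have s: "\<bar>s\<bar> < min d t" using y \<sigma>(1) by (auto simp: s_def dist_real_def)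
      have "k (\<gamma> (t + s)) = k y" using \<sigma>(4)[of s] s \<sigma>(1) by (auto simp: s_def)
      then have "\<gamma> (t + s) = y" by (rule inj_onD[OF isochartD(2)[OF W(1)]]) (use \<sigma>(3)[of s] s y in auto)
      moreover have "0 < t + s" using s by linarith
      ultimately show "y \<in> ?I" by (metis greaterThan_iff image_eqI)
    qed
    ultimately show "\<exists>T. openin X T \<and> x \<in> T \<and> T \<subseteq> ?I" by blast
  qed
  have o2: "openin X (topspace X - ?I)"
  proof (subst openin_subopen, intro ballI)
    fix x assume x: "x \<in> topspace X - ?I"
    obtain \<epsilon> where \<epsilon>: "0 < \<epsilon>" "\<epsilon> \<le> 1"
      "\<And>x. x \<in> topspace X \<Longrightarrow> \<exists>W k. isochart W k \<and> x \<in> W \<and> k x = 0 \<and> {-\<epsilon><..<\<epsilon>} \<subseteq> k ` W"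
      by (rule uniform_isochart) (rule that)
    have "x \<in> topspace X" using x by blast
    then obtain W k where W: "isochart W k" "x \<in> W" "k x = 0" "{-\<epsilon><..<\<epsilon>} \<subseteq> k ` W" using \<epsilon>(3) by meson
    let ?V = "{y \<in> W. k y \<in> {-(\<epsilon>/4)<..<\<epsilon>/4}}"
    have oV: "openin X ?V" by (rule isochart_open_less[OF W(1)]) simp
    have "y \<notin> ?I" if y: "y \<in> ?V" for y
    proof
      assume "y \<in> ?I"
      then obtain t where t: "0 < t" "y = \<gamma> t" by auto
      obtain n :: nat where "1 / L < real n" using reals_Archimedean2 by blast
      then have n: "1 \<le> t + L * real n" using t(1) L0 by (simp add: field_simps)
      have "\<gamma> (t + L * real n) = y" using mult[OF t(1)] t(2) by simp
      then have 1: "\<gamma> (t + L * real n) \<in> W" "\<bar>k (\<gamma> (t + L * real n))\<bar> < \<epsilon> / 4" using y by auto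
      obtain s where s: "\<bar>s\<bar> < 1 / 4" "\<gamma> (t + L * real n + s) = x"
        by (rule unit_speed_reach[OF u \<epsilon>(1,2) W n 1]) (assumption, rule that)
      have "0 < t + L * real n + s" using s(1) n by linarith
      then have "x \<in> ?I" using s(2) by (metis greaterThan_iff image_eqI)
      then show False using x by blast
    qed
    then have "?V \<subseteq> topspace X - ?I" using openin_subset[OF oV] by blast
    moreover have "x \<in> ?V" using W \<epsilon>(1) by simp
    ultimately show "\<exists>T. openin X T \<and> x \<in> T \<and> T \<subseteq> topspace X - ?I" using oV by blast
  qed
  have "closedin X ?I" using o2 IX by (simp add: closedin_def)
  then have "?I = {} \<or> ?I = topspace X" using connected o1 unfolding connected_space_clopen_in by blast
  moreover have "\<gamma> 1 \<in> ?I" by simp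
  ultimately have "?I = topspace X" by blast
  then have "\<exists>t>0. \<gamma> t = x" if "x \<in> topspace X" for x using that by (metis greaterThan_iff imageE)
  then show thesis using that[OF L0 u iff] by blast
qed

text \<open>Arc length scaled to total length \<open>2 * pi\<close> serves as the angle. Locally the
  map is \<open>E\<close> composed with an arc length parameter, which gives both smoothness and an
  injective derivative.\<close>

lemma circle_map:
  obtains F :: "'a \<Rightarrow> 'e \<times> real" and N where "smooth_immersion A F" "\<And>x. x \<in> topspace X \<Longrightarrow> norm (F x) = 1"
    "norm N = 1" "\<exists>!x. x \<in> topspace X \<and> F x = N"
proof -
  obtain \<gamma> and L :: real where L: "0 < L" and u: "\<And>t. 0 < t \<Longrightarrow> unit_speed \<gamma> t"
    and per: "\<And>s t. 0 < s \<Longrightarrow> 0 < t \<Longrightarrow> \<gamma> s = \<gamma> t \<longleftrightarrow> (\<exists>n::int. t = s + L * n)"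
    and onto: "\<And>x. x \<in> topspace X \<Longrightarrow> \<exists>t>0. \<gamma> t = x"
    by (rule unit_speed_closed) (rule that)
  obtain b :: 'e where b: "b \<in> Basis" using nonempty_Basis by blast
  define \<omega> where "\<omega> = 2 * pi / L"
  have \<omega>: "0 < \<omega>" "\<omega> * L = 2 * pi" using L by (auto simp: \<omega>_def)
  define E where "E t = (cos (\<omega> * t) *\<^sub>R b, sin (\<omega> * t))" for t
  have E_eq: "E s = E t \<longleftrightarrow> (\<exists>n::int. t = s + L * n)" for s t
  proof -
    have "b \<noteq> 0" using b by (rule nonzero_Basis)
    then have "E s = E t \<longleftrightarrow> sin (\<omega> * t) = sin (\<omega> * s) \<and> cos (\<omega> * t) = cos (\<omega> * s)" by (auto simp: E_def)
    also have "\<dots> \<longleftrightarrow> (\<exists>n::int. \<omega> * t = \<omega> * s + 2 * pi * n)" by (rule sin_cos_eq_iff)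
    also have "\<dots> \<longleftrightarrow> (\<exists>n::int. t = s + L * n)"
    proof -
      have "\<omega> * t = \<omega> * s + 2 * pi * n \<longleftrightarrow> t = s + L * n" for n :: int
      proof -
        have "\<omega> * s + 2 * pi * n = \<omega> * (s + L * n)" using \<omega>(2) by (simp add: distrib_left flip: mult.assoc)
        then show ?thesis using \<omega>(1) by simp
      qed
      then show ?thesis by simp
    qed
    finally show ?thesis .
  qed
  \<comment> \<open>The choice of the time does not matter: times with the same value differ by
    multiples of \<open>L\<close>, which are periods of \<open>E\<close>.\<close>
  define F where "F x = E (SOME t. 0 < t \<and> \<gamma> t = x)" for x
  have F: "F (\<gamma> t) = E t" if t: "0 < t" for t
  proof -
    let ?s = "SOME s. 0 < s \<and> \<gamma> s = \<gamma> t"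
    have "0 < ?s \<and> \<gamma> ?s = \<gamma> t" by (rule someI[of _ t]) (use t in simp)
    then have "\<exists>n::int. t = ?s + L * n" using per t by blast
    then show ?thesis unfolding F_def E_eq .
  qed
  have E1: "norm (E t) = 1" for t using b by (simp add: E_def norm_Pair)
  have ECk: "Ck_on k UNIV E" for k
  proof -
    have "bounded_linear (\<lambda>t::real. \<omega> * t)" by (rule bounded_linear_mult_right)
    then have l: "Ck_on k UNIV (\<lambda>t. \<omega> * t)" by (rule Ck_on_bounded_linear) simp
    have "Ck_on k UNIV (\<lambda>t. sin (\<omega> * t))" "Ck_on k UNIV (\<lambda>t. cos (\<omega> * t))"
      by (rule Ck_on_compose[OF open_UNIV open_UNIV l], rule Ck_on_sin_cos, simp)+
    then show ?thesis unfolding E_def[abs_def]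
      by (intro Ck_on_Pair Ck_on_scaleR Ck_on_const open_UNIV)
  qed
  have ED: "(E has_derivative (\<lambda>h. h *\<^sub>R ((- \<omega> * sin (\<omega> * t)) *\<^sub>R b, \<omega> * cos (\<omega> * t)))) (at t)" for t
    unfolding E_def[abs_def] by (auto intro!: derivative_eq_intros simp: algebra_simps)
  have E0: "((- \<omega> * sin (\<omega> * t)) *\<^sub>R b, \<omega> * cos (\<omega> * t)) \<noteq> 0" for t
  proof
    assume "((- \<omega> * sin (\<omega> * t)) *\<^sub>R b, \<omega> * cos (\<omega> * t)) = 0"
    then have "sin (\<omega> * t) = 0" "cos (\<omega> * t) = 0" using \<omega>(1) nonzero_Basis[OF b] by (auto simp: prod_eq_iff)
    then show False using sin_cos_squared_add[of "\<omega> * t"] by simp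
  qed
  have local: "\<exists>T. open T \<and> y \<in> T \<and> (\<forall>k. Ck_on k T (F \<circ> inv_into U \<phi>)) \<and>
      inj (frechet_derivative (F \<circ> inv_into U \<phi>) (at y))" if c: "(U, \<phi>) \<in> A" and y: "y \<in> \<phi> ` U" for U \<phi> y
  proof -
    note i = chart_inverse[OF c]
    let ?x = "inv_into U \<phi> y"
    have xU: "?x \<in> U" by (rule i(2)[OF y])
    then have "?x \<in> topspace X" using chart_props(4)[OF c] by blast
    then obtain t where t: "0 < t" "\<gamma> t = ?x" using onto by blast
    obtain W k where W: "isochart W k" "?x \<in> W" "W \<subseteq> U" "k ?x = 0" "open (\<phi> ` W)"
      "\<And>n. Ck_on n (\<phi> ` W) (k \<circ> inv_into U \<phi>)"
      "\<And>y. y \<in> \<phi> ` W \<Longrightarrow> inj (frechet_derivative (k \<circ> inv_into U \<phi>) (at y))"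
      by (rule chart_isochart[OF dim c xU]) (rule that)
    let ?k = "k \<circ> inv_into U \<phi>"
    have tW: "\<gamma> t \<in> W" using W(2) t(2) by simp
    obtain \<sigma> d :: real where \<sigma>: "\<sigma> = 1 \<or> \<sigma> = - 1" "0 < d"
      "\<And>s. \<bar>s\<bar> < d \<Longrightarrow> \<gamma> (t + s) \<in> W" "\<And>s. \<bar>s\<bar> < d \<Longrightarrow> k (\<gamma> (t + s)) = k (\<gamma> t) + \<sigma> * s"
      by (rule unit_speedE[OF u[OF t(1)] W(1) tW]) (rule that)
    let ?T = "\<phi> ` W \<inter> ?k -` ball 0 (min d t)"
    have T: "open ?T" by (rule continuous_open_preimage[OF Ck_on_imp_continuous_on[OF W(6)[of 0]] W(5) open_ball])
    have y\<phi>: "\<phi> ?x = y" by (rule i(3)[OF y])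
    have yT: "y \<in> ?T" using W(2,4) y\<phi> \<sigma>(2) t(1) by (auto intro!: image_eqI[of _ _ ?x])
    have eq: "E (t + \<sigma> * ?k z) = (F \<circ> inv_into U \<phi>) z" if z: "z \<in> ?T" for z
    proof -
      obtain w where w: "w \<in> W" "z = \<phi> w" using z by blast
      have iw: "inv_into U \<phi> z = w" using i(1) w W(3) by blast
      define s where "s = \<sigma> * k w"
      have "\<bar>k w\<bar> < min d t" using z iw by simp
      then have s: "\<bar>s\<bar> < min d t" using \<sigma>(1) by (auto simp: s_def)
      have "k (\<gamma> (t + s)) = k w" using \<sigma>(4)[of s] s \<sigma>(1) W(4) t(2) by (auto simp: s_def)
      then have "\<gamma> (t + s) = w" by (rule inj_onD[OF isochartD(2)[OF W(1)]]) (use \<sigma>(3)[of s] s w in auto)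
      moreover have "0 < t + s" using s by linarith
      ultimately have "F w = E (t + s)" using F by blast
      then show ?thesis using iw by (simp add: s_def)
    qed
    have inner: "Ck_on n ?T (\<lambda>z. t + \<sigma> * ?k z)" for n
      by (intro Ck_on_add Ck_on_mult Ck_on_const T Ck_on_subset[OF W(6)]) auto
    have E: "Ck_on n ?T (\<lambda>z. E (t + \<sigma> * ?k z))" for n
      by (rule Ck_on_compose[OF T open_UNIV inner ECk]) simp
    have Ck: "Ck_on n ?T (F \<circ> inv_into U \<phi>)" for n by (rule Ck_on_cong[OF T eq E])
    let ?K = "frechet_derivative ?k (at y)"
    have yW: "y \<in> \<phi> ` W" using yT by blast
    have K: "(?k has_derivative ?K) (at y)" by (rule Ck_on_SucD(1)[OF W(5) W(6) yW])
    have "((\<lambda>z. t + \<sigma> * ?k z) has_derivative (\<lambda>a. \<sigma> * ?K a)) (at y)"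
      using has_derivative_add[OF has_derivative_const has_derivative_mult_right[OF K]] by (simp only: add_0_left)
    from has_derivative_compose[OF this ED]
    have "((\<lambda>z. E (t + \<sigma> * ?k z)) has_derivative
      (\<lambda>a. (\<sigma> * ?K a) *\<^sub>R ((- \<omega> * sin (\<omega> * (t + \<sigma> * ?k y))) *\<^sub>R b, \<omega> * cos (\<omega> * (t + \<sigma> * ?k y))))) (at y)" .
    then have "(F \<circ> inv_into U \<phi> has_derivative
      (\<lambda>a. (\<sigma> * ?K a) *\<^sub>R ((- \<omega> * sin (\<omega> * (t + \<sigma> * ?k y))) *\<^sub>R b, \<omega> * cos (\<omega> * (t + \<sigma> * ?k y))))) (at y)"
      by (rule has_derivative_transform_within_open[OF _ T yT eq])
    note FD = this
    then have D: "frechet_derivative (F \<circ> inv_into U \<phi>) (at y) =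
      (\<lambda>a. (\<sigma> * ?K a) *\<^sub>R ((- \<omega> * sin (\<omega> * (t + \<sigma> * ?k y))) *\<^sub>R b, \<omega> * cos (\<omega> * (t + \<sigma> * ?k y))))"
      by (rule frechet_derivative_at[symmetric])
    have "a = 0" if "frechet_derivative (F \<circ> inv_into U \<phi>) (at y) a = 0" for a
    proof -
      have "\<sigma> * ?K a = 0" using that E0 unfolding D scaleR_eq_0_iff by blast
      then have "?K a = 0" using \<sigma>(1) by auto
      then show ?thesis using W(7)[OF yW] linear_injective_0[OF has_derivative_linear[OF K]] by blast
    qed
    then have "inj (frechet_derivative (F \<circ> inv_into U \<phi>) (at y))"
      using linear_injective_0[OF has_derivative_linear[OF FD]] unfolding D by blast
    then show ?thesis using T yT Ck by blast
  qed
  have "smooth_immersion A F"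
    unfolding smooth_immersion_def smooth_on_def
  proof (intro ballI, clarify, intro conjI ballI allI)
    fix U \<phi> assume c: "(U, \<phi>) \<in> A"
    show "Ck_on k (\<phi> ` U) (F \<circ> inv_into U \<phi>)" for k
      by (rule Ck_on_local[OF chart_props(2)[OF c]]) (use local[OF c] in meson)
    show "inj (frechet_derivative (F \<circ> inv_into U \<phi>) (at y))" if "y \<in> \<phi> ` U" for y
      using local[OF c that] by blast
  qed
  moreover have "norm (F x) = 1" for x unfolding F_def by (rule E1)
  moreover have "\<exists>!x. x \<in> topspace X \<and> F x = E 1"
  proof (rule ex1I[of _ "\<gamma> 1"])
    show "\<gamma> 1 \<in> topspace X \<and> F (\<gamma> 1) = E 1" using u[of 1] F[of 1] by (simp add: unit_speed_def)
    fix x assume x: "x \<in> topspace X \<and> F x = E 1"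
    then obtain t where t: "0 < t" "\<gamma> t = x" using onto by blast
    then have "E t = E 1" using F x by metis
    then have "\<gamma> t = \<gamma> 1" unfolding E_eq using per[of t 1] t(1) by simp
    then show "x = \<gamma> 1" using t(2) by simp
  qed
  ultimately show thesis using that E1 by blast
qed

end

section \<open>Immersions of small normal curvature\<close>

theorem theorem5:
  fixes X :: "'a topology"
    and A :: "('a, real ^ 'n) atlas"
    and f :: "'a \<Rightarrow> real ^ 'N"
  assumes "smooth_manifold X A"
    and "compact_space X"
    and "connected_space X"
    and "topspace X \<noteq> {}"
    and "smooth_immersion A f"
    and "f ` topspace X \<subseteq> cball 0 1"
    and "max_normal_curvature A f < ereal (sqrt (4 / 3))"
  shows "diffeomorphic X A
    (std_sphere :: ((real ^ 'n) \<times> real) topology) std_sphere_atlas"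
proof -
  interpret smooth_immersed X A f by standard fact+
  obtain F :: "'a \<Rightarrow> (real ^ 'n) \<times> real" and N where F: "smooth_immersion A F"
    "\<And>x. x \<in> topspace X \<Longrightarrow> norm (F x) = 1" "norm N = 1" "\<exists>!x. x \<in> topspace X \<and> F x = N"
  \<comment> \<open>Dimension one is separate: the arguments with rings and perpendicular directions
    rely on connected punctured balls and on tangent vectors orthogonal to a given one.\<close>
  proof (cases "CARD('n) = 1")
    case True
    interpret curve X A f by standard (use True assms in auto)
    show thesis by (rule circle_map) (rule that)
  next
    case False
    obtain \<kappa> where \<kappa>: "\<kappa> < sqrt (4 / 3)" "immersed X A f \<kappa>"
      by (rule smooth_immersed_curvature[OF smooth_immersed_axioms assms(7)]) (simp, rule that)
    interpret immersed X A f \<kappa> by fact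
    interpret closed_immersed X A f \<kappa>
      by standard (use assms in \<open>auto simp: image_subset_iff\<close>)
    have k: "sqrt 3 / 2 * \<kappa> < 1"
    proof -
      have "sqrt 3 / 2 * \<kappa> < sqrt 3 / 2 * sqrt (4 / 3)" using \<kappa>(1) by (intro mult_strict_left_mono) auto
      also have "\<dots> = 1" by (simp add: real_sqrt_divide)
      finally show ?thesis .
    qed
    \<comment> \<open>Since \<open>\<kappa> < sqrt (4 / 3)\<close> means
      \<open>sqrt 3 / 2 * \<kappa> < 1\<close>, any \<open>c\<close> slightly above
      \<open>sqrt 3 / 2\<close> will do.\<close>
    have "((\<lambda>c. c * \<kappa>) \<longlongrightarrow> sqrt 3 / 2 * \<kappa>) (at_right (sqrt 3 / 2))" by (intro tendsto_intros)
    then have "\<forall>\<^sub>F c in at_right (sqrt 3 / 2). c * \<kappa> < 1" using k by (rule order_tendstoD(2))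
    moreover have "\<forall>\<^sub>F c in at_right (sqrt 3 / 2). sqrt 3 / 2 < c" by (rule eventually_at_right_less)
    ultimately have "\<forall>\<^sub>F c in at_right (sqrt 3 / 2). c * \<kappa> < 1 \<and> sqrt 3 / 2 < c" by eventually_elim simp
    then obtain c where c: "c * \<kappa> < 1" "sqrt 3 / 2 < c"
      using eventually_happens' trivial_limit_at_right_real by blast
    have c0: "0 < c" by (rule less_trans[OF _ c(2)]) simp
    have "(sqrt 3 / 2)\<^sup>2 < c\<^sup>2" using c(2) by (intro power_strict_mono) auto
    then have c34: "3 / 4 < c\<^sup>2" by (simp add: power_divide)
    have "continuous_map X euclideanreal (\<lambda>x. norm (f x))" by (intro continuous_map_norm f_continuous)
    then obtain p where p: "p \<in> topspace X" "\<And>x. x \<in> topspace X \<Longrightarrow> norm (f x) \<le> norm (f p)"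
      using attains_max[OF closedin_topspace assms(4)] by blast
    have "2 \<le> CARD('n)" using False zero_less_card_finite[where 'a = 'n] by linarith
    then interpret farthest X A f \<kappa> c p
      by unfold_locales (use c c0 c34 p in auto)
    obtain F :: "'a \<Rightarrow> (real ^ 'n) \<times> real" where "smooth_immersion A F"
      "\<And>x. x \<in> topspace X \<Longrightarrow> norm (F x) = 1" "\<exists>!x. x \<in> topspace X \<and> F x = (0, 1)"
      by (rule sphere_map) (rule that)
    then show thesis using that[of F "(0, 1)"] by (simp add: norm_Pair)
  qed
  interpret S: sphere_immersed X A F by standard (use assms F in auto)
  show ?thesis using S.diffeomorphic_sphere[of N] F(3,4) by simp
qed

end
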